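(* Let $H_1,H_2\in(0,1)$ satisfy $H_1>\tfrac12$, $H_2>\tfrac12$ and $H_1+H_2>\tfrac32$. Let $W$ be a two-sided Brownian motion on $\mathbb R$ and, for $i=1,2$, let $$B^{H_i}_t=c(H_i)\int_{\mathbb R}dW_y\int_0^t(u-y)_+^{H_i-\frac32}\,du,\qquad t\geq 0,$$ where the constants $c(H_i)$ are chosen so that $E[(B^{H_i}_1)^2]=1$. For $n\geq 1$ set $$Z_n=n^{1-H_1-H_2}\sum_{k=0}^{n-1}\left[\frac{\big(B^{H_1}_{\frac{k+1}n}-B^{H_1}_{\frac kn}\big)\big(B^{H_2}_{\frac{k+1}n}-B^{H_2}_{\frac kn}\big)}{E\Big[\big(B^{H_1}_{\frac{k+1}n}-B^{H_1}_{\frac kn}\big)\big(B^{H_2}_{\frac{k+1}n}-B^{H_2}_{\frac kn}\big)\Big]}-1\right],$$ and let $$Z_\infty=b(H_1,H_2)\int_{\mathbb R^2}dW_x\,dW_y\int_0^1(s-x)_+^{H_1-\frac32}(s-y)_+^{H_2-\frac32}\,ds$$ be the non-symmetric Rosenblatt random variable, with $b(H_1,H_2)$ the normalizing constant for which $Z_n\to Z_\infty$ in $L^2(\Omega)$. Then, as $n\to\infty$, $$\sup_{C\in\mathcal B(\mathbb R)}\big|P(Z_n\in C)-P(Z_\infty\in C)\big|=O\big(n^{\frac32-H_1-H_2}\big).$$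
   Context: Both fractional Brownian motions $B^{H_1},B^{H_2}$ are Wiener integrals with respect to the same Brownian motion $W$ (so they are not independent). Here $a_+=\max(a,0)$, with the convention that $(u-y)_+^{\alpha}=0$ when $u\le y$ (also for negative $\alpha$). The integral $\int_{\mathbb R^2}dW_x\,dW_y\,f(x,y)$ is the double Wiener–Itô integral with respect to $W$ of $f\in L^2(\mathbb R^2)$, i.e. $I_2$ of the symmetrization of $f$, where $I_2$ is the continuous linear map from symmetric functions of $L^2(\mathbb R^2)$ to $L^2(\Omega)$ with $I_2(h\otimes h)=W(h)^2-1$ for $\|h\|_{L^2(\mathbb R)}=1$, $W(h)=\int_{\mathbb R} h\,dW$. It is known (Maejima and Tudor) that under the stated assumptions $Z_n$ converges in $L^2(\Omega)$ to $Z_\infty$ for the appropriate constant, namely $b(H_1,H_2)=c(H_1)c(H_2)/E[B^{H_1}_1B^{H_2}_1]$. $\mathcal B(\mathbb R)$ is the set of Borel subsets of $\mathbb R$. *)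

theory Defs
  imports "HOL-Probability.Probability" "HOL-Library.Landau_Symbols"
begin

definition L2 :: "'b measure \<Rightarrow> ('b \<Rightarrow> real) set" where
  "L2 N = {f \<in> borel_measurable N. integrable N (\<lambda>x. (f x)\<^sup>2)}"

definition sym_L2 :: "(real \<times> real \<Rightarrow> real) set" where
  "sym_L2 = {f \<in> L2 lborel. \<forall>x y. f (x, y) = f (y, x)}"

definition symmetrization :: "(real \<times> real \<Rightarrow> real) \<Rightarrow> real \<times> real \<Rightarrow> real" where
  "symmetrization f = (\<lambda>(x, y). (f (x, y) + f (y, x)) / 2)"

text \<open>
  Continuous linear maps from a linear subspace \<open>D\<close> of \<open>L2 N\<close> to \<open>L2 M\<close>. They act on
  representatives, so linearity is required up to null sets. Together with the norm bound, linearity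
  forces almost everywhere equal arguments to have almost everywhere equal images.
\<close>

definition bounded_linear_L2 ::
  "'b measure \<Rightarrow> ('b \<Rightarrow> real) set \<Rightarrow> 'a measure \<Rightarrow> (('b \<Rightarrow> real) \<Rightarrow> 'a \<Rightarrow> real) \<Rightarrow> bool" where
  "bounded_linear_L2 N D M T \<longleftrightarrow>
     (\<forall>f\<in>D. T f \<in> L2 M) \<and>
     (\<forall>f\<in>D. \<forall>g\<in>D. \<forall>a b. AE \<omega> in M. T (\<lambda>x. a * f x + b * g x) \<omega> = a * T f \<omega> + b * T g \<omega>) \<and>
     (\<exists>K. \<forall>f\<in>D. sqrt (\<integral>\<omega>. (T f \<omega>)\<^sup>2 \<partial>M) \<le> K * sqrt (\<integral>x. (f x)\<^sup>2 \<partial>N))"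

definition two_sided_brownian_motion :: "'a measure \<Rightarrow> (real \<Rightarrow> 'a \<Rightarrow> real) \<Rightarrow> bool" where
  "two_sided_brownian_motion M W \<longleftrightarrow>
     (\<forall>t. W t \<in> borel_measurable M) \<and>
     (AE \<omega> in M. W 0 \<omega> = 0) \<and>
     (\<forall>(n::nat) (t::nat \<Rightarrow> real). (\<forall>i<n. t i \<le> t (Suc i)) \<longrightarrow>
        prob_space.indep_vars M (\<lambda>_. borel) (\<lambda>i \<omega>. W (t (Suc i)) \<omega> - W (t i) \<omega>) {..<n}) \<and>
     (\<forall>s t. s < t \<longrightarrow>
        distributed M lborel (\<lambda>\<omega>. W t \<omega> - W s \<omega>) (normal_density 0 (sqrt (t - s)))) \<and>
     (AE \<omega> in M. continuous_on UNIV (\<lambda>t. W t \<omega>))"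

text \<open>
  The map \<open>h \<mapsto> \<integral> h dW\<close>: the continuous linear extension of \<open>indicator {s<..t} \<mapsto> W t - W s\<close>.
  It is determined up to the choice of a version of each \<open>I h\<close>.
\<close>

definition is_wiener_integral ::
  "'a measure \<Rightarrow> (real \<Rightarrow> 'a \<Rightarrow> real) \<Rightarrow> ((real \<Rightarrow> real) \<Rightarrow> 'a \<Rightarrow> real) \<Rightarrow> bool" where
  "is_wiener_integral M W I \<longleftrightarrow>
     bounded_linear_L2 lborel (L2 lborel) M I \<and>
     (\<forall>s t. s \<le> t \<longrightarrow> (AE \<omega> in M. I (indicator {s<..t}) \<omega> = W t \<omega> - W s \<omega>))"

text \<open>
  The map \<open>I\<^sub>2\<close> on symmetric square integrable functions, where \<open>I\<close> is the Wiener integral. The double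
  integral of a general \<open>f\<close> is \<open>J (symmetrization f)\<close>.
\<close>

definition is_double_wiener_integral ::
  "'a measure \<Rightarrow> ((real \<Rightarrow> real) \<Rightarrow> 'a \<Rightarrow> real) \<Rightarrow> ((real \<times> real \<Rightarrow> real) \<Rightarrow> 'a \<Rightarrow> real) \<Rightarrow> bool" where
  "is_double_wiener_integral M I J \<longleftrightarrow>
     bounded_linear_L2 lborel sym_L2 M J \<and>
     (\<forall>h \<in> L2 lborel. sqrt (\<integral>x. (h x)\<^sup>2 \<partial>lborel) = 1 \<longrightarrow>
        (AE \<omega> in M. J (\<lambda>(x, y). h x * h y) \<omega> = (I h \<omega>)\<^sup>2 - 1))"

text \<open>Since \<open>0 powr a = 0\<close> for every \<open>a\<close>, this vanishes for \<open>x \<le> 0\<close>, also when \<open>a < 0\<close>.\<close>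

definition pos_powr :: "real \<Rightarrow> real \<Rightarrow> real" where
  "pos_powr x a = (max x 0) powr a"

definition fbm_kernel :: "real \<Rightarrow> real \<Rightarrow> real \<Rightarrow> real" where
  "fbm_kernel H t y = (LINT u:{0..t}|lborel. pos_powr (u - y) (H - 3/2))"

definition fbm ::
  "((real \<Rightarrow> real) \<Rightarrow> 'a \<Rightarrow> real) \<Rightarrow> real \<Rightarrow> real \<Rightarrow> real \<Rightarrow> 'a \<Rightarrow> real" where
  "fbm I c H t \<omega> = c * I (fbm_kernel H t) \<omega>"

definition rosenblatt_kernel :: "real \<Rightarrow> real \<Rightarrow> real \<times> real \<Rightarrow> real" where
  "rosenblatt_kernel H1 H2 =
     (\<lambda>(x, y). LINT s:{0..1}|lborel. pos_powr (s - x) (H1 - 3/2) * pos_powr (s - y) (H2 - 3/2))"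

definition increment :: "(real \<Rightarrow> 'a \<Rightarrow> real) \<Rightarrow> nat \<Rightarrow> nat \<Rightarrow> 'a \<Rightarrow> real" where
  "increment B n k \<omega> = B ((real k + 1) / real n) \<omega> - B (real k / real n) \<omega>"

definition quadratic_covariation_stat ::
  "'a measure \<Rightarrow> real \<Rightarrow> real \<Rightarrow> (real \<Rightarrow> 'a \<Rightarrow> real) \<Rightarrow> (real \<Rightarrow> 'a \<Rightarrow> real) \<Rightarrow> nat \<Rightarrow> 'a \<Rightarrow> real" where
  "quadratic_covariation_stat M H1 H2 B1 B2 n \<omega> =
     real n powr (1 - H1 - H2) *
     (\<Sum>k<n. increment B1 n k \<omega> * increment B2 n k \<omega> /
              (\<integral>\<omega>'. increment B1 n k \<omega>' * increment B2 n k \<omega>' \<partial>M) - 1)"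

definition total_variation_dist :: "'a measure \<Rightarrow> ('a \<Rightarrow> real) \<Rightarrow> ('a \<Rightarrow> real) \<Rightarrow> real" where
  "total_variation_dist M X Y =
     (SUP C\<in>sets borel. \<bar>measure M {\<omega> \<in> space M. X \<omega> \<in> C} - measure M {\<omega> \<in> space M. Y \<omega> \<in> C}\<bar>)"

end

theory Submission
  imports Defs
begin

text \<open>
  Both \<open>Z n\<close> and \<open>Zinf\<close> are double integrals of explicit kernels. Comparing the kernels cell by cell, and
  using that the covariance \<open>C * \<bar>s - t\<bar> powr \<gamma>\<close> is monotone in the distance, the off-diagonal contributions
  telescope, and the \<open>L\<^sup>2\<close> distance of the kernels is \<open>O(n powr (3/2 - H1 - H2))\<close>.

  To pass from \<open>L\<^sup>2\<close> distance to total variation one needs a Malliavin integration by parts, which is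
  carried out in six directions only. Choose step functions \<open>e i\<close>, \<open>i < 6\<close>, normalised indicators of
  intervals \<open>{1 - r ^ i<..1}\<close> with \<open>r\<close> small, for which the Hessian of the Rosenblatt variable is close to
  twice the identity; by convergence of the kernels this also holds for \<open>Z n\<close> with \<open>n\<close> large. If \<open>p i\<close> is half
  the derivative of the variable in direction \<open>e i\<close>, then the field \<open>p i / \<bar>p\<bar>\<^sup>4\<close> has divergence at least
  \<open>1 / \<bar>p\<bar>\<^sup>4\<close> (this uses that the number of directions exceeds four), so Gaussian integration by parts bounds
  the expectation of \<open>1 / \<bar>p\<bar>\<^sup>4\<close> as in Hardy's inequality. A second integration by parts, against
  \<open>p i / \<bar>p\<bar>\<^sup>2\<close>, then removes the derivative of the test function along the segment from \<open>Z n\<close> to \<open>Z m\<close>.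
  Finally \<open>m\<close> tends to infinity.
\<close>

section \<open>Functions of finitely many coordinates\<close>

text \<open>No power of the rate is lost on the way to total variation because two second chaos
  variables and their derivatives in the directions \<open>e i\<close> differ by the same order
  \<open>\<rho>\<close> as their kernels, and the final estimate is linear in \<open>\<rho>\<close>.
  The rate is thus the square root of the squared kernel error,
  \<open>(- 1 - \<gamma>) / 2 = 3/2 - H1 - H2\<close>. The obstacle is that the derivative of a
  second chaos variable may vanish, so dividing by it requires negative moments. In \<open>d\<close>
  dimensions the divergence of \<open>p / \<bar>p\<bar> ^ 4\<close> is
  \<open>(d - 4) / \<bar>p\<bar> ^ 4\<close>. Six directions leave a margin of 2, half of which pays
  for a Hessian that is only close to a multiple of the identity. Calculus is done on polynomials in
  finitely many Gaussian variables. \<open>Zinf\<close> is not of this form, which is why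
  \<open>Z n\<close> is compared with \<open>Z m\<close> and not with \<open>Zinf\<close> itself. On
  the unit square the Rosenblatt kernel is homogeneous in the distances of its arguments to 1; this
  is why indicators ending at 1 with widely separated lengths are almost orthogonal for the
  Hessian.\<close>

definition wt :: "nat \<Rightarrow> (nat \<Rightarrow> real) \<Rightarrow> real" where
  "wt m x = 1 + (\<Sum>k<m. (x k)\<^sup>2)"

text \<open>The exponent counts powers of \<open>1 + \<bar>x\<bar>\<^sup>2\<close> over the first
  \<open>m\<close> coordinates: 1/2 is linear growth, 1 quadratic growth, 0 boundedness. Negative
  exponents record decay, so that a cutoff is balanced against a polynomial by adding
  exponents.\<close>

definition growth :: "nat \<Rightarrow> real \<Rightarrow> ((nat \<Rightarrow> real) \<Rightarrow> real) \<Rightarrow> bool" where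
  "growth m r f \<longleftrightarrow> (\<exists>C. \<forall>x. \<bar>f x\<bar> \<le> C * wt m x powr r)"

text \<open>
  Sequences stand in for \<open>\<real>\<^sup>m\<close>, because \<open>m\<close> varies within the proof; components from \<open>m\<close> on are irrelevant.
\<close>

definition C1_fun ::
  "nat \<Rightarrow> ((nat \<Rightarrow> real) \<Rightarrow> real) \<Rightarrow> (nat \<Rightarrow> (nat \<Rightarrow> real) \<Rightarrow> real) \<Rightarrow> bool" where
  "C1_fun m f f' \<longleftrightarrow> continuous_on UNIV f \<and> (\<forall>k. continuous_on UNIV (f' k)) \<and>
     (\<forall>x a. ((\<lambda>t. f (\<lambda>k. x k + t * a k)) has_real_derivative (\<Sum>k<m. a k * f' k x)) (at 0))"

lemma wt_ge_1: "wt m x \<ge> 1"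
  unfolding wt_def by (simp add: sum_nonneg)

lemma growthI: "(\<And>x. \<bar>f x\<bar> \<le> C * wt m x powr r) \<Longrightarrow> growth m r f"
  unfolding growth_def by blast

lemma growthE:
  assumes "growth m r f"
  obtains C where "C \<ge> 0" "\<And>x. \<bar>f x\<bar> \<le> C * wt m x powr r"
proof -
  obtain C where C: "\<And>x. \<bar>f x\<bar> \<le> C * wt m x powr r"
    using assms unfolding growth_def by blast
  have "\<bar>f x\<bar> \<le> \<bar>C\<bar> * wt m x powr r" for x
    by (intro order_trans[OF C[of x] mult_right_mono[OF abs_ge_self]]) simp
  then show ?thesis using that[of "\<bar>C\<bar>"] by auto
qed

lemma growth_mono:
  assumes "growth m r f" "r \<le> s" shows "growth m s f"
proof -
  obtain C where C: "C \<ge> 0" "\<And>x. \<bar>f x\<bar> \<le> C * wt m x powr r" by (rule growthE[OF assms(1)]) blast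
  show ?thesis
  proof (rule growthI[where C=C])
    fix x
    have "wt m x powr r \<le> wt m x powr s" using wt_ge_1 assms(2) by (intro powr_mono) auto
    then show "\<bar>f x\<bar> \<le> C * wt m x powr s" using C by (meson mult_left_mono order_trans)
  qed
qed

lemma growth_bounded: "growth m 0 f \<longleftrightarrow> (\<exists>C. \<forall>x. \<bar>f x\<bar> \<le> C)"
proof -
  have "wt m x powr 0 = 1" for x using wt_ge_1[of m x] by simp
  then show ?thesis unfolding growth_def by simp
qed

lemma growth_const: "growth m 0 (\<lambda>_. c)"
  by (auto simp: growth_bounded)

lemma growth_add:
  assumes "growth m r f" "growth m r g" shows "growth m r (\<lambda>x. f x + g x)"
proof -
  obtain C where C: "C \<ge> 0" "\<And>x. \<bar>f x\<bar> \<le> C * wt m x powr r" by (rule growthE[OF assms(1)]) blast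
  obtain E where E: "E \<ge> 0" "\<And>x. \<bar>g x\<bar> \<le> E * wt m x powr r" by (rule growthE[OF assms(2)]) blast
  show ?thesis
  proof (rule growthI[where C="C + E"])
    fix x show "\<bar>f x + g x\<bar> \<le> (C + E) * wt m x powr r"
      unfolding distrib_right using abs_triangle_ineq[of "f x" "g x"] C(2)[of x] E(2)[of x] by linarith
  qed
qed

lemma growth_sum:
  assumes "\<And>i. i \<in> A \<Longrightarrow> growth m r (f i)" "0 \<le> r"
  shows "growth m r (\<lambda>x. \<Sum>i\<in>A. f i x)"
  using assms(1)
proof (induction A rule: infinite_finite_induct)
  case (insert a A)
  then show ?case using growth_add by simp
qed (use growth_mono[OF growth_const assms(2)] in auto)

lemma growth_mult:
  assumes "growth m r f" "growth m s g" shows "growth m (r + s) (\<lambda>x. f x * g x)"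
proof -
  obtain C where C: "C \<ge> 0" "\<And>x. \<bar>f x\<bar> \<le> C * wt m x powr r" by (rule growthE[OF assms(1)]) blast
  obtain E where E: "E \<ge> 0" "\<And>x. \<bar>g x\<bar> \<le> E * wt m x powr s" by (rule growthE[OF assms(2)]) blast
  show ?thesis
  proof (rule growthI[where C="C*E"])
    fix x
    have "\<bar>f x * g x\<bar> \<le> (C * wt m x powr r) * (E * wt m x powr s)"
      unfolding abs_mult using C E by (intro mult_mono) auto
    then show "\<bar>f x * g x\<bar> \<le> C * E * wt m x powr (r+s)" by (simp add: powr_add mult_ac)
  qed
qed

lemma growth_mult':
  assumes "growth m r f" "growth m s g" "r + s = q" shows "growth m q (\<lambda>x. f x * g x)"
  using growth_mult[OF assms(1,2)] assms(3) by simp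

lemma growth_minus: "growth m r f \<Longrightarrow> growth m r (\<lambda>x. - f x)"
  unfolding growth_def by simp

lemma growth_coord:
  assumes "k < m" shows "growth m (1/2) (\<lambda>x. x k)"
proof (rule growthI[where C=1])
  fix x :: "nat \<Rightarrow> real"
  have "(x k)\<^sup>2 \<le> (\<Sum>k<m. (x k)\<^sup>2)" using assms by (intro member_le_sum) auto
  then have "(x k)\<^sup>2 \<le> wt m x" by (simp add: wt_def)
  then have "\<bar>x k\<bar> \<le> sqrt (wt m x)" by (metis real_sqrt_abs real_sqrt_le_iff)
  then show "\<bar>x k\<bar> \<le> 1 * wt m x powr (1/2)" using wt_ge_1[of m x] by (simp add: powr_half_sqrt)
qed

lemma C1_fun_cong:
  assumes "C1_fun m f f'" "\<And>x. f x = g x" "\<And>k x. f' k x = g' k x"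
  shows "C1_fun m g g'"
proof -
  have "f = g" "f' = g'" using assms(2,3) by (auto intro!: ext)
  then show ?thesis using assms(1) by simp
qed

text \<open>The definition provides the directional derivative at the base point only. Moving the
  base point along the line turns it into the derivative at every parameter.\<close>

lemma C1_funD:
  assumes "C1_fun m f f'"
  shows "((\<lambda>t. f (\<lambda>k. x k + t * a k)) has_real_derivative
      (\<Sum>k<m. a k * f' k (\<lambda>k. x k + s * a k))) (at s)"
proof -
  have "((\<lambda>t. f (\<lambda>k. (x k + s * a k) + t * a k)) has_real_derivative
      (\<Sum>k<m. a k * f' k (\<lambda>k. x k + s * a k))) (at 0)"
    using assms[unfolded C1_fun_def, THEN conjunct2, THEN conjunct2, rule_format,
        of "\<lambda>k. x k + s * a k" a] by simp
  then have "((\<lambda>t. f (\<lambda>k. (x k + s * a k) + (t - s) * a k)) has_real_derivative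
      (\<Sum>k<m. a k * f' k (\<lambda>k. x k + s * a k))) (at s)"
    using DERIV_shift[of "\<lambda>t. f (\<lambda>k. (x k + s * a k) + (t - s) * a k)" _ 0 s] by simp
  then show ?thesis by (simp add: algebra_simps)
qed

lemma C1_fun_const: "C1_fun m (\<lambda>_. c) (\<lambda>_ _. 0)"
  unfolding C1_fun_def by simp

lemma C1_fun_coord:
  assumes "i < m" shows "C1_fun m (\<lambda>x. x i) (\<lambda>k _. if k = i then 1 else 0)"
  unfolding C1_fun_def
proof (intro conjI allI)
  show "continuous_on UNIV (\<lambda>x :: nat \<Rightarrow> real. x i)" by (rule continuous_on_product_coordinates)
  fix x a :: "nat \<Rightarrow> real"
  have "(\<Sum>k<m. a k * (if k = i then 1 else 0)) = (\<Sum>k<m. if k = i then a k else 0)"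
    by (intro sum.cong) auto
  then have *: "(\<Sum>k<m. a k * (if k = i then 1 else 0)) = a i" using assms by simp
  show "((\<lambda>t. x i + t * a i) has_real_derivative (\<Sum>k<m. a k * (if k = i then 1 else 0))) (at 0)"
    unfolding * by (auto intro!: derivative_eq_intros)
qed auto

lemma C1_fun_add:
  assumes "C1_fun m f f'" "C1_fun m g g'"
  shows "C1_fun m (\<lambda>x. f x + g x) (\<lambda>k x. f' k x + g' k x)"
  using assms unfolding C1_fun_def
  by (auto intro!: continuous_intros DERIV_add simp: distrib_left sum.distrib)

lemma C1_fun_mult:
  assumes "C1_fun m f f'" "C1_fun m g g'"
  shows "C1_fun m (\<lambda>x. f x * g x) (\<lambda>k x. f' k x * g x + f x * g' k x)"
  unfolding C1_fun_def
proof (intro conjI allI)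
  fix x a :: "nat \<Rightarrow> real"
  have 1: "((\<lambda>t. f (\<lambda>k. x k + t * a k)) has_real_derivative (\<Sum>k<m. a k * f' k x)) (at 0)"
    using assms(1) unfolding C1_fun_def by auto
  have 2: "((\<lambda>t. g (\<lambda>k. x k + t * a k)) has_real_derivative (\<Sum>k<m. a k * g' k x)) (at 0)"
    using assms(2) unfolding C1_fun_def by auto
  show "((\<lambda>t. f (\<lambda>k. x k + t * a k) * g (\<lambda>k. x k + t * a k)) has_real_derivative
     (\<Sum>k<m. a k * (f' k x * g x + f x * g' k x))) (at 0)"
    using DERIV_mult[OF 1 2]
    by (simp add: distrib_left sum.distrib sum_distrib_left sum_distrib_right mult_ac)
qed (use assms in \<open>auto simp: C1_fun_def intro!: continuous_intros\<close>)

lemma C1_fun_cmult: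
  assumes "C1_fun m f f'" shows "C1_fun m (\<lambda>x. c * f x) (\<lambda>k x. c * f' k x)"
  by (rule C1_fun_cong[OF C1_fun_mult[OF C1_fun_const[of m c] assms]]) auto

lemma C1_fun_sum:
  assumes "\<And>i. i \<in> A \<Longrightarrow> C1_fun m (f i) (f' i)"
  shows "C1_fun m (\<lambda>x. \<Sum>i\<in>A. f i x) (\<lambda>k x. \<Sum>i\<in>A. f' i k x)"
  using assms
proof (induction A rule: infinite_finite_induct)
  case (insert a A)
  then have "C1_fun m (\<lambda>x. f a x + (\<Sum>i\<in>A. f i x)) (\<lambda>k x. f' a k x + (\<Sum>i\<in>A. f' i k x))"
    by (intro C1_fun_add) auto
  then show ?case using insert by simp
qed (auto intro: C1_fun_const)

lemma C1_fun_compose: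
  assumes "C1_fun m f f'" "\<And>y. (\<phi> has_real_derivative \<phi>' y) (at y)" "continuous_on UNIV \<phi>'"
  shows "C1_fun m (\<lambda>x. \<phi> (f x)) (\<lambda>k x. \<phi>' (f x) * f' k x)"
  unfolding C1_fun_def
proof (intro conjI allI)
  have cont: "continuous_on UNIV \<phi>"
    using assms(2) by (meson DERIV_isCont continuous_at_imp_continuous_on)
  have f: "continuous_on UNIV f" using assms(1) unfolding C1_fun_def by auto
  show "continuous_on UNIV (\<lambda>x. \<phi> (f x))"
    using continuous_on_compose2[OF cont f] by auto
  have "continuous_on UNIV (\<lambda>x. \<phi>' (f x))"
    using continuous_on_compose2[OF assms(3) f] by auto
  then show "continuous_on UNIV (\<lambda>x. \<phi>' (f x) * f' k x)" for k
    using assms(1) unfolding C1_fun_def by (auto intro!: continuous_intros)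
  fix x a :: "nat \<Rightarrow> real"
  have 1: "((\<lambda>t. f (\<lambda>k. x k + t * a k)) has_real_derivative (\<Sum>k<m. a k * f' k x)) (at 0)"
    using assms(1) unfolding C1_fun_def by auto
  have 2: "(\<phi> has_real_derivative \<phi>' (f x)) (at (f (\<lambda>k. x k + 0 * a k)))"
    using assms(2) by simp
  show "((\<lambda>t. \<phi> (f (\<lambda>k. x k + t * a k))) has_real_derivative
      (\<Sum>k<m. a k * (\<phi>' (f x) * f' k x))) (at 0)"
    using DERIV_chain2[OF 2 1] by (simp add: sum_distrib_left mult_ac)
qed

lemma C1_fun_inverse:
  assumes "C1_fun m f f'" "\<And>x. f x > 0"
  shows "C1_fun m (\<lambda>x. 1 / f x) (\<lambda>k x. - f' k x / (f x)\<^sup>2)"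
  unfolding C1_fun_def
proof (intro conjI allI)
  have nz: "f x \<noteq> 0" for x using assms(2)[of x] by simp
  have f: "continuous_on UNIV f" "\<And>k. continuous_on UNIV (f' k)"
    using assms(1) unfolding C1_fun_def by auto
  show "continuous_on UNIV (\<lambda>x. 1 / f x)" "\<And>k. continuous_on UNIV (\<lambda>x. - f' k x / (f x)\<^sup>2)"
    using f nz by (auto intro!: continuous_intros)
  fix x a :: "nat \<Rightarrow> real"
  have 1: "((\<lambda>t. f (\<lambda>k. x k + t * a k)) has_real_derivative (\<Sum>k<m. a k * f' k x)) (at 0)"
    using assms(1) unfolding C1_fun_def by auto
  have "((\<lambda>t. 1 / f (\<lambda>k. x k + t * a k)) has_real_derivative
      - (\<Sum>k<m. a k * f' k x) / (f x)\<^sup>2) (at 0)"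
    using DERIV_divide[OF DERIV_const[of 1] 1] nz by (simp add: power2_eq_square)
  moreover have "- (\<Sum>k<m. a k * f' k x) / (f x)\<^sup>2 = (\<Sum>k<m. a k * (- f' k x / (f x)\<^sup>2))"
    by (simp add: sum_negf sum_divide_distrib)
  ultimately show "((\<lambda>t. 1 / f (\<lambda>k. x k + t * a k)) has_real_derivative
      (\<Sum>k<m. a k * (- f' k x / (f x)\<^sup>2))) (at 0)" by simp
qed

lemma C1_fun_linear: "C1_fun m (\<lambda>x. \<Sum>k<m. c k * x k) (\<lambda>k _. if k < m then c k else 0)"
proof (rule C1_fun_cong)
  show "C1_fun m (\<lambda>x. \<Sum>k<m. c k * x k) (\<lambda>j x. \<Sum>k<m. c k * (if j = k then 1 else 0))"
    by (intro C1_fun_sum C1_fun_cmult C1_fun_coord) auto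
  show "(\<Sum>k<m. c k * (if j = k then 1 else 0)) = (if j < m then c j else 0)" for j
  proof -
    have "(\<Sum>k<m. c k * (if j = k then 1 else 0)) = (\<Sum>k<m. if k = j then c k else 0)"
      by (intro sum.cong) auto
    then show ?thesis by simp
  qed
qed simp

section \<open>Integration by parts in six directions\<close>

text \<open>The deviation from the identity contributes at most
  \<open>1/30 * (\<Sum>i<6. \<bar>p i\<bar>)\<^sup>2\<close>, which Cauchy-Schwarz over six terms
  turns into \<open>6/30\<close> of the squared norm. The identity contributes the squared norm
  itself.\<close>

lemma near_identity_form_bound:
  fixes a :: "nat \<Rightarrow> nat \<Rightarrow> real" and p :: "nat \<Rightarrow> real"
  assumes "\<And>i j. i < 6 \<Longrightarrow> j < 6 \<Longrightarrow> \<bar>a i j - (if i = j then 1 else 0)\<bar> \<le> 1/30"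
  shows "\<bar>\<Sum>i<6. \<Sum>j<6. a i j * (p i * p j)\<bar> \<le> 6/5 * (\<Sum>i<6. (p i)\<^sup>2)"
proof -
  let ?\<delta> = "\<lambda>i j :: nat. if i = j then 1 else 0 :: real"
  have diag: "(\<Sum>i<6. \<Sum>j<6. ?\<delta> i j * (p i * p j)) = (\<Sum>i<6. (p i)\<^sup>2)"
  proof (rule sum.cong)
    fix i :: nat assume i: "i \<in> {..<6}"
    have "(\<Sum>j<6. ?\<delta> i j * (p i * p j)) = (\<Sum>j<6. if j = i then (p i)\<^sup>2 else 0)"
      by (intro sum.cong) (auto simp: power2_eq_square)
    then show "(\<Sum>j<6. ?\<delta> i j * (p i * p j)) = (p i)\<^sup>2" using i by simp
  qed simp
  have "\<bar>\<Sum>i<6. \<Sum>j<6. (a i j - ?\<delta> i j) * (p i * p j)\<bar>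
      \<le> (\<Sum>i<6. \<Sum>j<6. \<bar>(a i j - ?\<delta> i j) * (p i * p j)\<bar>)"
    by (intro order_trans[OF sum_abs] sum_mono sum_abs)
  also have "\<dots> \<le> (\<Sum>i<6. \<Sum>j<6. 1/30 * (\<bar>p i\<bar> * \<bar>p j\<bar>))"
    unfolding abs_mult using assms by (intro sum_mono mult_right_mono) auto
  also have "\<dots> = 1/30 * (\<Sum>i<6. \<bar>p i\<bar>)\<^sup>2"
    unfolding power2_eq_square sum_product by (simp add: sum_distrib_left)
  also have "\<dots> \<le> 1/30 * (6 * (\<Sum>i<6. (p i)\<^sup>2))"
    using sum_squared_le_sum_of_squares[of "\<lambda>i. \<bar>p i\<bar>" "{..<6::nat}"] by simp
  finally have off: "\<bar>\<Sum>i<6. \<Sum>j<6. (a i j - ?\<delta> i j) * (p i * p j)\<bar> \<le> 1/5 * (\<Sum>i<6. (p i)\<^sup>2)"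
    by simp
  have "(\<Sum>i<6. \<Sum>j<6. a i j * (p i * p j)) =
      (\<Sum>i<6. \<Sum>j<6. (a i j - ?\<delta> i j) * (p i * p j)) + (\<Sum>i<6. \<Sum>j<6. ?\<delta> i j * (p i * p j))"
    unfolding sum.distrib[symmetric] by (intro sum.cong refl) (simp add: algebra_simps)
  moreover have "(\<Sum>i<6. (p i)\<^sup>2) \<ge> 0" by (simp add: sum_nonneg)
  ultimately show ?thesis using off unfolding diag by linarith
qed

text \<open>Weighted arithmetic-geometric inequality for \<open>x, v, v, v\<close>. In
  \<open>hardy\<close> it is applied with \<open>x ^ 4 = X_sq\<^sup>2\<close> and
  \<open>v ^ 4 = iS\<^sup>2\<close>, so that the term to be absorbed receives the weight
  3/4.\<close>

lemma young_3_4: "4 * x * v ^ 3 \<le> x ^ 4 + 3 * v ^ 4" for x v :: real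
proof -
  have "x ^ 4 + 3 * v ^ 4 - 4 * x * v ^ 3 = (x - v)\<^sup>2 * ((x + v)\<^sup>2 + 2 * v\<^sup>2)"
    by (simp add: power2_eq_square power3_eq_cube power4_eq_xxxx algebra_simps)
  moreover have "0 \<le> (x - v)\<^sup>2 * ((x + v)\<^sup>2 + 2 * v\<^sup>2)" by simp
  ultimately show ?thesis by linarith
qed

text \<open>The weight is made for an \<open>x\<close> of size \<open>\<rho>\<close> and a
  \<open>y\<close> of size 1: both terms on the right are then of order \<open>\<rho>\<close>, which
  keeps the final estimate linear in \<open>\<rho>\<close>.\<close>

lemma young_2:
  fixes x y :: real assumes "\<rho> > 0" shows "x * y \<le> x\<^sup>2 / (2 * \<rho>) + \<rho> / 2 * y\<^sup>2"
proof -
  have "0 \<le> (x - \<rho> * y)\<^sup>2" by simp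
  then have "2 * \<rho> * (x * y) \<le> x\<^sup>2 + \<rho>\<^sup>2 * y\<^sup>2"
    by (simp add: power2_diff power_mult_distrib mult_ac)
  then have "x * y \<le> (x\<^sup>2 + \<rho>\<^sup>2 * y\<^sup>2) / (2 * \<rho>)" using assms by (simp add: field_simps)
  also have "\<dots> = x\<^sup>2 / (2 * \<rho>) + \<rho> / 2 * y\<^sup>2" using assms by (simp add: field_simps power2_eq_square)
  finally show ?thesis .
qed

text \<open>
  \<open>\<xi>\<close> will be a Gaussian vector and \<open>X i\<close> a Gaussian variable with \<open>\<alpha> i k\<close> the covariance of \<open>X i\<close> and
  \<open>\<xi> k\<close>, so that \<open>\<Sum>k<m. \<alpha> i k * f' k\<close> is the Malliavin derivative of \<open>f \<xi>\<close> in direction \<open>i\<close>.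
\<close>

locale stein_vector = prob_space M for M :: "'a measure" +
  fixes m :: nat and \<xi> :: "'a \<Rightarrow> nat \<Rightarrow> real" and X :: "nat \<Rightarrow> 'a \<Rightarrow> real"
    and \<alpha> :: "nat \<Rightarrow> nat \<Rightarrow> real"
  assumes xi_meas [measurable]: "\<xi> \<in> borel_measurable M"
    and X_meas [measurable]: "\<And>i. X i \<in> borel_measurable M"
    and X4: "\<And>i. i < 6 \<Longrightarrow> integrable M (\<lambda>\<omega>. X i \<omega> ^ 4)"
    and stein: "\<And>i f f'. i < 6 \<Longrightarrow> C1_fun m f f' \<Longrightarrow> growth m 0 f \<Longrightarrow> (\<And>k. k < m \<Longrightarrow> growth m 0 (f' k)) \<Longrightarrow>
      expectation (\<lambda>\<omega>. f (\<xi> \<omega>) * X i \<omega>) = (\<Sum>k<m. \<alpha> i k * expectation (\<lambda>\<omega>. f' k (\<xi> \<omega>)))"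
begin

lemma X_int:
  assumes "i < 6" shows "integrable M (X i)" "integrable M (\<lambda>\<omega>. (X i \<omega>)\<^sup>2)"
proof -
  have *: "\<bar>x\<bar> \<le> 1 + x ^ 4 \<and> x\<^sup>2 \<le> 1 + x ^ 4" for x :: real
  proof -
    have "2 * x\<^sup>2 \<le> 1 + (x\<^sup>2)\<^sup>2" "2 * \<bar>x\<bar> \<le> 1 + x\<^sup>2"
      using sum_squares_bound[of 1 "x\<^sup>2"] sum_squares_bound[of 1 "\<bar>x\<bar>"] by auto
    moreover have "(x\<^sup>2)\<^sup>2 = x ^ 4" by simp
    moreover have "0 \<le> x\<^sup>2" "0 \<le> x ^ 4" by simp_all
    ultimately have "\<bar>x\<bar> \<le> 1 + x ^ 4" "x\<^sup>2 \<le> 1 + x ^ 4" by linarith+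
    then show ?thesis by simp
  qed
  show "integrable M (X i)"
    by (rule Bochner_Integration.integrable_bound[of M "\<lambda>\<omega>. 1 + X i \<omega> ^ 4"])
      (use X4[OF assms] * in \<open>auto intro!: AE_I2 simp: abs_le_iff\<close>)
  show "integrable M (\<lambda>\<omega>. (X i \<omega>)\<^sup>2)"
    by (rule Bochner_Integration.integrable_bound[of M "\<lambda>\<omega>. 1 + X i \<omega> ^ 4"])
      (use X4[OF assms] * in \<open>auto intro!: AE_I2\<close>)
qed

lemma cont_meas:
  assumes "continuous_on UNIV f" shows "(\<lambda>\<omega>. f (\<xi> \<omega>)) \<in> borel_measurable M"
  using borel_measurable_continuous_onI[OF assms] xi_meas by measurable

lemma bounded_int:
  assumes "continuous_on UNIV f" "growth m 0 f"
  shows "integrable M (\<lambda>\<omega>. f (\<xi> \<omega>))"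
proof -
  obtain C where "\<And>x. \<bar>f x\<bar> \<le> C" using assms(2) by (auto simp: growth_bounded)
  then show ?thesis using cont_meas[OF assms(1)]
    by (intro integrable_const_bound[where B=C]) auto
qed

lemma bounded_int_X:
  assumes "continuous_on UNIV f" "growth m 0 f" "i < 6"
  shows "integrable M (\<lambda>\<omega>. f (\<xi> \<omega>) * X i \<omega>)"
proof -
  obtain C where C: "\<And>x. \<bar>f x\<bar> \<le> C" using assms(2) by (auto simp: growth_bounded)
  have [measurable]: "(\<lambda>\<omega>. f (\<xi> \<omega>)) \<in> borel_measurable M" using cont_meas[OF assms(1)] .
  show ?thesis
  proof (rule Bochner_Integration.integrable_bound[of M "\<lambda>\<omega>. C * X i \<omega>"])
    show "integrable M (\<lambda>\<omega>. C * X i \<omega>)" using X_int assms(3) by simp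
    have "\<bar>f x\<bar> * \<bar>X i \<omega>\<bar> \<le> \<bar>C\<bar> * \<bar>X i \<omega>\<bar>" for x \<omega>
      using C[of x] by (intro mult_right_mono) auto
    then show "AE \<omega> in M. norm (f (\<xi> \<omega>) * X i \<omega>) \<le> norm (C * X i \<omega>)"
      by (auto simp: abs_mult)
  qed measurable
qed

text \<open>Gaussian divergence theorem in the six directions: the field \<open>f\<close> is paired
  with the Gaussian variables \<open>X i\<close> on one side, and its divergence is integrated on
  the other.\<close>

lemma stein_sum:
  assumes "\<And>i. i < 6 \<Longrightarrow> C1_fun m (f i) (f' i)" "\<And>i. i < 6 \<Longrightarrow> growth m 0 (f i)"
    "\<And>i k. i < 6 \<Longrightarrow> k < m \<Longrightarrow> growth m 0 (f' i k)"
  shows "integrable M (\<lambda>\<omega>. \<Sum>i<6. f i (\<xi> \<omega>) * X i \<omega>)"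
    "integrable M (\<lambda>\<omega>. \<Sum>i<6. \<Sum>k<m. \<alpha> i k * f' i k (\<xi> \<omega>))"
    "expectation (\<lambda>\<omega>. \<Sum>i<6. f i (\<xi> \<omega>) * X i \<omega>) =
     expectation (\<lambda>\<omega>. \<Sum>i<6. \<Sum>k<m. \<alpha> i k * f' i k (\<xi> \<omega>))"
proof -
  have c: "i < 6 \<Longrightarrow> continuous_on UNIV (f i)" "i < 6 \<Longrightarrow> continuous_on UNIV (f' i k)" for i k
    using assms(1) unfolding C1_fun_def by auto
  have i1: "integrable M (\<lambda>\<omega>. f i (\<xi> \<omega>) * X i \<omega>)" if "i < 6" for i
    using bounded_int_X c assms(2) that by blast
  have i2: "integrable M (\<lambda>\<omega>. f' i k (\<xi> \<omega>))" if "i < 6" "k < m" for i k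
    using bounded_int[OF c(2) assms(3)] that by blast
  show "integrable M (\<lambda>\<omega>. \<Sum>i<6. f i (\<xi> \<omega>) * X i \<omega>)" using i1 by auto
  show "integrable M (\<lambda>\<omega>. \<Sum>i<6. \<Sum>k<m. \<alpha> i k * f' i k (\<xi> \<omega>))"
    using i2 by (intro Bochner_Integration.integrable_sum integrable_mult_right) auto
  have "expectation (\<lambda>\<omega>. \<Sum>i<6. f i (\<xi> \<omega>) * X i \<omega>)
      = (\<Sum>i<6. expectation (\<lambda>\<omega>. f i (\<xi> \<omega>) * X i \<omega>))"
    using i1 by (intro Bochner_Integration.integral_sum) auto
  also have "\<dots> = (\<Sum>i<6. \<Sum>k<m. \<alpha> i k * expectation (\<lambda>\<omega>. f' i k (\<xi> \<omega>)))"
    using stein assms by (intro sum.cong) auto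
  also have "\<dots> = (\<Sum>i<6. \<Sum>k<m. expectation (\<lambda>\<omega>. \<alpha> i k * f' i k (\<xi> \<omega>)))" by simp
  also have "\<dots> = (\<Sum>i<6. expectation (\<lambda>\<omega>. \<Sum>k<m. \<alpha> i k * f' i k (\<xi> \<omega>)))"
    using i2 by (intro sum.cong Bochner_Integration.integral_sum[symmetric]) auto
  also have "\<dots> = expectation (\<lambda>\<omega>. \<Sum>i<6. \<Sum>k<m. \<alpha> i k * f' i k (\<xi> \<omega>))"
    using i2 by (intro Bochner_Integration.integral_sum[symmetric] Bochner_Integration.integrable_sum integrable_mult_right) auto
  finally show "expectation (\<lambda>\<omega>. \<Sum>i<6. f i (\<xi> \<omega>) * X i \<omega>) =
     expectation (\<lambda>\<omega>. \<Sum>i<6. \<Sum>k<m. \<alpha> i k * f' i k (\<xi> \<omega>))" .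
qed

definition X_sq :: "'a \<Rightarrow> real" where "X_sq \<omega> = (\<Sum>i<6. (X i \<omega>)\<^sup>2)"

lemma X_sq_meas [measurable]: "X_sq \<in> borel_measurable M" unfolding X_sq_def by measurable

lemma X_sq_nonneg: "X_sq \<omega> \<ge> 0" unfolding X_sq_def by (simp add: sum_nonneg)

lemma X_sq_int: "integrable M (\<lambda>\<omega>. (X_sq \<omega>)\<^sup>2)"
proof (rule Bochner_Integration.integrable_bound[of M "\<lambda>\<omega>. 6 * (\<Sum>i<6. X i \<omega> ^ 4)"])
  show "integrable M (\<lambda>\<omega>. 6 * (\<Sum>i<6. X i \<omega> ^ 4))"
    using X4 by (intro integrable_mult_right Bochner_Integration.integrable_sum) auto
  have "(X_sq \<omega>)\<^sup>2 \<le> 6 * (\<Sum>i<6. X i \<omega> ^ 4)" for \<omega>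
    using sum_squared_le_sum_of_squares[of "\<lambda>i. (X i \<omega>)\<^sup>2" "{..<6::nat}"]
    unfolding X_sq_def by (simp flip: power_mult)
  then show "AE \<omega> in M. norm ((X_sq \<omega>)\<^sup>2) \<le> norm (6 * (\<Sum>i<6. X i \<omega> ^ 4))"
    by (auto intro!: AE_I2 order_trans[OF _ abs_ge_self])
qed measurable

text \<open>The only moment that survives in the final estimate. It depends on the directions alone
  and not on the quadratic polynomial under consideration.\<close>

definition \<kappa> :: real where "\<kappa> = expectation (\<lambda>\<omega>. (X_sq \<omega>)\<^sup>2)"

end

text \<open>
  The linear forms \<open>p i\<close> below are halved derivatives of a quadratic polynomial. The regularisation \<open>\<eta>\<close>,
  which tends to zero in the end, keeps \<open>S\<close> away from zero.
\<close>

locale stein_field = stein_vector M m \<xi> X \<alpha> for M :: "'a measure" and m \<xi> X \<alpha> +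
  fixes \<beta> :: "nat \<Rightarrow> nat \<Rightarrow> real" and \<eta> :: real
  assumes near_id: "\<And>i j. i < 6 \<Longrightarrow> j < 6 \<Longrightarrow>
      \<bar>(\<Sum>k<m. \<alpha> i k * \<beta> j k) - (if i = j then 1 else 0)\<bar> \<le> 1/30"
    and eta: "\<eta> > 0"
begin

definition p :: "nat \<Rightarrow> (nat \<Rightarrow> real) \<Rightarrow> real" where "p i x = (\<Sum>k<m. \<beta> i k * x k)"
definition a :: "nat \<Rightarrow> nat \<Rightarrow> real" where "a i j = (\<Sum>k<m. \<alpha> i k * \<beta> j k)"
definition S :: "(nat \<Rightarrow> real) \<Rightarrow> real" where "S x = \<eta> + (\<Sum>i<6. (p i x)\<^sup>2)"
definition iS :: "(nat \<Rightarrow> real) \<Rightarrow> real" where "iS x = 1 / S x"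
text \<open>The regularised field \<open>p / \<bar>p\<bar>\<^sup>2\<close>. Multiplied once more by
  \<open>iS\<close> it becomes the regularised \<open>p / \<bar>p\<bar> ^ 4\<close>.\<close>

definition w :: "nat \<Rightarrow> (nat \<Rightarrow> real) \<Rightarrow> real" where "w i x = p i x * iS x"
text \<open>Padded with zeros from \<open>m\<close> on, the form in which
  \<open>C1_fun_linear\<close> returns the gradient of a linear form.\<close>

definition \<beta>' :: "nat \<Rightarrow> nat \<Rightarrow> real" where "\<beta>' i k = (if k < m then \<beta> i k else 0)"

lemma S_ge: "S x \<ge> \<eta>" unfolding S_def by (simp add: sum_nonneg)
lemma S_pos: "S x > 0" using S_ge eta by (rule less_le_trans[rotated])
lemma iS_pos: "iS x > 0" unfolding iS_def using S_pos by simp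

lemma C1_p: "C1_fun m (p i) (\<lambda>k _. \<beta>' i k)"
  unfolding p_def \<beta>'_def by (rule C1_fun_linear)

lemma C1_S: "C1_fun m S (\<lambda>k x. \<Sum>j<6. 2 * \<beta>' j k * p j x)"
  by (rule C1_fun_cong[OF C1_fun_add[OF C1_fun_const[of m \<eta>]
        C1_fun_sum[OF C1_fun_mult[OF C1_p C1_p]]]])
    (auto simp: S_def power2_eq_square algebra_simps)

lemma C1_iS: "C1_fun m iS (\<lambda>k x. - (\<Sum>j<6. 2 * \<beta>' j k * w j x) * iS x)"
  by (rule C1_fun_cong[OF C1_fun_inverse[OF C1_S S_pos]])
    (auto simp: iS_def w_def power2_eq_square sum_divide_distrib sum_distrib_right)

lemma C1_w: "C1_fun m (w i) (\<lambda>k x. \<beta>' i k * iS x - (\<Sum>j<6. 2 * \<beta>' j k * (w i x * w j x)))"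
  unfolding w_def
  by (rule C1_fun_cong[OF C1_fun_mult[OF C1_p C1_iS]])
    (auto simp: w_def sum_distrib_left sum_distrib_right mult_ac sum_negf)

text \<open>The function is \<open>p i * iS\<^sup>2\<close>. The coefficient 4 is the exponent in
  \<open>1 / \<bar>p\<bar> ^ 4\<close>; in the divergence it competes with the trace of
  \<open>a\<close>, which is close to 6.\<close>

lemma C1_v: "C1_fun m (\<lambda>x. w i x * iS x)
   (\<lambda>k x. \<beta>' i k * (iS x * iS x) - (\<Sum>j<6. 4 * \<beta>' j k * (w i x * w j x * iS x)))"
proof (rule C1_fun_cong[OF C1_fun_mult[OF C1_w C1_iS]])
  fix k x
  have "(\<beta>' i k * iS x - (\<Sum>j<6. 2 * \<beta>' j k * (w i x * w j x))) * iS x +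
       w i x * (- (\<Sum>j<6. 2 * \<beta>' j k * w j x) * iS x)
     = \<beta>' i k * (iS x * iS x) - ((\<Sum>j<6. 2 * \<beta>' j k * (w i x * w j x * iS x)) +
        (\<Sum>j<6. 2 * \<beta>' j k * (w i x * w j x * iS x)))"
    by (simp add: algebra_simps sum_distrib_left sum_distrib_right)
  also have "\<dots> = \<beta>' i k * (iS x * iS x) - (\<Sum>j<6. 4 * \<beta>' j k * (w i x * w j x * iS x))"
    unfolding sum.distrib[symmetric] by (simp add: algebra_simps)
  finally show "(\<beta>' i k * iS x - (\<Sum>j<6. 2 * \<beta>' j k * (w i x * w j x))) * iS x +
       w i x * (- (\<Sum>j<6. 2 * \<beta>' j k * w j x) * iS x)
     = \<beta>' i k * (iS x * iS x) - (\<Sum>j<6. 4 * \<beta>' j k * (w i x * w j x * iS x))" .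
qed simp

lemma iS_le: "iS x \<le> 1 / \<eta>"
  unfolding iS_def using S_ge[of x] eta by (simp add: frac_le)

lemma p_sq_le: assumes "i < 6" shows "(p i x)\<^sup>2 \<le> S x"
proof -
  have "(p i x)\<^sup>2 \<le> (\<Sum>i<6. (p i x)\<^sup>2)" using assms by (intro member_le_sum) auto
  then show ?thesis unfolding S_def using eta by simp
qed

lemma w_le: assumes "i < 6" shows "\<bar>w i x\<bar> \<le> 1 + 1 / \<eta>"
proof -
  have "\<bar>p i x\<bar> \<le> 1 + (p i x)\<^sup>2" using sum_squares_bound[of 1 "\<bar>p i x\<bar>"]
    by simp
  then have "\<bar>w i x\<bar> \<le> (1 + S x) * iS x"
    unfolding w_def abs_mult abs_of_pos[OF iS_pos] using p_sq_le[OF assms, of x] iS_pos[of x]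
    by (intro mult_right_mono) auto
  also have "\<dots> = 1 + iS x" unfolding iS_def using S_pos[of x] by (simp add: field_simps)
  finally show ?thesis using iS_le[of x] by simp
qed

lemma growth_iS: "growth m 0 iS"
  unfolding growth_bounded using iS_le iS_pos by (intro exI[of _ "1 / \<eta>"]) (simp add: less_imp_le)

lemma growth_w: "i < 6 \<Longrightarrow> growth m 0 (w i)"
  unfolding growth_bounded using w_le by (intro exI[of _ "1 + 1/\<eta>"]) auto

lemma growth_0_mult: "growth m 0 f \<Longrightarrow> growth m 0 g \<Longrightarrow> growth m 0 (\<lambda>x. f x * g x)"
  by (rule growth_mult') auto

lemma growth_0_diff: "growth m 0 f \<Longrightarrow> growth m 0 g \<Longrightarrow> growth m 0 (\<lambda>x. f x - g x)"
  using growth_add[of m 0 f "\<lambda>x. - g x"] growth_minus by simp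

text \<open>\<open>S\<close> exceeds \<open>\<bar>p\<bar>\<^sup>2\<close> by \<open>\<eta>\<close>,
  so cancelling it against one factor \<open>iS\<close> costs an inequality in the favourable
  direction only.\<close>

lemma sum_w_sq: "(\<Sum>i<6. (w i x)\<^sup>2) \<le> iS x"
proof -
  have "(\<Sum>i<6. (w i x)\<^sup>2) = (\<Sum>i<6. (p i x)\<^sup>2) * (iS x)\<^sup>2"
    unfolding w_def by (simp add: power_mult_distrib sum_distrib_right)
  also have "\<dots> \<le> S x * (iS x)\<^sup>2" unfolding S_def using eta by (intro mult_right_mono) auto
  also have "\<dots> = iS x" unfolding iS_def using S_pos[of x] by (simp add: power2_eq_square)
  finally show ?thesis .
qed

lemma sum_alpha_beta: "(\<Sum>k<m. \<alpha> i k * \<beta>' j k) = a i j"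
  unfolding a_def \<beta>'_def by (intro sum.cong) auto

lemma a_near: "i < 6 \<Longrightarrow> j < 6 \<Longrightarrow> \<bar>a i j - (if i = j then 1 else 0)\<bar> \<le> 1/30"
  using near_id unfolding a_def by auto

lemma trace_a: "\<bar>(\<Sum>i<6. a i i) - 6\<bar> \<le> 1/5"
proof -
  have "\<bar>\<Sum>i<6::nat. a i i - 1\<bar> \<le> (\<Sum>i<6::nat. 1/30)"
    using a_near by (intro order_trans[OF sum_abs] sum_mono) force
  then show ?thesis by (simp add: sum_subtractf)
qed

text \<open>The trace of \<open>a\<close> is at least 29/5 and the quadratic form in
  \<open>w\<close> at most \<open>6/5 * iS\<close>, so the coefficient of \<open>iS\<^sup>2\<close>
  is at least \<open>29/5 - 4 * 6/5 = 1\<close>. The tolerance 1/30 in \<open>near_id\<close> is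
  chosen to make this difference exactly 1.\<close>

lemma div_v: "(\<Sum>i<6. \<Sum>k<m. \<alpha> i k * (\<beta>' i k * (iS x * iS x) - (\<Sum>j<6. 4 * \<beta>' j k * (w i x * w j x * iS x))))
   \<ge> (iS x)\<^sup>2" (is "?L \<ge> _")
proof -
  have "(\<Sum>k<m. \<alpha> i k * (\<beta>' i k * (iS x * iS x) - (\<Sum>j<6. 4 * \<beta>' j k * (w i x * w j x * iS x))))
      = a i i * (iS x)\<^sup>2 - 4 * iS x * (\<Sum>j<6. a i j * (w i x * w j x))" for i
  proof -
    have "(\<Sum>k<m. \<alpha> i k * (\<Sum>j<6. 4 * \<beta>' j k * (w i x * w j x * iS x)))
       = (\<Sum>j<6. \<Sum>k<m. \<alpha> i k * (4 * \<beta>' j k * (w i x * w j x * iS x)))"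
      unfolding sum_distrib_left by (rule sum.swap)
    also have "\<dots> = (\<Sum>j<6. 4 * iS x * (w i x * w j x) * (\<Sum>k<m. \<alpha> i k * \<beta>' j k))"
      by (simp add: sum_distrib_left mult_ac)
    also have "\<dots> = 4 * iS x * (\<Sum>j<6. a i j * (w i x * w j x))"
      by (simp add: sum_alpha_beta sum_distrib_left mult_ac)
    finally show ?thesis
      using sum_alpha_beta[of i i]
      by (simp add: right_diff_distrib sum_subtractf power2_eq_square mult.assoc[symmetric]
          flip: sum_distrib_right)
  qed
  then have "?L = (\<Sum>i<6. a i i) * (iS x)\<^sup>2 - 4 * iS x * (\<Sum>i<6. \<Sum>j<6. a i j * (w i x * w j x))"
    by (simp add: sum_subtractf sum_distrib_left sum_distrib_right)
  moreover have "4 * iS x * (\<Sum>i<6. \<Sum>j<6. a i j * (w i x * w j x)) \<le> 4 * iS x * (6/5 * iS x)"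
    using near_identity_form_bound[of a "\<lambda>i. w i x", OF a_near] sum_w_sq[of x] iS_pos[of x]
    by (intro mult_left_mono) auto
  moreover have "(\<Sum>i<6. a i i) * (iS x)\<^sup>2 \<ge> 29/5 * (iS x)\<^sup>2"
  proof (rule mult_right_mono)
    show "29/5 \<le> (\<Sum>i<6. a i i)" using trace_a by linarith
  qed simp
  ultimately show ?thesis by (simp add: power2_eq_square)
qed

lemma sum_wX: "(\<Sum>i<6. w i x * X i \<omega>)\<^sup>2 \<le> iS x * X_sq \<omega>"
proof -
  have "(\<Sum>i<6. w i x * X i \<omega>)\<^sup>2 \<le> (\<Sum>i<6. (w i x)\<^sup>2) * (\<Sum>i<6. (X i \<omega>)\<^sup>2)"
    by (rule Cauchy_Schwarz_ineq_sum)
  also have "\<dots> \<le> iS x * X_sq \<omega>" unfolding X_sq_def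
    using sum_w_sq by (intro mult_right_mono sum_nonneg) auto
  finally show ?thesis .
qed

lemma C1_iS_cont: "continuous_on UNIV iS" using C1_iS unfolding C1_fun_def by auto

text \<open>
  Integrates the divergence estimate \<open>div_v\<close> and absorbs a part of the right hand side by Young's inequality.
  The bound does not depend on \<open>\<eta>\<close>, nor on the form \<open>\<beta>\<close>.
\<close>

lemma hardy: "integrable M (\<lambda>\<omega>. (iS (\<xi> \<omega>))\<^sup>2)" "expectation (\<lambda>\<omega>. (iS (\<xi> \<omega>))\<^sup>2) \<le> \<kappa>"
proof -
  let ?f' = "\<lambda>i k x. \<beta>' i k * (iS x * iS x) - (\<Sum>j<6. 4 * \<beta>' j k * (w i x * w j x * iS x))"
  have g1: "growth m 0 (\<lambda>x. w i x * iS x)" if "i < 6" for i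
    using that by (intro growth_0_mult growth_w growth_iS)
  have g2: "growth m 0 (?f' i k)" if "i < 6" for i k
    using that by (intro growth_0_mult growth_0_diff growth_w growth_iS growth_const growth_sum) auto
  note st = stein_sum[where f="\<lambda>i x. w i x * iS x" and f'="?f'", OF C1_v g1 g2]
  show int: "integrable M (\<lambda>\<omega>. (iS (\<xi> \<omega>))\<^sup>2)"
    unfolding power2_eq_square
    using C1_iS_cont growth_iS by (intro bounded_int growth_0_mult continuous_intros) auto
  have "expectation (\<lambda>\<omega>. (iS (\<xi> \<omega>))\<^sup>2) \<le> expectation (\<lambda>\<omega>. \<Sum>i<6. \<Sum>k<m. \<alpha> i k * ?f' i k (\<xi> \<omega>))"
    using int st(2) div_v by (intro integral_mono) auto
  also have "\<dots> = expectation (\<lambda>\<omega>. \<Sum>i<6. (w i (\<xi> \<omega>) * iS (\<xi> \<omega>)) * X i \<omega>)"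
    using st(3) by simp
  also have "\<dots> \<le> expectation (\<lambda>\<omega>. 3/4 * (iS (\<xi> \<omega>))\<^sup>2 + 1/4 * (X_sq \<omega>)\<^sup>2)"
  proof (rule integral_mono)
    show "integrable M (\<lambda>\<omega>. \<Sum>i<6. (w i (\<xi> \<omega>) * iS (\<xi> \<omega>)) * X i \<omega>)" using st(1) by simp
    show "integrable M (\<lambda>\<omega>. 3/4 * (iS (\<xi> \<omega>))\<^sup>2 + 1/4 * (X_sq \<omega>)\<^sup>2)" using int X_sq_int by auto
    fix \<omega>
    let ?x = "\<xi> \<omega>"
    have pos: "iS ?x \<ge> 0" "X_sq \<omega> \<ge> 0" using iS_pos[of ?x] X_sq_nonneg by auto
    have "(\<Sum>i<6. (w i ?x * iS ?x) * X i \<omega>) = iS ?x * (\<Sum>i<6. w i ?x * X i \<omega>)"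
      by (simp add: sum_distrib_left mult_ac)
    also have "\<dots> \<le> iS ?x * sqrt (iS ?x * X_sq \<omega>)"
      using sum_wX[of ?x \<omega>] pos by (intro mult_left_mono real_le_rsqrt) auto
    also have "\<dots> = sqrt (X_sq \<omega>) * (sqrt (iS ?x)) ^ 3"
      using pos by (simp add: real_sqrt_mult power3_eq_cube)
    also have "\<dots> \<le> (sqrt (X_sq \<omega>) ^ 4 + 3 * sqrt (iS ?x) ^ 4) / 4"
      using young_3_4[of "sqrt (X_sq \<omega>)" "sqrt (iS ?x)"] by simp
    also have "\<dots> = 3/4 * (iS ?x)\<^sup>2 + 1/4 * (X_sq \<omega>)\<^sup>2"
    proof -
      have "sqrt y ^ 4 = y\<^sup>2" if "y \<ge> 0" for y :: real
        using that by (simp add: power4_eq_xxxx power2_eq_square)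
      then show ?thesis using pos by simp
    qed
    finally show "(\<Sum>i<6. (w i ?x * iS ?x) * X i \<omega>) \<le> 3/4 * (iS ?x)\<^sup>2 + 1/4 * (X_sq \<omega>)\<^sup>2" .
  qed
  also have "\<dots> = 3/4 * expectation (\<lambda>\<omega>. (iS (\<xi> \<omega>))\<^sup>2) + 1/4 * \<kappa>"
    unfolding \<kappa>_def using int X_sq_int by simp
  \<comment> \<open>The term with weight 3/4 moves to the left side. This is legitimate because it
    is finite: \<open>iS\<close> is bounded by \<open>1 / \<eta>\<close>.\<close>
  finally show "expectation (\<lambda>\<omega>. (iS (\<xi> \<omega>))\<^sup>2) \<le> \<kappa>" by simp
qed

end

text \<open>
  Integration by parts is available for bounded functions with bounded derivatives only; a squared cutoff
  compensates the quadratic growth of \<open>Y * F'\<close>.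
\<close>

definition cutoff :: "nat \<Rightarrow> real \<Rightarrow> (nat \<Rightarrow> real) \<Rightarrow> real" where
  "cutoff m \<epsilon> x = 1 / (1 + \<epsilon> * (\<Sum>k<m. (x k)\<^sup>2))"

definition cutoff' :: "nat \<Rightarrow> real \<Rightarrow> nat \<Rightarrow> (nat \<Rightarrow> real) \<Rightarrow> real" where
  "cutoff' m \<epsilon> k x = (if k < m then - 2 * \<epsilon> * x k * (cutoff m \<epsilon> x)\<^sup>2 else 0)"

lemma C1_sum_sq: "C1_fun m (\<lambda>x. \<Sum>k<m. (x k)\<^sup>2) (\<lambda>j x. if j < m then 2 * x j else 0)"
proof (rule C1_fun_cong)
  show "C1_fun m (\<lambda>x. \<Sum>k<m. x k * x k)
     (\<lambda>j x. \<Sum>k<m. (if j = k then 1 else 0) * x k + x k * (if j = k then 1 else 0))"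
    by (intro C1_fun_sum C1_fun_mult C1_fun_coord) auto
  fix j :: nat and x :: "nat \<Rightarrow> real"
  have "(\<Sum>k<m. (if j = k then 1 else 0) * x k + x k * (if j = k then 1 else 0))
     = (\<Sum>k<m. if k = j then 2 * x j else 0)"
    by (intro sum.cong) auto
  then show "(\<Sum>k<m. (if j = k then 1 else 0) * x k + x k * (if j = k then 1 else 0))
     = (if j < m then 2 * x j else 0)" by simp
qed (simp add: power2_eq_square)

context
  fixes \<epsilon> :: real and m :: nat
  assumes eps: "0 < \<epsilon>" "\<epsilon> \<le> 1"
begin

lemma cutoff_denom: "1 + \<epsilon> * (\<Sum>k<m. (x k)\<^sup>2) \<ge> 1"
  using eps by (simp add: sum_nonneg)

lemma cutoff_pos: "0 < cutoff m \<epsilon> x" and cutoff_le_1: "cutoff m \<epsilon> x \<le> 1"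
  unfolding cutoff_def using cutoff_denom[of x] by auto

lemma C1_cutoff: "C1_fun m (cutoff m \<epsilon>) (cutoff' m \<epsilon>)"
proof (rule C1_fun_cong)
  show "C1_fun m (\<lambda>x. 1 / (1 + \<epsilon> * (\<Sum>k<m. (x k)\<^sup>2)))
    (\<lambda>k x. - (0 + \<epsilon> * (if k < m then 2 * x k else 0)) / (1 + \<epsilon> * (\<Sum>k<m. (x k)\<^sup>2))\<^sup>2)"
    using cutoff_denom
    by (intro C1_fun_inverse C1_fun_add C1_fun_const C1_fun_cmult C1_sum_sq) (rule less_le_trans[OF zero_less_one])
qed (auto simp: cutoff_def cutoff'_def power_divide)

lemma cutoff_le_wt: "cutoff m \<epsilon> x \<le> (1 / \<epsilon>) * wt m x powr (-1)"
proof -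
  have "\<epsilon> * wt m x \<le> 1 + \<epsilon> * (\<Sum>k<m. (x k)\<^sup>2)" unfolding wt_def using eps by (simp add: algebra_simps)
  then have "cutoff m \<epsilon> x \<le> 1 / (\<epsilon> * wt m x)"
    unfolding cutoff_def using eps wt_ge_1[of m x] by (intro divide_left_mono) (auto intro!: mult_pos_pos less_le_trans[OF zero_less_one cutoff_denom])
  also have "\<dots> = (1 / \<epsilon>) * wt m x powr (-1)" using wt_ge_1[of m x] by (simp add: powr_minus_divide)
  finally show ?thesis .
qed

text \<open>Uses \<open>2 * \<bar>x k\<bar> \<le> 1 + \<bar>x\<bar>\<^sup>2\<close> and
  \<open>\<epsilon> \<le> 1\<close>. The derivative of the cutoff thus decays as fast as the cutoff,
  so the product rule does not spoil the growth exponent of its square.\<close>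

lemma cutoff'_le: "\<bar>cutoff' m \<epsilon> k x\<bar> \<le> cutoff m \<epsilon> x"
proof (cases "k < m")
  case True
  have "(x k)\<^sup>2 \<le> (\<Sum>k<m. (x k)\<^sup>2)" using True by (intro member_le_sum) auto
  then have "2 * \<bar>x k\<bar> \<le> 1 + (\<Sum>k<m. (x k)\<^sup>2)"
    using sum_squares_bound[of 1 "\<bar>x k\<bar>"] by simp
  then have "\<epsilon> * (2 * \<bar>x k\<bar>) \<le> \<epsilon> * (1 + (\<Sum>k<m. (x k)\<^sup>2))" using eps by (intro mult_left_mono) auto
  also have "\<dots> \<le> 1 + \<epsilon> * (\<Sum>k<m. (x k)\<^sup>2)" using eps by (simp add: algebra_simps)
  finally have "\<epsilon> * (2 * \<bar>x k\<bar>) * cutoff m \<epsilon> x \<le> 1"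
    unfolding cutoff_def using cutoff_denom[of x] by (simp add: field_simps)
  then have "\<epsilon> * (2 * \<bar>x k\<bar>) * cutoff m \<epsilon> x * cutoff m \<epsilon> x \<le> 1 * cutoff m \<epsilon> x"
    using cutoff_pos[of x] by (intro mult_right_mono) auto
  then show ?thesis
    unfolding cutoff'_def using True eps by (simp add: abs_mult power2_eq_square mult_ac)
qed (use cutoff_pos[of x] in \<open>simp add: cutoff'_def\<close>)

text \<open>The factor \<open>sqrt \<epsilon>\<close> comes from \<open>2 * sqrt \<epsilon> *
  \<bar>x k\<bar> \<le> 1 + \<epsilon> * \<bar>x\<bar>\<^sup>2\<close>. It makes the terms in which
  the cutoff is differentiated vanish in the limit.\<close>

lemma cutoff'_small: "\<bar>cutoff' m \<epsilon> k x\<bar> \<le> sqrt \<epsilon> * cutoff m \<epsilon> x"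
proof (cases "k < m")
  case True
  have "(x k)\<^sup>2 \<le> (\<Sum>k<m. (x k)\<^sup>2)" using True by (intro member_le_sum) auto
  then have "\<epsilon> * (x k)\<^sup>2 \<le> \<epsilon> * (\<Sum>k<m. (x k)\<^sup>2)" using eps by (intro mult_left_mono) auto
  moreover have "2 * (sqrt \<epsilon> * \<bar>x k\<bar>) \<le> 1 + \<epsilon> * (x k)\<^sup>2"
    using sum_squares_bound[of 1 "sqrt \<epsilon> * \<bar>x k\<bar>"] eps by (simp add: power_mult_distrib)
  ultimately have "2 * (sqrt \<epsilon> * \<bar>x k\<bar>) \<le> 1 + \<epsilon> * (\<Sum>k<m. (x k)\<^sup>2)" by simp
  then have "2 * (sqrt \<epsilon> * \<bar>x k\<bar>) * cutoff m \<epsilon> x \<le> 1"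
    unfolding cutoff_def using cutoff_denom[of x] by (simp add: field_simps)
  then have "sqrt \<epsilon> * cutoff m \<epsilon> x * (2 * (sqrt \<epsilon> * \<bar>x k\<bar>) * cutoff m \<epsilon> x) \<le> sqrt \<epsilon> * cutoff m \<epsilon> x * 1"
    using cutoff_pos[of x] eps by (intro mult_left_mono) auto
  moreover have "sqrt \<epsilon> * cutoff m \<epsilon> x * (2 * (sqrt \<epsilon> * \<bar>x k\<bar>) * cutoff m \<epsilon> x) =
     2 * (sqrt \<epsilon> * sqrt \<epsilon>) * \<bar>x k\<bar> * (cutoff m \<epsilon> x)\<^sup>2"
    by (simp add: power2_eq_square mult_ac)
  ultimately show ?thesis
    unfolding cutoff'_def using True eps by (simp add: abs_mult)
qed (use cutoff_pos[of x] eps in \<open>simp add: cutoff'_def\<close>)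

lemma growth_cutoff: "growth m (-1) (cutoff m \<epsilon>)"
proof (rule growthI[where C="1 / \<epsilon>"])
  fix x show "\<bar>cutoff m \<epsilon> x\<bar> \<le> 1 / \<epsilon> * wt m x powr (-1)"
    using cutoff_le_wt[of x] cutoff_pos[of x] by simp
qed

lemma growth_cutoff': "growth m (-1) (cutoff' m \<epsilon> k)"
proof (rule growthI[where C="1 / \<epsilon>"])
  fix x show "\<bar>cutoff' m \<epsilon> k x\<bar> \<le> 1 / \<epsilon> * wt m x powr (-1)"
    using cutoff_le_wt[of x] cutoff'_le[of k x] by simp
qed

end

section \<open>The second integration by parts, with the cutoff in place\<close>

context stein_field
begin

definition w' :: "nat \<Rightarrow> nat \<Rightarrow> (nat \<Rightarrow> real) \<Rightarrow> real" where
  "w' i k x = \<beta>' i k * iS x - (\<Sum>j<6. 2 * \<beta>' j k * (w i x * w j x))"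

lemma C1_w': "C1_fun m (w i) (w' i)"
  unfolding w'_def[abs_def] by (rule C1_w)

lemma growth_w': "i < 6 \<Longrightarrow> growth m 0 (w' i k)"
  unfolding w'_def[abs_def]
  by (intro growth_0_mult growth_0_diff growth_w growth_iS growth_const growth_sum) auto

text \<open>The trace contributes at most 31/5 and the quadratic form at most
  \<open>2 * 6/5\<close>, together 43/5, rounded up to 9. Only the size matters here, whereas
  \<open>div_v\<close> is a lower bound.\<close>

lemma div_w: "\<bar>\<Sum>i<6. \<Sum>k<m. \<alpha> i k * w' i k x\<bar> \<le> 9 * iS x"
proof -
  have "(\<Sum>k<m. \<alpha> i k * w' i k x) = a i i * iS x - 2 * (\<Sum>j<6. a i j * (w i x * w j x))" for i
  proof -
    have "(\<Sum>k<m. \<alpha> i k * (\<Sum>j<6. 2 * \<beta>' j k * (w i x * w j x)))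
       = (\<Sum>j<6. \<Sum>k<m. \<alpha> i k * (2 * \<beta>' j k * (w i x * w j x)))"
      unfolding sum_distrib_left by (rule sum.swap)
    also have "\<dots> = (\<Sum>j<6. 2 * (w i x * w j x) * (\<Sum>k<m. \<alpha> i k * \<beta>' j k))"
      by (simp add: sum_distrib_left mult_ac)
    also have "\<dots> = 2 * (\<Sum>j<6. a i j * (w i x * w j x))"
      by (simp add: sum_alpha_beta sum_distrib_left mult_ac)
    finally show ?thesis
      using sum_alpha_beta[of i i] unfolding w'_def
      by (simp add: right_diff_distrib sum_subtractf mult.assoc[symmetric] flip: sum_distrib_right)
  qed
  then have eq: "(\<Sum>i<6. \<Sum>k<m. \<alpha> i k * w' i k x) =
      (\<Sum>i<6. a i i) * iS x - 2 * (\<Sum>i<6. \<Sum>j<6. a i j * (w i x * w j x))"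
    by (simp add: sum_subtractf sum_distrib_left sum_distrib_right)
  have "\<bar>\<Sum>i<6. \<Sum>j<6. a i j * (w i x * w j x)\<bar> \<le> 6/5 * iS x"
    using near_identity_form_bound[of a "\<lambda>i. w i x", OF a_near] sum_w_sq[of x] by simp
  moreover have "\<bar>(\<Sum>i<6. a i i) * iS x\<bar> \<le> 31/5 * iS x"
  proof -
    have "\<bar>\<Sum>i<6. a i i\<bar> \<le> 31/5" using trace_a by linarith
    then show ?thesis unfolding abs_mult using iS_pos[of x] by (simp add: mult_right_mono)
  qed
  ultimately show ?thesis unfolding eq using iS_pos[of x] by linarith
qed

text \<open>The reason for the choice of \<open>w\<close>: the derivatives of \<open>F\<close> in
  the six directions are \<open>2 * p i\<close>, so pairing them with \<open>w\<close> gives the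
  constant 2 up to an error proportional to \<open>\<eta>\<close>.\<close>

lemma sum_pw: "(\<Sum>i<6. p i x * w i x) = 1 - \<eta> * iS x"
proof -
  have "(\<Sum>i<6. p i x * w i x) = (\<Sum>i<6. (p i x)\<^sup>2) * iS x"
    unfolding w_def by (simp add: sum_distrib_left power2_eq_square mult_ac)
  also have "\<dots> = (S x - \<eta>) * iS x" unfolding S_def by simp
  also have "\<dots> = 1 - \<eta> * iS x" unfolding iS_def using S_pos[of x] by (simp add: field_simps)
  finally show ?thesis .
qed

text \<open>The divergence theorem is applied to \<open>\<phi> F * Y * T\<^sup>2 * w i\<close> with
  \<open>T\<close> the cutoff. The derivative falling on \<open>\<phi> F\<close> reproduces, by
  \<open>sum_pw\<close>, the quantity to be bounded. In the other terms \<open>\<phi>\<close> is not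
  differentiated and is bounded by 1, so \<open>L\<close> enters only together with the factor
  \<open>\<eta>\<close>. Negative powers of \<open>p\<close> are controlled by
  \<open>hardy\<close>.\<close>

lemma ibp_cutoff:
  assumes F: "C1_fun m F F'" "growth m 1 F" "\<And>k. k < m \<Longrightarrow> growth m 1 (F' k)"
    and DF: "\<And>i x. i < 6 \<Longrightarrow> (\<Sum>k<m. \<alpha> i k * F' k x) = 2 * p i x"
    and Y: "C1_fun m Y Y'" "growth m 1 Y" "\<And>k. k < m \<Longrightarrow> growth m 1 (Y' k)"
    and rho: "\<rho> > 0"
    and Y2: "integrable M (\<lambda>\<omega>. (Y (\<xi> \<omega>))\<^sup>2)" "expectation (\<lambda>\<omega>. (Y (\<xi> \<omega>))\<^sup>2) \<le> \<rho>\<^sup>2"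
    and DY2: "\<And>i. i < 6 \<Longrightarrow> integrable M (\<lambda>\<omega>. (\<Sum>k<m. \<alpha> i k * Y' k (\<xi> \<omega>))\<^sup>2)"
      "\<And>i. i < 6 \<Longrightarrow> expectation (\<lambda>\<omega>. (\<Sum>k<m. \<alpha> i k * Y' k (\<xi> \<omega>))\<^sup>2) \<le> \<rho>\<^sup>2"
    and phi: "\<And>y. \<bar>\<phi> y\<bar> \<le> 1" "\<And>y. (\<phi> has_real_derivative \<phi>' y) (at y)" "continuous_on UNIV \<phi>'"
      "\<And>y. \<bar>\<phi>' y\<bar> \<le> L"
    and eps: "0 < \<epsilon>" "\<epsilon> \<le> 1"
  shows "2 * \<bar>expectation (\<lambda>\<omega>. \<phi>' (F (\<xi> \<omega>)) * Y (\<xi> \<omega>) * (cutoff m \<epsilon> (\<xi> \<omega>))\<^sup>2)\<bar>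
     \<le> \<rho> * (9 + 6 * \<kappa>) + \<eta> * L * (\<rho>\<^sup>2 + \<kappa>)
       + sqrt \<epsilon> * (2 * (1 + 1 / \<eta>) * (\<Sum>i<6. \<Sum>k<m. \<bar>\<alpha> i k\<bar>) * expectation (\<lambda>\<omega>. \<bar>Y (\<xi> \<omega>)\<bar>))"
proof -
  let ?T = "cutoff m \<epsilon>" and ?T' = "cutoff' m \<epsilon>"
  define f where "f i x = \<phi> (F x) * Y x * (?T x * ?T x) * w i x" for i x
  define f' where "f' i k x = ((\<phi>' (F x) * F' k x * Y x + \<phi> (F x) * Y' k x) * (?T x * ?T x)
     + \<phi> (F x) * Y x * (?T' k x * ?T x + ?T x * ?T' k x)) * w i x
     + \<phi> (F x) * Y x * (?T x * ?T x) * w' i k x" for i k x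
  have C1: "C1_fun m (f i) (f' i)" for i
    unfolding f_def[abs_def] f'_def[abs_def]
    by (intro C1_fun_mult C1_w' C1_cutoff[OF eps] C1_fun_compose[OF F(1) phi(2,3)] Y(1))
  have gphi: "growth m 0 (\<lambda>x. \<phi> (F x))" "growth m 0 (\<lambda>x. \<phi>' (F x))"
    unfolding growth_bounded using phi(1,4) by blast+
  have gT: "growth m (-2) (\<lambda>x. ?T x * ?T x)"
    by (rule growth_mult'[OF growth_cutoff[OF eps] growth_cutoff[OF eps]]) simp
  have gT': "growth m (-2) (\<lambda>x. ?T' k x * ?T x + ?T x * ?T' k x)" for k
    by (intro growth_add growth_mult'[OF growth_cutoff[OF eps] growth_cutoff'[OF eps]]
        growth_mult'[OF growth_cutoff'[OF eps] growth_cutoff[OF eps]]) simp_all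
  have gY: "growth m 2 (\<lambda>x. \<phi> (F x) * Y x)"
    by (rule growth_mono[OF growth_mult[OF gphi(1) Y(2)]]) simp
  have g1: "growth m 0 (f i)" if "i < 6" for i
    unfolding f_def[abs_def]
    by (rule growth_mult'[OF growth_mult'[OF gY gT] growth_w[OF that]]) auto
  have g2: "growth m 0 (f' i k)" if "i < 6" "k < m" for i k
  proof -
    have "growth m 2 (\<lambda>x. \<phi>' (F x) * F' k x * Y x)"
      by (rule growth_mult'[OF growth_mult'[OF gphi(2) F(3)[OF that(2)]] Y(2)]) auto
    moreover have "growth m 2 (\<lambda>x. \<phi> (F x) * Y' k x)"
      by (rule growth_mono[OF growth_mult[OF gphi(1) Y(3)[OF that(2)]]]) simp
    ultimately have 1: "growth m 2 (\<lambda>x. \<phi>' (F x) * F' k x * Y x + \<phi> (F x) * Y' k x)"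
      by (rule growth_add)
    show ?thesis unfolding f'_def[abs_def]
      by (intro growth_add growth_mult'[OF _ growth_w[OF that(1)]]
          growth_mult'[OF _ growth_w'[OF that(1)]] growth_mult'[OF 1 gT] growth_mult'[OF gY gT']
          growth_mult'[OF gY gT]) auto
  qed
  define U where "U x = (\<Sum>i<6. \<Sum>k<m. \<alpha> i k * f' i k x)" for x
  define V where "V \<omega> = (\<Sum>i<6. f i (\<xi> \<omega>) * X i \<omega>)" for \<omega>
  have UV: "integrable M V" "integrable M (\<lambda>\<omega>. U (\<xi> \<omega>))"
    "expectation V = expectation (\<lambda>\<omega>. U (\<xi> \<omega>))"
    using stein_sum[OF C1 g1 g2] unfolding U_def V_def by auto
  define DY where "DY i x = (\<Sum>k<m. \<alpha> i k * Y' k x)" for i x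
  define DT where "DT i x = (\<Sum>k<m. \<alpha> i k * ?T' k x)" for i x
  define G where "G x = 2 * (\<phi>' (F x) * Y x * (?T x)\<^sup>2)" for x
  \<comment> \<open>The divergence of \<open>f\<close>, sorted by the factor that is differentiated:
    \<open>\<phi> F\<close>, \<open>Y\<close>, the cutoff, and the field \<open>w\<close>.\<close>
  have Uexp: "U x = G x * (1 - \<eta> * iS x) + \<phi> (F x) * (?T x)\<^sup>2 * (\<Sum>i<6. DY i x * w i x)
     + 2 * \<phi> (F x) * Y x * ?T x * (\<Sum>i<6. DT i x * w i x)
     + \<phi> (F x) * Y x * (?T x)\<^sup>2 * (\<Sum>i<6. \<Sum>k<m. \<alpha> i k * w' i k x)" for x
  proof -
    have "(\<Sum>k<m. \<alpha> i k * f' i k x) = \<phi>' (F x) * Y x * (?T x)\<^sup>2 * (2 * p i x) * w i x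
       + \<phi> (F x) * (?T x)\<^sup>2 * (DY i x * w i x) + 2 * \<phi> (F x) * Y x * ?T x * (DT i x * w i x)
       + \<phi> (F x) * Y x * (?T x)\<^sup>2 * (\<Sum>k<m. \<alpha> i k * w' i k x)" if "i < 6" for i
    proof -
      have "(\<Sum>k<m. \<alpha> i k * f' i k x) =
         (\<Sum>k<m. \<phi>' (F x) * Y x * (?T x)\<^sup>2 * w i x * (\<alpha> i k * F' k x)
          + \<phi> (F x) * (?T x)\<^sup>2 * w i x * (\<alpha> i k * Y' k x)
          + 2 * \<phi> (F x) * Y x * ?T x * w i x * (\<alpha> i k * ?T' k x)
          + \<phi> (F x) * Y x * (?T x)\<^sup>2 * (\<alpha> i k * w' i k x))"
        unfolding f'_def by (intro sum.cong) (auto simp: algebra_simps power2_eq_square)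
      also have "\<dots> = \<phi>' (F x) * Y x * (?T x)\<^sup>2 * w i x * (2 * p i x)
          + \<phi> (F x) * (?T x)\<^sup>2 * w i x * DY i x
          + 2 * \<phi> (F x) * Y x * ?T x * w i x * DT i x
          + \<phi> (F x) * Y x * (?T x)\<^sup>2 * (\<Sum>k<m. \<alpha> i k * w' i k x)"
        unfolding DY_def DT_def DF[OF that, symmetric]
        by (simp only: sum.distrib sum_distrib_left)
      finally show ?thesis by (simp only: mult_ac)
    qed
    then have "U x = (\<Sum>i<6. \<phi>' (F x) * Y x * (?T x)\<^sup>2 * (2 * p i x) * w i x
       + \<phi> (F x) * (?T x)\<^sup>2 * (DY i x * w i x) + 2 * \<phi> (F x) * Y x * ?T x * (DT i x * w i x)
       + \<phi> (F x) * Y x * (?T x)\<^sup>2 * (\<Sum>k<m. \<alpha> i k * w' i k x))"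
      unfolding U_def by (intro sum.cong) auto
    also have "\<dots> = G x * (\<Sum>i<6. p i x * w i x) + \<phi> (F x) * (?T x)\<^sup>2 * (\<Sum>i<6. DY i x * w i x)
     + 2 * \<phi> (F x) * Y x * ?T x * (\<Sum>i<6. DT i x * w i x)
     + \<phi> (F x) * Y x * (?T x)\<^sup>2 * (\<Sum>i<6. \<Sum>k<m. \<alpha> i k * w' i k x)"
      unfolding G_def by (simp add: sum.distrib sum_distrib_left mult_ac)
    finally show ?thesis unfolding sum_pw .
  qed
  define c where "c = 2 * (1 + 1 / \<eta>) * (\<Sum>i<6. \<Sum>k<m. \<bar>\<alpha> i k\<bar>)"
  define B where "B \<omega> = (5 / \<rho> + \<eta> * L) * (Y (\<xi> \<omega>))\<^sup>2 + (21/4 * \<rho> + \<eta> * L) * (iS (\<xi> \<omega>))\<^sup>2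
     + \<rho> / 4 * (X_sq \<omega>)\<^sup>2 + \<rho> / 4 + 1 / (2 * \<rho>) * (\<Sum>i<6. (DY i (\<xi> \<omega>))\<^sup>2) + sqrt \<epsilon> * c * \<bar>Y (\<xi> \<omega>)\<bar>" for \<omega>
  have L: "L \<ge> 0" using phi(4)[of 0] by simp
  \<comment> \<open>\<open>U\<close> and \<open>V\<close> have the same expectation, so
    \<open>G - U + V\<close> has the expectation of \<open>G\<close>. Its leading parts cancel and
    only remainders have to be estimated.\<close>
  have bound: "\<bar>G (\<xi> \<omega>) - U (\<xi> \<omega>) + V \<omega>\<bar> \<le> B \<omega>" for \<omega>
  proof -
    let ?x = "\<xi> \<omega>"
    have T: "0 \<le> ?T ?x" "?T ?x \<le> 1" using cutoff_pos[OF eps, of m ?x] cutoff_le_1[OF eps, of m ?x] by auto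
    have T2: "0 \<le> (?T ?x)\<^sup>2" "(?T ?x)\<^sup>2 \<le> 1" using T by (auto simp: power_le_one)
    have i: "0 \<le> iS ?x" using iS_pos[of ?x] by simp
    have V: "V \<omega> = \<phi> (F ?x) * Y ?x * (?T ?x)\<^sup>2 * (\<Sum>i<6. w i ?x * X i \<omega>)"
      unfolding V_def f_def by (simp add: sum_distrib_left power2_eq_square mult_ac)
    have eq: "G ?x - U ?x + V \<omega> = G ?x * (\<eta> * iS ?x) - \<phi> (F ?x) * (?T ?x)\<^sup>2 * (\<Sum>i<6. DY i ?x * w i ?x)
     - 2 * \<phi> (F ?x) * Y ?x * ?T ?x * (\<Sum>i<6. DT i ?x * w i ?x)
     - \<phi> (F ?x) * Y ?x * (?T ?x)\<^sup>2 * (\<Sum>i<6. \<Sum>k<m. \<alpha> i k * w' i k ?x)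
     + \<phi> (F ?x) * Y ?x * (?T ?x)\<^sup>2 * (\<Sum>i<6. w i ?x * X i \<omega>)"
      unfolding Uexp V by (simp add: algebra_simps)
    have abs5: "\<bar>t1 - t2 - t3 - t4 + t5\<bar> \<le> u1 + u2 + u3 + u4 + u5"
      if "\<bar>t1\<bar> \<le> u1" "\<bar>t2\<bar> \<le> u2" "\<bar>t3\<bar> \<le> u3" "\<bar>t4\<bar> \<le> u4" "\<bar>t5\<bar> \<le> u5" for t1 t2 t3 t4 t5 u1 u2 u3 u4 u5 :: real
      using that by linarith
    have phiT: "\<bar>\<phi> (F ?x) * (?T ?x)\<^sup>2\<bar> \<le> 1"
      unfolding abs_mult using phi(1)[of "F ?x"] T2 by (intro mult_le_one) auto
    have drop: "\<bar>\<phi> (F ?x) * (?T ?x)\<^sup>2 * z\<bar> \<le> \<bar>z\<bar>" for z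
      using mult_right_mono[OF phiT, of "\<bar>z\<bar>"] by (simp add: abs_mult)
    have b1: "\<bar>G ?x * (\<eta> * iS ?x)\<bar> \<le> \<eta> * L * (Y ?x)\<^sup>2 + \<eta> * L * (iS ?x)\<^sup>2"
    proof -
      have "\<bar>\<phi>' (F ?x) * (?T ?x)\<^sup>2\<bar> \<le> L * 1"
        unfolding abs_mult using phi(4)[of "F ?x"] T2 L by (intro mult_mono) auto
      then have "\<bar>\<phi>' (F ?x) * (?T ?x)\<^sup>2\<bar> * (2 * \<eta> * \<bar>Y ?x\<bar> * iS ?x) \<le> L * 1 * (2 * \<eta> * \<bar>Y ?x\<bar> * iS ?x)"
        using eta i by (intro mult_right_mono) auto
      also have "\<dots> = L * \<eta> * (2 * \<bar>Y ?x\<bar> * iS ?x)" by simp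
      also have "\<dots> \<le> L * \<eta> * ((Y ?x)\<^sup>2 + (iS ?x)\<^sup>2)"
        using sum_squares_bound[of "\<bar>Y ?x\<bar>" "iS ?x"] L eta by (intro mult_left_mono) auto
      also have "\<bar>\<phi>' (F ?x) * (?T ?x)\<^sup>2\<bar> * (2 * \<eta> * \<bar>Y ?x\<bar> * iS ?x) = \<bar>G ?x * (\<eta> * iS ?x)\<bar>"
        unfolding G_def using eta i by (simp add: abs_mult)
      finally show ?thesis by (simp only: algebra_simps)
    qed
    have b2: "\<bar>\<phi> (F ?x) * (?T ?x)\<^sup>2 * (\<Sum>i<6. DY i ?x * w i ?x)\<bar>
       \<le> (\<Sum>i<6. (DY i ?x)\<^sup>2) / (2 * \<rho>) + \<rho> / 4 * (1 + (iS ?x)\<^sup>2)"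
    proof -
      have "\<bar>\<Sum>i<6. DY i ?x * w i ?x\<bar> \<le> (\<Sum>i<6. \<bar>DY i ?x\<bar> * \<bar>w i ?x\<bar>)"
        using sum_abs[of "\<lambda>i. DY i ?x * w i ?x" "{..<6}"] by (simp add: abs_mult)
      also have "\<dots> \<le> (\<Sum>i<6. \<bar>DY i ?x\<bar>\<^sup>2 / (2 * \<rho>) + \<rho> / 2 * \<bar>w i ?x\<bar>\<^sup>2)"
        by (intro sum_mono young_2 rho)
      also have "\<dots> = (\<Sum>i<6. (DY i ?x)\<^sup>2) / (2 * \<rho>) + \<rho> / 2 * (\<Sum>i<6. (w i ?x)\<^sup>2)"
        by (simp add: sum.distrib sum_distrib_left sum_divide_distrib)
      also have "\<rho> / 2 * (\<Sum>i<6. (w i ?x)\<^sup>2) \<le> \<rho> / 2 * iS ?x"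
        using sum_w_sq rho by (intro mult_left_mono) auto
      also have "\<rho> / 2 * iS ?x \<le> \<rho> / 2 * ((1 + (iS ?x)\<^sup>2) / 2)"
        using sum_squares_bound[of 1 "iS ?x"] rho by (intro mult_left_mono) auto
      finally show ?thesis using drop[of "\<Sum>i<6. DY i ?x * w i ?x"] by simp
    qed
    \<comment> \<open>The crude bound on \<open>w\<close> costs a factor of order
      \<open>1 / \<eta>\<close>. This is affordable because \<open>\<epsilon>\<close> will tend to
      zero while \<open>\<eta>\<close> is fixed.\<close>
    have b3: "\<bar>2 * \<phi> (F ?x) * Y ?x * ?T ?x * (\<Sum>i<6. DT i ?x * w i ?x)\<bar> \<le> sqrt \<epsilon> * c * \<bar>Y ?x\<bar>"
    proof -
      have "\<bar>\<Sum>i<6. DT i ?x * w i ?x\<bar> \<le> (\<Sum>i<6. \<bar>DT i ?x\<bar> * \<bar>w i ?x\<bar>)"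
        using sum_abs[of "\<lambda>i. DT i ?x * w i ?x" "{..<6}"] by (simp add: abs_mult)
      also have "\<dots> \<le> (\<Sum>i<6. (sqrt \<epsilon> * (\<Sum>k<m. \<bar>\<alpha> i k\<bar>)) * (1 + 1 / \<eta>))"
      proof (intro sum_mono mult_mono)
        fix i :: nat assume "i \<in> {..<6}"
        then show "\<bar>w i ?x\<bar> \<le> 1 + 1 / \<eta>" using w_le by auto
        have "\<bar>DT i ?x\<bar> \<le> (\<Sum>k<m. \<bar>\<alpha> i k\<bar> * \<bar>?T' k ?x\<bar>)"
          unfolding DT_def using sum_abs[of "\<lambda>k. \<alpha> i k * ?T' k ?x" "{..<m}"] by (simp add: abs_mult)
        also have "\<dots> \<le> (\<Sum>k<m. \<bar>\<alpha> i k\<bar> * sqrt \<epsilon>)"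
        proof (intro sum_mono mult_left_mono)
          fix k
          have "sqrt \<epsilon> * ?T ?x \<le> sqrt \<epsilon> * 1" using T eps by (intro mult_left_mono) auto
          then show "\<bar>?T' k ?x\<bar> \<le> sqrt \<epsilon>" using cutoff'_small[OF eps, of m k ?x] by simp
        qed auto
        finally show "\<bar>DT i ?x\<bar> \<le> sqrt \<epsilon> * (\<Sum>k<m. \<bar>\<alpha> i k\<bar>)" by (simp add: sum_distrib_right mult_ac sum_distrib_left)
      qed (use eps eta in \<open>auto intro!: mult_nonneg_nonneg sum_nonneg\<close>)
      also have "\<dots> = sqrt \<epsilon> * ((1 + 1 / \<eta>) * (\<Sum>i<6. \<Sum>k<m. \<bar>\<alpha> i k\<bar>))"
        by (simp only: sum_distrib_left sum_distrib_right mult_ac)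
      also have "\<dots> = sqrt \<epsilon> * c / 2" unfolding c_def by simp
      finally have 1: "\<bar>\<Sum>i<6. DT i ?x * w i ?x\<bar> \<le> sqrt \<epsilon> * c / 2" .
      have "\<bar>\<phi> (F ?x) * ?T ?x\<bar> \<le> 1"
        unfolding abs_mult using phi(1)[of "F ?x"] T by (intro mult_le_one) auto
      then have "\<bar>\<phi> (F ?x) * ?T ?x\<bar> * \<bar>\<Sum>i<6. DT i ?x * w i ?x\<bar> \<le> 1 * (sqrt \<epsilon> * c / 2)"
        using 1 by (intro mult_mono) auto
      then have "\<bar>\<phi> (F ?x) * ?T ?x\<bar> * \<bar>\<Sum>i<6. DT i ?x * w i ?x\<bar> * (2 * \<bar>Y ?x\<bar>) \<le> 1 * (sqrt \<epsilon> * c / 2) * (2 * \<bar>Y ?x\<bar>)"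
        by (intro mult_right_mono) auto
      then show ?thesis by (simp add: abs_mult mult_ac)
    qed
    have b4: "\<bar>\<phi> (F ?x) * Y ?x * (?T ?x)\<^sup>2 * (\<Sum>i<6. \<Sum>k<m. \<alpha> i k * w' i k ?x)\<bar>
       \<le> 9 * ((Y ?x)\<^sup>2 / (2 * \<rho>) + \<rho> / 2 * (iS ?x)\<^sup>2)"
    proof -
      have "\<bar>\<phi> (F ?x) * (?T ?x)\<^sup>2 * (Y ?x * (\<Sum>i<6. \<Sum>k<m. \<alpha> i k * w' i k ?x))\<bar>
        \<le> \<bar>Y ?x\<bar> * \<bar>\<Sum>i<6. \<Sum>k<m. \<alpha> i k * w' i k ?x\<bar>"
        using drop[of "Y ?x * (\<Sum>i<6. \<Sum>k<m. \<alpha> i k * w' i k ?x)"] by (simp add: abs_mult)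
      also have "\<dots> \<le> \<bar>Y ?x\<bar> * (9 * iS ?x)" using div_w by (intro mult_left_mono) auto
      also have "\<dots> = 9 * (\<bar>Y ?x\<bar> * iS ?x)" by simp
      also have "\<dots> \<le> 9 * (\<bar>Y ?x\<bar>\<^sup>2 / (2 * \<rho>) + \<rho> / 2 * (iS ?x)\<^sup>2)"
        using young_2[OF rho, of "\<bar>Y ?x\<bar>" "iS ?x"] by (intro mult_left_mono) auto
      finally show ?thesis by (simp add: mult_ac)
    qed
    have b5: "\<bar>\<phi> (F ?x) * Y ?x * (?T ?x)\<^sup>2 * (\<Sum>i<6. w i ?x * X i \<omega>)\<bar>
       \<le> (Y ?x)\<^sup>2 / (2 * \<rho>) + \<rho> / 4 * ((iS ?x)\<^sup>2 + (X_sq \<omega>)\<^sup>2)"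
    proof -
      have "\<bar>\<phi> (F ?x) * (?T ?x)\<^sup>2 * (Y ?x * (\<Sum>i<6. w i ?x * X i \<omega>))\<bar>
        \<le> \<bar>Y ?x\<bar> * \<bar>\<Sum>i<6. w i ?x * X i \<omega>\<bar>"
        using drop[of "Y ?x * (\<Sum>i<6. w i ?x * X i \<omega>)"] by (simp add: abs_mult)
      also have "\<dots> \<le> \<bar>Y ?x\<bar>\<^sup>2 / (2 * \<rho>) + \<rho> / 2 * \<bar>\<Sum>i<6. w i ?x * X i \<omega>\<bar>\<^sup>2"
        by (rule young_2[OF rho])
      also have "\<bar>\<Sum>i<6. w i ?x * X i \<omega>\<bar>\<^sup>2 \<le> iS ?x * X_sq \<omega>" using sum_wX by simp
      also have "iS ?x * X_sq \<omega> \<le> ((iS ?x)\<^sup>2 + (X_sq \<omega>)\<^sup>2) / 2"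
        using sum_squares_bound[of "iS ?x" "X_sq \<omega>"] by simp
      finally show ?thesis using rho by (simp add: mult_ac mult_left_mono)
    qed
    have "\<bar>G ?x - U ?x + V \<omega>\<bar> \<le> (\<eta> * L * (Y ?x)\<^sup>2 + \<eta> * L * (iS ?x)\<^sup>2)
       + ((\<Sum>i<6. (DY i ?x)\<^sup>2) / (2 * \<rho>) + \<rho> / 4 * (1 + (iS ?x)\<^sup>2)) + sqrt \<epsilon> * c * \<bar>Y ?x\<bar>
       + 9 * ((Y ?x)\<^sup>2 / (2 * \<rho>) + \<rho> / 2 * (iS ?x)\<^sup>2)
       + ((Y ?x)\<^sup>2 / (2 * \<rho>) + \<rho> / 4 * ((iS ?x)\<^sup>2 + (X_sq \<omega>)\<^sup>2))"
      unfolding eq by (rule abs5[OF b1 b2 b3 b4 b5])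
    also have "\<dots> \<le> B \<omega>"
    proof -
      have "\<rho> * (iS ?x)\<^sup>2 \<ge> 0" using rho by simp
      moreover have "10 * ((Y ?x)\<^sup>2 / (2 * \<rho>)) = 5 / \<rho> * (Y ?x)\<^sup>2" by simp
      ultimately show ?thesis unfolding B_def by (simp add: algebra_simps)
    qed
    finally show ?thesis .
  qed
  have [measurable]: "(\<lambda>\<omega>. Y (\<xi> \<omega>)) \<in> borel_measurable M"
    using cont_meas[of Y] Y(1) unfolding C1_fun_def by auto
  have intY: "integrable M (\<lambda>\<omega>. \<bar>Y (\<xi> \<omega>)\<bar>)"
  proof (rule Bochner_Integration.integrable_bound[of M "\<lambda>\<omega>. 1 + (Y (\<xi> \<omega>))\<^sup>2"])
    have "\<bar>y\<bar> \<le> 1 + y\<^sup>2" for y :: real using sum_squares_bound[of 1 "\<bar>y\<bar>"] by simp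
    then show "AE \<omega> in M. norm \<bar>Y (\<xi> \<omega>)\<bar> \<le> norm (1 + (Y (\<xi> \<omega>))\<^sup>2)" by simp
  qed (use Y2 in auto)
  have "has_bochner_integral M B ((5 / \<rho> + \<eta> * L) * expectation (\<lambda>\<omega>. (Y (\<xi> \<omega>))\<^sup>2)
     + (21/4 * \<rho> + \<eta> * L) * expectation (\<lambda>\<omega>. (iS (\<xi> \<omega>))\<^sup>2) + \<rho> / 4 * \<kappa> + expectation (\<lambda>_. \<rho> / 4)
     + 1 / (2 * \<rho>) * (\<Sum>i<6. expectation (\<lambda>\<omega>. (DY i (\<xi> \<omega>))\<^sup>2)) + sqrt \<epsilon> * c * expectation (\<lambda>\<omega>. \<bar>Y (\<xi> \<omega>)\<bar>))"
    unfolding B_def[abs_def] \<kappa>_def DY_def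
    by (intro has_bochner_integral_add has_bochner_integral_mult_right has_bochner_integral_sum
        has_bochner_integral_integrable Y2(1) hardy(1) X_sq_int DY2(1) intY) auto
  then have intB: "integrable M B" and EB: "expectation B = (5 / \<rho> + \<eta> * L) * expectation (\<lambda>\<omega>. (Y (\<xi> \<omega>))\<^sup>2)
     + (21/4 * \<rho> + \<eta> * L) * expectation (\<lambda>\<omega>. (iS (\<xi> \<omega>))\<^sup>2) + \<rho> / 4 * \<kappa> + \<rho> / 4
     + 1 / (2 * \<rho>) * (\<Sum>i<6. expectation (\<lambda>\<omega>. (DY i (\<xi> \<omega>))\<^sup>2)) + sqrt \<epsilon> * c * expectation (\<lambda>\<omega>. \<bar>Y (\<xi> \<omega>)\<bar>)"
    by (auto simp: has_bochner_integral_iff prob_space)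
  have c0: "c \<ge> 0" unfolding c_def using eta by (intro mult_nonneg_nonneg sum_nonneg) auto
  have intG: "integrable M (\<lambda>\<omega>. G (\<xi> \<omega>))"
  proof (rule Bochner_Integration.integrable_bound[of M "\<lambda>\<omega>. B \<omega> + \<bar>U (\<xi> \<omega>)\<bar> + \<bar>V \<omega>\<bar>"])
    show "(\<lambda>\<omega>. G (\<xi> \<omega>)) \<in> borel_measurable M"
    proof (rule cont_meas)
      have "continuous_on UNIV F" "continuous_on UNIV Y" "continuous_on UNIV ?T"
        using F(1) Y(1) C1_cutoff[OF eps] unfolding C1_fun_def by auto
      then show "continuous_on UNIV G"
        unfolding G_def[abs_def] using continuous_on_compose2[OF phi(3), of UNIV F]
        by (auto intro!: continuous_intros)
    qed
    have "\<bar>G (\<xi> \<omega>)\<bar> \<le> B \<omega> + \<bar>U (\<xi> \<omega>)\<bar> + \<bar>V \<omega>\<bar>" for \<omega> using bound[of \<omega>] by linarith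
    then show "AE \<omega> in M. norm (G (\<xi> \<omega>)) \<le> norm (B \<omega> + \<bar>U (\<xi> \<omega>)\<bar> + \<bar>V \<omega>\<bar>)"
      by (intro AE_I2) (metis (no_types) abs_ge_self order_trans real_norm_def)
  qed (use intB UV in auto)
  have "expectation (\<lambda>\<omega>. G (\<xi> \<omega>)) = expectation (\<lambda>\<omega>. G (\<xi> \<omega>) - U (\<xi> \<omega>) + V \<omega>)"
    using intG UV by simp
  also have "\<bar>\<dots>\<bar> \<le> expectation (\<lambda>\<omega>. \<bar>G (\<xi> \<omega>) - U (\<xi> \<omega>) + V \<omega>\<bar>)"
    by (rule integral_abs_bound)
  also have "\<dots> \<le> expectation B"
    using bound intB intG UV by (intro integral_mono) auto
  \<comment> \<open>Apart from the terms with \<open>\<eta>\<close> or \<open>\<epsilon>\<close>,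
    each summand is of order \<open>\<rho>\<close>: the second moments of \<open>Y\<close> and of
    its derivatives are at most \<open>\<rho>\<^sup>2\<close> and carry a factor
    \<open>1 / \<rho>\<close>. The coefficients add up to 33/4 without \<open>\<kappa>\<close> and
    11/2 with it, and are rounded up to 9 and 6.\<close>
  also have "expectation B \<le> (5 / \<rho> + \<eta> * L) * \<rho>\<^sup>2 + (21/4 * \<rho> + \<eta> * L) * \<kappa> + \<rho> / 4 * \<kappa> + \<rho> / 4
     + 1 / (2 * \<rho>) * (\<Sum>i<6::nat. \<rho>\<^sup>2) + sqrt \<epsilon> * c * expectation (\<lambda>\<omega>. \<bar>Y (\<xi> \<omega>)\<bar>)"
    using Y2(2) hardy(2) DY2(2) rho eta L c0 eps unfolding EB unfolding DY_def
    by (intro add_mono mult_left_mono sum_mono) (auto intro!: add_nonneg_nonneg)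
  also have "\<dots> \<le> \<rho> * (9 + 6 * \<kappa>) + \<eta> * L * (\<rho>\<^sup>2 + \<kappa>) + sqrt \<epsilon> * c * expectation (\<lambda>\<omega>. \<bar>Y (\<xi> \<omega>)\<bar>)"
  proof -
    have "\<kappa> \<ge> 0" unfolding \<kappa>_def by simp
    then have "\<rho> * \<kappa> \<ge> 0" using rho by simp
    then show ?thesis using rho by (simp add: field_simps power2_eq_square)
  qed
  finally show ?thesis unfolding G_def c_def by (simp add: abs_mult mult_ac)
qed

end

section \<open>Total variation and smooth test functions\<close>

lemma DERIV_bound_lipschitz:
  fixes \<phi> :: "real \<Rightarrow> real"
  assumes "\<And>y. (\<phi> has_real_derivative \<phi>' y) (at y)" "\<And>y. \<bar>\<phi>' y\<bar> \<le> L"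
  shows "\<bar>\<phi> x - \<phi> y\<bar> \<le> L * \<bar>x - y\<bar>"
  using field_differentiable_bound[of UNIV \<phi> \<phi>' L x y] assms
  by (auto simp: has_field_derivative_at_within)

text \<open>Differentiation under the expectation by dominated convergence: the Lipschitz bound of
  \<open>\<phi>\<close> provides the majorant \<open>L * \<bar>Y\<bar>\<close> for all difference
  quotients.\<close>

lemma (in prob_space) DERIV_expectation_shift:
  assumes [measurable]: "F \<in> borel_measurable M" and Y: "integrable M Y"
    and phi: "\<And>y. \<bar>\<phi> y\<bar> \<le> 1" "\<And>y. (\<phi> has_real_derivative \<phi>' y) (at y)"
      "continuous_on UNIV \<phi>'" "\<And>y. \<bar>\<phi>' y\<bar> \<le> L"
  shows "((\<lambda>s. expectation (\<lambda>\<omega>. \<phi> (F \<omega> + s * Y \<omega>))) has_real_derivative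
     expectation (\<lambda>\<omega>. \<phi>' (F \<omega> + s * Y \<omega>) * Y \<omega>)) (at s)"
  unfolding has_field_derivative_iff tendsto_at_iff_sequentially
proof (intro allI impI)
  fix z :: "nat \<Rightarrow> real" assume z0: "\<forall>i. z i \<in> UNIV - {s}" and zs: "z \<longlonglongrightarrow> s"
  then have nz: "z i - s \<noteq> 0" for i by auto
  have [measurable]: "Y \<in> borel_measurable M" using Y by auto
  have cphi: "continuous_on UNIV \<phi>" using phi(2) by (meson DERIV_isCont continuous_at_imp_continuous_on)
  have [measurable]: "\<phi> \<in> borel_measurable borel" "\<phi>' \<in> borel_measurable borel"
    using cphi phi(3) by (auto intro: borel_measurable_continuous_onI)
  have int: "integrable M (\<lambda>\<omega>. \<phi> (F \<omega> + r * Y \<omega>))" for r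
    using phi(1) by (intro integrable_const_bound[where B=1]) auto
  have "(\<lambda>i. expectation (\<lambda>\<omega>. (\<phi> (F \<omega> + z i * Y \<omega>) - \<phi> (F \<omega> + s * Y \<omega>)) / (z i - s)))
      \<longlonglongrightarrow> expectation (\<lambda>\<omega>. \<phi>' (F \<omega> + s * Y \<omega>) * Y \<omega>)"
  proof (rule integral_dominated_convergence[where w="\<lambda>\<omega>. L * \<bar>Y \<omega>\<bar>"])
    show "integrable M (\<lambda>\<omega>. L * \<bar>Y \<omega>\<bar>)" using Y by auto
    show "AE \<omega> in M. (\<lambda>i. (\<phi> (F \<omega> + z i * Y \<omega>) - \<phi> (F \<omega> + s * Y \<omega>)) / (z i - s))
       \<longlonglongrightarrow> \<phi>' (F \<omega> + s * Y \<omega>) * Y \<omega>"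
    proof (intro AE_I2)
      fix \<omega>
      have "((\<lambda>r. \<phi> (F \<omega> + r * Y \<omega>)) has_real_derivative \<phi>' (F \<omega> + s * Y \<omega>) * Y \<omega>) (at s)"
        by (rule DERIV_chain2[OF phi(2)]) (auto intro!: derivative_eq_intros)
      then show "(\<lambda>i. (\<phi> (F \<omega> + z i * Y \<omega>) - \<phi> (F \<omega> + s * Y \<omega>)) / (z i - s))
       \<longlonglongrightarrow> \<phi>' (F \<omega> + s * Y \<omega>) * Y \<omega>"
        unfolding has_field_derivative_iff tendsto_at_iff_sequentially using z0 zs
        by (auto simp: comp_def)
    qed
    fix i
    show "AE \<omega> in M. norm ((\<phi> (F \<omega> + z i * Y \<omega>) - \<phi> (F \<omega> + s * Y \<omega>)) / (z i - s)) \<le> L * \<bar>Y \<omega>\<bar>"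
    proof (intro AE_I2)
      fix \<omega>
      have "\<bar>\<phi> (F \<omega> + z i * Y \<omega>) - \<phi> (F \<omega> + s * Y \<omega>)\<bar> \<le> L * \<bar>(z i - s) * Y \<omega>\<bar>"
        using DERIV_bound_lipschitz[OF phi(2,4), of "F \<omega> + z i * Y \<omega>" "F \<omega> + s * Y \<omega>"]
        by (simp add: left_diff_distrib)
      then show "norm ((\<phi> (F \<omega> + z i * Y \<omega>) - \<phi> (F \<omega> + s * Y \<omega>)) / (z i - s)) \<le> L * \<bar>Y \<omega>\<bar>"
        using nz[of i] by (simp add: abs_mult pos_divide_le_eq mult_ac)
    qed
  qed measurable
  moreover have "expectation (\<lambda>\<omega>. (\<phi> (F \<omega> + z i * Y \<omega>) - \<phi> (F \<omega> + s * Y \<omega>)) / (z i - s)) =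
     (expectation (\<lambda>\<omega>. \<phi> (F \<omega> + z i * Y \<omega>)) - expectation (\<lambda>\<omega>. \<phi> (F \<omega> + s * Y \<omega>))) / (z i - s)" for i
    by (simp add: Bochner_Integration.integral_diff[OF int int])
  ultimately show "((\<lambda>y. (expectation (\<lambda>\<omega>. \<phi> (F \<omega> + y * Y \<omega>)) - expectation (\<lambda>\<omega>. \<phi> (F \<omega> + s * Y \<omega>))) /
        (y - s)) \<circ> z) \<longlonglongrightarrow> expectation (\<lambda>\<omega>. \<phi>' (F \<omega> + s * Y \<omega>) * Y \<omega>)"
    by (simp only: comp_def)
qed

text \<open>\<open>\<psi>\<close> is the moving average of \<open>\<phi>\<close> over a window of
  length \<open>h = e / K'\<close>. By the mean value theorem each of its values is a value of
  \<open>\<phi>\<close> at distance less than \<open>h\<close>, which gives the range and the error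
  at once. Its derivative is a difference quotient of \<open>\<phi>\<close>, hence bounded by
  \<open>1 / h\<close>.\<close>

lemma lipschitz_C1_approx:
  fixes \<phi> :: "real \<Rightarrow> real"
  assumes "\<And>x. 0 \<le> \<phi> x" "\<And>x. \<phi> x \<le> 1" "\<And>x y. \<bar>\<phi> x - \<phi> y\<bar> \<le> K * \<bar>x - y\<bar>" "e > 0"
  obtains \<psi> \<psi>' L where "\<And>x. 0 \<le> \<psi> x" "\<And>x. \<psi> x \<le> 1" "\<And>y. (\<psi> has_real_derivative \<psi>' y) (at y)"
    "continuous_on UNIV \<psi>'" "\<And>y. \<bar>\<psi>' y\<bar> \<le> L" "\<And>x. \<bar>\<psi> x - \<phi> x\<bar> \<le> e"
proof -
  define K' where "K' = \<bar>K\<bar> + 1"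
  have K': "K' > 0" "\<bar>\<phi> x - \<phi> y\<bar> \<le> K' * \<bar>x - y\<bar>" for x y
  proof -
    show "\<bar>\<phi> x - \<phi> y\<bar> \<le> K' * \<bar>x - y\<bar>"
      using assms(3)[of x y] mult_right_mono[of K "\<bar>K\<bar> + 1" "\<bar>x - y\<bar>"] unfolding K'_def by linarith
  qed (simp add: K'_def)
  have cont: "continuous_on UNIV \<phi>"
  proof (rule lipschitz_on_continuous_on)
    show "K'-lipschitz_on UNIV \<phi>" using K' by (intro lipschitz_onI) (auto simp: dist_real_def)
  qed
  obtain \<Phi> where \<Phi>: "\<And>x. (\<Phi> has_real_derivative \<phi> x) (at x)"
  proof -
    have "isCont \<phi> x" for x using cont by (simp add: continuous_on_eq_continuous_at)
    then obtain \<Phi> where "\<And>x. (\<Phi> has_vector_derivative \<phi> x) (at x)"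
      using einterval_antiderivative[of "-\<infinity>" "\<infinity>" \<phi>] by auto
    then show thesis by (intro that) (simp add: has_real_derivative_iff_has_vector_derivative)
  qed
  define h where "h = e / K'"
  have h: "h > 0" unfolding h_def using assms(4) K'(1) by simp
  define \<psi> where "\<psi> x = (\<Phi> (x + h) - \<Phi> x) / h" for x
  define \<psi>' where "\<psi>' x = (\<phi> (x + h) - \<phi> x) / h" for x
  have mv: "\<exists>z. x < z \<and> z < x + h \<and> \<psi> x = \<phi> z" for x
  proof -
    obtain z where "z > x" "z < x + h" "\<Phi> (x + h) - \<Phi> x = (x + h - x) * \<phi> z"
      using MVT2[of x "x + h" \<Phi> \<phi>] h \<Phi> by auto
    then show ?thesis unfolding \<psi>_def using h by auto
  qed
  show ?thesis
  proof (rule that[of \<psi> \<psi>' "1 / h"])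
    show "0 \<le> \<psi> x" "\<psi> x \<le> 1" for x using mv[of x] assms(1,2) by auto
    have s: "((\<lambda>x. \<Phi> (x + h)) has_real_derivative \<phi> (y + h)) (at y)" for y
      using DERIV_shift[of \<Phi> "\<phi> (y + h)" y h] \<Phi> by simp
    show "(\<psi> has_real_derivative \<psi>' y) (at y)" for y
      using DERIV_cdivide[OF DERIV_diff[OF s \<Phi>], of h y] unfolding \<psi>_def[abs_def] \<psi>'_def by simp
    show "continuous_on UNIV \<psi>'"
    proof -
      have "continuous_on UNIV (\<lambda>x. \<phi> (x + h))"
        by (rule continuous_on_compose2[OF cont]) (auto intro!: continuous_intros)
      then show ?thesis unfolding \<psi>'_def[abs_def] using cont h
        by (intro continuous_on_divide continuous_on_diff continuous_on_const) auto
    qed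
    show "\<bar>\<psi>' y\<bar> \<le> 1 / h" for y
    proof -
      have "\<bar>\<phi> (y + h) - \<phi> y\<bar> \<le> 1" using assms(1,2)[of "y + h"] assms(1,2)[of y] by linarith
      then show ?thesis unfolding \<psi>'_def using h by (simp add: divide_right_mono)
    qed
    show "\<bar>\<psi> x - \<phi> x\<bar> \<le> e" for x
    proof -
      obtain z where z: "x < z" "z < x + h" "\<psi> x = \<phi> z" using mv by blast
      have "\<bar>\<phi> z - \<phi> x\<bar> \<le> K' * \<bar>z - x\<bar>" by (rule K'(2))
      also have "\<dots> \<le> K' * h" using z K'(1) by (intro mult_left_mono) auto
      also have "\<dots> = e" unfolding h_def using K'(1) by simp
      finally show ?thesis using z by simp
    qed
  qed
qed

text \<open>The constant \<open>c\<close> must not depend on \<open>L\<close>, because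
  \<open>L\<close> is unbounded on the way: smooth functions approximate Lipschitz ones uniformly,
  tents of increasing slope decrease to the indicator of a compact set, and inner regularity of the
  two laws reaches all Borel sets.\<close>

lemma (in prob_space) total_variation_dist_le:
  assumes [measurable]: "U \<in> borel_measurable M" "V \<in> borel_measurable M"
    and bound: "\<And>\<phi> \<phi>' L. (\<And>y. \<bar>\<phi> y\<bar> \<le> 1) \<Longrightarrow> (\<And>y. (\<phi> has_real_derivative \<phi>' y) (at y)) \<Longrightarrow>
       continuous_on UNIV \<phi>' \<Longrightarrow> (\<And>y. \<bar>\<phi>' y\<bar> \<le> L) \<Longrightarrow>
       \<bar>expectation (\<lambda>\<omega>. \<phi> (U \<omega>)) - expectation (\<lambda>\<omega>. \<phi> (V \<omega>))\<bar> \<le> c"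
  shows "total_variation_dist M U V \<le> c"
proof -
  have lip: "\<bar>expectation (\<lambda>\<omega>. \<phi> (U \<omega>)) - expectation (\<lambda>\<omega>. \<phi> (V \<omega>))\<bar> \<le> c"
    if \<phi>: "\<And>x. 0 \<le> \<phi> x" "\<And>x. \<phi> x \<le> 1" "\<And>x y. \<bar>\<phi> x - \<phi> y\<bar> \<le> K * \<bar>x - y\<bar>"
      and [measurable]: "\<phi> \<in> borel_measurable borel" for \<phi> K
  proof (rule field_le_epsilon)
    fix e :: real assume e: "e > 0"
    obtain \<psi> \<psi>' L where \<psi>: "\<And>x. 0 \<le> \<psi> x" "\<And>x. \<psi> x \<le> 1" "\<And>y. (\<psi> has_real_derivative \<psi>' y) (at y)"
      "continuous_on UNIV \<psi>'" "\<And>y. \<bar>\<psi>' y\<bar> \<le> L" "\<And>x. \<bar>\<psi> x - \<phi> x\<bar> \<le> e/2"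
      by (rule lipschitz_C1_approx[OF \<phi>, of "e/2"]) (use e in auto)
    have "continuous_on UNIV \<psi>" using \<psi>(3) by (meson DERIV_isCont continuous_at_imp_continuous_on)
    then have [measurable]: "\<psi> \<in> borel_measurable borel" by (intro borel_measurable_continuous_onI)
    have 1: "\<bar>expectation (\<lambda>\<omega>. \<psi> (R \<omega>)) - expectation (\<lambda>\<omega>. \<phi> (R \<omega>))\<bar> \<le> e/2"
      if [measurable]: "R \<in> borel_measurable M" for R
    proof -
      have i: "integrable M (\<lambda>\<omega>. \<psi> (R \<omega>))" "integrable M (\<lambda>\<omega>. \<phi> (R \<omega>))"
        using \<psi>(1,2) \<phi>(1,2) by (auto intro!: integrable_const_bound[where B=1] simp: abs_le_iff)
      have "\<bar>expectation (\<lambda>\<omega>. \<psi> (R \<omega>) - \<phi> (R \<omega>))\<bar> \<le> expectation (\<lambda>\<omega>. \<bar>\<psi> (R \<omega>) - \<phi> (R \<omega>)\<bar>)"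
        by (rule integral_abs_bound)
      also have "\<dots> \<le> expectation (\<lambda>\<omega>. e/2)" using i \<psi>(6) by (intro integral_mono) auto
      finally show ?thesis using i by (simp add: prob_space)
    qed
    have "\<bar>\<psi> y\<bar> \<le> 1" for y using \<psi>(1,2)[of y] by auto
    then have "\<bar>expectation (\<lambda>\<omega>. \<psi> (U \<omega>)) - expectation (\<lambda>\<omega>. \<psi> (V \<omega>))\<bar> \<le> c"
      using bound[OF _ \<psi>(3,4,5)] by blast
    then show "\<bar>expectation (\<lambda>\<omega>. \<phi> (U \<omega>)) - expectation (\<lambda>\<omega>. \<phi> (V \<omega>))\<bar> \<le> c + e"
      using 1[OF assms(1)] 1[OF assms(2)] by linarith
  qed
  have comp: "\<bar>prob {\<omega> \<in> space M. U \<omega> \<in> K} - prob {\<omega> \<in> space M. V \<omega> \<in> K}\<bar> \<le> c" if K: "compact K" for K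
  \<comment> \<open>The distance to the empty set is 0 by convention, so the tents below would be
    constantly 1 instead of decreasing to 0. The empty set is therefore treated apart.\<close>
  proof (cases "K = {}")
    case True
    then show ?thesis using bound[of "\<lambda>_. 0" "\<lambda>_. 0" 0] by simp
  next
    case False
    have closed: "closed K" using K compact_imp_closed by blast
    define \<phi> where "\<phi> j x = max 0 (1 - real j * infdist x K)" for j x
    have [measurable]: "\<phi> j \<in> borel_measurable borel" for j
      unfolding \<phi>_def[abs_def]
      by (intro borel_measurable_continuous_onI continuous_intros)
    have [measurable]: "K \<in> sets borel" using closed by simp
    have b: "0 \<le> \<phi> j x" "\<phi> j x \<le> 1" for j x unfolding \<phi>_def using infdist_nonneg[of x K] by auto
    have l: "\<bar>\<phi> j x - \<phi> j y\<bar> \<le> real j * \<bar>x - y\<bar>" for j x y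
    proof -
      have "\<bar>\<phi> j x - \<phi> j y\<bar> \<le> \<bar>real j * infdist x K - real j * infdist y K\<bar>" unfolding \<phi>_def by linarith
      also have "\<dots> = real j * \<bar>infdist x K - infdist y K\<bar>" by (simp add: abs_mult flip: right_diff_distrib)
      also have "\<dots> \<le> real j * \<bar>x - y\<bar>"
        using infdist_triangle_abs[of x K y] by (intro mult_left_mono) (auto simp: dist_real_def)
      finally show ?thesis .
    qed
    have lim: "(\<lambda>j. expectation (\<lambda>\<omega>. \<phi> j (R \<omega>))) \<longlonglongrightarrow> prob {\<omega> \<in> space M. R \<omega> \<in> K}"
      if [measurable]: "R \<in> borel_measurable M" for R
    proof -
      have "(\<lambda>j. expectation (\<lambda>\<omega>. \<phi> j (R \<omega>))) \<longlonglongrightarrow> expectation (\<lambda>\<omega>. indicator {\<omega> \<in> space M. R \<omega> \<in> K} \<omega>)"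
      proof (rule integral_dominated_convergence[where w="\<lambda>_. 1"])
        show "AE \<omega> in M. (\<lambda>j. \<phi> j (R \<omega>)) \<longlonglongrightarrow> indicator {\<omega> \<in> space M. R \<omega> \<in> K} \<omega>"
        proof (intro AE_I2)
          fix \<omega> assume \<omega>: "\<omega> \<in> space M"
          show "(\<lambda>j. \<phi> j (R \<omega>)) \<longlonglongrightarrow> indicator {\<omega> \<in> space M. R \<omega> \<in> K} \<omega>"
          proof (cases "R \<omega> \<in> K")
            case True
            then show ?thesis using \<omega> by (simp add: \<phi>_def)
          next
            case nin: False
            then have pos: "infdist (R \<omega>) K > 0"
              using in_closed_iff_infdist_zero[OF closed False, of "R \<omega>"] infdist_nonneg[of "R \<omega>" K] by simp
            obtain j0 where j0: "1 / infdist (R \<omega>) K \<le> real j0" using real_arch_simple by blast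
            have "\<phi> j (R \<omega>) = 0" if "j \<ge> j0" for j
            proof -
              have "1 / infdist (R \<omega>) K \<le> real j" using j0 that by linarith
              then have "1 \<le> real j * infdist (R \<omega>) K" using pos by (simp add: field_simps)
              then show ?thesis unfolding \<phi>_def by simp
            qed
            then have "eventually (\<lambda>j. \<phi> j (R \<omega>) = 0) sequentially"
              by (auto simp: eventually_sequentially)
            then show ?thesis using nin by (simp add: tendsto_eventually)
          qed
        qed
        show "AE \<omega> in M. norm (\<phi> j (R \<omega>)) \<le> 1" for j using b by auto
      qed auto
      then show ?thesis by simp
    qed
    have "(\<lambda>j. \<bar>expectation (\<lambda>\<omega>. \<phi> j (U \<omega>)) - expectation (\<lambda>\<omega>. \<phi> j (V \<omega>))\<bar>)
      \<longlonglongrightarrow> \<bar>prob {\<omega> \<in> space M. U \<omega> \<in> K} - prob {\<omega> \<in> space M. V \<omega> \<in> K}\<bar>"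
      by (intro tendsto_intros lim) auto
    moreover have "\<bar>expectation (\<lambda>\<omega>. \<phi> j (U \<omega>)) - expectation (\<lambda>\<omega>. \<phi> j (V \<omega>))\<bar> \<le> c" for j
      by (rule lip[OF b l]) auto
    ultimately show ?thesis by (intro LIMSEQ_le_const2) auto
  qed
  have inner: "\<exists>K. K \<subseteq> C \<and> compact K \<and> prob {\<omega> \<in> space M. R \<omega> \<in> C} < prob {\<omega> \<in> space M. R \<omega> \<in> K} + e"
    if [measurable]: "R \<in> borel_measurable M" "C \<in> sets borel" and e: "e > 0"
    for R :: "'a \<Rightarrow> real" and C :: "real set" and e :: real
  proof -
    let ?D = "distr M borel R"
    interpret D: prob_space ?D by (rule prob_space_distr) auto
    have pr: "measure ?D A = prob {\<omega> \<in> space M. R \<omega> \<in> A}" if "A \<in> sets borel" for A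
      using that by (subst measure_distr) (auto simp: vimage_def Int_def conj_commute)
    have "emeasure ?D C = (SUP K \<in> {K. K \<subseteq> C \<and> compact K}. emeasure ?D K)"
      by (rule inner_regular) auto
    \<comment> \<open>\<open>ennreal\<close> truncates negative numbers to 0, so the strict
      inequality fails when \<open>C\<close> has measure 0.\<close>
    moreover have "ennreal (measure ?D C - e) < emeasure ?D C \<or> measure ?D C = 0"
    proof (cases "measure ?D C = 0")
      case False
      then have "measure ?D C > 0" by (simp add: less_le)
      then have "ennreal (measure ?D C - e) < ennreal (measure ?D C)"
        using e by (intro ennreal_lessI) auto
      then show ?thesis by (simp only: D.emeasure_eq_measure simp_thms)
    qed simp
    ultimately consider "measure ?D C = 0"
      | K where "K \<subseteq> C" "compact K" "ennreal (measure ?D C - e) < emeasure ?D K"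
      unfolding less_SUP_iff[symmetric] by (metis (no_types, lifting) less_SUP_iff mem_Collect_eq)
    then show ?thesis
    proof cases
      case 1
      then show ?thesis using e pr[OF that(2)] by (intro exI[of _ "{}"]) auto
    next
      case (2 K)
      have "measure ?D C - e < measure ?D K"
      proof (cases "measure ?D C - e \<ge> 0")
        case True
        then show ?thesis using 2(3) by (simp add: D.emeasure_eq_measure ennreal_less_iff)
      next
        case False
        moreover have "0 \<le> measure ?D K" by simp
        ultimately show ?thesis by linarith
      qed
      then show ?thesis using pr[OF that(2)] pr[of K] 2 compact_imp_closed[OF 2(2)] by (intro exI[of _ K]) auto
    qed
  qed
  have borel: "\<bar>prob {\<omega> \<in> space M. U \<omega> \<in> C} - prob {\<omega> \<in> space M. V \<omega> \<in> C}\<bar> \<le> c"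
    if C[measurable]: "C \<in> sets borel" for C
  proof (rule field_le_epsilon)
    fix e :: real assume e: "e > 0"
    obtain K1 where K1: "K1 \<subseteq> C" "compact K1" "prob {\<omega> \<in> space M. U \<omega> \<in> C} < prob {\<omega> \<in> space M. U \<omega> \<in> K1} + e/2"
      using inner[of U C "e/2"] e by auto
    obtain K2 where K2: "K2 \<subseteq> C" "compact K2" "prob {\<omega> \<in> space M. V \<omega> \<in> C} < prob {\<omega> \<in> space M. V \<omega> \<in> K2} + e/2"
      using inner[of V C "e/2"] e by auto
    \<comment> \<open>The compact sets that approximate \<open>C\<close> under the two laws may
      differ; their union approximates \<open>C\<close> under both.\<close>
    let ?K = "K1 \<union> K2"
    have K: "compact ?K" using K1 K2 by auto
    have closed: "closed K1" "closed K2" using K1(2) K2(2) by (auto intro: compact_imp_closed)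
    then have [measurable]: "?K \<in> sets borel" "K1 \<in> sets borel" "K2 \<in> sets borel" by auto
    have "prob {\<omega> \<in> space M. U \<omega> \<in> K1} \<le> prob {\<omega> \<in> space M. U \<omega> \<in> ?K}"
      "prob {\<omega> \<in> space M. U \<omega> \<in> ?K} \<le> prob {\<omega> \<in> space M. U \<omega> \<in> C}"
      "prob {\<omega> \<in> space M. V \<omega> \<in> K2} \<le> prob {\<omega> \<in> space M. V \<omega> \<in> ?K}"
      "prob {\<omega> \<in> space M. V \<omega> \<in> ?K} \<le> prob {\<omega> \<in> space M. V \<omega> \<in> C}"
      by (rule finite_measure_mono; use K1(1) K2(1) in \<open>blast | measurable\<close>)+
    then show "\<bar>prob {\<omega> \<in> space M. U \<omega> \<in> C} - prob {\<omega> \<in> space M. V \<omega> \<in> C}\<bar> \<le> c + e"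
      using comp[OF K] K1(3) K2(3) by linarith
  qed
  show ?thesis unfolding total_variation_dist_def
    using borel by (intro cSUP_least) auto
qed

lemma (in prob_space) total_variation_dist_nonneg:
  "0 \<le> total_variation_dist M U V"
proof -
  have "bdd_above ((\<lambda>C. \<bar>prob {\<omega> \<in> space M. U \<omega> \<in> C} - prob {\<omega> \<in> space M. V \<omega> \<in> C}\<bar>) ` sets borel)"
  proof (rule bdd_aboveI2)
    fix C show "\<bar>prob {\<omega> \<in> space M. U \<omega> \<in> C} - prob {\<omega> \<in> space M. V \<omega> \<in> C}\<bar> \<le> 1"
      using measure_nonneg[of M "{\<omega> \<in> space M. U \<omega> \<in> C}"] measure_nonneg[of M "{\<omega> \<in> space M. V \<omega> \<in> C}"]
        prob_le_1[of "{\<omega> \<in> space M. U \<omega> \<in> C}"] prob_le_1[of "{\<omega> \<in> space M. V \<omega> \<in> C}"] by linarith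
  qed
  then have "\<bar>prob {\<omega> \<in> space M. U \<omega> \<in> {}} - prob {\<omega> \<in> space M. V \<omega> \<in> {}}\<bar> \<le> total_variation_dist M U V"
    unfolding total_variation_dist_def by (intro cSUP_upper) auto
  then show ?thesis by simp
qed

text \<open>Here \<open>L\<close> may enter the estimate, because the limit is taken for one fixed
  test function.\<close>

lemma (in prob_space) expectation_lipschitz_limit:
  assumes V: "\<And>n. integrable M (V n)" "integrable M W"
    and lim: "(\<lambda>n. expectation (\<lambda>\<omega>. \<bar>V n \<omega> - W \<omega>\<bar>)) \<longlonglongrightarrow> 0"
    and phi: "\<And>y. \<bar>\<phi> y\<bar> \<le> 1" "\<And>y. (\<phi> has_real_derivative \<phi>' y) (at y)" "\<And>y. \<bar>\<phi>' y\<bar> \<le> L"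
  shows "(\<lambda>n. expectation (\<lambda>\<omega>. \<phi> (V n \<omega>))) \<longlonglongrightarrow> expectation (\<lambda>\<omega>. \<phi> (W \<omega>))"
proof -
  have cphi: "continuous_on UNIV \<phi>" using phi(2) by (meson DERIV_isCont continuous_at_imp_continuous_on)
  have [measurable]: "\<phi> \<in> borel_measurable borel" using cphi by (intro borel_measurable_continuous_onI)
  have [measurable]: "V n \<in> borel_measurable M" "W \<in> borel_measurable M" for n using V by auto
  have int: "integrable M (\<lambda>\<omega>. \<phi> (V n \<omega>))" "integrable M (\<lambda>\<omega>. \<phi> (W \<omega>))" for n
    using phi(1) by (auto intro!: integrable_const_bound[where B=1])
  have "norm (expectation (\<lambda>\<omega>. \<phi> (V n \<omega>)) - expectation (\<lambda>\<omega>. \<phi> (W \<omega>))) \<le> L * expectation (\<lambda>\<omega>. \<bar>V n \<omega> - W \<omega>\<bar>)" for n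
  proof -
    have "\<bar>expectation (\<lambda>\<omega>. \<phi> (V n \<omega>) - \<phi> (W \<omega>))\<bar> \<le> expectation (\<lambda>\<omega>. \<bar>\<phi> (V n \<omega>) - \<phi> (W \<omega>)\<bar>)"
      by (rule integral_abs_bound)
    also have "\<dots> \<le> expectation (\<lambda>\<omega>. L * \<bar>V n \<omega> - W \<omega>\<bar>)"
      using int V DERIV_bound_lipschitz[OF phi(2,3)] by (intro integral_mono) auto
    finally show ?thesis using int V by simp
  qed
  moreover have "(\<lambda>n. L * expectation (\<lambda>\<omega>. \<bar>V n \<omega> - W \<omega>\<bar>)) \<longlonglongrightarrow> 0"
    using tendsto_mult_left[OF lim, of L] by simp
  ultimately have "(\<lambda>n. expectation (\<lambda>\<omega>. \<phi> (V n \<omega>)) - expectation (\<lambda>\<omega>. \<phi> (W \<omega>))) \<longlonglongrightarrow> 0"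
    by (rule Lim_null_comparison[OF always_eventually[OF allI]])
  then show ?thesis by (rule LIM_zero_cancel)
qed

section \<open>Removal of cutoff and regularisation, and interpolation between two
  polynomials\<close>

context stein_vector
begin

lemma kappa_nonneg: "\<kappa> \<ge> 0" unfolding \<kappa>_def by simp

lemma C1_meas: "C1_fun m f f' \<Longrightarrow> (\<lambda>\<omega>. f (\<xi> \<omega>)) \<in> borel_measurable M"
  by (rule cont_meas) (simp add: C1_fun_def)

lemma integrable_if_square:
  assumes "f \<in> borel_measurable M" "integrable M (\<lambda>\<omega>. (f \<omega>)\<^sup>2)"
  shows "integrable M (f :: 'a \<Rightarrow> real)"
proof (rule Bochner_Integration.integrable_bound[of M "\<lambda>\<omega>. 1 + (f \<omega>)\<^sup>2"])
  have "\<bar>y\<bar> \<le> 1 + y\<^sup>2" for y :: real using sum_squares_bound[of 1 "\<bar>y\<bar>"] by simp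
  then show "AE \<omega> in M. norm (f \<omega>) \<le> norm (1 + (f \<omega>)\<^sup>2)" by simp
qed (use assms in auto)

text \<open>The order of the limits matters: \<open>\<epsilon>\<close> tends to zero for fixed
  \<open>\<eta>\<close>, because the cutoff error contains \<open>1 / \<eta>\<close>, and
  \<open>\<eta>\<close> follows. The second limit also removes \<open>L\<close>, as
  \<open>total_variation_dist_le\<close> requires.\<close>

lemma ibp_bound:
  assumes near: "\<And>i j. i < 6 \<Longrightarrow> j < 6 \<Longrightarrow>
      \<bar>(\<Sum>k<m. \<alpha> i k * \<beta> j k) - (if i = j then 1 else 0)\<bar> \<le> 1/30"
    and F: "C1_fun m F F'" "growth m 1 F" "\<And>k. k < m \<Longrightarrow> growth m 1 (F' k)"
    and DF: "\<And>i x. i < 6 \<Longrightarrow> (\<Sum>k<m. \<alpha> i k * F' k x) = 2 * (\<Sum>k<m. \<beta> i k * x k)"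
    and Y: "C1_fun m Y Y'" "growth m 1 Y" "\<And>k. k < m \<Longrightarrow> growth m 1 (Y' k)"
    and rho: "\<rho> > 0"
    and Y2: "integrable M (\<lambda>\<omega>. (Y (\<xi> \<omega>))\<^sup>2)" "expectation (\<lambda>\<omega>. (Y (\<xi> \<omega>))\<^sup>2) \<le> \<rho>\<^sup>2"
    and DY2: "\<And>i. i < 6 \<Longrightarrow> integrable M (\<lambda>\<omega>. (\<Sum>k<m. \<alpha> i k * Y' k (\<xi> \<omega>))\<^sup>2)"
      "\<And>i. i < 6 \<Longrightarrow> expectation (\<lambda>\<omega>. (\<Sum>k<m. \<alpha> i k * Y' k (\<xi> \<omega>))\<^sup>2) \<le> \<rho>\<^sup>2"
    and phi: "\<And>y. \<bar>\<phi> y\<bar> \<le> 1" "\<And>y. (\<phi> has_real_derivative \<phi>' y) (at y)" "continuous_on UNIV \<phi>'"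
      "\<And>y. \<bar>\<phi>' y\<bar> \<le> L"
  shows "\<bar>expectation (\<lambda>\<omega>. \<phi>' (F (\<xi> \<omega>)) * Y (\<xi> \<omega>))\<bar> \<le> \<rho> * (5 + 3 * \<kappa>)"
proof -
  have L: "L \<ge> 0" using phi(4)[of 0] by simp
  have [measurable]: "(\<lambda>\<omega>. F (\<xi> \<omega>)) \<in> borel_measurable M" "(\<lambda>\<omega>. Y (\<xi> \<omega>)) \<in> borel_measurable M"
    by (rule C1_meas[OF F(1)]) (rule C1_meas[OF Y(1)])
  have [measurable]: "\<phi>' \<in> borel_measurable borel" using phi(3) by (rule borel_measurable_continuous_onI)
  have intY: "integrable M (\<lambda>\<omega>. Y (\<xi> \<omega>))" by (rule integrable_if_square) (use Y2(1) in simp_all)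
  define \<epsilon> where "\<epsilon> n = 1 / real (Suc n)" for n
  have e: "0 < \<epsilon> n" "\<epsilon> n \<le> 1" for n unfolding \<epsilon>_def by auto
  have e0: "\<epsilon> \<longlonglongrightarrow> 0" unfolding \<epsilon>_def using LIMSEQ_inverse_real_of_nat by (simp add: inverse_eq_divide)
  let ?E = "expectation (\<lambda>\<omega>. \<phi>' (F (\<xi> \<omega>)) * Y (\<xi> \<omega>))"
  have lim: "(\<lambda>n. expectation (\<lambda>\<omega>. \<phi>' (F (\<xi> \<omega>)) * Y (\<xi> \<omega>) * (cutoff m (\<epsilon> n) (\<xi> \<omega>))\<^sup>2)) \<longlonglongrightarrow> ?E"
  proof (rule integral_dominated_convergence[where w="\<lambda>\<omega>. L * \<bar>Y (\<xi> \<omega>)\<bar>"])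
    show "integrable M (\<lambda>\<omega>. L * \<bar>Y (\<xi> \<omega>)\<bar>)" using intY by auto
    have mc: "(\<lambda>\<omega>. cutoff m (\<epsilon> n) (\<xi> \<omega>)) \<in> borel_measurable M" for n
      using C1_cutoff[OF e] by (rule C1_meas)
    show "(\<lambda>\<omega>. \<phi>' (F (\<xi> \<omega>)) * Y (\<xi> \<omega>) * (cutoff m (\<epsilon> n) (\<xi> \<omega>))\<^sup>2) \<in> borel_measurable M" for n
      by (intro borel_measurable_times borel_measurable_power mc) measurable
    show "AE \<omega> in M. (\<lambda>n. \<phi>' (F (\<xi> \<omega>)) * Y (\<xi> \<omega>) * (cutoff m (\<epsilon> n) (\<xi> \<omega>))\<^sup>2)
        \<longlonglongrightarrow> \<phi>' (F (\<xi> \<omega>)) * Y (\<xi> \<omega>)"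
    proof (intro AE_I2)
      fix \<omega>
      have "(\<lambda>n. \<phi>' (F (\<xi> \<omega>)) * Y (\<xi> \<omega>) * (cutoff m (\<epsilon> n) (\<xi> \<omega>))\<^sup>2)
        \<longlonglongrightarrow> \<phi>' (F (\<xi> \<omega>)) * Y (\<xi> \<omega>) * (1 / (1 + 0 * (\<Sum>k<m. (\<xi> \<omega> k)\<^sup>2)))\<^sup>2"
        unfolding cutoff_def by (intro tendsto_intros e0) auto
      then show "(\<lambda>n. \<phi>' (F (\<xi> \<omega>)) * Y (\<xi> \<omega>) * (cutoff m (\<epsilon> n) (\<xi> \<omega>))\<^sup>2)
        \<longlonglongrightarrow> \<phi>' (F (\<xi> \<omega>)) * Y (\<xi> \<omega>)" by simp
    qed
    fix n
    show "AE \<omega> in M. norm (\<phi>' (F (\<xi> \<omega>)) * Y (\<xi> \<omega>) * (cutoff m (\<epsilon> n) (\<xi> \<omega>))\<^sup>2) \<le> L * \<bar>Y (\<xi> \<omega>)\<bar>"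
    proof (intro AE_I2)
      fix \<omega>
      have "(cutoff m (\<epsilon> n) (\<xi> \<omega>))\<^sup>2 \<le> 1"
        using cutoff_pos[OF e, of m n "\<xi> \<omega>"] cutoff_le_1[OF e, of m n "\<xi> \<omega>"] by (intro power_le_one) auto
      then have "\<bar>\<phi>' (F (\<xi> \<omega>)) * Y (\<xi> \<omega>)\<bar> * (cutoff m (\<epsilon> n) (\<xi> \<omega>))\<^sup>2 \<le> \<bar>\<phi>' (F (\<xi> \<omega>)) * Y (\<xi> \<omega>)\<bar> * 1"
        by (intro mult_left_mono) auto
      also have "\<dots> \<le> L * \<bar>Y (\<xi> \<omega>)\<bar>" using phi(4) by (simp add: abs_mult mult_right_mono)
      finally show "norm (\<phi>' (F (\<xi> \<omega>)) * Y (\<xi> \<omega>) * (cutoff m (\<epsilon> n) (\<xi> \<omega>))\<^sup>2) \<le> L * \<bar>Y (\<xi> \<omega>)\<bar>"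
        by (simp add: abs_mult)
    qed
  qed measurable
  have step: "2 * \<bar>?E\<bar> \<le> \<rho> * (9 + 6 * \<kappa>) + \<eta> * L * (\<rho>\<^sup>2 + \<kappa>)" if eta: "\<eta> > 0" for \<eta>
  proof -
    interpret S: stein_field M m \<xi> X \<alpha> \<beta> \<eta>
      by unfold_locales (use near eta in auto)
    define c where "c = 2 * (1 + 1 / \<eta>) * (\<Sum>i<6. \<Sum>k<m. \<bar>\<alpha> i k\<bar>) * expectation (\<lambda>\<omega>. \<bar>Y (\<xi> \<omega>)\<bar>)"
    have le: "2 * \<bar>expectation (\<lambda>\<omega>. \<phi>' (F (\<xi> \<omega>)) * Y (\<xi> \<omega>) * (cutoff m (\<epsilon> n) (\<xi> \<omega>))\<^sup>2)\<bar>
      \<le> \<rho> * (9 + 6 * \<kappa>) + \<eta> * L * (\<rho>\<^sup>2 + \<kappa>) + sqrt (\<epsilon> n) * c" for n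
      unfolding c_def
      by (rule S.ibp_cutoff[OF F _ Y rho Y2 DY2 phi e]) (auto simp: DF S.p_def)
    have r: "(\<lambda>n. \<rho> * (9 + 6 * \<kappa>) + \<eta> * L * (\<rho>\<^sup>2 + \<kappa>) + sqrt (\<epsilon> n) * c) \<longlonglongrightarrow>
       \<rho> * (9 + 6 * \<kappa>) + \<eta> * L * (\<rho>\<^sup>2 + \<kappa>) + sqrt 0 * c"
      by (intro tendsto_intros e0)
    have l: "(\<lambda>n. 2 * \<bar>expectation (\<lambda>\<omega>. \<phi>' (F (\<xi> \<omega>)) * Y (\<xi> \<omega>) * (cutoff m (\<epsilon> n) (\<xi> \<omega>))\<^sup>2)\<bar>) \<longlonglongrightarrow> 2 * \<bar>?E\<bar>"
      by (intro tendsto_intros lim)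
    have "2 * \<bar>?E\<bar> \<le> \<rho> * (9 + 6 * \<kappa>) + \<eta> * L * (\<rho>\<^sup>2 + \<kappa>) + sqrt 0 * c"
      using le by (intro LIMSEQ_le[OF l r]) blast
    then show ?thesis by simp
  qed
  have "2 * \<bar>?E\<bar> \<le> \<rho> * (9 + 6 * \<kappa>)"
  proof (rule field_le_epsilon)
    fix d :: real assume d: "d > 0"
    define K where "K = L * (\<rho>\<^sup>2 + \<kappa>) + 1"
    have K: "K > 0" unfolding K_def using L kappa_nonneg by (intro add_nonneg_pos mult_nonneg_nonneg) auto
    have "d / K * (L * (\<rho>\<^sup>2 + \<kappa>)) \<le> d / K * K"
      using d K by (intro mult_left_mono) (auto simp: K_def)
    then show "2 * \<bar>?E\<bar> \<le> \<rho> * (9 + 6 * \<kappa>) + d" using step[of "d / K"] d K by (simp add: mult.assoc)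
  qed
  then show ?thesis using rho by (simp add: algebra_simps)
qed

text \<open>The two polynomials are joined by the segment \<open>F0 + s * Y\<close> with
  \<open>Y = F1 - F0\<close>. Being close to the identity is a convex condition, so
  \<open>ibp_bound\<close> applies at every point of the segment with the same constant.\<close>

lemma smooth_distance_bound:
  assumes near0: "\<And>i j. i < 6 \<Longrightarrow> j < 6 \<Longrightarrow>
      \<bar>(\<Sum>k<m. \<alpha> i k * \<beta>0 j k) - (if i = j then 1 else 0)\<bar> \<le> 1/30"
    and near1: "\<And>i j. i < 6 \<Longrightarrow> j < 6 \<Longrightarrow>
      \<bar>(\<Sum>k<m. \<alpha> i k * \<beta>1 j k) - (if i = j then 1 else 0)\<bar> \<le> 1/30"
    and F0: "C1_fun m F0 F0'" "growth m 1 F0" "\<And>k. k < m \<Longrightarrow> growth m 1 (F0' k)"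
    and F1: "C1_fun m F1 F1'" "growth m 1 F1" "\<And>k. k < m \<Longrightarrow> growth m 1 (F1' k)"
    and DF0: "\<And>i x. i < 6 \<Longrightarrow> (\<Sum>k<m. \<alpha> i k * F0' k x) = 2 * (\<Sum>k<m. \<beta>0 i k * x k)"
    and DF1: "\<And>i x. i < 6 \<Longrightarrow> (\<Sum>k<m. \<alpha> i k * F1' k x) = 2 * (\<Sum>k<m. \<beta>1 i k * x k)"
    and rho: "\<rho> > 0"
    and Y2: "integrable M (\<lambda>\<omega>. (F1 (\<xi> \<omega>) - F0 (\<xi> \<omega>))\<^sup>2)"
      "expectation (\<lambda>\<omega>. (F1 (\<xi> \<omega>) - F0 (\<xi> \<omega>))\<^sup>2) \<le> \<rho>\<^sup>2"
    and DY2: "\<And>i. i < 6 \<Longrightarrow> integrable M (\<lambda>\<omega>. (2 * (\<Sum>k<m. (\<beta>1 i k - \<beta>0 i k) * \<xi> \<omega> k))\<^sup>2)"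
      "\<And>i. i < 6 \<Longrightarrow> expectation (\<lambda>\<omega>. (2 * (\<Sum>k<m. (\<beta>1 i k - \<beta>0 i k) * \<xi> \<omega> k))\<^sup>2) \<le> \<rho>\<^sup>2"
    and phi: "\<And>y. \<bar>\<phi> y\<bar> \<le> 1" "\<And>y. (\<phi> has_real_derivative \<phi>' y) (at y)" "continuous_on UNIV \<phi>'"
      "\<And>y. \<bar>\<phi>' y\<bar> \<le> L"
  shows "\<bar>expectation (\<lambda>\<omega>. \<phi> (F1 (\<xi> \<omega>))) - expectation (\<lambda>\<omega>. \<phi> (F0 (\<xi> \<omega>)))\<bar> \<le> \<rho> * (5 + 3 * \<kappa>)"
proof -
  define Y where "Y x = F1 x + (-1) * F0 x" for x
  define Y' where "Y' k x = F1' k x + (-1) * F0' k x" for k x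
  have g: "growth m 1 (\<lambda>x. c * f x)" if "growth m 1 f" for c :: real and f
    using growth_mult'[OF growth_const that, of 1 c] by simp
  have Y: "C1_fun m Y Y'" "growth m 1 Y" "\<And>k. k < m \<Longrightarrow> growth m 1 (Y' k)"
    unfolding Y_def[abs_def] Y'_def[abs_def]
    by (intro C1_fun_add C1_fun_cmult growth_add g F0 F1; assumption)+
  have Y2': "integrable M (\<lambda>\<omega>. (Y (\<xi> \<omega>))\<^sup>2)" "expectation (\<lambda>\<omega>. (Y (\<xi> \<omega>))\<^sup>2) \<le> \<rho>\<^sup>2"
    using Y2 unfolding Y_def by auto
  have DY: "(\<Sum>k<m. \<alpha> i k * Y' k x) = 2 * (\<Sum>k<m. (\<beta>1 i k - \<beta>0 i k) * x k)" if "i < 6" for i x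
  proof -
    have "(\<Sum>k<m. \<alpha> i k * Y' k x) = (\<Sum>k<m. \<alpha> i k * F1' k x) - (\<Sum>k<m. \<alpha> i k * F0' k x)"
      unfolding Y'_def by (simp add: algebra_simps sum_subtractf)
    then show ?thesis using DF0[OF that] DF1[OF that] by (simp add: left_diff_distrib sum_subtractf)
  qed
  have [measurable]: "(\<lambda>\<omega>. F0 (\<xi> \<omega>)) \<in> borel_measurable M" "(\<lambda>\<omega>. Y (\<xi> \<omega>)) \<in> borel_measurable M"
    by (rule C1_meas[OF F0(1)]) (rule C1_meas[OF Y(1)])
  have intY: "integrable M (\<lambda>\<omega>. Y (\<xi> \<omega>))" by (rule integrable_if_square) (use Y2' in simp_all)
  let ?h = "\<lambda>s. expectation (\<lambda>\<omega>. \<phi> (F0 (\<xi> \<omega>) + s * Y (\<xi> \<omega>)))"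
  let ?h' = "\<lambda>s. expectation (\<lambda>\<omega>. \<phi>' (F0 (\<xi> \<omega>) + s * Y (\<xi> \<omega>)) * Y (\<xi> \<omega>))"
  have "(?h has_real_derivative ?h' s) (at s)" for s
    by (rule DERIV_expectation_shift[OF _ intY phi]) simp
  \<comment> \<open>The mean value theorem selects a single point of the segment, which takes the
    place of an integral over \<open>s\<close>.\<close>
  then obtain s where s: "0 < s" "s < 1" "?h 1 - ?h 0 = ?h' s"
    using MVT2[of 0 1 ?h ?h'] by auto
  define \<beta> where "\<beta> i k = \<beta>0 i k + s * (\<beta>1 i k - \<beta>0 i k)" for i k
  have "\<bar>expectation (\<lambda>\<omega>. \<phi>' ((\<lambda>x. F0 x + s * Y x) (\<xi> \<omega>)) * Y (\<xi> \<omega>))\<bar> \<le> \<rho> * (5 + 3 * \<kappa>)"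
  proof (rule ibp_bound[OF _ _ _ _ _ Y rho Y2' _ _ phi])
    fix i j :: nat assume ij: "i < 6" "j < 6"
    let ?d = "if i = j then 1 else 0 :: real"
    let ?a0 = "(\<Sum>k<m. \<alpha> i k * \<beta>0 j k)" and ?a1 = "(\<Sum>k<m. \<alpha> i k * \<beta>1 j k)"
    have "(\<Sum>k<m. \<alpha> i k * \<beta> j k) = (\<Sum>k<m. (1 - s) * (\<alpha> i k * \<beta>0 j k) + s * (\<alpha> i k * \<beta>1 j k))"
      unfolding \<beta>_def by (intro sum.cong) (auto simp: algebra_simps)
    also have "\<dots> = (1 - s) * ?a0 + s * ?a1" by (simp add: sum.distrib sum_distrib_left)
    finally have "(\<Sum>k<m. \<alpha> i k * \<beta> j k) - ?d = (1 - s) * (?a0 - ?d) + s * (?a1 - ?d)"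
      by (simp only:) (simp add: algebra_simps)
    also have "\<bar>\<dots>\<bar> \<le> \<bar>(1 - s) * (?a0 - ?d)\<bar> + \<bar>s * (?a1 - ?d)\<bar>" by (rule abs_triangle_ineq)
    also have "\<dots> = (1 - s) * \<bar>?a0 - ?d\<bar> + s * \<bar>?a1 - ?d\<bar>" using s by (simp add: abs_mult)
    also have "\<dots> \<le> (1 - s) * (1/30) + s * (1/30)"
      using s near0[OF ij] near1[OF ij] by (intro add_mono mult_left_mono) auto
    also have "\<dots> = 1/30" by (simp add: field_simps)
    finally show "\<bar>(\<Sum>k<m. \<alpha> i k * \<beta> j k) - ?d\<bar> \<le> 1/30" .
  next
    show "C1_fun m (\<lambda>x. F0 x + s * Y x) (\<lambda>k x. F0' k x + s * Y' k x)"
      by (intro C1_fun_add C1_fun_cmult F0 Y)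
    show "growth m 1 (\<lambda>x. F0 x + s * Y x)" by (intro growth_add g F0 Y)
    show "growth m 1 (\<lambda>x. F0' k x + s * Y' k x)" if "k < m" for k using that by (intro growth_add g F0 Y)
    fix i assume i: "i < (6 :: nat)"
    show "(\<Sum>k<m. \<alpha> i k * (F0' k x + s * Y' k x)) = 2 * (\<Sum>k<m. \<beta> i k * x k)" for x
    proof -
      have "(\<Sum>k<m. \<alpha> i k * (F0' k x + s * Y' k x)) = (\<Sum>k<m. \<alpha> i k * F0' k x) + s * (\<Sum>k<m. \<alpha> i k * Y' k x)"
        by (simp add: distrib_left sum.distrib sum_distrib_left mult_ac)
      then show ?thesis unfolding DF0[OF i] DY[OF i] \<beta>_def
        by (simp add: distrib_left distrib_right sum.distrib sum_distrib_left mult_ac)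
    qed
    show "integrable M (\<lambda>\<omega>. (\<Sum>k<m. \<alpha> i k * Y' k (\<xi> \<omega>))\<^sup>2)"
      "expectation (\<lambda>\<omega>. (\<Sum>k<m. \<alpha> i k * Y' k (\<xi> \<omega>))\<^sup>2) \<le> \<rho>\<^sup>2"
      unfolding DY[OF i] using DY2[OF i] by auto
  qed
  then have "\<bar>?h 1 - ?h 0\<bar> \<le> \<rho> * (5 + 3 * \<kappa>)" using s(3) by simp
  then show ?thesis unfolding Y_def by simp
qed

end

section \<open>Square integrable functions\<close>

text \<open>Defined on functions and not on classes modulo null sets, to fit
  \<open>bounded_linear_L2\<close>, which acts on representatives. The additivity rules therefore
  carry membership in \<open>L2\<close> as a hypothesis.\<close>

definition ip :: "'b measure \<Rightarrow> ('b \<Rightarrow> real) \<Rightarrow> ('b \<Rightarrow> real) \<Rightarrow> real" where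
  "ip N f g = (\<integral>x. f x * g x \<partial>N)"

lemma L2_meas [measurable_dest]: "f \<in> L2 N \<Longrightarrow> f \<in> borel_measurable N"
  and L2_sq_int: "f \<in> L2 N \<Longrightarrow> integrable N (\<lambda>x. (f x)\<^sup>2)"
  unfolding L2_def by auto

lemma L2I: "f \<in> borel_measurable N \<Longrightarrow> integrable N (\<lambda>x. (f x)\<^sup>2) \<Longrightarrow> f \<in> L2 N"
  unfolding L2_def by auto

lemma L2_bound:
  assumes "g \<in> L2 N" "f \<in> borel_measurable N" "\<And>x. x \<in> space N \<Longrightarrow> \<bar>f x\<bar> \<le> \<bar>g x\<bar>"
  shows "f \<in> L2 N"
proof (rule L2I)
  show "integrable N (\<lambda>x. (f x)\<^sup>2)"
  proof (rule Bochner_Integration.integrable_bound[OF L2_sq_int[OF assms(1)]])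
    show "AE x in N. norm ((f x)\<^sup>2) \<le> norm ((g x)\<^sup>2)"
      using assms(3) by (auto intro!: AE_I2 simp: abs_le_square_iff)
  qed (use assms in measurable)
qed fact

lemma L2_mult_int: "f \<in> L2 N \<Longrightarrow> g \<in> L2 N \<Longrightarrow> integrable N (\<lambda>x. f x * g x)"
proof (rule Bochner_Integration.integrable_bound[of N "\<lambda>x. (f x)\<^sup>2 + (g x)\<^sup>2"])
  assume *: "f \<in> L2 N" "g \<in> L2 N"
  then show "integrable N (\<lambda>x. (f x)\<^sup>2 + (g x)\<^sup>2)" by (auto intro: L2_sq_int)
  show "(\<lambda>x. f x * g x) \<in> borel_measurable N" using * by measurable
  have "\<bar>a * b\<bar> \<le> a\<^sup>2 + b\<^sup>2" for a b :: real
  proof -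
    have "2 * \<bar>a * b\<bar> \<le> a\<^sup>2 + b\<^sup>2"
      using sum_squares_bound[of "\<bar>a\<bar>" "\<bar>b\<bar>"] by (simp add: abs_mult)
    then show ?thesis using abs_ge_zero[of "a * b"] by linarith
  qed
  then show "AE x in N. norm (f x * g x) \<le> norm ((f x)\<^sup>2 + (g x)\<^sup>2)" by (auto intro!: AE_I2)
qed

lemma L2_lin:
  assumes "f \<in> L2 N" "g \<in> L2 N" shows "(\<lambda>x. a * f x + b * g x) \<in> L2 N"
proof (rule L2I)
  have eq: "(\<lambda>x. (a * f x + b * g x)\<^sup>2) = (\<lambda>x. a\<^sup>2 * (f x)\<^sup>2 + b\<^sup>2 * (g x)\<^sup>2 + 2 * a * b * (f x * g x))"
    by (auto simp: power2_eq_square algebra_simps)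
  show "integrable N (\<lambda>x. (a * f x + b * g x)\<^sup>2)"
    unfolding eq
    by (intro Bochner_Integration.integrable_add integrable_mult_right L2_sq_int L2_mult_int assms)
qed (use assms in measurable)

lemma L2_add: "f \<in> L2 N \<Longrightarrow> g \<in> L2 N \<Longrightarrow> (\<lambda>x. f x + g x) \<in> L2 N"
  using L2_lin[of f N g 1 1] by simp

lemma L2_diff: "f \<in> L2 N \<Longrightarrow> g \<in> L2 N \<Longrightarrow> (\<lambda>x. f x - g x) \<in> L2 N"
  using L2_lin[of f N g 1 "-1"] by simp

lemma L2_scale: "f \<in> L2 N \<Longrightarrow> (\<lambda>x. a * f x) \<in> L2 N"
  using L2_lin[of f N f a 0] by simp

lemma L2_zero: "(\<lambda>_. 0) \<in> L2 N"
  by (rule L2I) auto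

lemma L2_sum: "(\<And>i. i \<in> A \<Longrightarrow> f i \<in> L2 N) \<Longrightarrow> (\<lambda>x. \<Sum>i\<in>A. f i x) \<in> L2 N"
  by (induction A rule: infinite_finite_induct) (auto intro: L2_zero L2_add)

lemma ip_commute: "ip N f g = ip N g f"
  unfolding ip_def by (simp add: mult.commute)

lemma ip_self: "ip N f f = (\<integral>x. (f x)\<^sup>2 \<partial>N)"
  unfolding ip_def by (simp add: power2_eq_square)

lemma ip_self_nonneg: "0 \<le> ip N f f"
  unfolding ip_self by simp

lemma ip_add_left: "f \<in> L2 N \<Longrightarrow> g \<in> L2 N \<Longrightarrow> h \<in> L2 N \<Longrightarrow>
    ip N (\<lambda>x. f x + g x) h = ip N f h + ip N g h"
  unfolding ip_def using L2_mult_int[of f N h] L2_mult_int[of g N h] by (simp add: distrib_right)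

lemma ip_diff_left: "f \<in> L2 N \<Longrightarrow> g \<in> L2 N \<Longrightarrow> h \<in> L2 N \<Longrightarrow>
    ip N (\<lambda>x. f x - g x) h = ip N f h - ip N g h"
  unfolding ip_def using L2_mult_int[of f N h] L2_mult_int[of g N h] by (simp add: left_diff_distrib)

lemma ip_scale_left: "ip N (\<lambda>x. a * f x) h = a * ip N f h"
  unfolding ip_def by (simp add: mult.assoc)

lemma ip_add_right: "f \<in> L2 N \<Longrightarrow> g \<in> L2 N \<Longrightarrow> h \<in> L2 N \<Longrightarrow>
    ip N h (\<lambda>x. f x + g x) = ip N h f + ip N h g"
  by (simp add: ip_commute[of N h] ip_add_left)

lemma ip_diff_right: "f \<in> L2 N \<Longrightarrow> g \<in> L2 N \<Longrightarrow> h \<in> L2 N \<Longrightarrow>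
    ip N h (\<lambda>x. f x - g x) = ip N h f - ip N h g"
  by (simp add: ip_commute[of N h] ip_diff_left)

lemma ip_scale_right: "ip N h (\<lambda>x. a * f x) = a * ip N h f"
  by (simp add: ip_commute[of N h] ip_scale_left)

lemma ip_sum_left: "(\<And>i. i \<in> A \<Longrightarrow> f i \<in> L2 N) \<Longrightarrow> h \<in> L2 N \<Longrightarrow>
    ip N (\<lambda>x. \<Sum>i\<in>A. f i x) h = (\<Sum>i\<in>A. ip N (f i) h)"
  unfolding ip_def sum_distrib_right by (rule Bochner_Integration.integral_sum) (rule L2_mult_int)

lemma ip_sum_right: "(\<And>i. i \<in> A \<Longrightarrow> f i \<in> L2 N) \<Longrightarrow> h \<in> L2 N \<Longrightarrow>
    ip N h (\<lambda>x. \<Sum>i\<in>A. f i x) = (\<Sum>i\<in>A. ip N h (f i))"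
  by (simp add: ip_commute[of N h] ip_sum_left)

text \<open>A non-negative quadratic form in \<open>s, t\<close>, evaluated at
  \<open>(?c, - ?b)\<close>, which is proportional to the minimising ratio. If \<open>?c = 0\<close>
  this point carries no information, whence the case distinction.\<close>

lemma ip_Cauchy_Schwarz:
  assumes "f \<in> L2 N" "g \<in> L2 N" shows "(ip N f g)\<^sup>2 \<le> ip N f f * ip N g g"
proof -
  let ?a = "ip N f f" and ?b = "ip N f g" and ?c = "ip N g g"
  have pos: "0 \<le> s\<^sup>2 * ?a + 2 * s * t * ?b + t\<^sup>2 * ?c" for s t
  proof -
    have sf: "(\<lambda>x. s * f x) \<in> L2 N" "(\<lambda>x. t * g x) \<in> L2 N" using assms L2_scale by auto
    have "0 \<le> ip N (\<lambda>x. s * f x + t * g x) (\<lambda>x. s * f x + t * g x)" by (rule ip_self_nonneg)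
    also have "\<dots> = s\<^sup>2 * ?a + 2 * s * t * ?b + t\<^sup>2 * ?c"
      by (simp add: ip_add_left[OF sf L2_add[OF sf]] ip_add_right[OF sf] assms ip_scale_left ip_scale_right
          ip_commute[of N g f] power2_eq_square algebra_simps)
    finally show ?thesis .
  qed
  show ?thesis
  proof (cases "?c = 0")
    case True
    have "?b = 0"
    proof (rule ccontr)
      assume nz: "?b \<noteq> 0"
      \<comment> \<open>For \<open>?c = 0\<close> the form is affine in \<open>t\<close>, and this
        \<open>t\<close> is chosen to make its value -1.\<close>
      have "0 \<le> ?a + 2 * (- (?a + 1) / (2 * ?b)) * ?b"
        using pos[of 1 "- (?a + 1) / (2 * ?b)"] True by simp
      also have "\<dots> = - 1" using nz by (simp add: field_simps)
      finally show False by simp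
    qed
    then show ?thesis using True by simp
  next
    case False
    then have c: "?c > 0" using ip_self_nonneg[of N g] by simp
    have "?c\<^sup>2 * ?a + 2 * ?c * (- ?b) * ?b + (- ?b)\<^sup>2 * ?c = ?c * (?a * ?c - ?b\<^sup>2)"
      by (simp add: power2_eq_square algebra_simps)
    then have "0 \<le> ?c * (?a * ?c - ?b\<^sup>2)" using pos[of ?c "- ?b"] by simp
    then show ?thesis using c by (simp add: zero_le_mult_iff)
  qed
qed

lemma ip_abs_le:
  assumes "f \<in> L2 N" "g \<in> L2 N" shows "\<bar>ip N f g\<bar> \<le> sqrt (ip N f f) * sqrt (ip N g g)"
  using real_sqrt_le_mono[OF ip_Cauchy_Schwarz[OF assms]] by (simp add: real_sqrt_mult)

text \<open>Each bound drops a non-negative term from the parallelogram identity.\<close>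

lemma
  assumes "f \<in> L2 N" "g \<in> L2 N"
  shows ip_self_add_le: "ip N (\<lambda>x. f x + g x) (\<lambda>x. f x + g x) \<le> 2 * ip N f f + 2 * ip N g g"
    and ip_self_diff_le: "ip N (\<lambda>x. f x - g x) (\<lambda>x. f x - g x) \<le> 2 * ip N f f + 2 * ip N g g"
proof -
  have *: "ip N (\<lambda>x. f x + g x) (\<lambda>x. f x + g x) + ip N (\<lambda>x. f x - g x) (\<lambda>x. f x - g x)
     = 2 * ip N f f + 2 * ip N g g"
    using assms L2_add[OF assms] L2_diff[OF assms]
    by (simp add: ip_add_left ip_add_right ip_diff_left ip_diff_right)
  show "ip N (\<lambda>x. f x + g x) (\<lambda>x. f x + g x) \<le> 2 * ip N f f + 2 * ip N g g"
    using * ip_self_nonneg[of N "\<lambda>x. f x - g x"] by linarith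
  show "ip N (\<lambda>x. f x - g x) (\<lambda>x. f x - g x) \<le> 2 * ip N f f + 2 * ip N g g"
    using * ip_self_nonneg[of N "\<lambda>x. f x + g x"] by linarith
qed

section \<open>Density of step functions\<close>

definition approximable :: "(real \<Rightarrow> real) set \<Rightarrow> (real \<Rightarrow> real) \<Rightarrow> bool" where
  "approximable D g \<longleftrightarrow> g \<in> L2 lborel \<and> (\<forall>e>0. \<exists>u\<in>D. u \<in> L2 lborel \<and>
     ip lborel (\<lambda>x. g x - u x) (\<lambda>x. g x - u x) < e)"

lemma approximable_mem: "approximable D g \<Longrightarrow> g \<in> L2 lborel"
  unfolding approximable_def by simp

lemma approximableE:
  assumes "approximable D g" "e > 0"
  obtains u where "u \<in> D" "u \<in> L2 lborel" "ip lborel (\<lambda>x. g x - u x) (\<lambda>x. g x - u x) < e"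
  using assms unfolding approximable_def by blast

text \<open>Squared norms satisfy the triangle inequality only up to a factor 2, whence the quarters
  of \<open>e\<close>.\<close>

lemma approximable_closed:
  assumes "g \<in> L2 lborel" "\<And>e. e > 0 \<Longrightarrow> \<exists>f. approximable D f \<and> ip lborel (\<lambda>x. g x - f x) (\<lambda>x. g x - f x) < e"
  shows "approximable D g"
  unfolding approximable_def
proof (intro conjI allI impI)
  fix e :: real assume "e > 0"
  then obtain f where f: "approximable D f" "ip lborel (\<lambda>x. g x - f x) (\<lambda>x. g x - f x) < e/4"
    using assms(2)[of "e/4"] by auto
  obtain u where u: "u \<in> D" "u \<in> L2 lborel" "ip lborel (\<lambda>x. f x - u x) (\<lambda>x. f x - u x) < e/4"
    by (rule approximableE[OF f(1), of "e/4"]) (use \<open>e > 0\<close> in auto)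
  have "f \<in> L2 lborel" using f(1) by (rule approximable_mem)
  then have "ip lborel (\<lambda>x. (g x - f x) + (f x - u x)) (\<lambda>x. (g x - f x) + (f x - u x)) < e"
    using ip_self_add_le[OF L2_diff[OF assms(1), of f] L2_diff[of f lborel u]] f u by linarith
  then show "\<exists>u\<in>D. u \<in> L2 lborel \<and> ip lborel (\<lambda>x. g x - u x) (\<lambda>x. g x - u x) < e"
    using u by (intro bexI[of _ u]) auto
qed fact

lemma approximable_lin:
  assumes D: "\<And>u v a b. u \<in> D \<Longrightarrow> v \<in> D \<Longrightarrow> (\<lambda>x. a * u x + b * v x) \<in> D"
    and f: "approximable D f" and g: "approximable D g"
  shows "approximable D (\<lambda>x. a * f x + b * g x)"
  unfolding approximable_def
proof (intro conjI allI impI)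
  have fg: "f \<in> L2 lborel" "g \<in> L2 lborel" using f g unfolding approximable_def by auto
  then show "(\<lambda>x. a * f x + b * g x) \<in> L2 lborel" by (rule L2_lin)
  fix e :: real assume e: "e > 0"
  define K where "K = 2 * a\<^sup>2 + 2 * b\<^sup>2 + 1"
  have K: "K > 0" unfolding K_def by (intro add_nonneg_pos add_nonneg_nonneg) auto
  obtain u where u: "u \<in> D" "u \<in> L2 lborel" "ip lborel (\<lambda>x. f x - u x) (\<lambda>x. f x - u x) < e / K"
    by (rule approximableE[OF f, of "e / K"]) (use e K in auto)
  obtain v where v: "v \<in> D" "v \<in> L2 lborel" "ip lborel (\<lambda>x. g x - v x) (\<lambda>x. g x - v x) < e / K"
    by (rule approximableE[OF g, of "e / K"]) (use e K in auto)
  have "ip lborel (\<lambda>x. a * (f x - u x) + b * (g x - v x)) (\<lambda>x. a * (f x - u x) + b * (g x - v x))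
     \<le> 2 * (a\<^sup>2 * ip lborel (\<lambda>x. f x - u x) (\<lambda>x. f x - u x)) + 2 * (b\<^sup>2 * ip lborel (\<lambda>x. g x - v x) (\<lambda>x. g x - v x))"
    using ip_self_add_le[OF L2_scale[OF L2_diff[OF fg(1) u(2)], of a] L2_scale[OF L2_diff[OF fg(2) v(2)], of b]]
    by (simp add: ip_scale_left ip_scale_right power2_eq_square mult.assoc)
  also have "\<dots> \<le> 2 * (a\<^sup>2 * (e / K)) + 2 * (b\<^sup>2 * (e / K))"
    using u v by (intro add_mono mult_left_mono) auto
  also have "\<dots> = (2 * a\<^sup>2 + 2 * b\<^sup>2) * (e / K)" by (simp add: algebra_simps add_divide_distrib)
  also have "2 * a\<^sup>2 + 2 * b\<^sup>2 = K - 1" unfolding K_def by simp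
  also have "(K - 1) * (e / K) < e" using K e by (simp add: field_simps)
  finally have "ip lborel (\<lambda>x. (a * f x + b * g x) - (a * u x + b * v x)) (\<lambda>x. (a * f x + b * g x) - (a * u x + b * v x)) < e"
    by (simp add: algebra_simps)
  then show "\<exists>w\<in>D. w \<in> L2 lborel \<and> ip lborel (\<lambda>x. a * f x + b * g x - w x) (\<lambda>x. a * f x + b * g x - w x) < e"
    using D[OF u(1) v(1), of a b] L2_lin[OF u(2) v(2), of a b] by blast
qed

text \<open>The limit dominates its own approximants, so \<open>(2 * g)\<^sup>2\<close> is an
  integrable majorant of the squared differences.\<close>

lemma approximable_dominated_limit:
  assumes f: "\<And>i. approximable D (f i)" and g: "g \<in> L2 lborel"
    and lim: "\<And>x. (\<lambda>i. f i x) \<longlonglongrightarrow> g x" and dom: "\<And>i x. \<bar>f i x\<bar> \<le> \<bar>g x\<bar>"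
  shows "approximable D g"
proof (rule approximable_closed[OF g])
  fix e :: real assume e: "e > 0"
  have [measurable]: "f i \<in> borel_measurable lborel" "g \<in> borel_measurable lborel" for i
    by (rule L2_meas[OF approximable_mem[OF f]]) (rule L2_meas[OF g])
  have "(\<lambda>i. \<integral>x. (g x - f i x)\<^sup>2 \<partial>lborel) \<longlonglongrightarrow> (\<integral>x. 0 \<partial>(lborel :: real measure))"
  proof (rule integral_dominated_convergence[where w="\<lambda>x. 4 * (g x)\<^sup>2"])
    show "integrable lborel (\<lambda>x. 4 * (g x)\<^sup>2)" using L2_sq_int[OF g] by simp
    show "AE x in lborel. (\<lambda>i. (g x - f i x)\<^sup>2) \<longlonglongrightarrow> 0"
    proof (intro AE_I2)
      fix x
      have "(\<lambda>i. (g x - f i x)\<^sup>2) \<longlonglongrightarrow> (g x - g x)\<^sup>2" by (intro tendsto_intros lim)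
      then show "(\<lambda>i. (g x - f i x)\<^sup>2) \<longlonglongrightarrow> 0" by simp
    qed
    fix i
    have "(g x - f i x)\<^sup>2 \<le> (2 * g x)\<^sup>2" for x
      using dom[of i x] by (subst abs_le_square_iff[symmetric]) linarith
    then show "AE x in lborel. norm ((g x - f i x)\<^sup>2) \<le> 4 * (g x)\<^sup>2" by (auto simp: power_mult_distrib)
  qed measurable
  then have "eventually (\<lambda>i. (\<integral>x. (g x - f i x)\<^sup>2 \<partial>lborel) < e) sequentially"
    using e by (intro order_tendstoD(2)) auto
  then obtain i where "(\<integral>x. (g x - f i x)\<^sup>2 \<partial>lborel) < e" by (auto simp: eventually_sequentially)
  then show "\<exists>f. approximable D f \<and> ip lborel (\<lambda>x. g x - f x) (\<lambda>x. g x - f x) < e"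
    using f[of i] by (auto simp: ip_self)
qed

lemma indicator_L2:
  assumes "A \<in> sets lborel" "emeasure lborel A < \<infinity>" shows "(indicator A :: real \<Rightarrow> real) \<in> L2 lborel"
proof (rule L2I)
  have "(\<lambda>x. (indicator A x :: real)\<^sup>2) = indicator A" by (auto simp: indicator_def)
  then show "integrable lborel (\<lambda>x. (indicator A x :: real)\<^sup>2)" using assms by simp
qed (use assms in measurable)

lemma indicator_bounded_L2:
  assumes "A \<in> sets borel" shows "(indicator (A \<inter> {-real n<..real n}) :: real \<Rightarrow> real) \<in> L2 lborel"
proof (rule indicator_L2)
  have "emeasure lborel (A \<inter> {-real n<..real n}) \<le> emeasure lborel {-real n<..real n}"
    using assms by (intro emeasure_mono) auto
  also have "\<dots> < \<infinity>" by simp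
  finally show "emeasure lborel (A \<inter> {-real n<..real n}) < \<infinity>" .
qed (use assms in auto)

text \<open>Inside a bounded window the sets with approximable indicator are closed under
  complements and countable disjoint unions, so they exhaust the Borel sets once they contain the
  half-open intervals. Without the window, complements could have infinite measure. Non-negative
  functions follow by monotone approximation; window and sign are dealt with at the end.\<close>

theorem approximable_L2:
  assumes D: "\<And>u v a b. u \<in> D \<Longrightarrow> v \<in> D \<Longrightarrow> (\<lambda>x. a * u x + b * v x) \<in> D"
    and Ioc: "\<And>s t. s \<le> t \<Longrightarrow> indicator {s<..t} \<in> D"
    and g: "g \<in> L2 lborel"
  shows "approximable D g"
proof -
  have lin: "approximable D (\<lambda>x. a * f x + b * g x)" if "approximable D f" "approximable D g" for f g a b
    by (rule approximable_lin) (use D that in auto)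
  have subset_Pow_UNIV: "A \<subseteq> Pow UNIV" for A :: "real set set" by auto
  have base: "approximable D (indicator {s<..t})" for s t
  proof -
    have L: "(indicator {s<..t} :: real \<Rightarrow> real) \<in> L2 lborel"
      by (rule indicator_L2) (cases "s \<le> t"; simp)+
    have "indicator {s<..t} \<in> D"
    proof (cases "s \<le> t")
      case False
      then have "{s<..t} = {0<..0}" by auto
      then show ?thesis using Ioc[of 0 0] by simp
    qed (use Ioc in auto)
    then show ?thesis unfolding approximable_def using L by (auto intro!: bexI[of _ "indicator {s<..t}"] simp: ip_def)
  qed
  have zero: "approximable D (\<lambda>_. 0)" using lin[OF base[of 0 0] base[of 0 0], of 0 0] by simp
  \<comment> \<open>The half-open intervals are stable under intersection, which is what permits an
    induction over disjoint unions only.\<close>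
  have ind: "approximable D (indicator (A \<inter> {-real n<..real n}))" if "A \<in> sets borel" for A n
  proof -
    let ?J = "{-real n<..real n}"
    let ?G = "range (\<lambda>(a, b). {a<..b::real})"
    have A: "A \<in> sigma_sets UNIV ?G"
      using that unfolding borel_sigma_sets_Ioc by (simp add: sets_measure_of)
    have st: "Int_stable ?G"
    proof (rule Int_stableI)
      fix a b assume "a \<in> ?G" "b \<in> ?G"
      then obtain s t u v where "a = {s<..t}" "b = {u<..v}" by auto
      then have "a \<inter> b = {max s u<..min t v}" by auto
      then show "a \<inter> b \<in> ?G" by auto
    qed
    from A show ?thesis
    proof (induction rule: sigma_sets_induct_disjoint[OF st subset_Pow_UNIV, consumes 1, case_names basic empty compl union])
      case (basic A)
      then obtain s t where "A = {s<..t}" by auto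
      then have "A \<inter> ?J = {max s (-real n)<..min t (real n)}" by auto
      then show ?case using base by simp
    next
      case empty
      then show ?case using zero by simp
    next
      case (compl A)
      have "indicator ((UNIV - A) \<inter> ?J) = (\<lambda>x. 1 * indicator ?J x + (-1) * indicator (A \<inter> ?J) x :: real)"
        by (auto simp: indicator_def)
      then show ?case using lin[OF base compl(2), of 1 _ _ "-1"] by simp
    next
      case (union A)
      have fin: "approximable D (\<lambda>x. \<Sum>i<k. indicator (A i \<inter> ?J) x)" for k
      proof (induction k)
        case (Suc k)
        then show ?case using lin[OF Suc union(3)[of k], of 1 1] by simp
      qed (use zero in simp)
      have dis: "disjoint_family (\<lambda>i. A i \<inter> ?J)" using union(1) by (auto simp: disjoint_family_on_def)
      have eq: "(\<Sum>i<k. indicator (A i \<inter> ?J) x) = (indicator (\<Union>i<k. A i \<inter> ?J) x :: real)" for k x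
        by (subst indicator_UN_disjoint) (use dis in \<open>auto simp: disjoint_family_on_def\<close>)
      have bor: "(\<Union>i. A i) \<in> sets borel"
        using union(2) unfolding borel_sigma_sets_Ioc by (auto simp: sets_measure_of intro!: sigma_sets.Union)
      show ?case
      proof (rule approximable_dominated_limit[OF fin])
        show "(indicator (\<Union> (range A) \<inter> ?J) :: real \<Rightarrow> real) \<in> L2 lborel"
          using indicator_bounded_L2[OF bor] by simp
        show "(\<lambda>k. \<Sum>i<k. indicator (A i \<inter> ?J) x :: real) \<longlonglongrightarrow> indicator (\<Union> (range A) \<inter> ?J) x" for x
        proof -
          have "(\<lambda>k. indicator (\<Union>i<k. A i \<inter> ?J) x :: real) \<longlonglongrightarrow> indicator (\<Union>i. A i \<inter> ?J) x"
            by (rule LIMSEQ_indicator_UN)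
          moreover have "(\<Union>i. A i \<inter> ?J) = \<Union> (range A) \<inter> ?J" by auto
          ultimately show ?thesis unfolding eq by (simp only:)
        qed
        show "\<bar>\<Sum>i<k. indicator (A i \<inter> ?J) x :: real\<bar> \<le> \<bar>indicator (\<Union> (range A) \<inter> ?J) x\<bar>" for k x
          unfolding eq by (auto simp: indicator_def)
      qed
    qed
  qed
  have nonneg: "u \<in> L2 lborel \<Longrightarrow> approximable D (\<lambda>x. u x * indicator {-real n<..real n} x)"
    if "u \<in> borel_measurable lborel" "\<And>x. 0 \<le> u x" for u n
    using that
  proof (induction rule: borel_measurable_induct_real)
    case (set A)
    have "(\<lambda>x. indicator A x * indicator {-real n<..real n} x) = (indicator (A \<inter> {-real n<..real n}) :: real \<Rightarrow> real)"
      by (auto simp: indicator_def)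
    then show ?case using ind[of A n] set by simp
  next
    case (mult u c)
    show ?case
    proof (cases "c = 0")
      case False
      have "u \<in> L2 lborel" using L2_scale[OF mult.prems, of "1 / c"] False by simp
      then show ?thesis using lin[OF mult.IH zero, of c 0] by (simp add: mult.assoc)
    qed (use zero in simp)
  next
    case (add u v)
    have "\<bar>u x\<bar> \<le> \<bar>v x + u x\<bar> \<and> \<bar>v x\<bar> \<le> \<bar>v x + u x\<bar>" for x
      using add.hyps(2)[of x] add.hyps(4)[of x] by linarith
    then have "u \<in> L2 lborel" "v \<in> L2 lborel"
      using L2_bound[OF add.prems add.hyps(1)] L2_bound[OF add.prems add.hyps(3)] by blast+
    then show ?case using lin[OF add.IH(1) add.IH(2), of 1 1] by (simp add: distrib_right add.commute)
  next
    case (seq U)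
    have le: "U i x \<le> u x" for i x
    proof (rule incseq_le)
      show "incseq (\<lambda>i. U i x)" using seq.hyps(3) by (auto simp: incseq_def le_fun_def)
      show "(\<lambda>i. U i x) \<longlonglongrightarrow> u x" using seq.hyps(4)[of x] by simp
    qed
    have L: "U i \<in> L2 lborel" for i
    proof (rule L2_bound[OF seq.prems seq.hyps(1)])
      fix x show "\<bar>U i x\<bar> \<le> \<bar>u x\<bar>" using seq.hyps(2)[of i x] le[of i x] by linarith
    qed
    show ?case
    proof (rule approximable_dominated_limit)
      show "approximable D (\<lambda>x. U i x * indicator {-real n<..real n} x)" for i by (rule seq.IH[OF L])
      show "(\<lambda>x. u x * indicator {-real n<..real n} x) \<in> L2 lborel"
        using L2_meas[OF seq.prems] by (intro L2_bound[OF seq.prems]) (auto simp: indicator_def)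
      show "(\<lambda>i. U i x * indicator {- real n<..real n} x) \<longlonglongrightarrow> u x * indicator {- real n<..real n} x" for x
        using seq.hyps(4)[of x] by (intro tendsto_mult tendsto_const) simp
      show "\<bar>U i x * indicator {- real n<..real n} x\<bar> \<le> \<bar>u x * indicator {- real n<..real n} x\<bar>" for i x
        using le[of i x] seq.hyps(2)[of i x] by (auto simp: indicator_def)
    qed
  qed
  have nonneg': "approximable D u" if u: "u \<in> L2 lborel" "\<And>x. 0 \<le> u x" for u :: "real \<Rightarrow> real"
  proof (rule approximable_dominated_limit[OF nonneg[OF L2_meas[OF u(1)] u(2) u(1)] u(1)])
    show "(\<lambda>i. u x * indicator {- real i<..real i} x) \<longlonglongrightarrow> u x" for x
    proof -
      obtain N where N: "real N > \<bar>x\<bar>" using reals_Archimedean2 by blast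
      have "eventually (\<lambda>i. u x * indicator {- real i<..real i} x = u x) sequentially"
        unfolding eventually_sequentially
      proof (intro exI[of _ N] allI impI)
        fix i assume "N \<le> i"
        then have "real i > \<bar>x\<bar>" using N by linarith
        then show "u x * indicator {- real i<..real i} x = u x" by (auto simp: indicator_def)
      qed
      then show ?thesis by (rule tendsto_eventually)
    qed
  qed (use u in \<open>auto simp: indicator_def\<close>)
  have "approximable D (\<lambda>x. 1 * max (g x) 0 + (-1) * max (- g x) 0)"
    using L2_meas[OF g]
    by (intro lin nonneg' L2_bound[OF g]) auto
  moreover have "(\<lambda>x. 1 * max (g x) 0 + (-1) * max (- g x) 0) = g" by auto
  ultimately show ?thesis by simp
qed

section \<open>Gaussian integration by parts for step functions\<close>

text \<open>Continuity of functions of a sequence refers to the product topology, so convergence of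
  every coordinate is what the limit passage in \<open>stein_L2\<close> has to supply.\<close>

lemma tendsto_fun_componentwise:
  fixes f :: "'a \<Rightarrow> 'i \<Rightarrow> real"
  assumes "\<And>i. ((\<lambda>x. f x i) \<longlongrightarrow> l i) F"
  shows "(f \<longlongrightarrow> l) F"
proof -
  have "limitin (product_topology (\<lambda>_. euclidean) UNIV) f l F"
    unfolding limitin_componentwise using assms by simp
  then show ?thesis unfolding euclidean_product_topology by simp
qed

text \<open>Comparing \<open>exp y\<close> with \<open>1 + y\<close> yields a rational majorant,
  from which the limits at both ends can be read off.\<close>

lemma normal_density_bound:
  assumes "\<sigma> > 0"
  shows "normal_density 0 \<sigma> x \<le> 1 / sqrt (2 * pi * \<sigma>\<^sup>2) * inverse (1 + x\<^sup>2 / (2 * \<sigma>\<^sup>2))"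
proof -
  let ?y = "x\<^sup>2 / (2 * \<sigma>\<^sup>2)"
  have y: "?y \<ge> 0" by simp
  have "1 + ?y \<le> exp ?y" by (rule exp_ge_add_one_self)
  then have "inverse (exp ?y) \<le> inverse (1 + ?y)" by (rule le_imp_inverse_le) (use y in linarith)
  then have "exp (- ?y) \<le> inverse (1 + ?y)" by (simp add: exp_minus)
  then have "1 / sqrt (2 * pi * \<sigma>\<^sup>2) * exp (- ?y) \<le> 1 / sqrt (2 * pi * \<sigma>\<^sup>2) * inverse (1 + ?y)"
    by (intro mult_left_mono) auto
  then show ?thesis unfolding normal_density_def by simp
qed

lemma normal_density_tendsto_0:
  assumes s: "\<sigma> > 0"
  shows "(normal_density 0 \<sigma> \<longlongrightarrow> 0) at_top" "(normal_density 0 \<sigma> \<longlongrightarrow> 0) at_bot"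
proof -
  have "LIM x at_top. 1 + x\<^sup>2 / (2 * \<sigma>\<^sup>2) :> at_top"
  proof (rule filterlim_tendsto_add_at_top[OF tendsto_const])
    have "LIM x at_top. (1 / (2 * \<sigma>\<^sup>2)) * x\<^sup>2 :> at_top"
      by (rule filterlim_tendsto_pos_mult_at_top[OF tendsto_const])
        (use s in \<open>auto intro!: filterlim_pow_at_top filterlim_ident\<close>)
    then show "LIM x at_top. x\<^sup>2 / (2 * \<sigma>\<^sup>2) :> at_top" by simp
  qed
  then have "((\<lambda>x. inverse (1 + x\<^sup>2 / (2 * \<sigma>\<^sup>2))) \<longlongrightarrow> 0) at_top"
    by (rule tendsto_inverse_0_at_top)
  then have l: "((\<lambda>x. 1 / sqrt (2 * pi * \<sigma>\<^sup>2) * inverse (1 + x\<^sup>2 / (2 * \<sigma>\<^sup>2))) \<longlongrightarrow> 0) at_top"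
    using tendsto_mult_right_zero by blast
  show top: "(normal_density 0 \<sigma> \<longlongrightarrow> 0) at_top"
  proof (rule Lim_null_comparison[OF always_eventually[OF allI] l])
    fix x
    have "0 \<le> normal_density 0 \<sigma> x" by (rule normal_density_nonneg)
    then show "norm (normal_density 0 \<sigma> x) \<le> 1 / sqrt (2 * pi * \<sigma>\<^sup>2) * inverse (1 + x\<^sup>2 / (2 * \<sigma>\<^sup>2))"
      using normal_density_bound[OF s, of x] by (simp only: real_norm_def abs_of_nonneg)
  qed
  have "(\<lambda>x. normal_density 0 \<sigma> (- x)) = normal_density 0 \<sigma>" by (auto simp: normal_density_def)
  then show "(normal_density 0 \<sigma> \<longlongrightarrow> 0) at_bot" using top by (simp add: filterlim_at_bot_mirror)
qed

text \<open>The density \<open>p\<close> satisfies \<open>p' = - (x / \<sigma>\<^sup>2) * p\<close>,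
  so the integrand is the derivative of \<open>- \<sigma>\<^sup>2 * g * p\<close>. The latter
  vanishes at both ends because \<open>g\<close> is bounded.\<close>

lemma normal_stein:
  fixes g :: "real \<Rightarrow> real"
  assumes s: "\<sigma> > 0" and g: "\<And>x. (g has_real_derivative g' x) (at x)" "continuous_on UNIV g'"
    and bd: "\<And>x. \<bar>g x\<bar> \<le> C" "\<And>x. \<bar>g' x\<bar> \<le> C"
  shows "integrable lborel (\<lambda>x. normal_density 0 \<sigma> x * (g x * x - \<sigma>\<^sup>2 * g' x))"
    "(\<integral>x. normal_density 0 \<sigma> x * (g x * x - \<sigma>\<^sup>2 * g' x) \<partial>lborel) = 0"
proof -
  let ?p = "normal_density 0 \<sigma>"
  let ?F = "\<lambda>x. - \<sigma>\<^sup>2 * (g x * ?p x)"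
  let ?f = "\<lambda>x. ?p x * (g x * x - \<sigma>\<^sup>2 * g' x)"
  have gc: "continuous_on UNIV g" using g(1) by (meson DERIV_isCont continuous_at_imp_continuous_on)
  have [measurable]: "g \<in> borel_measurable borel" "g' \<in> borel_measurable borel"
    using gc g(2) by (auto intro: borel_measurable_continuous_onI)
  have C: "C \<ge> 0" using bd(1)[of 0] by simp
  have dp: "(?p has_real_derivative - (x / \<sigma>\<^sup>2) * ?p x) (at x)" for x
  proof -
    have "((\<lambda>x. - (x - 0)\<^sup>2 / (2 * \<sigma>\<^sup>2)) has_real_derivative - (x / \<sigma>\<^sup>2)) (at x)"
      using s by (auto intro!: derivative_eq_intros simp: field_simps power2_eq_square)
    then have "((\<lambda>x. exp (- (x - 0)\<^sup>2 / (2 * \<sigma>\<^sup>2))) has_real_derivative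
        exp (- (x - 0)\<^sup>2 / (2 * \<sigma>\<^sup>2)) * (- (x / \<sigma>\<^sup>2))) (at x)"
      by (rule DERIV_chain2[OF DERIV_exp])
    from DERIV_cmult[OF this, of "1 / sqrt (2 * pi * \<sigma>\<^sup>2)"] show ?thesis
      unfolding normal_density_def by (simp add: mult_ac)
  qed
  have dF: "(?F has_real_derivative ?f x) (at x)" for x
  proof -
    have "(?F has_real_derivative - \<sigma>\<^sup>2 * (g' x * ?p x + (- (x / \<sigma>\<^sup>2) * ?p x) * g x)) (at x)"
      by (rule DERIV_cmult[OF DERIV_mult[OF g(1) dp]])
    moreover have "- \<sigma>\<^sup>2 * (g' x * ?p x + (- (x / \<sigma>\<^sup>2) * ?p x) * g x) = ?f x"
      using s by (simp add: field_simps)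
    ultimately show ?thesis by simp
  qed
  show int: "integrable lborel ?f"
  \<comment> \<open>The powers \<open>(x - 0) ^ 1\<close> and \<open>(x - 0) ^ 0\<close> are written
    out to match the general moments of the normal density.\<close>
  proof (rule Bochner_Integration.integrable_bound[of lborel "\<lambda>x. C * \<bar>?p x * (x - 0) ^ 1\<bar> + \<sigma>\<^sup>2 * C * (?p x * (x - 0) ^ 0)"])
    show "integrable lborel (\<lambda>x. C * \<bar>?p x * (x - 0) ^ 1\<bar> + \<sigma>\<^sup>2 * C * (?p x * (x - 0) ^ 0))"
      by (intro Bochner_Integration.integrable_add integrable_mult_right integrable_abs integrable_normal_moment s)
    show "AE x in lborel. norm (?f x) \<le> norm (C * \<bar>?p x * (x - 0) ^ 1\<bar> + \<sigma>\<^sup>2 * C * (?p x * (x - 0) ^ 0))"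
    proof (intro AE_I2)
      fix x
      have p: "?p x \<ge> 0" by (rule normal_density_nonneg)
      have "\<bar>g x * x - \<sigma>\<^sup>2 * g' x\<bar> \<le> \<bar>g x\<bar> * \<bar>x\<bar> + \<sigma>\<^sup>2 * \<bar>g' x\<bar>"
        using abs_triangle_ineq4[of "g x * x" "\<sigma>\<^sup>2 * g' x"] by (simp add: abs_mult)
      also have "\<dots> \<le> C * \<bar>x\<bar> + \<sigma>\<^sup>2 * C"
        using bd[of x] by (intro add_mono mult_right_mono mult_left_mono) auto
      finally have "?p x * \<bar>g x * x - \<sigma>\<^sup>2 * g' x\<bar> \<le> ?p x * (C * \<bar>x\<bar> + \<sigma>\<^sup>2 * C)"
        using p by (rule mult_left_mono)
      also have "\<dots> = C * \<bar>?p x * (x - 0) ^ 1\<bar> + \<sigma>\<^sup>2 * C * (?p x * (x - 0) ^ 0)"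
        using p by (simp add: abs_mult algebra_simps)
      also have "?p x * \<bar>g x * x - \<sigma>\<^sup>2 * g' x\<bar> = norm (?f x)"
        by (simp only: real_norm_def abs_mult abs_of_nonneg[OF p])
      finally show "norm (?f x) \<le> norm (C * \<bar>?p x * (x - 0) ^ 1\<bar> + \<sigma>\<^sup>2 * C * (?p x * (x - 0) ^ 0))"
        unfolding real_norm_def by linarith
    qed
  qed measurable
  have lim: "(?F \<longlongrightarrow> 0) F" if "(?p \<longlongrightarrow> 0) F" for F
  proof (rule Lim_null_comparison[OF always_eventually[OF allI]])
    fix x
    have "\<bar>g x\<bar> * ?p x \<le> C * ?p x" using bd(1) by (intro mult_right_mono) auto
    then have "\<sigma>\<^sup>2 * (\<bar>g x\<bar> * ?p x) \<le> \<sigma>\<^sup>2 * (C * ?p x)" by (intro mult_left_mono) auto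
    then show "norm (?F x) \<le> \<sigma>\<^sup>2 * (C * ?p x)" by (simp add: abs_mult)
    show "((\<lambda>x. \<sigma>\<^sup>2 * (C * ?p x)) \<longlongrightarrow> 0) F"
      using tendsto_mult_left[OF tendsto_mult_left[OF that, of C], of "\<sigma>\<^sup>2"] by simp
  qed
  have "(LBINT x=-\<infinity>..\<infinity>. ?f x) = 0 - 0"
  proof (rule interval_integral_FTC_integrable)
    show "(?F has_vector_derivative ?f x) (at x)" for x
      using dF by (simp add: has_real_derivative_iff_has_vector_derivative)
    show "isCont ?f x" for x
    proof -
      have "isCont ?p x" using dp by (rule DERIV_isCont)
      moreover have "isCont g x" "isCont g' x" using gc g(2) by (simp_all add: continuous_on_eq_continuous_at)
      ultimately show ?thesis by (intro continuous_intros)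
    qed
    show "set_integrable lborel (einterval (-\<infinity>) \<infinity>) ?f"
      using int by (simp add: set_integrable_def)
    show "((?F \<circ> real_of_ereal) \<longlongrightarrow> 0) (at_right (-\<infinity>))" "((?F \<circ> real_of_ereal) \<longlongrightarrow> 0) (at_left \<infinity>)"
      unfolding ereal_tendsto_simps1 by (intro lim normal_density_tendsto_0 s)+
  qed simp
  then show "(\<integral>x. ?f x \<partial>lborel) = 0"
    by (simp add: interval_lebesgue_integral_def set_lebesgue_integral_def)
qed

text \<open>By independence the law of the vector is a product measure. Fubini integrates coordinate
  \<open>l\<close> first; with the other coordinates frozen, the one-dimensional identity makes the
  inner integral vanish.\<close>

lemma (in prob_space) independent_normal_stein:
  fixes D :: "nat \<Rightarrow> 'a \<Rightarrow> real" and N :: nat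
  assumes ind: "indep_vars (\<lambda>_. borel) D {..<N}" and [measurable]: "\<And>i. D i \<in> borel_measurable M"
    and dist: "\<And>i. i < N \<Longrightarrow> distributed M lborel (D i) (normal_density 0 (\<sigma> i))"
    and sig: "\<And>i. i < N \<Longrightarrow> \<sigma> i > 0" and l: "l < N"
    and Phi: "\<Phi> \<in> borel_measurable (Pi\<^sub>M {..<N} (\<lambda>_. borel))" "\<Phi>' \<in> borel_measurable (Pi\<^sub>M {..<N} (\<lambda>_. borel))"
    and der: "\<And>x t. ((\<lambda>t. \<Phi> (x(l := t))) has_real_derivative \<Phi>' (x(l := t))) (at t)"
    and cont: "\<And>x. continuous_on UNIV (\<lambda>t. \<Phi>' (x(l := t)))"
    and bd: "\<And>x. \<exists>C. \<forall>t. \<bar>\<Phi> (x(l := t))\<bar> \<le> C \<and> \<bar>\<Phi>' (x(l := t))\<bar> \<le> C"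
    and int: "integrable M (\<lambda>\<omega>. \<Phi> (\<lambda>i\<in>{..<N}. D i \<omega>) * D l \<omega>)" "integrable M (\<lambda>\<omega>. \<Phi>' (\<lambda>i\<in>{..<N}. D i \<omega>))"
  shows "expectation (\<lambda>\<omega>. \<Phi> (\<lambda>i\<in>{..<N}. D i \<omega>) * D l \<omega>) = (\<sigma> l)\<^sup>2 * expectation (\<lambda>\<omega>. \<Phi>' (\<lambda>i\<in>{..<N}. D i \<omega>))"
proof -
  define Q where "Q i = distr M borel (D i)" for i
  interpret Q: product_prob_space Q "{..<N}"
    unfolding Q_def by (intro product_prob_spaceI prob_space_distr) measurable
  let ?P = "Pi\<^sub>M {..<N} Q" and ?X = "\<lambda>\<omega>. \<lambda>i\<in>{..<N}. D i \<omega>"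
  have sP: "sets ?P = sets (Pi\<^sub>M {..<N} (\<lambda>_. borel))"
    by (intro sets_PiM_cong) (auto simp: Q_def)
  have dP: "distr M (Pi\<^sub>M {..<N} (\<lambda>_. borel)) ?X = ?P"
    using ind l unfolding Q_def by (subst (asm) indep_vars_iff_distr_eq_PiM) auto
  have [measurable]: "?X \<in> measurable M (Pi\<^sub>M {..<N} (\<lambda>_. borel))" by measurable
  define h where "h x = \<Phi> x * x l - (\<sigma> l)\<^sup>2 * \<Phi>' x" for x
  have comp: "(\<lambda>x. x l) \<in> borel_measurable (Pi\<^sub>M {..<N} (\<lambda>_. borel :: real measure))"
    by (rule measurable_component_singleton) (use l in simp)
  have hm: "h \<in> borel_measurable (Pi\<^sub>M {..<N} (\<lambda>_. borel))" unfolding h_def using Phi comp by measurable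
  have hX: "h (?X \<omega>) = \<Phi> (?X \<omega>) * D l \<omega> - (\<sigma> l)\<^sup>2 * \<Phi>' (?X \<omega>)" for \<omega> unfolding h_def using l by simp
  have hint: "integrable M (\<lambda>\<omega>. h (?X \<omega>))" unfolding hX using int by simp
  have hP: "integrable ?P h"
    using hint hm unfolding dP[symmetric] by (subst integrable_distr_eq) auto
  have ins: "{..<N} = insert l ({..<N} - {l})" using l by auto
  have hP': "integrable (Pi\<^sub>M (insert l ({..<N} - {l})) Q) h" using hP by (simp only: ins[symmetric])
  have "expectation (\<lambda>\<omega>. h (?X \<omega>)) = integral\<^sup>L ?P h"
    unfolding dP[symmetric] using hm by (subst integral_distr) auto
  also have "\<dots> = integral\<^sup>L (Pi\<^sub>M (insert l ({..<N} - {l})) Q) h" using ins by simp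
  also have "\<dots> = (\<integral>x. (\<integral>y. h (x(l := y)) \<partial>Q l) \<partial>Pi\<^sub>M ({..<N} - {l}) Q)"
    by (rule Q.product_integral_insert[OF _ _ hP']) simp_all
  also have "(\<lambda>x. \<integral>y. h (x(l := y)) \<partial>Q l) = (\<lambda>x. 0)"
  proof
    fix x
    obtain C where C: "\<And>t. \<bar>\<Phi> (x(l := t))\<bar> \<le> C" "\<And>t. \<bar>\<Phi>' (x(l := t))\<bar> \<le> C" using bd[of x] by blast
    have "isCont (\<lambda>t. \<Phi> (x(l := t))) t" for t using der[of x t] by (rule DERIV_isCont)
    then have "continuous_on UNIV (\<lambda>t. \<Phi> (x(l := t)))" by (simp add: continuous_at_imp_continuous_on)
    then have [measurable]: "(\<lambda>t. \<Phi> (x(l := t))) \<in> borel_measurable borel" "(\<lambda>t. \<Phi>' (x(l := t))) \<in> borel_measurable borel"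
      using cont[of x] by (simp_all add: borel_measurable_continuous_onI)
    have hh: "h (x(l := y)) = \<Phi> (x(l := y)) * y - (\<sigma> l)\<^sup>2 * \<Phi>' (x(l := y))" for y unfolding h_def by simp
    have "(\<integral>y. h (x(l := y)) \<partial>Q l) = expectation (\<lambda>\<omega>. h (x(l := D l \<omega>)))"
      unfolding Q_def hh by (intro integral_distr) measurable
    also have "\<dots> = (\<integral>y. normal_density 0 (\<sigma> l) y * h (x(l := y)) \<partial>lborel)"
      unfolding hh by (rule distributed_integral[OF dist[OF l], symmetric]) auto
    also have "\<dots> = 0"
      unfolding hh by (rule normal_stein(2)[OF sig[OF l] der cont C])
    finally show "(\<integral>y. h (x(l := y)) \<partial>Q l) = 0" .
  qed
  also have "(\<integral>x. (\<lambda>x. 0) x \<partial>Pi\<^sub>M ({..<N} - {l}) Q) = (0 :: real)" by simp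
  finally have "expectation (\<lambda>\<omega>. h (?X \<omega>)) = 0" .
  then show ?thesis unfolding hX using int by simp
qed

text \<open>
  A function that is constant between consecutive points of \<open>T\<close> and zero outside; the set \<open>{\<tau> \<in> T. \<tau> < x}\<close>
  identifies the interval containing \<open>x\<close>.
\<close>

definition step_on :: "real set \<Rightarrow> (real \<Rightarrow> real) \<Rightarrow> bool" where
  "step_on T h \<longleftrightarrow>
     (\<forall>x. {\<tau>\<in>T. \<tau> < x} = {} \<or> {\<tau>\<in>T. \<tau> < x} = T \<longrightarrow> h x = 0) \<and>
     (\<forall>x y. {\<tau>\<in>T. \<tau> < x} = {\<tau>\<in>T. \<tau> < y} \<longrightarrow> h x = h y)"

lemma step_on_mono: assumes "step_on T h" "T \<subseteq> T'" shows "step_on T' h"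
proof -
  have *: "{\<tau>\<in>T. \<tau> < x} = {\<tau>\<in>T'. \<tau> < x} \<inter> T" for x using assms(2) by auto
  show ?thesis unfolding step_on_def
  proof (intro conjI allI impI)
    fix x assume "{\<tau>\<in>T'. \<tau> < x} = {} \<or> {\<tau>\<in>T'. \<tau> < x} = T'"
    then have "{\<tau>\<in>T. \<tau> < x} = {} \<or> {\<tau>\<in>T. \<tau> < x} = T" unfolding * using assms(2) by auto
    then show "h x = 0" using assms(1) unfolding step_on_def by blast
  next
    fix x y assume "{\<tau>\<in>T'. \<tau> < x} = {\<tau>\<in>T'. \<tau> < y}"
    then have "{\<tau>\<in>T. \<tau> < x} = {\<tau>\<in>T. \<tau> < y}" unfolding * by simp
    then show "h x = h y" using assms(1) unfolding step_on_def by blast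
  qed
qed

lemma step_on_lin:
  assumes "step_on T f" "step_on T g" shows "step_on T (\<lambda>x. a * f x + b * g x)"
  unfolding step_on_def
proof (intro conjI allI impI)
  fix x assume "{\<tau>\<in>T. \<tau> < x} = {} \<or> {\<tau>\<in>T. \<tau> < x} = T"
  then have "f x = 0" "g x = 0" using assms unfolding step_on_def by blast+
  then show "a * f x + b * g x = 0" by simp
next
  fix x y assume "{\<tau>\<in>T. \<tau> < x} = {\<tau>\<in>T. \<tau> < y}"
  then have "f x = f y" "g x = g y" using assms unfolding step_on_def by blast+
  then show "a * f x + b * g x = a * f y + b * g y" by simp
qed

lemma step_on_Ioc: "s \<le> t \<Longrightarrow> step_on {s, t} (indicator {s<..t})"
  unfolding step_on_def
proof (intro conjI allI impI)
  fix x assume "s \<le> t" and *: "{\<tau>\<in>{s, t}. \<tau> < x} = {} \<or> {\<tau>\<in>{s, t}. \<tau> < x} = {s, t}"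
  then have "\<not> (s < x) \<or> t < x" by blast
  then show "(indicator {s<..t} x :: real) = 0" by (auto simp: indicator_def)
next
  fix x y assume "{\<tau>\<in>{s, t}. \<tau> < x} = {\<tau>\<in>{s, t}. \<tau> < y}"
  then have "s < x \<longleftrightarrow> s < y" "t < x \<longleftrightarrow> t < y" by blast+
  then show "(indicator {s<..t} x :: real) = indicator {s<..t} y" by (auto simp: indicator_def)
qed

text \<open>If \<open>t (j - 1) < x \<le> t j\<close> for consecutive points of \<open>T\<close>,
  then the same points of \<open>T\<close> lie below \<open>x\<close> and below \<open>t j\<close>,
  so \<open>h x = h (t j)\<close>. The partition depends on \<open>T\<close> only and serves all
  \<open>h\<close> at once.\<close>

lemma step_on_representation:
  assumes "finite T"
  shows "\<exists>N t. (\<forall>l<N. t l < t (Suc l)) \<and>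
    (\<forall>h x. step_on T h \<longrightarrow> h x = (\<Sum>l<N. h (t (Suc l)) * indicator {t l<..t (Suc l)} x))"
proof -
  define L where "L = sorted_list_of_set T"
  define n where "n = length L"
  \<comment> \<open>Truncated subtraction: \<open>N = 0\<close> when \<open>T\<close> is empty or a
    single point, and in these cases \<open>step_on\<close> forces \<open>h\<close> to
    vanish.\<close>
  define N where "N = n - 1"
  define t where "t l = L ! l" for l
  have setL: "set L = T" unfolding L_def using assms by simp
  have mono: "i < j \<Longrightarrow> j < n \<Longrightarrow> t i < t j" for i j
    unfolding t_def L_def n_def using strict_sorted_list_of_set[of T] by (simp add: sorted_wrt_nth_less)
  have T: "T = t ` {..<n}" unfolding t_def n_def setL[symmetric] by (auto simp: in_set_conv_nth)
  show ?thesis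
  proof (rule exI[of _ N], rule exI[of _ t], intro conjI allI impI)
    show "t l < t (Suc l)" if "l < N" for l using mono that unfolding N_def by auto
    fix h :: "real \<Rightarrow> real" and x assume h: "step_on T h"
    \<comment> \<open>\<open>j\<close> is the number of points below \<open>x\<close>. The guard
      \<open>i < n\<close> ensures that a least element exists, with \<open>j = n\<close> when
      \<open>x\<close> lies beyond all points.\<close>
    define j where "j = (LEAST i. \<not> (i < n \<and> t i < x))"
    have jP: "\<not> (j < n \<and> t j < x)" unfolding j_def by (rule LeastI[of _ n]) simp
    have less: "i < n \<and> t i < x" if "i < j" for i using that unfolding j_def using not_less_Least by blast
    have ge: "\<not> (t i < x)" if "j \<le> i" "i < n" for i
      using jP mono[of j i] that by (cases "j = i") auto
    have jn: "j \<le> n" unfolding j_def by (rule Least_le) simp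
    have S: "{\<tau>\<in>T. \<tau> < x} = t ` {..<j}"
    proof (intro set_eqI iffI)
      fix \<tau> assume "\<tau> \<in> {\<tau>\<in>T. \<tau> < x}"
      then obtain i where "i < n" "\<tau> = t i" "t i < x" unfolding T by auto
      then show "\<tau> \<in> t ` {..<j}" using ge[of i] by (cases "i < j") auto
    qed (use less T in auto)
    show "h x = (\<Sum>l<N. h (t (Suc l)) * indicator {t l<..t (Suc l)} x)"
    proof (cases "j = 0 \<or> j = n")
      case True
      then have "t ` {..<j} = {} \<or> t ` {..<j} = T" unfolding T by auto
      then have "h x = 0" using h unfolding step_on_def S[symmetric] by blast
      moreover have "(\<Sum>l<N. h (t (Suc l)) * indicator {t l<..t (Suc l)} x) = 0"
      proof (rule sum.neutral, intro ballI)
        fix l assume "l \<in> {..<N}"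
        then have "Suc l < n" unfolding N_def by auto
        then have "\<not> (t l < x \<and> x \<le> t (Suc l))" using True less[of "Suc l"] ge[of l] by auto
        then show "h (t (Suc l)) * indicator {t l<..t (Suc l)} x = 0" by (auto simp: indicator_def)
      qed
      ultimately show ?thesis by simp
    next
      case False
      then have j: "0 < j" "j < n" using jn by auto
      have "t (j - 1) < x" using less[of "j - 1"] j by simp
      have "x \<le> t j" using jP j by simp
      have "{\<tau>\<in>T. \<tau> < t j} = t ` {..<j}"
      proof (intro set_eqI iffI)
        fix \<tau> assume "\<tau> \<in> {\<tau>\<in>T. \<tau> < t j}"
        then obtain i where "i < n" "\<tau> = t i" "t i < t j" unfolding T by auto
        then have "i < j" using mono[of j i] by (cases "i < j"; cases "i = j") auto
        then show "\<tau> \<in> t ` {..<j}" using \<open>\<tau> = t i\<close> by auto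
      next
        fix \<tau> assume "\<tau> \<in> t ` {..<j}"
        then obtain i where "i < j" "\<tau> = t i" by auto
        then show "\<tau> \<in> {\<tau>\<in>T. \<tau> < t j}" using mono[of i j] j unfolding T by auto
      qed
      then have "{\<tau>\<in>T. \<tau> < x} = {\<tau>\<in>T. \<tau> < t j}" using S by simp
      then have hx: "h x = h (t j)" using h unfolding step_on_def by blast
      have "(\<Sum>l<N. h (t (Suc l)) * indicator {t l<..t (Suc l)} x)
         = (\<Sum>l<N. if l = j - 1 then h (t j) else 0)"
      proof (intro sum.cong refl)
        fix l assume "l \<in> {..<N}"
        then have l: "Suc l < n" unfolding N_def by auto
        show "h (t (Suc l)) * indicator {t l<..t (Suc l)} x = (if l = j - 1 then h (t j) else 0)"
        proof (cases "l = j - 1")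
          case True
          then show ?thesis using j \<open>t (j - 1) < x\<close> \<open>x \<le> t j\<close> by simp
        next
          case False
          then have "Suc l < j \<or> j \<le> l" using j by auto
          then have "\<not> (t l < x \<and> x \<le> t (Suc l))" using less[of "Suc l"] ge[of l] l by auto
          then show ?thesis using False by (auto simp: indicator_def)
        qed
      qed
      also have "\<dots> = h (t j)" using j unfolding N_def by simp
      finally show ?thesis using hx by simp
    qed
  qed
qed

section \<open>Convergence in mean square\<close>

definition L2_tendsto :: "'b measure \<Rightarrow> (nat \<Rightarrow> 'b \<Rightarrow> real) \<Rightarrow> ('b \<Rightarrow> real) \<Rightarrow> bool" where
  "L2_tendsto N F f \<longleftrightarrow> (\<forall>j. F j \<in> L2 N) \<and> f \<in> L2 N \<and>
     (\<lambda>j. ip N (\<lambda>x. F j x - f x) (\<lambda>x. F j x - f x)) \<longlonglongrightarrow> 0"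

lemma ip_tendsto_0:
  assumes "\<And>j. u j \<in> L2 N" "\<And>j. v j \<in> L2 N"
    and "(\<lambda>j. ip N (u j) (u j)) \<longlonglongrightarrow> 0" "(\<lambda>j. ip N (v j) (v j)) \<longlonglongrightarrow> c"
  shows "(\<lambda>j. ip N (u j) (v j)) \<longlonglongrightarrow> 0"
proof (rule Lim_null_comparison[OF always_eventually[OF allI]])
  show "norm (ip N (u j) (v j)) \<le> sqrt (ip N (u j) (u j)) * sqrt (ip N (v j) (v j))" for j
    using ip_abs_le[OF assms(1,2)] by simp
  have "(\<lambda>j. sqrt (ip N (u j) (u j)) * sqrt (ip N (v j) (v j))) \<longlonglongrightarrow> sqrt 0 * sqrt c"
    by (intro tendsto_mult tendsto_real_sqrt assms)
  then show "(\<lambda>j. sqrt (ip N (u j) (u j)) * sqrt (ip N (v j) (v j))) \<longlonglongrightarrow> 0" by simp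
qed

lemma ip_tendsto:
  assumes "L2_tendsto N F f" "L2_tendsto N G g"
  shows "(\<lambda>j. ip N (F j) (G j)) \<longlonglongrightarrow> ip N f g"
proof -
  have F: "\<And>j. F j \<in> L2 N" "f \<in> L2 N" "(\<lambda>j. ip N (\<lambda>x. F j x - f x) (\<lambda>x. F j x - f x)) \<longlonglongrightarrow> 0"
    and G: "\<And>j. G j \<in> L2 N" "g \<in> L2 N" "(\<lambda>j. ip N (\<lambda>x. G j x - g x) (\<lambda>x. G j x - g x)) \<longlonglongrightarrow> 0"
    using assms unfolding L2_tendsto_def by auto
  note dF = L2_diff[OF F(1,2)] and dG = L2_diff[OF G(1,2)]
  have "(\<lambda>j. ip N (\<lambda>x. F j x - f x) (\<lambda>x. G j x - g x) + ip N (\<lambda>x. F j x - f x) g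
       + ip N (\<lambda>x. G j x - g x) f + ip N f g) \<longlonglongrightarrow> 0 + 0 + 0 + ip N f g"
    by (intro tendsto_add tendsto_const ip_tendsto_0[OF dF dG F(3) G(3)]
        ip_tendsto_0[OF dF G(2) F(3) tendsto_const] ip_tendsto_0[OF dG F(2) G(3) tendsto_const])
  moreover have "ip N (\<lambda>x. F j x - f x) (\<lambda>x. G j x - g x) + ip N (\<lambda>x. F j x - f x) g
       + ip N (\<lambda>x. G j x - g x) f + ip N f g = ip N (F j) (G j)" for j
    using F G dG by (simp add: ip_diff_left ip_diff_right ip_commute)
  ultimately show ?thesis by simp
qed

lemma step_on_mult: "step_on T f \<Longrightarrow> step_on T g \<Longrightarrow> step_on T (\<lambda>x. f x * g x)"
  unfolding step_on_def
proof (intro conjI allI impI)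
  assume *: "(\<forall>x. {\<tau> \<in> T. \<tau> < x} = {} \<or> {\<tau> \<in> T. \<tau> < x} = T \<longrightarrow> f x = 0) \<and>
    (\<forall>x y. {\<tau> \<in> T. \<tau> < x} = {\<tau> \<in> T. \<tau> < y} \<longrightarrow> f x = f y)"
   "(\<forall>x. {\<tau> \<in> T. \<tau> < x} = {} \<or> {\<tau> \<in> T. \<tau> < x} = T \<longrightarrow> g x = 0) \<and>
    (\<forall>x y. {\<tau> \<in> T. \<tau> < x} = {\<tau> \<in> T. \<tau> < y} \<longrightarrow> g x = g y)"
  show "f x * g x = 0" if "{\<tau>\<in>T. \<tau> < x} = {} \<or> {\<tau>\<in>T. \<tau> < x} = T" for x
  proof -
    have "f x = 0" using *(1) that by blast
    then show ?thesis by simp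
  qed
  show "f x * g x = f y * g y" if "{\<tau>\<in>T. \<tau> < x} = {\<tau>\<in>T. \<tau> < y}" for x y
  proof -
    have "f x = f y" "g x = g y" using * that by blast+
    then show ?thesis by simp
  qed
qed

lemma Ioc_L2: "(indicator {s<..t} :: real \<Rightarrow> real) \<in> L2 lborel"
  by (rule indicator_L2) (cases "s \<le> t"; simp)+

lemma step_on_L2:
  assumes "finite T" "step_on T h" shows "h \<in> L2 lborel"
proof -
  obtain N t where rep: "\<forall>h x. step_on T h \<longrightarrow> h x = (\<Sum>l<N. h (t (Suc l)) * indicator {t l<..t (Suc l)} x)"
    using step_on_representation[OF assms(1)] by (elim exE conjE)
  have "h = (\<lambda>x. \<Sum>l<N. h (t (Suc l)) * indicator {t l<..t (Suc l)} x)"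
    by (rule ext) (rule rep[rule_format, OF assms(2)])
  also have "(\<lambda>x. \<Sum>l<N. h (t (Suc l)) * indicator {t l<..t (Suc l)} x) \<in> L2 lborel"
    by (intro L2_sum L2_scale Ioc_L2)
  finally show ?thesis .
qed

section \<open>Wiener integrals\<close>

locale wiener = prob_space M for M :: "'a measure" +
  fixes W :: "real \<Rightarrow> 'a \<Rightarrow> real" and I :: "(real \<Rightarrow> real) \<Rightarrow> 'a \<Rightarrow> real"
  assumes bm: "two_sided_brownian_motion M W" and wi: "is_wiener_integral M W I"
begin

lemma W_meas [measurable]: "W t \<in> borel_measurable M"
  using bm unfolding two_sided_brownian_motion_def by blast

lemma I_L2: "f \<in> L2 lborel \<Longrightarrow> I f \<in> L2 M"
  using wi unfolding is_wiener_integral_def bounded_linear_L2_def by blast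

lemma I_lin: "f \<in> L2 lborel \<Longrightarrow> g \<in> L2 lborel \<Longrightarrow> AE \<omega> in M. I (\<lambda>x. a * f x + b * g x) \<omega> = a * I f \<omega> + b * I g \<omega>"
  using wi unfolding is_wiener_integral_def bounded_linear_L2_def by blast

lemma I_Ioc: "s \<le> t \<Longrightarrow> AE \<omega> in M. I (indicator {s<..t}) \<omega> = W t \<omega> - W s \<omega>"
  using wi unfolding is_wiener_integral_def by blast

lemma I_bounded: obtains K where "K \<ge> 0" "\<And>f. f \<in> L2 lborel \<Longrightarrow> ip M (I f) (I f) \<le> K * ip lborel f f"
proof -
  obtain K where K: "\<And>f. f \<in> L2 lborel \<Longrightarrow> sqrt (\<integral>\<omega>. (I f \<omega>)\<^sup>2 \<partial>M) \<le> K * sqrt (\<integral>x. (f x)\<^sup>2 \<partial>lborel)"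
    using wi unfolding is_wiener_integral_def bounded_linear_L2_def by blast
  show ?thesis
  proof (rule that[of "K\<^sup>2"])
    fix f :: "real \<Rightarrow> real" assume f: "f \<in> L2 lborel"
    have "(sqrt (ip M (I f) (I f)))\<^sup>2 \<le> (K * sqrt (ip lborel f f))\<^sup>2"
      using K[OF f] by (intro power_mono) (auto simp: ip_self)
    then show "ip M (I f) (I f) \<le> K\<^sup>2 * ip lborel f f"
      by (simp add: power_mult_distrib ip_self_nonneg)
  qed simp
qed

lemma I_diff: "f \<in> L2 lborel \<Longrightarrow> g \<in> L2 lborel \<Longrightarrow> AE \<omega> in M. I (\<lambda>x. f x - g x) \<omega> = I f \<omega> - I g \<omega>"
  using I_lin[of f g 1 "-1"] by simp

lemma I_scale: "f \<in> L2 lborel \<Longrightarrow> AE \<omega> in M. I (\<lambda>x. a * f x) \<omega> = a * I f \<omega>"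
  using I_lin[of f f a 0] by simp

lemma I_sum:
  assumes "finite A" "\<And>l. l \<in> A \<Longrightarrow> f l \<in> L2 lborel"
  shows "AE \<omega> in M. I (\<lambda>x. \<Sum>l\<in>A. c l * f l x) \<omega> = (\<Sum>l\<in>A. c l * I (f l) \<omega>)"
  using assms
proof (induction A rule: finite_induct)
  case empty
  then show ?case using I_lin[OF L2_zero L2_zero, of 0 0] by simp
next
  case (insert a A)
  have "(\<lambda>x. \<Sum>l\<in>A. c l * f l x) \<in> L2 lborel" using insert by (intro L2_sum L2_scale) auto
  then have "AE \<omega> in M. I (\<lambda>x. c a * f a x + 1 * (\<Sum>l\<in>A. c l * f l x)) \<omega>
      = c a * I (f a) \<omega> + 1 * I (\<lambda>x. \<Sum>l\<in>A. c l * f l x) \<omega>"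
    using insert by (intro I_lin) auto
  then have 1: "AE \<omega> in M. I (\<lambda>x. \<Sum>l\<in>insert a A. c l * f l x) \<omega>
      = c a * I (f a) \<omega> + I (\<lambda>x. \<Sum>l\<in>A. c l * f l x) \<omega>"
    using insert by simp
  have "AE \<omega> in M. I (\<lambda>x. \<Sum>l\<in>A. c l * f l x) \<omega> = (\<Sum>l\<in>A. c l * I (f l) \<omega>)"
    using insert by auto
  with 1 show ?case by eventually_elim (use insert(1,2) in simp)
qed

lemma I_tendsto: assumes "L2_tendsto lborel F f" shows "L2_tendsto M (\<lambda>j. I (F j)) (I f)"
proof -
  have F: "\<And>j. F j \<in> L2 lborel" "f \<in> L2 lborel" "(\<lambda>j. ip lborel (\<lambda>x. F j x - f x) (\<lambda>x. F j x - f x)) \<longlonglongrightarrow> 0"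
    using assms unfolding L2_tendsto_def by auto
  obtain K where K: "K \<ge> 0" "\<And>f. f \<in> L2 lborel \<Longrightarrow> ip M (I f) (I f) \<le> K * ip lborel f f"
    by (rule I_bounded) blast
  have eq: "ip M (\<lambda>\<omega>. I (F j) \<omega> - I f \<omega>) (\<lambda>\<omega>. I (F j) \<omega> - I f \<omega>) = ip M (I (\<lambda>x. F j x - f x)) (I (\<lambda>x. F j x - f x))" for j
    unfolding ip_def
  proof (rule integral_cong_AE)
    show "AE \<omega> in M. (I (F j) \<omega> - I f \<omega>) * (I (F j) \<omega> - I f \<omega>) = I (\<lambda>x. F j x - f x) \<omega> * I (\<lambda>x. F j x - f x) \<omega>"
      using I_diff[OF F(1)[of j] F(2)] by auto
  qed (use L2_meas[OF I_L2[OF F(1)[of j]]] L2_meas[OF I_L2[OF F(2)]] L2_meas[OF I_L2[OF L2_diff[OF F(1)[of j] F(2)]]] in auto)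
  have "(\<lambda>j. ip M (\<lambda>\<omega>. I (F j) \<omega> - I f \<omega>) (\<lambda>\<omega>. I (F j) \<omega> - I f \<omega>)) \<longlonglongrightarrow> 0"
  proof (rule Lim_null_comparison[OF always_eventually[OF allI]])
    show "norm (ip M (\<lambda>\<omega>. I (F j) \<omega> - I f \<omega>) (\<lambda>\<omega>. I (F j) \<omega> - I f \<omega>))
       \<le> K * ip lborel (\<lambda>x. F j x - f x) (\<lambda>x. F j x - f x)" for j
      using K(2)[OF L2_diff[OF F(1)[of j] F(2)]] ip_self_nonneg[of M "I (\<lambda>x. F j x - f x)"] unfolding eq by simp
    show "(\<lambda>j. K * ip lborel (\<lambda>x. F j x - f x) (\<lambda>x. F j x - f x)) \<longlonglongrightarrow> 0"
      using tendsto_mult_left[OF F(3), of K] by simp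
  qed
  then show ?thesis unfolding L2_tendsto_def using I_L2 F by auto
qed

definition steps :: "(real \<Rightarrow> real) set" where "steps = {u. \<exists>T. finite T \<and> step_on T u}"

lemma step_sequence:
  assumes "f \<in> L2 lborel" obtains F where "\<And>j. F j \<in> steps" "L2_tendsto lborel F f"
proof -
  have "approximable steps f"
  proof (rule approximable_L2[OF _ _ assms])
    fix u v :: "real \<Rightarrow> real" and a b assume "u \<in> steps" "v \<in> steps"
    then obtain T T' where "finite T" "step_on T u" "finite T'" "step_on T' v" unfolding steps_def by auto
    then have "step_on (T \<union> T') u" "step_on (T \<union> T') v"
      by (auto intro: step_on_mono[OF _ Un_upper1] step_on_mono[OF _ Un_upper2])
    then have "step_on (T \<union> T') (\<lambda>x. a * u x + b * v x)" by (rule step_on_lin)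
    moreover have "finite (T \<union> T')" using \<open>finite T\<close> \<open>finite T'\<close> by simp
    ultimately show "(\<lambda>x. a * u x + b * v x) \<in> steps" unfolding steps_def by blast
  next
    show "indicator {s<..t} \<in> steps" if "s \<le> t" for s t
      unfolding steps_def by (rule CollectI, rule exI[of _ "{s, t}"]) (use step_on_Ioc[OF that] in simp)
  qed
  then have "\<exists>u. u \<in> steps \<and> u \<in> L2 lborel \<and> ip lborel (\<lambda>x. f x - u x) (\<lambda>x. f x - u x) < 1 / real (Suc j)" for j
    by (rule approximableE[of _ _ "1 / real (Suc j)"]) auto
  then obtain F where F: "\<And>j. F j \<in> steps" "\<And>j. F j \<in> L2 lborel"
      "\<And>j. ip lborel (\<lambda>x. f x - F j x) (\<lambda>x. f x - F j x) < 1 / real (Suc j)"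
    by metis
  have sw: "ip lborel (\<lambda>x. F j x - f x) (\<lambda>x. F j x - f x) = ip lborel (\<lambda>x. f x - F j x) (\<lambda>x. f x - F j x)" for j
    unfolding ip_self by (simp add: power2_commute)
  have "(\<lambda>j. ip lborel (\<lambda>x. F j x - f x) (\<lambda>x. F j x - f x)) \<longlonglongrightarrow> 0"
  proof (rule Lim_null_comparison[OF always_eventually[OF allI]])
    show "norm (ip lborel (\<lambda>x. F j x - f x) (\<lambda>x. F j x - f x)) \<le> 1 / real (Suc j)" for j
      unfolding sw using F(3)[of j] ip_self_nonneg[of lborel "\<lambda>x. f x - F j x"] by simp
    show "(\<lambda>j. 1 / real (Suc j)) \<longlonglongrightarrow> 0" using LIMSEQ_inverse_real_of_nat by (simp add: inverse_eq_divide)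
  qed
  then show ?thesis using that[of F] F assms unfolding L2_tendsto_def by blast
qed

lemma increment_distributed:
  "s < t \<Longrightarrow> distributed M lborel (\<lambda>\<omega>. W t \<omega> - W s \<omega>) (normal_density 0 (sqrt (t - s)))"
  using bm unfolding two_sided_brownian_motion_def by blast

lemma increment_moment:
  assumes "s < t" shows "integrable M (\<lambda>\<omega>. (W t \<omega> - W s \<omega>) ^ k)"
  using distributed_integrable[OF increment_distributed[OF assms], of "\<lambda>x. x ^ k"]
    integrable_normal_moment[of "sqrt (t - s)" 0 k] assms
  by simp

lemma increment_variance:
  assumes "s < t" shows "expectation (\<lambda>\<omega>. (W t \<omega> - W s \<omega>)\<^sup>2) = t - s"
  using normal_distributed_variance[OF _ increment_distributed[OF assms]]
    normal_distributed_expectation[OF _ increment_distributed[OF assms]] assms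
  by simp

lemma increments_indep:
  assumes "\<And>l. l < N \<Longrightarrow> t l < t (Suc l)"
  shows "indep_vars (\<lambda>_. borel) (\<lambda>l \<omega>. W (t (Suc l)) \<omega> - W (t l) \<omega>) {..<N}"
  using bm assms unfolding two_sided_brownian_motion_def by (simp add: less_imp_le)

section \<open>Brownian increments over a fixed partition\<close>

context
  fixes N :: nat and t :: "nat \<Rightarrow> real" and T :: "real set"
  assumes t: "\<And>l. l < N \<Longrightarrow> t l < t (Suc l)"
    and rep: "\<And>h x. step_on T h \<Longrightarrow> h x = (\<Sum>l<N. h (t (Suc l)) * indicator {t l<..t (Suc l)} x)"
begin

definition \<Delta> :: "nat \<Rightarrow> 'a \<Rightarrow> real" where "\<Delta> l \<omega> = W (t (Suc l)) \<omega> - W (t l) \<omega>"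

lemma Delta_meas [measurable]: "\<Delta> l \<in> borel_measurable M" unfolding \<Delta>_def by measurable

lemma rep_L2: assumes "step_on T h" shows "h \<in> L2 lborel"
proof -
  have "h = (\<lambda>x. \<Sum>l<N. h (t (Suc l)) * indicator {t l<..t (Suc l)} x)" using rep[OF assms] by blast
  also have "(\<lambda>x. \<Sum>l<N. h (t (Suc l)) * indicator {t l<..t (Suc l)} x) \<in> L2 lborel"
    by (intro L2_sum L2_scale Ioc_L2)
  finally show ?thesis .
qed

lemma I_step:
  assumes "step_on T h" shows "AE \<omega> in M. I h \<omega> = (\<Sum>l<N. h (t (Suc l)) * \<Delta> l \<omega>)"
proof -
  have "h = (\<lambda>x. \<Sum>l<N. h (t (Suc l)) * indicator {t l<..t (Suc l)} x)" using rep[OF assms] by blast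
  then have Ih: "I h = I (\<lambda>x. \<Sum>l<N. h (t (Suc l)) * indicator {t l<..t (Suc l)} x)" by (rule arg_cong)
  have "AE \<omega> in M. I (\<lambda>x. \<Sum>l<N. h (t (Suc l)) * indicator {t l<..t (Suc l)} x) \<omega>
     = (\<Sum>l<N. h (t (Suc l)) * I (indicator {t l<..t (Suc l)}) \<omega>)"
    by (rule I_sum) (auto intro: Ioc_L2)
  moreover have "AE \<omega> in M. \<forall>l\<in>{..<N}. I (indicator {t l<..t (Suc l)}) \<omega> = \<Delta> l \<omega>"
    unfolding \<Delta>_def using t by (intro AE_finite_allI I_Ioc) (auto intro: less_imp_le)
  ultimately show ?thesis unfolding Ih by eventually_elim simp
qed

lemma ip_step:
  assumes "step_on T h" "step_on T e"
  shows "ip lborel h e = (\<Sum>l<N. h (t (Suc l)) * e (t (Suc l)) * (t (Suc l) - t l))"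
proof -
  have "ip lborel h e = (\<integral>x. (\<Sum>l<N. (h (t (Suc l)) * e (t (Suc l))) * indicator {t l<..t (Suc l)} x) \<partial>lborel)"
    unfolding ip_def by (intro Bochner_Integration.integral_cong refl) (rule rep[OF step_on_mult[OF assms]])
  also have "\<dots> = (\<Sum>l<N. (h (t (Suc l)) * e (t (Suc l))) * (\<integral>x. indicator {t l<..t (Suc l)} x \<partial>lborel))"
    by (subst Bochner_Integration.integral_sum) (use t in \<open>auto simp: less_imp_le\<close>)
  also have "\<dots> = (\<Sum>l<N. h (t (Suc l)) * e (t (Suc l)) * (t (Suc l) - t l))"
    using t by (intro sum.cong) (auto simp: less_imp_le)
  finally show ?thesis .
qed

lemma Delta_normal: "l < N \<Longrightarrow> distributed M lborel (\<Delta> l) (normal_density 0 (sqrt (t (Suc l) - t l)))"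
  unfolding \<Delta>_def[abs_def] using t by (intro increment_distributed) auto

lemma Delta_L2: "l < N \<Longrightarrow> \<Delta> l \<in> L2 M"
  using increment_moment[OF t, of l 2] by (intro L2I) (auto simp: \<Delta>_def[abs_def])

text \<open>For \<open>j \<noteq> l\<close> the Stein identity in coordinate \<open>l\<close> is
  applied to the coordinate function \<open>x j\<close>, whose derivative in that coordinate is
  0.\<close>

lemma Delta_covariance:
  assumes "l < N" "j < N" shows "ip M (\<Delta> j) (\<Delta> l) = (if j = l then t (Suc l) - t l else 0)"
proof (cases "j = l")
  case True
  then show ?thesis using increment_variance[OF t[OF assms(1)]] by (simp add: ip_self \<Delta>_def)
next
  case False
  have "expectation (\<lambda>\<omega>. (\<lambda>x. x j) (\<lambda>i\<in>{..<N}. \<Delta> i \<omega>) * \<Delta> l \<omega>)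
     = (sqrt (t (Suc l) - t l))\<^sup>2 * expectation (\<lambda>\<omega>. (\<lambda>x. 0) (\<lambda>i\<in>{..<N}. \<Delta> i \<omega>))"
  proof (rule independent_normal_stein[where \<sigma>="\<lambda>l. sqrt (t (Suc l) - t l)"])
    show "indep_vars (\<lambda>_. borel) \<Delta> {..<N}"
      using increments_indep[of N t, OF t] unfolding \<Delta>_def[abs_def] .
    show "(\<lambda>x. x j) \<in> borel_measurable (Pi\<^sub>M {..<N} (\<lambda>_. borel :: real measure))"
      by (rule measurable_component_singleton) (use assms in simp)
    show "((\<lambda>t. (x(l := t)) j) has_real_derivative 0) (at s)" for x :: "nat \<Rightarrow> real" and s
      using False by simp
    show "\<exists>C. \<forall>t. \<bar>(x(l := t)) j\<bar> \<le> C \<and> \<bar>0 :: real\<bar> \<le> C" for x :: "nat \<Rightarrow> real"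
      using False by (intro exI[of _ "\<bar>x j\<bar>"]) simp
    show "integrable M (\<lambda>\<omega>. (\<lambda>i\<in>{..<N}. \<Delta> i \<omega>) j * \<Delta> l \<omega>)"
      using L2_mult_int[OF Delta_L2[OF assms(2)] Delta_L2[OF assms(1)]] assms by simp
  qed (use t assms Delta_normal in auto)
  then show ?thesis using False assms unfolding ip_def by simp
qed

lemma isometry_step:
  assumes "step_on T h" "step_on T e" shows "ip M (I h) (I e) = ip lborel h e"
proof -
  have L: "h \<in> L2 lborel \<Longrightarrow> I h \<in> borel_measurable M" for h using L2_meas I_L2 by blast
  note hL = rep_L2
  let ?S = "\<lambda>h \<omega>. \<Sum>l<N. h (t (Suc l)) * \<Delta> l \<omega>"
  have SL: "?S h \<in> L2 M" for h by (intro L2_sum L2_scale Delta_L2) auto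
  have "ip M (I h) (I e) = ip M (?S h) (?S e)"
    unfolding ip_def
  proof (rule integral_cong_AE)
    show "AE \<omega> in M. I h \<omega> * I e \<omega> = ?S h \<omega> * ?S e \<omega>"
      using I_step[OF assms(1)] I_step[OF assms(2)] by eventually_elim simp
  qed (use L[OF hL[OF assms(1)]] L[OF hL[OF assms(2)]] in measurable)
  also have "\<dots> = (\<Sum>j<N. \<Sum>l<N. h (t (Suc j)) * (e (t (Suc l)) * ip M (\<Delta> j) (\<Delta> l)))"
  proof -
    have "ip M (?S h) (?S e) = (\<Sum>j<N. ip M (\<lambda>\<omega>. h (t (Suc j)) * \<Delta> j \<omega>) (?S e))"
      by (rule ip_sum_left) (auto intro: L2_scale Delta_L2 SL)
    also have "\<dots> = (\<Sum>j<N. h (t (Suc j)) * (\<Sum>l<N. ip M (\<Delta> j) (\<lambda>\<omega>. e (t (Suc l)) * \<Delta> l \<omega>)))"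
      unfolding ip_scale_left
      by (intro sum.cong refl arg_cong2[where f="(*)"] ip_sum_right) (auto intro: L2_scale Delta_L2)
    finally show ?thesis by (simp add: ip_scale_right sum_distrib_left)
  qed
  also have "\<dots> = (\<Sum>j<N. \<Sum>l<N. if l = j then h (t (Suc j)) * e (t (Suc j)) * (t (Suc j) - t j) else 0)"
    by (intro sum.cong refl) (auto simp: Delta_covariance)
  also have "\<dots> = ip lborel h e" unfolding ip_step[OF assms] by simp
  finally show ?thesis .
qed

text \<open>The vector of Wiener integrals of the step functions \<open>h k\<close> as a linear
  function of the increments; \<open>x l\<close> stands for \<open>\<Delta> l\<close>.\<close>

definition lin_arg :: "nat \<Rightarrow> (nat \<Rightarrow> real \<Rightarrow> real) \<Rightarrow> (nat \<Rightarrow> real) \<Rightarrow> nat \<Rightarrow> real" where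
  "lin_arg m h x k = (if k < m then \<Sum>l<N. h k (t (Suc l)) * x l else 0)"

lemma lin_arg_upd:
  assumes "l < N"
  shows "lin_arg m h (x(l := s)) = (\<lambda>k. lin_arg m h (x(l := 0)) k + s * (if k < m then h k (t (Suc l)) else 0))"
proof
  fix k
  have "(\<Sum>j<N. h k (t (Suc j)) * (x(l := s)) j)
     = (\<Sum>j<N. h k (t (Suc j)) * (x(l := 0)) j + (if j = l then s * h k (t (Suc l)) else 0))"
    by (intro sum.cong) auto
  then show "lin_arg m h (x(l := s)) k = lin_arg m h (x(l := 0)) k + s * (if k < m then h k (t (Suc l)) else 0)"
    using assms by (simp add: lin_arg_def sum.distrib)
qed

lemma lin_arg_meas [measurable]: "lin_arg m h \<in> borel_measurable (Pi\<^sub>M {..<N} (\<lambda>_. borel))"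
proof (rule measurable_coordinatewise_then_product)
  fix k
  have [measurable]: "(\<lambda>x. x l) \<in> borel_measurable (Pi\<^sub>M {..<N} (\<lambda>_. borel :: real measure))" if "l < N" for l
    by (rule measurable_component_singleton) (use that in simp)
  show "(\<lambda>x. lin_arg m h x k) \<in> borel_measurable (Pi\<^sub>M {..<N} (\<lambda>_. borel))"
    unfolding lin_arg_def
    by (cases "k < m") (auto intro!: borel_measurable_sum borel_measurable_times)
qed

text \<open>Integration by parts in the increment \<open>\<Delta> l\<close> produces its variance
  \<open>t (Suc l) - t l\<close> and, by the chain rule, the factors \<open>h k (t (Suc l))\<close>.
  Summation against the values of \<open>e\<close> reassembles the inner products
  \<open>ip lborel (h k) e\<close>.\<close>

lemma stein_step:
  assumes h: "\<And>k. k < m \<Longrightarrow> step_on T (h k)" and e: "step_on T e"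
    and psi: "C1_fun m \<psi> \<psi>'" "growth m 0 \<psi>" "\<And>k. k < m \<Longrightarrow> growth m 0 (\<psi>' k)"
  shows "expectation (\<lambda>\<omega>. \<psi> (\<lambda>k. if k < m then I (h k) \<omega> else 0) * I e \<omega>)
     = (\<Sum>k<m. ip lborel (h k) e * expectation (\<lambda>\<omega>. \<psi>' k (\<lambda>k. if k < m then I (h k) \<omega> else 0)))"
proof -
  let ?X = "\<lambda>\<omega>. \<lambda>i\<in>{..<N}. \<Delta> i \<omega>"
  have [measurable]: "?X \<in> measurable M (Pi\<^sub>M {..<N} (\<lambda>_. borel))" by measurable
  have c: "continuous_on UNIV \<psi>" "\<And>k. continuous_on UNIV (\<psi>' k)" using psi(1) unfolding C1_fun_def by auto
  have [measurable]: "\<psi> \<in> borel_measurable borel" "\<psi>' k \<in> borel_measurable borel" for k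
    using c by (simp_all add: borel_measurable_continuous_onI)
  obtain C0 where C0: "\<And>x. \<bar>\<psi> x\<bar> \<le> C0" using psi(2) unfolding growth_bounded by blast
  have "\<forall>k. \<exists>C. k < m \<longrightarrow> (\<forall>x. \<bar>\<psi>' k x\<bar> \<le> C)" using psi(3) unfolding growth_bounded by blast
  then obtain C1 where C1: "\<And>k x. k < m \<Longrightarrow> \<bar>\<psi>' k x\<bar> \<le> C1 k" by metis
  define Y where "Y \<omega> = lin_arg m h (?X \<omega>)" for \<omega>
  have Ym: "Y \<in> borel_measurable M" unfolding Y_def[abs_def] by measurable
  have intp: "integrable M (\<lambda>\<omega>. \<psi>' k (Y \<omega>))" if "k < m" for k
    using C1[OF that] Ym by (intro integrable_const_bound[where B="C1 k"]) auto
  have int0: "integrable M (\<lambda>\<omega>. \<psi> (Y \<omega>) * \<Delta> l \<omega>)" if "l < N" for l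
  proof -
    have "(\<lambda>\<omega>. \<psi> (Y \<omega>)) \<in> L2 M"
    proof (rule L2I)
      have "(\<psi> x)\<^sup>2 \<le> C0\<^sup>2" for x using C0[of x] by (metis abs_le_square_iff abs_ge_self order_trans)
      then show "integrable M (\<lambda>\<omega>. (\<psi> (Y \<omega>))\<^sup>2)"
        using Ym by (intro integrable_const_bound[where B="C0\<^sup>2"]) auto
    qed (use Ym in measurable)
    then show ?thesis using Delta_L2[OF that] by (rule L2_mult_int)
  qed
  have core: "expectation (\<lambda>\<omega>. \<psi> (Y \<omega>) * \<Delta> l \<omega>)
      = (t (Suc l) - t l) * (\<Sum>k<m. h k (t (Suc l)) * expectation (\<lambda>\<omega>. \<psi>' k (Y \<omega>)))" if l: "l < N" for l
  proof -
    define a where "a k = (if k < m then h k (t (Suc l)) else 0)" for k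
    define \<Phi> where "\<Phi> x = \<psi> (lin_arg m h x)" for x
    define \<Phi>' where "\<Phi>' x = (\<Sum>k<m. a k * \<psi>' k (lin_arg m h x))" for x
    have "expectation (\<lambda>\<omega>. \<Phi> (?X \<omega>) * \<Delta> l \<omega>) = (sqrt (t (Suc l) - t l))\<^sup>2 * expectation (\<lambda>\<omega>. \<Phi>' (?X \<omega>))"
    proof (rule independent_normal_stein[where \<sigma>="\<lambda>l. sqrt (t (Suc l) - t l)"])
      show "indep_vars (\<lambda>_. borel) \<Delta> {..<N}" using increments_indep[of N t, OF t] unfolding \<Delta>_def[abs_def] .
      show "\<Phi> \<in> borel_measurable (Pi\<^sub>M {..<N} (\<lambda>_. borel))" unfolding \<Phi>_def[abs_def] by measurable
      show "\<Phi>' \<in> borel_measurable (Pi\<^sub>M {..<N} (\<lambda>_. borel))" unfolding \<Phi>'_def[abs_def] by measurable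
      fix x :: "nat \<Rightarrow> real"
      obtain z where u: "\<And>s. lin_arg m h (x(l := s)) = (\<lambda>k. z k + s * a k)"
        using lin_arg_upd[OF l, of m h x] unfolding a_def by blast
      show "((\<lambda>s. \<Phi> (x(l := s))) has_real_derivative \<Phi>' (x(l := s))) (at s)" for s
        unfolding \<Phi>_def \<Phi>'_def u by (rule C1_funD[OF psi(1)])
      show "continuous_on UNIV (\<lambda>s. \<Phi>' (x(l := s)))"
        unfolding \<Phi>'_def u
      proof (intro continuous_on_sum continuous_on_mult continuous_on_const)
        fix k
        show "continuous_on UNIV (\<lambda>s. \<psi>' k (\<lambda>k. z k + s * a k))"
          by (rule continuous_on_compose2[OF c(2)]) (auto intro!: continuous_on_coordinatewise_then_product continuous_intros)
      qed
      show "\<exists>C. \<forall>s. \<bar>\<Phi> (x(l := s))\<bar> \<le> C \<and> \<bar>\<Phi>' (x(l := s))\<bar> \<le> C"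
      proof (intro exI allI conjI)
        fix s
        have "\<bar>\<Phi>' (x(l := s))\<bar> \<le> (\<Sum>k<m. \<bar>a k\<bar> * C1 k)"
          unfolding \<Phi>'_def using C1 by (intro order_trans[OF sum_abs] sum_mono) (auto simp: abs_mult intro!: mult_left_mono)
        then show "\<bar>\<Phi>' (x(l := s))\<bar> \<le> max C0 (\<Sum>k<m. \<bar>a k\<bar> * C1 k)" by simp
        show "\<bar>\<Phi> (x(l := s))\<bar> \<le> max C0 (\<Sum>k<m. \<bar>a k\<bar> * C1 k)" unfolding \<Phi>_def using C0 by (simp add: le_max_iff_disj)
      qed
      show "integrable M (\<lambda>\<omega>. \<Phi> (?X \<omega>) * \<Delta> l \<omega>)" using int0[OF l] unfolding \<Phi>_def Y_def .
      show "integrable M (\<lambda>\<omega>. \<Phi>' (?X \<omega>))"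
        unfolding \<Phi>'_def using intp unfolding Y_def by (intro Bochner_Integration.integrable_sum integrable_mult_right) auto
    qed (use t l Delta_normal in auto)
    moreover have "expectation (\<lambda>\<omega>. \<Phi>' (?X \<omega>)) = (\<Sum>k<m. a k * expectation (\<lambda>\<omega>. \<psi>' k (Y \<omega>)))"
      unfolding \<Phi>'_def using intp unfolding Y_def by (subst Bochner_Integration.integral_sum) auto
    moreover have "(\<Sum>k<m. a k * expectation (\<lambda>\<omega>. \<psi>' k (Y \<omega>))) = (\<Sum>k<m. h k (t (Suc l)) * expectation (\<lambda>\<omega>. \<psi>' k (Y \<omega>)))"
      by (intro sum.cong) (auto simp: a_def)
    ultimately show ?thesis unfolding \<Phi>_def Y_def using t[OF l] by simp
  qed
  have "AE \<omega> in M. \<forall>k\<in>{..<m}. I (h k) \<omega> = (\<Sum>l<N. h k (t (Suc l)) * \<Delta> l \<omega>)"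
    using h by (intro AE_finite_allI I_step) auto
  then have AEY: "AE \<omega> in M. (\<lambda>k. if k < m then I (h k) \<omega> else 0) = Y \<omega>"
    by eventually_elim (auto simp: Y_def lin_arg_def)
  have hL: "h k \<in> L2 lborel" if "k < m" for k using rep_L2[OF h[OF that]] .
  have eL: "e \<in> L2 lborel" using rep_L2[OF e] .
  have xm: "(\<lambda>\<omega> k. if k < m then I (h k) \<omega> else 0) \<in> borel_measurable M"
  proof (rule measurable_coordinatewise_then_product)
    fix k show "(\<lambda>\<omega>. if k < m then I (h k) \<omega> else 0) \<in> borel_measurable M"
      using L2_meas[OF I_L2[OF hL[of k]]] by (cases "k < m") auto
  qed
  have Iem: "I e \<in> borel_measurable M" by (rule L2_meas[OF I_L2[OF eL]])
  have "expectation (\<lambda>\<omega>. \<psi> (\<lambda>k. if k < m then I (h k) \<omega> else 0) * I e \<omega>)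
     = expectation (\<lambda>\<omega>. \<Sum>l<N. e (t (Suc l)) * (\<psi> (Y \<omega>) * \<Delta> l \<omega>))"
  proof (rule integral_cong_AE)
    show "AE \<omega> in M. \<psi> (\<lambda>k. if k < m then I (h k) \<omega> else 0) * I e \<omega> = (\<Sum>l<N. e (t (Suc l)) * (\<psi> (Y \<omega>) * \<Delta> l \<omega>))"
      using AEY I_step[OF e] by eventually_elim (simp add: sum_distrib_left mult_ac)
    show "(\<lambda>\<omega>. \<psi> (\<lambda>k. if k < m then I (h k) \<omega> else 0) * I e \<omega>) \<in> borel_measurable M"
      using Iem measurable_compose[OF xm, of \<psi> borel] by measurable
  qed (use Ym in measurable)
  also have "\<dots> = (\<Sum>l<N. e (t (Suc l)) * expectation (\<lambda>\<omega>. \<psi> (Y \<omega>) * \<Delta> l \<omega>))"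
    using int0 by (subst Bochner_Integration.integral_sum) auto
  also have "\<dots> = (\<Sum>l<N. \<Sum>k<m. (h k (t (Suc l)) * e (t (Suc l)) * (t (Suc l) - t l)) * expectation (\<lambda>\<omega>. \<psi>' k (Y \<omega>)))"
    using core by (intro sum.cong refl) (simp add: sum_distrib_left mult_ac)
  also have "\<dots> = (\<Sum>k<m. (\<Sum>l<N. h k (t (Suc l)) * e (t (Suc l)) * (t (Suc l) - t l)) * expectation (\<lambda>\<omega>. \<psi>' k (Y \<omega>)))"
    unfolding sum_distrib_right by (rule sum.swap)
  also have "\<dots> = (\<Sum>k<m. ip lborel (h k) e * expectation (\<lambda>\<omega>. \<psi>' k (\<lambda>k. if k < m then I (h k) \<omega> else 0)))"
  proof (intro sum.cong refl arg_cong2[where f="(*)"])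
    fix k assume "k \<in> {..<m}"
    then show "(\<Sum>l<N. h k (t (Suc l)) * e (t (Suc l)) * (t (Suc l) - t l)) = ip lborel (h k) e"
      using ip_step[OF h e] by simp
    show "expectation (\<lambda>\<omega>. \<psi>' k (Y \<omega>)) = expectation (\<lambda>\<omega>. \<psi>' k (\<lambda>k. if k < m then I (h k) \<omega> else 0))"
    proof (rule integral_cong_AE)
      show "AE \<omega> in M. \<psi>' k (Y \<omega>) = \<psi>' k (\<lambda>k. if k < m then I (h k) \<omega> else 0)"
        using AEY by eventually_elim simp
      show "(\<lambda>\<omega>. \<psi>' k (\<lambda>k. if k < m then I (h k) \<omega> else 0)) \<in> borel_measurable M"
        using measurable_compose[OF xm, of "\<psi>' k" borel] by measurable
    qed (use Ym in measurable)
  qed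
  finally show ?thesis .
qed

end

end

section \<open>From step functions to square integrable integrands\<close>

context wiener
begin

definition xi :: "nat \<Rightarrow> (nat \<Rightarrow> real \<Rightarrow> real) \<Rightarrow> 'a \<Rightarrow> nat \<Rightarrow> real" where
  "xi m h \<omega> k = (if k < m then I (h k) \<omega> else 0)"

lemma xi_meas: assumes "\<And>k. k < m \<Longrightarrow> h k \<in> L2 lborel" shows "xi m h \<in> borel_measurable M"
proof (rule measurable_coordinatewise_then_product)
  fix k show "(\<lambda>\<omega>. xi m h \<omega> k) \<in> borel_measurable M"
    unfolding xi_def using L2_meas[OF I_L2[OF assms[of k]]] by (cases "k < m") auto
qed

lemma steps_L2: "u \<in> steps \<Longrightarrow> u \<in> L2 lborel"
  unfolding steps_def using step_on_L2 by blast

lemma step_sequences: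
  assumes "\<And>k. k < m \<Longrightarrow> h k \<in> L2 lborel"
  obtains F where "\<And>k j. k < m \<Longrightarrow> F k j \<in> steps" "\<And>k. k < m \<Longrightarrow> L2_tendsto lborel (F k) (h k)"
proof -
  have "\<exists>F. k < m \<longrightarrow> (\<forall>j. F j \<in> steps) \<and> L2_tendsto lborel F (h k)" for k
  proof (cases "k < m")
    case True
    obtain F where "\<And>j. F j \<in> steps" "L2_tendsto lborel F (h k)" by (rule step_sequence[OF assms[OF True]]) blast
    then show ?thesis by blast
  qed simp
  then obtain F where "\<forall>k. k < m \<longrightarrow> (\<forall>j. F k j \<in> steps) \<and> L2_tendsto lborel (F k) (h k)"
    by metis
  then show ?thesis using that[of F] by blast
qed

lemma stein_steps:
  assumes h: "\<And>k. k < m \<Longrightarrow> h k \<in> steps" and e: "e \<in> steps"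
    and psi: "C1_fun m \<psi> \<psi>'" "growth m 0 \<psi>" "\<And>k. k < m \<Longrightarrow> growth m 0 (\<psi>' k)"
  shows "expectation (\<lambda>\<omega>. \<psi> (xi m h \<omega>) * I e \<omega>)
     = (\<Sum>k<m. ip lborel (h k) e * expectation (\<lambda>\<omega>. \<psi>' k (xi m h \<omega>)))"
proof -
  have "\<exists>T. k < m \<longrightarrow> finite T \<and> step_on T (h k)" for k using h[of k] unfolding steps_def by blast
  then obtain T where T: "\<And>k. k < m \<Longrightarrow> finite (T k) \<and> step_on (T k) (h k)" by metis
  obtain T' where T': "finite T'" "step_on T' e" using e unfolding steps_def by blast
  \<comment> \<open>A common refinement, on which \<open>e\<close> and all \<open>h k\<close> are
    step functions.\<close>
  define S where "S = T' \<union> (\<Union>k<m. T k)"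
  have fin: "finite S" unfolding S_def using T T' by auto
  have hS: "step_on S (h k)" if "k < m" for k
    by (rule step_on_mono[of "T k"]) (use T that in \<open>auto simp: S_def\<close>)
  have eS: "step_on S e" by (rule step_on_mono[OF T'(2)]) (auto simp: S_def)
  obtain N t where Nt: "\<forall>l<N. t l < t (Suc l)"
    "\<forall>h x. step_on S h \<longrightarrow> h x = (\<Sum>l<N. h (t (Suc l)) * indicator {t l<..t (Suc l)} x)"
    using step_on_representation[OF fin] by (elim exE conjE)
  show ?thesis unfolding xi_def[abs_def]
    by (rule stein_step[OF Nt(1)[rule_format] Nt(2)[rule_format] hS eS psi])
qed

text \<open>The assumptions provide continuity of \<open>I\<close> with some constant. Equality of
  the inner products holds for step functions and passes to the limit, both sides being continuous
  along mean square convergence.\<close>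

lemma isometry:
  assumes "f \<in> L2 lborel" "g \<in> L2 lborel" shows "ip M (I f) (I g) = ip lborel f g"
proof -
  obtain F where F: "\<And>j. F j \<in> steps" "L2_tendsto lborel F f" by (rule step_sequence[OF assms(1)]) blast
  obtain G where G: "\<And>j. G j \<in> steps" "L2_tendsto lborel G g" by (rule step_sequence[OF assms(2)]) blast
  have eq: "ip M (I (F j)) (I (G j)) = ip lborel (F j) (G j)" for j
  proof -
    obtain T T' where T: "finite T" "step_on T (F j)" "finite T'" "step_on T' (G j)"
      using F(1)[of j] G(1)[of j] unfolding steps_def by blast
    have fin: "finite (T \<union> T')" using T by simp
    obtain N t where Nt: "\<forall>l<N. t l < t (Suc l)"
      "\<forall>h x. step_on (T \<union> T') h \<longrightarrow> h x = (\<Sum>l<N. h (t (Suc l)) * indicator {t l<..t (Suc l)} x)"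
      using step_on_representation[OF fin] by (elim exE conjE)
    show ?thesis
      by (rule isometry_step[OF Nt(1)[rule_format] Nt(2)[rule_format] step_on_mono[OF T(2) Un_upper1] step_on_mono[OF T(4) Un_upper2]])
  qed
  have "(\<lambda>j. ip M (I (F j)) (I (G j))) \<longlonglongrightarrow> ip M (I f) (I g)"
    by (rule ip_tendsto[OF I_tendsto[OF F(2)] I_tendsto[OF G(2)]])
  moreover have "(\<lambda>j. ip M (I (F j)) (I (G j))) \<longlonglongrightarrow> ip lborel f g"
    unfolding eq by (rule ip_tendsto[OF F(2) G(2)])
  ultimately show ?thesis by (rule LIMSEQ_unique)
qed

text \<open>Only the \<open>h k\<close> are approximated. Along a subsequence the approximating
  vectors converge almost surely, and bounded continuous functions of them pass to the limit by
  dominated convergence.\<close>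

lemma stein_L2:
  assumes h: "\<And>k. k < m \<Longrightarrow> h k \<in> L2 lborel" and e: "e \<in> steps"
    and psi: "C1_fun m \<psi> \<psi>'" "growth m 0 \<psi>" "\<And>k. k < m \<Longrightarrow> growth m 0 (\<psi>' k)"
  shows "expectation (\<lambda>\<omega>. \<psi> (xi m h \<omega>) * I e \<omega>)
     = (\<Sum>k<m. ip lborel (h k) e * expectation (\<lambda>\<omega>. \<psi>' k (xi m h \<omega>)))"
proof -
  obtain F where F: "\<And>k j. k < m \<Longrightarrow> F k j \<in> steps" "\<And>k. k < m \<Longrightarrow> L2_tendsto lborel (F k) (h k)"
    by (rule step_sequences[OF h]) blast+
  have FL: "k < m \<Longrightarrow> F k j \<in> L2 lborel" for k j using steps_L2 F(1) by blast
  let ?u = "\<lambda>j \<omega>. \<Sum>k<m. (I (F k j) \<omega> - I (h k) \<omega>)\<^sup>2"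
  have iu: "integrable M (\<lambda>\<omega>. (I (F k j) \<omega> - I (h k) \<omega>)\<^sup>2)" if "k < m" for k j
    using L2_sq_int[OF L2_diff[OF I_L2[OF FL[OF that]] I_L2[OF h[OF that]]]] .
  \<comment> \<open>Summing the squared differences over \<open>k\<close> first yields one
    subsequence that serves all coordinates.\<close>
  have "\<exists>r::nat \<Rightarrow> nat. strict_mono r \<and> (AE \<omega> in M. (\<lambda>n. ?u (r n) \<omega>) \<longlonglongrightarrow> 0)"
  proof (rule tendsto_L1_AE_subseq)
    show "integrable M (?u j)" for j using iu by (intro Bochner_Integration.integrable_sum) auto
    have n: "norm (?u j \<omega>) = ?u j \<omega>" for j \<omega> by (simp add: sum_nonneg)
    have "(\<integral>\<omega>. norm (?u j \<omega>) \<partial>M) = (\<Sum>k<m. ip M (\<lambda>\<omega>. I (F k j) \<omega> - I (h k) \<omega>) (\<lambda>\<omega>. I (F k j) \<omega> - I (h k) \<omega>))" for j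
      unfolding n ip_self using iu by (intro Bochner_Integration.integral_sum) auto
    moreover have "(\<lambda>j. \<Sum>k<m. ip M (\<lambda>\<omega>. I (F k j) \<omega> - I (h k) \<omega>) (\<lambda>\<omega>. I (F k j) \<omega> - I (h k) \<omega>)) \<longlonglongrightarrow> (\<Sum>k<m. 0)"
    proof (rule tendsto_sum)
      fix k assume "k \<in> {..<m}"
      then show "(\<lambda>j. ip M (\<lambda>\<omega>. I (F k j) \<omega> - I (h k) \<omega>) (\<lambda>\<omega>. I (F k j) \<omega> - I (h k) \<omega>)) \<longlonglongrightarrow> 0"
        using I_tendsto[OF F(2)[of k]] unfolding L2_tendsto_def by auto
    qed
    ultimately show "(\<lambda>j. \<integral>\<omega>. norm (?u j \<omega>) \<partial>M) \<longlonglongrightarrow> 0" by simp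
  qed
  then obtain r :: "nat \<Rightarrow> nat" where r: "strict_mono r" "AE \<omega> in M. (\<lambda>n. ?u (r n) \<omega>) \<longlonglongrightarrow> 0" by blast
  let ?x = "\<lambda>j. xi m (\<lambda>k. F k j)"
  have conv: "AE \<omega> in M. (\<lambda>n. ?x (r n) \<omega>) \<longlonglongrightarrow> xi m h \<omega>"
    using r(2)
  proof eventually_elim
    case (elim \<omega>)
    show ?case
    proof (rule tendsto_fun_componentwise)
      fix k
      show "(\<lambda>n. ?x (r n) \<omega> k) \<longlonglongrightarrow> xi m h \<omega> k"
      proof (cases "k < m")
        case True
        have "(\<lambda>n. (I (F k (r n)) \<omega> - I (h k) \<omega>)\<^sup>2) \<longlonglongrightarrow> 0"
        proof (rule Lim_null_comparison[OF always_eventually[OF allI] elim])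
          fix n
          have "(I (F k (r n)) \<omega> - I (h k) \<omega>)\<^sup>2 \<le> ?u (r n) \<omega>"
            using True by (intro member_le_sum) auto
          then show "norm ((I (F k (r n)) \<omega> - I (h k) \<omega>)\<^sup>2) \<le> ?u (r n) \<omega>" by simp
        qed
        then have "(\<lambda>n. sqrt ((I (F k (r n)) \<omega> - I (h k) \<omega>)\<^sup>2)) \<longlonglongrightarrow> sqrt 0" by (rule tendsto_real_sqrt)
        then have "(\<lambda>n. \<bar>I (F k (r n)) \<omega> - I (h k) \<omega>\<bar>) \<longlonglongrightarrow> 0" by simp
        then have "(\<lambda>n. I (F k (r n)) \<omega> - I (h k) \<omega>) \<longlonglongrightarrow> 0" by (rule tendsto_rabs_zero_cancel)
        then have "(\<lambda>n. I (F k (r n)) \<omega>) \<longlonglongrightarrow> I (h k) \<omega>" by (rule LIM_zero_cancel)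
        then show ?thesis using True by (simp add: xi_def)
      qed (simp add: xi_def)
    qed
  qed
  have c: "continuous_on UNIV \<psi>" "\<And>k. continuous_on UNIV (\<psi>' k)" using psi(1) unfolding C1_fun_def by auto
  have cm: "(\<lambda>\<omega>. f (xi m g \<omega>)) \<in> borel_measurable M"
    if "continuous_on UNIV f" "\<And>k. k < m \<Longrightarrow> g k \<in> L2 lborel" for f :: "(nat \<Rightarrow> real) \<Rightarrow> real" and g
    by (rule measurable_compose[OF xi_meas[OF that(2)] borel_measurable_continuous_onI[OF that(1)]])
  have clim: "AE \<omega> in M. (\<lambda>n. f (?x (r n) \<omega>)) \<longlonglongrightarrow> f (xi m h \<omega>)"
    if "continuous_on UNIV f" for f :: "(nat \<Rightarrow> real) \<Rightarrow> real"
    using conv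
  proof eventually_elim
    case (elim \<omega>)
    have "isCont f (xi m h \<omega>)" using that by (simp add: continuous_on_eq_continuous_at)
    then show ?case using elim by (rule isCont_tendsto_compose)
  qed
  have eL: "e \<in> L2 lborel" using e by (rule steps_L2)
  have Iem: "I e \<in> borel_measurable M" using L2_meas[OF I_L2[OF eL]] .
  have Ie1: "integrable M (I e)"
  proof (rule Bochner_Integration.integrable_bound[of M "\<lambda>\<omega>. 1 + (I e \<omega>)\<^sup>2"])
    have "\<bar>y\<bar> \<le> 1 + y\<^sup>2" for y :: real using sum_squares_bound[of 1 "\<bar>y\<bar>"] by simp
    then show "AE \<omega> in M. norm (I e \<omega>) \<le> norm (1 + (I e \<omega>)\<^sup>2)" by simp
  qed (use L2_sq_int[OF I_L2[OF eL]] Iem in auto)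
  obtain C0 where C0: "\<And>x. \<bar>\<psi> x\<bar> \<le> C0" using psi(2) unfolding growth_bounded by blast
  have lim1: "(\<lambda>n. expectation (\<lambda>\<omega>. \<psi> (?x (r n) \<omega>) * I e \<omega>)) \<longlonglongrightarrow> expectation (\<lambda>\<omega>. \<psi> (xi m h \<omega>) * I e \<omega>)"
  proof (rule integral_dominated_convergence[where w="\<lambda>\<omega>. C0 * \<bar>I e \<omega>\<bar>"])
    show "(\<lambda>\<omega>. \<psi> (xi m h \<omega>) * I e \<omega>) \<in> borel_measurable M"
      using cm[OF c(1) h] Iem by simp
    show "(\<lambda>\<omega>. \<psi> (?x (r n) \<omega>) * I e \<omega>) \<in> borel_measurable M" for n
      using cm[OF c(1), of "\<lambda>k. F k (r n)"] FL Iem by simp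
    show "integrable M (\<lambda>\<omega>. C0 * \<bar>I e \<omega>\<bar>)" using Ie1 by simp
    show "AE \<omega> in M. (\<lambda>n. \<psi> (?x (r n) \<omega>) * I e \<omega>) \<longlonglongrightarrow> \<psi> (xi m h \<omega>) * I e \<omega>"
      using clim[OF c(1)] by eventually_elim (rule tendsto_mult_right)
    show "AE \<omega> in M. norm (\<psi> (?x (r n) \<omega>) * I e \<omega>) \<le> C0 * \<bar>I e \<omega>\<bar>" for n
      using C0 by (auto intro!: AE_I2 mult_right_mono simp: abs_mult)
  qed
  have lim2: "(\<lambda>n. expectation (\<lambda>\<omega>. \<psi>' k (?x (r n) \<omega>))) \<longlonglongrightarrow> expectation (\<lambda>\<omega>. \<psi>' k (xi m h \<omega>))" if k: "k < m" for k
  proof -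
    obtain C where C: "\<And>x. \<bar>\<psi>' k x\<bar> \<le> C" using psi(3)[OF k] unfolding growth_bounded by blast
    show ?thesis
    proof (rule integral_dominated_convergence[where w="\<lambda>_. C"])
      show "(\<lambda>\<omega>. \<psi>' k (xi m h \<omega>)) \<in> borel_measurable M" by (rule cm[OF c(2) h])
      show "(\<lambda>\<omega>. \<psi>' k (?x (r n) \<omega>)) \<in> borel_measurable M" for n by (rule cm[OF c(2) FL])
      show "AE \<omega> in M. (\<lambda>n. \<psi>' k (?x (r n) \<omega>)) \<longlonglongrightarrow> \<psi>' k (xi m h \<omega>)" by (rule clim[OF c(2)])
      show "AE \<omega> in M. norm (\<psi>' k (?x (r n) \<omega>)) \<le> C" for n using C by auto
    qed simp
  qed
  have ec: "L2_tendsto lborel (\<lambda>_. e) e" unfolding L2_tendsto_def using eL by (simp add: ip_def)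
  have lim3: "(\<lambda>n. ip lborel (F k (r n)) e) \<longlonglongrightarrow> ip lborel (h k) e" if "k < m" for k
    using LIMSEQ_subseq_LIMSEQ[OF ip_tendsto[OF F(2)[OF that] ec] r(1)] by (simp add: comp_def)
  have "(\<lambda>n. \<Sum>k<m. ip lborel (F k (r n)) e * expectation (\<lambda>\<omega>. \<psi>' k (?x (r n) \<omega>)))
     \<longlonglongrightarrow> (\<Sum>k<m. ip lborel (h k) e * expectation (\<lambda>\<omega>. \<psi>' k (xi m h \<omega>)))"
    by (intro tendsto_sum tendsto_mult lim2 lim3) auto
  moreover have "(\<Sum>k<m. ip lborel (F k (r n)) e * expectation (\<lambda>\<omega>. \<psi>' k (?x (r n) \<omega>)))
     = expectation (\<lambda>\<omega>. \<psi> (?x (r n) \<omega>) * I e \<omega>)" for n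
    by (rule stein_steps[OF F(1) e psi, symmetric])
  ultimately show ?thesis using lim1 by (simp add: LIMSEQ_unique)
qed

end

section \<open>Double Wiener integrals\<close>

definition tensor :: "(real \<Rightarrow> real) \<Rightarrow> (real \<Rightarrow> real) \<Rightarrow> real \<times> real \<Rightarrow> real" where
  "tensor g h = (\<lambda>(x, y). g x * h y)"

lemma integrable_tensor:
  assumes "integrable lborel g" "integrable lborel h"
  shows "integrable lborel (tensor g h)" "(\<integral>p. tensor g h p \<partial>lborel) = (\<integral>x. g x \<partial>lborel) * (\<integral>y. h y \<partial>lborel)"
proof -
  have [measurable]: "g \<in> borel_measurable borel" "h \<in> borel_measurable borel" using assms by auto
  have int: "integrable (lborel \<Otimes>\<^sub>M lborel) (tensor g h)"
  proof (rule lborel_pair.Fubini_integrable)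
    show "tensor g h \<in> borel_measurable (lborel \<Otimes>\<^sub>M lborel)" unfolding tensor_def by measurable
    show "integrable lborel (\<lambda>x. \<integral>y. norm (tensor g h (x, y)) \<partial>lborel)"
      unfolding tensor_def using assms by (simp add: abs_mult)
    show "AE x in lborel. integrable lborel (\<lambda>y. tensor g h (x, y))"
      unfolding tensor_def using assms by simp
  qed
  then show "integrable lborel (tensor g h)" by (simp add: lborel_prod)
  have "(\<integral>x. (\<integral>y. tensor g h (x, y) \<partial>lborel) \<partial>lborel) = integral\<^sup>L (lborel \<Otimes>\<^sub>M lborel) (tensor g h)"
    by (rule lborel_pair.integral_fst'[OF int])
  then show "(\<integral>p. tensor g h p \<partial>lborel) = (\<integral>x. g x \<partial>lborel) * (\<integral>y. h y \<partial>lborel)"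
    by (simp add: lborel_prod tensor_def)
qed

lemma tensor_L2:
  assumes "g \<in> L2 lborel" "h \<in> L2 lborel" shows "tensor g h \<in> L2 lborel"
proof (rule L2I)
  have [measurable]: "g \<in> borel_measurable borel" "h \<in> borel_measurable borel"
    using assms by (auto dest: L2_meas)
  have "tensor g h \<in> borel_measurable (lborel \<Otimes>\<^sub>M lborel)" unfolding tensor_def by measurable
  then show "tensor g h \<in> borel_measurable lborel" by (simp add: lborel_prod)
  have "(\<lambda>p. (tensor g h p)\<^sup>2) = tensor (\<lambda>x. (g x)\<^sup>2) (\<lambda>x. (h x)\<^sup>2)"
    by (auto simp: tensor_def power_mult_distrib)
  then show "integrable lborel (\<lambda>p. (tensor g h p)\<^sup>2)"
    using integrable_tensor(1)[OF L2_sq_int[OF assms(1)] L2_sq_int[OF assms(2)]] by (simp only:)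
qed

lemma ip_tensor:
  assumes "g \<in> L2 lborel" "h \<in> L2 lborel" "g' \<in> L2 lborel" "h' \<in> L2 lborel"
  shows "ip lborel (tensor g h) (tensor g' h') = ip lborel g g' * ip lborel h h'"
proof -
  have "(\<lambda>p. tensor g h p * tensor g' h' p) = tensor (\<lambda>x. g x * g' x) (\<lambda>x. h x * h' x)"
    by (auto simp: tensor_def)
  then show ?thesis unfolding ip_def
    using integrable_tensor(2)[OF L2_mult_int[OF assms(1,3)] L2_mult_int[OF assms(2,4)]] by (simp only:)
qed

lemma swap_L2:
  assumes "f \<in> L2 lborel" shows "(\<lambda>(x, y). f (y, x)) \<in> L2 (lborel :: (real \<times> real) measure)"
    "ip lborel (\<lambda>(x, y). f (y, x)) (\<lambda>(x, y). f (y, x)) = ip lborel f f"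
proof -
  have [measurable]: "f \<in> borel_measurable (lborel \<Otimes>\<^sub>M lborel)" using L2_meas[OF assms] by (simp add: lborel_prod)
  have sq: "(\<lambda>p. ((\<lambda>(x, y). f (y, x)) p)\<^sup>2) = (\<lambda>(x, y). (\<lambda>p. (f p)\<^sup>2) (y, x))" by auto
  have int: "integrable (lborel \<Otimes>\<^sub>M lborel) (\<lambda>p. (f p)\<^sup>2)" using L2_sq_int[OF assms] by (simp add: lborel_prod)
  show "(\<lambda>(x, y). f (y, x)) \<in> L2 (lborel :: (real \<times> real) measure)"
  proof (rule L2I)
    have "(\<lambda>(x, y). f (y, x)) \<in> borel_measurable (lborel \<Otimes>\<^sub>M lborel)" by measurable
    then show "(\<lambda>(x, y). f (y, x)) \<in> borel_measurable (lborel :: (real \<times> real) measure)" by (simp add: lborel_prod)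
    show "integrable lborel (\<lambda>p. ((\<lambda>(x, y). f (y, x)) p)\<^sup>2)"
      unfolding sq lborel_prod[symmetric] by (rule lborel_pair.integrable_product_swap[OF int])
  qed
  have "(\<integral>p. ((\<lambda>(x, y). f (y, x)) p)\<^sup>2 \<partial>(lborel \<Otimes>\<^sub>M lborel)) = (\<integral>p. (f p)\<^sup>2 \<partial>(lborel \<Otimes>\<^sub>M lborel))"
    unfolding sq by (rule lborel_pair.integral_product_swap) measurable
  then show "ip lborel (\<lambda>(x, y). f (y, x)) (\<lambda>(x, y). f (y, x)) = ip lborel f f"
    unfolding ip_self lborel_prod by simp
qed

lemma symmetrization_eq: "symmetrization f = (\<lambda>p. (1/2) * f p + (1/2) * (\<lambda>(x, y). f (y, x)) p)"
  unfolding symmetrization_def by (auto simp: field_simps)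

lemma symmetrization_sym_L2:
  assumes "f \<in> L2 lborel" shows "symmetrization f \<in> sym_L2"
proof -
  have "symmetrization f \<in> L2 lborel"
    unfolding symmetrization_eq by (rule L2_lin[OF assms swap_L2(1)[OF assms]])
  then show ?thesis unfolding sym_L2_def by (auto simp: symmetrization_def)
qed

text \<open>The coordinate swap is an isometry, so averaging a function with its swap cannot
  increase the norm.\<close>

lemma ip_symmetrization_le:
  assumes "f \<in> L2 lborel"
  shows "ip lborel (symmetrization f) (symmetrization f) \<le> ip lborel f f"
proof -
  note sw = swap_L2[OF assms]
  have "ip lborel (symmetrization f) (symmetrization f)
      \<le> 2 * ip lborel (\<lambda>p. (1/2) * f p) (\<lambda>p. (1/2) * f p)
        + 2 * ip lborel (\<lambda>p. (1/2) * (\<lambda>(x, y). f (y, x)) p) (\<lambda>p. (1/2) * (\<lambda>(x, y). f (y, x)) p)"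
    unfolding symmetrization_eq by (rule ip_self_add_le[OF L2_scale[OF assms] L2_scale[OF sw(1)]])
  then show ?thesis unfolding ip_scale_left ip_scale_right sw(2) by simp
qed

section \<open>Double integrals of tensor products\<close>

locale double_wiener = wiener M W I for M :: "'a measure" and W I +
  fixes J :: "(real \<times> real \<Rightarrow> real) \<Rightarrow> 'a \<Rightarrow> real"
  assumes dw: "is_double_wiener_integral M I J"
begin

lemma J_L2: "f \<in> sym_L2 \<Longrightarrow> J f \<in> L2 M"
  using dw unfolding is_double_wiener_integral_def bounded_linear_L2_def by blast

lemma J_lin: "f \<in> sym_L2 \<Longrightarrow> g \<in> sym_L2 \<Longrightarrow> AE \<omega> in M. J (\<lambda>x. a * f x + b * g x) \<omega> = a * J f \<omega> + b * J g \<omega>"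
  using dw unfolding is_double_wiener_integral_def bounded_linear_L2_def by blast

lemma J_square: "h \<in> L2 lborel \<Longrightarrow> ip lborel h h = 1 \<Longrightarrow> AE \<omega> in M. J (tensor h h) \<omega> = (I h \<omega>)\<^sup>2 - 1"
  using dw unfolding is_double_wiener_integral_def tensor_def ip_self by simp

lemma J_bounded: obtains K where "K \<ge> 0" "\<And>f. f \<in> sym_L2 \<Longrightarrow> ip M (J f) (J f) \<le> K * ip lborel f f"
proof -
  obtain K where K: "\<And>f. f \<in> sym_L2 \<Longrightarrow> sqrt (\<integral>\<omega>. (J f \<omega>)\<^sup>2 \<partial>M) \<le> K * sqrt (\<integral>x. (f x)\<^sup>2 \<partial>lborel)"
    using dw unfolding is_double_wiener_integral_def bounded_linear_L2_def by blast
  show ?thesis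
  proof (rule that[of "K\<^sup>2"])
    fix f assume f: "f \<in> sym_L2"
    have "(sqrt (ip M (J f) (J f)))\<^sup>2 \<le> (K * sqrt (ip lborel f f))\<^sup>2"
      using K[OF f] by (intro power_mono) (auto simp: ip_self)
    then show "ip M (J f) (J f) \<le> K\<^sup>2 * ip lborel f f"
      by (simp add: power_mult_distrib ip_self_nonneg)
  qed simp
qed

lemma tensor_sym: "h \<in> L2 lborel \<Longrightarrow> tensor h h \<in> sym_L2"
  unfolding sym_L2_def using tensor_L2[of h h] by (auto simp: tensor_def mult.commute)

lemma AE_zero_if_ip: assumes "f \<in> L2 M" "ip M f f \<le> 0" shows "AE \<omega> in M. f \<omega> = 0"
proof -
  have "ip M f f = 0" using assms(2) ip_self_nonneg[of M f] by simp
  then have "AE \<omega> in M. (f \<omega>)\<^sup>2 = 0"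
    using integral_nonneg_eq_0_iff_AE[OF L2_sq_int[OF assms(1)]] unfolding ip_self by simp
  then show ?thesis by simp
qed

text \<open>The defining property covers unit vectors, and scaling extends it to positive norm. For
  norm zero both sides vanish almost surely, the left one by the norm bound of \<open>J\<close> and
  the right one by the isometry of \<open>I\<close>.\<close>

lemma J_tensor_square:
  assumes h: "h \<in> L2 lborel"
  shows "AE \<omega> in M. J (tensor h h) \<omega> = (I h \<omega>)\<^sup>2 - ip lborel h h"
proof (cases "ip lborel h h = 0")
  case True
  obtain K where K: "\<And>f. f \<in> sym_L2 \<Longrightarrow> ip M (J f) (J f) \<le> K * ip lborel f f" by (rule J_bounded) blast
  have "ip M (J (tensor h h)) (J (tensor h h)) \<le> 0"
    using K[OF tensor_sym[OF h]] ip_tensor[OF h h h h] True by simp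
  then have 1: "AE \<omega> in M. J (tensor h h) \<omega> = 0" by (rule AE_zero_if_ip[OF J_L2[OF tensor_sym[OF h]]])
  have "ip M (I h) (I h) \<le> 0" using isometry[OF h h] True by simp
  then have 2: "AE \<omega> in M. I h \<omega> = 0" by (rule AE_zero_if_ip[OF I_L2[OF h]])
  show ?thesis using 1 2 by eventually_elim (simp add: True)
next
  case False
  define c where "c = sqrt (ip lborel h h)"
  have c: "c > 0" "c\<^sup>2 = ip lborel h h" unfolding c_def using False ip_self_nonneg[of lborel h] by auto
  define u where "u x = (1 / c) * h x" for x
  have uL: "u \<in> L2 lborel" unfolding u_def[abs_def] by (rule L2_scale[OF h])
  have "ip lborel u u = (1 / c) * ((1 / c) * ip lborel h h)"
    unfolding u_def[abs_def] ip_scale_left ip_scale_right ..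
  then have u1: "ip lborel u u = 1" unfolding c(2)[symmetric] using c(1) by (simp add: power2_eq_square)
  have hu: "h = (\<lambda>x. c * u x)" unfolding u_def using c(1) by auto
  have th: "tensor h h = (\<lambda>x. c\<^sup>2 * tensor u u x + 0 * tensor u u x)"
    unfolding u_def[abs_def] tensor_def using c(1) by (auto simp: power2_eq_square)
  have 1: "AE \<omega> in M. J (tensor h h) \<omega> = c\<^sup>2 * J (tensor u u) \<omega> + 0 * J (tensor u u) \<omega>"
    unfolding th by (rule J_lin[OF tensor_sym[OF uL] tensor_sym[OF uL]])
  have 2: "AE \<omega> in M. I h \<omega> = c * I u \<omega>" unfolding hu by (rule I_scale[OF uL, unfolded hu[symmetric]])
  show ?thesis using 1 2 J_square[OF uL u1]
    by eventually_elim (simp add: c(2)[symmetric] power_mult_distrib algebra_simps)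
qed

text \<open>Polarisation: the symmetrised tensor of \<open>g\<close> and \<open>h\<close> is a
  quarter of the difference of the tensor squares of \<open>g + h\<close> and
  \<open>g - h\<close>.\<close>

lemma J_tensor:
  assumes g: "g \<in> L2 lborel" and h: "h \<in> L2 lborel"
  shows "AE \<omega> in M. J (symmetrization (tensor g h)) \<omega> = I g \<omega> * I h \<omega> - ip lborel g h"
proof -
  let ?s = "\<lambda>x. g x + h x" and ?d = "\<lambda>x. g x - h x"
  note sL = L2_add[OF g h] and dL = L2_diff[OF g h]
  have eq: "symmetrization (tensor g h) = (\<lambda>x. (1/4) * tensor ?s ?s x + (-1/4) * tensor ?d ?d x)"
  proof (rule ext)
    fix p :: "real \<times> real"
    obtain x y where p: "p = (x, y)" by (cases p)
    show "symmetrization (tensor g h) p = (1/4) * tensor ?s ?s p + (-1/4) * tensor ?d ?d p"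
      unfolding p symmetrization_def tensor_def by (simp add: field_simps)
  qed
  have 1: "AE \<omega> in M. J (symmetrization (tensor g h)) \<omega> = (1/4) * J (tensor ?s ?s) \<omega> + (-1/4) * J (tensor ?d ?d) \<omega>"
    unfolding eq by (rule J_lin[OF tensor_sym[OF sL] tensor_sym[OF dL]])
  have 2: "AE \<omega> in M. I ?s \<omega> = I g \<omega> + I h \<omega>" using I_lin[OF g h, of 1 1] by simp
  have 3: "AE \<omega> in M. I ?d \<omega> = I g \<omega> - I h \<omega>" by (rule I_diff[OF g h])
  have 4: "ip lborel ?s ?s - ip lborel ?d ?d = 4 * ip lborel g h"
    using g h sL dL by (simp add: ip_add_left ip_add_right ip_diff_left ip_diff_right ip_commute[of lborel h g])
  show ?thesis using 1 2 3 J_tensor_square[OF sL] J_tensor_square[OF dL]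
  proof eventually_elim
    case (elim \<omega>)
    have "(I g \<omega> + I h \<omega>)\<^sup>2 - (I g \<omega> - I h \<omega>)\<^sup>2 = 4 * (I g \<omega> * I h \<omega>)" by (simp add: power2_eq_square algebra_simps)
    moreover have "J (tensor ?s ?s) \<omega> = (I g \<omega> + I h \<omega>)\<^sup>2 - ip lborel ?s ?s"
      "J (tensor ?d ?d) \<omega> = (I g \<omega> - I h \<omega>)\<^sup>2 - ip lborel ?d ?d"
      using elim(4,5) unfolding elim(2,3) .
    ultimately show ?case using elim(1) 4 by linarith
  qed
qed

lemma J_tensor_sum:
  assumes "finite A" "\<And>k. k \<in> A \<Longrightarrow> g k \<in> L2 lborel" "\<And>k. k \<in> A \<Longrightarrow> h k \<in> L2 lborel"
  shows "AE \<omega> in M. J (symmetrization (\<lambda>p. \<Sum>k\<in>A. c k * tensor (g k) (h k) p)) \<omega>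
     = (\<Sum>k\<in>A. c k * (I (g k) \<omega> * I (h k) \<omega> - ip lborel (g k) (h k)))"
  using assms
proof (induction A rule: finite_induct)
  case empty
  have z: "(\<lambda>_. 0) \<in> sym_L2" unfolding sym_L2_def using L2_zero by auto
  have "symmetrization (\<lambda>p. \<Sum>k\<in>{}. c k * tensor (g k) (h k) p) = (\<lambda>x. 0 * 0 + 0 * 0)"
    unfolding symmetrization_def by auto
  then show ?case using J_lin[OF z z, of 0 0] by simp
next
  case (insert a A)
  let ?R = "\<lambda>p. \<Sum>k\<in>A. c k * tensor (g k) (h k) p"
  have aL: "tensor (g a) (h a) \<in> L2 lborel" using insert by (intro tensor_L2) auto
  have RL: "?R \<in> L2 lborel" using insert by (intro L2_sum L2_scale tensor_L2) auto
  have eq: "symmetrization (\<lambda>p. \<Sum>k\<in>insert a A. c k * tensor (g k) (h k) p)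
     = (\<lambda>x. c a * symmetrization (tensor (g a) (h a)) x + 1 * symmetrization ?R x)"
    using insert(1,2) unfolding symmetrization_def by (auto simp: field_simps)
  have 1: "AE \<omega> in M. J (symmetrization (\<lambda>p. \<Sum>k\<in>insert a A. c k * tensor (g k) (h k) p)) \<omega>
     = c a * J (symmetrization (tensor (g a) (h a))) \<omega> + 1 * J (symmetrization ?R) \<omega>"
    unfolding eq by (rule J_lin[OF symmetrization_sym_L2[OF aL] symmetrization_sym_L2[OF RL]])
  have 2: "AE \<omega> in M. J (symmetrization (tensor (g a) (h a))) \<omega> = I (g a) \<omega> * I (h a) \<omega> - ip lborel (g a) (h a)"
    using insert by (intro J_tensor) auto
  have 3: "AE \<omega> in M. J (symmetrization ?R) \<omega> = (\<Sum>k\<in>A. c k * (I (g k) \<omega> * I (h k) \<omega> - ip lborel (g k) (h k)))"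
    using insert by auto
  show ?case using 1 2 3 by eventually_elim (use insert(1,2) in simp)
qed

text \<open>The kernels may be compared before symmetrisation, which does not increase the norm.
  \<open>U\<close> and \<open>V\<close> are arbitrary versions of the double integrals, so they can
  be concrete polynomials in Wiener integrals.\<close>

lemma J_diff_le:
  assumes K: "\<And>f. f \<in> sym_L2 \<Longrightarrow> ip M (J f) (J f) \<le> K * ip lborel f f" "K \<ge> 0"
    and f: "f \<in> L2 lborel" and g: "g \<in> L2 lborel"
    and U: "U \<in> L2 M" "AE \<omega> in M. U \<omega> = J (symmetrization f) \<omega>"
    and V: "V \<in> L2 M" "AE \<omega> in M. V \<omega> = J (symmetrization g) \<omega>"
  shows "ip M (\<lambda>\<omega>. U \<omega> - V \<omega>) (\<lambda>\<omega>. U \<omega> - V \<omega>) \<le> K * ip lborel (\<lambda>p. f p - g p) (\<lambda>p. f p - g p)"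
proof -
  let ?d = "\<lambda>p. f p - g p"
  have dL: "?d \<in> L2 lborel" by (rule L2_diff[OF f g])
  have eq: "symmetrization ?d = (\<lambda>x. 1 * symmetrization f x + (-1) * symmetrization g x)"
    unfolding symmetrization_def by (auto simp: field_simps)
  have "AE \<omega> in M. J (symmetrization ?d) \<omega> = 1 * J (symmetrization f) \<omega> + (-1) * J (symmetrization g) \<omega>"
    unfolding eq by (rule J_lin[OF symmetrization_sym_L2[OF f] symmetrization_sym_L2[OF g]])
  then have AE: "AE \<omega> in M. U \<omega> - V \<omega> = J (symmetrization ?d) \<omega>"
    using U(2) V(2) by eventually_elim simp
  have "ip M (\<lambda>\<omega>. U \<omega> - V \<omega>) (\<lambda>\<omega>. U \<omega> - V \<omega>) = ip M (J (symmetrization ?d)) (J (symmetrization ?d))"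
    unfolding ip_def
  proof (rule integral_cong_AE)
    show "AE \<omega> in M. (U \<omega> - V \<omega>) * (U \<omega> - V \<omega>) = J (symmetrization ?d) \<omega> * J (symmetrization ?d) \<omega>"
      using AE by eventually_elim simp
  qed (use L2_meas[OF U(1)] L2_meas[OF V(1)] L2_meas[OF J_L2[OF symmetrization_sym_L2[OF dL]]] in simp_all)
  also have "\<dots> \<le> K * ip lborel (symmetrization ?d) (symmetrization ?d)"
    by (rule K(1)[OF symmetrization_sym_L2[OF dL]])
  also have "\<dots> \<le> K * ip lborel ?d ?d"
    by (rule mult_left_mono[OF ip_symmetrization_le[OF dL] K(2)])
  finally show ?thesis .
qed

end

section \<open>Kernels of fractional Brownian motion\<close>

lemma pos_powr_meas [measurable]: "(\<lambda>x. pos_powr (f x) a) \<in> borel_measurable N"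
  if [measurable]: "f \<in> borel_measurable N"
  unfolding pos_powr_def by measurable

lemma pos_powr_nonneg [simp]: "pos_powr x a \<ge> 0"
  unfolding pos_powr_def by simp

lemma pos_powr_pos: "x > 0 \<Longrightarrow> pos_powr x a = x powr a"
  unfolding pos_powr_def by simp

lemma pos_powr_nonpos: "x \<le> 0 \<Longrightarrow> pos_powr x a = 0"
  unfolding pos_powr_def by simp

lemma pos_powr_mult: assumes "r > 0" shows "pos_powr (r * x) a = r powr a * pos_powr x a"
proof (cases "x > 0")
  case True
  then show ?thesis using assms by (simp add: pos_powr_pos powr_mult)
next
  case False
  then have "r * x \<le> 0" using assms by (simp add: mult_nonneg_nonpos)
  then show ?thesis using False by (simp add: pos_powr_nonpos)
qed

lemma pos_powr_mono: assumes "x \<le> y" "0 \<le> a" shows "pos_powr x a \<le> pos_powr y a"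
  unfolding pos_powr_def using assms by (intro powr_mono2) auto

text \<open>The primitive is continuous on the whole interval because \<open>a + 1 > 0\<close>,
  while the integrand may blow up at \<open>y\<close>. The fundamental theorem is therefore used
  with \<open>y\<close> as exceptional point.\<close>

lemma pos_powr_has_integral:
  assumes pq: "p \<le> q" and a: "a > -1"
  shows "((\<lambda>u. pos_powr (u - y) a) has_integral
     (pos_powr (q - y) (a + 1) - pos_powr (p - y) (a + 1)) / (a + 1)) {p..q}"
proof -
  have "((\<lambda>u. pos_powr (u - y) a) has_integral
     pos_powr (q - y) (a + 1) / (a + 1) - pos_powr (p - y) (a + 1) / (a + 1)) {p..q}"
  proof (rule fundamental_theorem_of_calculus_interior_strong[of "{y}"])
    show "continuous_on {p..q} (\<lambda>u. pos_powr (u - y) (a + 1) / (a + 1))"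
      unfolding pos_powr_def using a by (intro continuous_intros continuous_on_powr') auto
    fix u assume u: "u \<in> {p<..<q} - {y}"
    show "((\<lambda>u. pos_powr (u - y) (a + 1) / (a + 1)) has_vector_derivative pos_powr (u - y) a) (at u)"
    proof (cases "u > y")
      case True
      have d: "((\<lambda>u. (u - y) powr (a + 1) / (a + 1)) has_real_derivative (u - y) powr a) (at u)"
        using True a by (auto intro!: derivative_eq_intros)
      have "((\<lambda>u. pos_powr (u - y) (a + 1) / (a + 1)) has_real_derivative (u - y) powr a) (at u)"
      proof (rule has_field_derivative_transform_within_open[OF d, of "{y<..}"])
        show "(x - y) powr (a + 1) / (a + 1) = pos_powr (x - y) (a + 1) / (a + 1)" if "x \<in> {y<..}" for x
          using that by (simp add: pos_powr_pos)
      qed (use True in auto)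
      then show ?thesis using True
        by (simp add: has_real_derivative_iff_has_vector_derivative pos_powr_pos)
    next
      case False
      then have uy: "u < y" using u by auto
      have d: "((\<lambda>u. 0) has_real_derivative 0) (at u)" by simp
      have "((\<lambda>u. pos_powr (u - y) (a + 1) / (a + 1)) has_real_derivative 0) (at u)"
      proof (rule has_field_derivative_transform_within_open[OF d, of "{..<y}"])
        show "0 = pos_powr (x - y) (a + 1) / (a + 1)" if "x \<in> {..<y}" for x
          using that by (simp add: pos_powr_nonpos)
      qed (use uy in auto)
      then show ?thesis using uy
        by (simp add: has_real_derivative_iff_has_vector_derivative pos_powr_nonpos)
    qed
  qed (use pq in auto)
  then show ?thesis by (simp add: diff_divide_distrib)
qed

lemma pos_powr_nn_integral:
  assumes "p \<le> q" "a > -1"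
  shows "(\<integral>\<^sup>+u. ennreal (pos_powr (u - y) a) * indicator {p..q} u \<partial>lborel)
     = ennreal ((pos_powr (q - y) (a + 1) - pos_powr (p - y) (a + 1)) / (a + 1))"
  by (rule nn_integral_has_integral_lebesgue'[OF _ pos_powr_has_integral[OF assms]]) simp

lemma pos_powr_nn_integral_flip:
  assumes "p \<le> q" "a > -1"
  shows "(\<integral>\<^sup>+x. ennreal (pos_powr (s - x) a) * indicator {p..q} x \<partial>lborel)
     = ennreal ((pos_powr (s - p) (a + 1) - pos_powr (s - q) (a + 1)) / (a + 1))"
proof -
  have "(\<integral>\<^sup>+x. ennreal (pos_powr (s - x) a) * indicator {p..q} x \<partial>lborel)
     = (\<integral>\<^sup>+x. ennreal (pos_powr (s - (0 + (-1) * x)) a) * indicator {p..q} (0 + (-1) * x) \<partial>lborel)"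
    using nn_integral_real_affine[of "\<lambda>x. ennreal (pos_powr (s - x) a) * indicator {p..q} x" "-1" 0] by simp
  also have "\<dots> = (\<integral>\<^sup>+x. ennreal (pos_powr (x - (- s)) a) * indicator {- q..- p} x \<partial>lborel)"
    by (intro nn_integral_cong) (auto simp: indicator_def add.commute)
  also have "\<dots> = ennreal ((pos_powr (- p - (- s)) (a + 1) - pos_powr (- q - (- s)) (a + 1)) / (a + 1))"
    using assms by (intro pos_powr_nn_integral) auto
  finally show ?thesis by (simp add: add.commute)
qed

text \<open>Closed form of the integral of \<open>pos_powr (u - y) a\<close> over
  \<open>u \<in> {p..q}\<close>. With \<open>a = H - 3/2\<close> it is, up to the constant
  \<open>c\<close>, the kernel of the increment of fractional Brownian motion from \<open>p\<close>
  to \<open>q\<close>.\<close>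

definition cell_kernel :: "real \<Rightarrow> real \<Rightarrow> real \<Rightarrow> real \<Rightarrow> real" where
  "cell_kernel a p q y = (pos_powr (q - y) (a + 1) - pos_powr (p - y) (a + 1)) / (a + 1)"

lemma cell_kernel_meas [measurable]: "cell_kernel a p q \<in> borel_measurable borel"
  unfolding cell_kernel_def[abs_def] by measurable

lemma cell_kernel_nonneg: "p \<le> q \<Longrightarrow> a > -1 \<Longrightarrow> cell_kernel a p q y \<ge> 0"
  unfolding cell_kernel_def by (intro divide_nonneg_pos) (auto intro!: pos_powr_mono)

lemma nn_integral_cell_kernel:
  "p \<le> q \<Longrightarrow> a > -1 \<Longrightarrow> (\<integral>\<^sup>+u. ennreal (pos_powr (u - y) a) * indicator {p..q} u \<partial>lborel) = ennreal (cell_kernel a p q y)"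
  unfolding cell_kernel_def by (rule pos_powr_nn_integral)

lemma LINT_pos_powr:
  assumes "p \<le> q" "a > -1"
  shows "set_integrable lborel {p..q} (\<lambda>u. pos_powr (u - y) a)"
    "(LINT u:{p..q}|lborel. pos_powr (u - y) a) = cell_kernel a p q y"
proof -
  let ?f = "\<lambda>u. indicator {p..q} u *\<^sub>R pos_powr (u - y) a"
  have nn: "(\<integral>\<^sup>+u. ennreal (?f u) \<partial>lborel) = ennreal (cell_kernel a p q y)"
    unfolding nn_integral_cell_kernel[OF assms, symmetric]
    by (intro nn_integral_cong) (auto simp: indicator_def)
  show "set_integrable lborel {p..q} (\<lambda>u. pos_powr (u - y) a)"
    unfolding set_integrable_def by (rule integrableI_nn_integral_finite[OF _ _ nn]) auto
  show "(LINT u:{p..q}|lborel. pos_powr (u - y) a) = cell_kernel a p q y"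
    unfolding set_lebesgue_integral_def
    using nn by (subst integral_eq_nn_integral) (auto simp: cell_kernel_nonneg[OF assms])
qed

lemma fbm_kernel_eq: "t \<ge> 0 \<Longrightarrow> H > 1/2 \<Longrightarrow> fbm_kernel H t = cell_kernel (H - 3/2) 0 t"
  unfolding fbm_kernel_def by (rule ext) (rule LINT_pos_powr(2), auto)

lemma cell_kernel_diff: "cell_kernel a 0 q y - cell_kernel a 0 p y = cell_kernel a p q y"
  unfolding cell_kernel_def by (simp add: diff_divide_distrib)

text \<open>Self-similarity: the kernel of a cell of length \<open>1 / n\<close> is a translated and
  rescaled copy of the kernel of the unit interval.\<close>

lemma cell_kernel_scale:
  assumes "n > 0" "a > -1"
  shows "cell_kernel a (k / n) ((k + 1) / n) ((k + z) / n) = n powr (- (a + 1)) * cell_kernel a 0 1 z"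
proof -
  have 1: "(k + 1) / n - (k + z) / n = (1 / n) * (1 - z)" "k / n - (k + z) / n = (1 / n) * (0 - z)"
    using assms by (simp_all add: field_simps)
  have "(1 / n) powr (a + 1) = n powr (- (a + 1))"
    unfolding powr_minus_divide using assms by (simp add: powr_divide)
  then show ?thesis unfolding cell_kernel_def 1 using assms(1)
    by (simp only: pos_powr_mult[of "1/n"] zero_less_divide_1_iff) (simp add: right_diff_distrib)
qed

text \<open>Up to constants, the covariance density of fractional noise. It takes values in
  \<open>ennreal\<close> because it is infinite on the diagonal for the exponents considered,
  \<open>-1 < a < -1/2\<close>.\<close>

definition kk :: "real \<Rightarrow> real \<Rightarrow> real \<Rightarrow> ennreal" where
  "kk a s t = (\<integral>\<^sup>+x. ennreal (pos_powr (s - x) a) * ennreal (pos_powr (t - x) a) \<partial>lborel)"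

text \<open>The Beta value \<open>B(a + 1, - 2 * a - 1)\<close> as an integral;
  \<open>enn2real\<close> is faithful in the range of \<open>kconst_finite\<close>.\<close>

definition kconst :: "real \<Rightarrow> real" where
  "kconst a = enn2real (\<integral>\<^sup>+z. ennreal (pos_powr z a) * ennreal (pos_powr (z + 1) a) \<partial>lborel)"

lemma kk_commute: "kk a s t = kk a t s"
  unfolding kk_def by (simp add: mult.commute)

text \<open>Near 0 the integrand is at most \<open>z powr a\<close> with \<open>a > -1\<close>, and
  for large \<open>z\<close> at most \<open>z powr (2 * a)\<close> with
  \<open>2 * a < -1\<close>.\<close>

lemma kconst_finite:
  assumes "-1 < a" "a < -1/2"
  shows "(\<integral>\<^sup>+z. ennreal (pos_powr z a) * ennreal (pos_powr (z + 1) a) \<partial>lborel) < \<infinity>"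
proof -
  have "ennreal (pos_powr z a) * ennreal (pos_powr (z + 1) a)
      \<le> ennreal (z powr a) * indicator {0..1} z + ennreal (z powr (2 * a)) * indicator {1..} z" for z
  proof (cases "z > 0")
    case True
    have p: "pos_powr z a = z powr a" "pos_powr (z + 1) a = (z + 1) powr a" using True by (simp_all add: pos_powr_pos)
    show ?thesis
    proof (cases "z \<le> 1")
      case z1: True
      have "(z + 1) powr a \<le> 1" using powr_mono2'[of a 1 "z + 1"] True assms by simp
      then have "ennreal (z powr a) * ennreal ((z + 1) powr a) \<le> ennreal (z powr a) * 1"
        by (intro mult_left_mono) auto
      then have "ennreal (z powr a) * ennreal ((z + 1) powr a) \<le> ennreal (z powr a) * indicator {0..1} z"
        using z1 True by simp
      then show ?thesis unfolding p by (rule order_trans) (rule add_increasing2, simp_all)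
    next
      case False
      have "(z + 1) powr a \<le> z powr a" using powr_mono2'[of a z "z + 1"] True assms by simp
      then have "z powr a * (z + 1) powr a \<le> z powr (2 * a)"
        using True mult_left_mono[of "(z + 1) powr a" "z powr a" "z powr a"] by (simp flip: powr_add)
      then show ?thesis using False True unfolding p by (simp add: indicator_def flip: ennreal_mult')
    qed
  qed (simp add: pos_powr_nonpos)
  then have "(\<integral>\<^sup>+z. ennreal (pos_powr z a) * ennreal (pos_powr (z + 1) a) \<partial>lborel)
      \<le> (\<integral>\<^sup>+z. ennreal (z powr a) * indicator {0..1} z + ennreal (z powr (2 * a)) * indicator {1..} z \<partial>lborel)"
    by (intro nn_integral_mono) auto
  also have "\<dots> = (\<integral>\<^sup>+z. ennreal (z powr a) * indicator {0..1} z \<partial>lborel)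
      + (\<integral>\<^sup>+z. ennreal (z powr (2 * a)) * indicator {1..} z \<partial>lborel)"
    by (intro nn_integral_add) measurable
  also have "(\<integral>\<^sup>+z. ennreal (z powr a) * indicator {0..1} z \<partial>lborel) = ennreal (1 powr (a + 1) / (a + 1))"
    by (rule nn_integral_has_integral_lebesgue'[OF _ has_integral_powr_from_0]) (use assms in auto)
  also have "(\<integral>\<^sup>+z. ennreal (z powr (2 * a)) * indicator {1..} z \<partial>lborel) = ennreal (- (1 powr (2 * a + 1)) / (2 * a + 1))"
    by (rule nn_integral_has_integral_lebesgue'[OF _ has_integral_powr_to_inf]) (use assms in auto)
  finally show ?thesis by (rule le_less_trans) (simp add: less_top)
qed

text \<open>Substitution \<open>x = s - r * z\<close> with \<open>r = t - s\<close>: the two factors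
  contribute \<open>r powr a\<close> each, and the Jacobian one more \<open>r\<close>.\<close>

lemma kk_eq_less:
  assumes a: "-1 < a" "a < -1/2" and st: "s < t"
  shows "kk a s t = ennreal (kconst a * (t - s) powr (2 * a + 1))"
proof -
  define r where "r = t - s"
  have r: "r > 0" unfolding r_def using st by simp
  have "kk a s t = ennreal \<bar>- r\<bar> * (\<integral>\<^sup>+z. ennreal (pos_powr (s - (s + (- r) * z)) a) * ennreal (pos_powr (t - (s + (- r) * z)) a) \<partial>lborel)"
    unfolding kk_def by (rule nn_integral_real_affine) (use r in auto)
  also have "(\<lambda>z. ennreal (pos_powr (s - (s + (- r) * z)) a) * ennreal (pos_powr (t - (s + (- r) * z)) a))
     = (\<lambda>z. ennreal (r powr (2 * a)) * (ennreal (pos_powr z a) * ennreal (pos_powr (z + 1) a)))"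
  proof
    fix z
    have e: "s - (s + (- r) * z) = r * z" "t - (s + (- r) * z) = r * (z + 1)" unfolding r_def by (simp_all add: algebra_simps)
    have "pos_powr (r * z) a * pos_powr (r * (z + 1)) a = r powr (2 * a) * (pos_powr z a * pos_powr (z + 1) a)"
      unfolding pos_powr_mult[OF r] by (simp add: mult_ac flip: powr_add)
    then show "ennreal (pos_powr (s - (s + (- r) * z)) a) * ennreal (pos_powr (t - (s + (- r) * z)) a)
       = ennreal (r powr (2 * a)) * (ennreal (pos_powr z a) * ennreal (pos_powr (z + 1) a))"
      unfolding e by (simp flip: ennreal_mult)
  qed
  also have "(\<integral>\<^sup>+z. ennreal (r powr (2 * a)) * (ennreal (pos_powr z a) * ennreal (pos_powr (z + 1) a)) \<partial>lborel)
     = ennreal (r powr (2 * a)) * (\<integral>\<^sup>+z. ennreal (pos_powr z a) * ennreal (pos_powr (z + 1) a) \<partial>lborel)"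
    by (intro nn_integral_cmult) measurable
  also have "(\<integral>\<^sup>+z. ennreal (pos_powr z a) * ennreal (pos_powr (z + 1) a) \<partial>lborel) = ennreal (kconst a)"
    unfolding kconst_def using kconst_finite[OF a] by (simp add: less_top)
  also have "ennreal \<bar>- r\<bar> * (ennreal (r powr (2 * a)) * ennreal (kconst a)) = ennreal (kconst a * (r * r powr (2 * a)))"
    using r by (simp add: kconst_def mult_ac flip: ennreal_mult)
  also have "r * r powr (2 * a) = r powr (2 * a + 1)" using r by (simp add: powr_add)
  finally show ?thesis unfolding r_def .
qed

lemma kk_eq:
  assumes a: "-1 < a" "a < -1/2" and st: "s \<noteq> t"
  shows "kk a s t = ennreal (kconst a * \<bar>s - t\<bar> powr (2 * a + 1))"
proof (cases "s < t")
  case True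
  then show ?thesis using kk_eq_less[OF a True] by simp
next
  case False
  then have "t < s" using st by simp
  then show ?thesis using kk_eq_less[OF a, of t s] by (simp add: kk_commute[of a s])
qed

lemma kconst_nonneg: "kconst a \<ge> 0" unfolding kconst_def by simp

text \<open>The integral is split at \<open>s\<close>; each one-sided part is at most the integral
  over the full length, whence the 2.\<close>

lemma nn_integral_dist_powr_le:
  assumes c: "c > -1" and s: "p \<le> s" "s \<le> q"
  shows "(\<integral>\<^sup>+t. ennreal (\<bar>s - t\<bar> powr c) * indicator {p..q} t \<partial>lborel) \<le> ennreal (2 * (q - p) powr (c + 1) / (c + 1))"
proof -
  have "(\<integral>\<^sup>+t. ennreal (\<bar>s - t\<bar> powr c) * indicator {p..q} t \<partial>lborel)
     \<le> (\<integral>\<^sup>+t. ennreal (pos_powr (t - s) c) * indicator {s..q} t + ennreal (pos_powr (s - t) c) * indicator {p..s} t \<partial>lborel)"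
  proof (intro nn_integral_mono)
    fix t :: real
    consider "t < s" | "t = s" | "t > s" by linarith
    then show "ennreal (\<bar>s - t\<bar> powr c) * indicator {p..q} t
      \<le> ennreal (pos_powr (t - s) c) * indicator {s..q} t + ennreal (pos_powr (s - t) c) * indicator {p..s} t"
      by cases (auto simp: indicator_def pos_powr_pos pos_powr_nonpos)
  qed
  also have "\<dots> = (\<integral>\<^sup>+t. ennreal (pos_powr (t - s) c) * indicator {s..q} t \<partial>lborel)
      + (\<integral>\<^sup>+t. ennreal (pos_powr (s - t) c) * indicator {p..s} t \<partial>lborel)"
    by (intro nn_integral_add) measurable
  also have "\<dots> = ennreal (pos_powr (q - s) (c + 1) / (c + 1)) + ennreal (pos_powr (s - p) (c + 1) / (c + 1))"
    using pos_powr_nn_integral[OF s(2) c, of s] pos_powr_nn_integral_flip[OF s(1) c, of s]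
    by (simp add: pos_powr_nonpos)
  also have "\<dots> = ennreal (pos_powr (q - s) (c + 1) / (c + 1) + pos_powr (s - p) (c + 1) / (c + 1))"
    using c by simp
  also have "\<dots> \<le> ennreal (2 * (q - p) powr (c + 1) / (c + 1))"
  proof (rule ennreal_leI)
    have m: "pos_powr (q - s) (c + 1) \<le> pos_powr (q - p) (c + 1)" "pos_powr (s - p) (c + 1) \<le> pos_powr (q - p) (c + 1)"
      using s c by (auto intro!: pos_powr_mono)
    have "pos_powr (q - p) (c + 1) = (q - p) powr (c + 1)" unfolding pos_powr_def using s by simp
    then have "pos_powr (q - s) (c + 1) + pos_powr (s - p) (c + 1) \<le> 2 * (q - p) powr (c + 1)" using m by linarith
    then show "pos_powr (q - s) (c + 1) / (c + 1) + pos_powr (s - p) (c + 1) / (c + 1) \<le> 2 * (q - p) powr (c + 1) / (c + 1)"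
      using c by (simp add: divide_right_mono flip: add_divide_distrib)
  qed
  finally show ?thesis .
qed

section \<open>The rate of convergence of the kernels\<close>

text \<open>Tonelli for superpositions: if two functions of \<open>x\<close> are integrals over
  parameters, their pairing is the double parameter integral of the pairings of the
  integrands.\<close>

lemma nn_integral_mult_swap:
  assumes "sigma_finite_measure \<mu>" "sigma_finite_measure \<nu>" "sigma_finite_measure N"
    and f [measurable]: "case_prod f \<in> borel_measurable (\<mu> \<Otimes>\<^sub>M N)"
    and g [measurable]: "case_prod g \<in> borel_measurable (\<nu> \<Otimes>\<^sub>M N)"
  shows "(\<integral>\<^sup>+x. (\<integral>\<^sup>+s. f s x \<partial>\<mu>) * (\<integral>\<^sup>+t. g t x \<partial>\<nu>) \<partial>N) = (\<integral>\<^sup>+s. (\<integral>\<^sup>+t. (\<integral>\<^sup>+x. f s x * g t x \<partial>N) \<partial>\<nu>) \<partial>\<mu>)"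
proof -
  interpret mu: sigma_finite_measure \<mu> by fact
  interpret nu: sigma_finite_measure \<nu> by fact
  interpret N: sigma_finite_measure N by fact
  interpret A: pair_sigma_finite \<mu> N ..
  interpret B: pair_sigma_finite \<nu> N ..
  have gx [measurable]: "(\<lambda>x. \<integral>\<^sup>+t. g t x \<partial>\<nu>) \<in> borel_measurable N" by measurable
  have "(\<integral>\<^sup>+x. (\<integral>\<^sup>+s. f s x \<partial>\<mu>) * (\<integral>\<^sup>+t. g t x \<partial>\<nu>) \<partial>N) = (\<integral>\<^sup>+x. (\<integral>\<^sup>+s. f s x * (\<integral>\<^sup>+t. g t x \<partial>\<nu>) \<partial>\<mu>) \<partial>N)"
  proof (rule nn_integral_cong)
    fix x assume [measurable]: "x \<in> space N"
    show "(\<integral>\<^sup>+s. f s x \<partial>\<mu>) * (\<integral>\<^sup>+t. g t x \<partial>\<nu>) = (\<integral>\<^sup>+s. f s x * (\<integral>\<^sup>+t. g t x \<partial>\<nu>) \<partial>\<mu>)"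
      by (rule nn_integral_multc[symmetric]) measurable
  qed
  also have "\<dots> = (\<integral>\<^sup>+s. (\<integral>\<^sup>+x. f s x * (\<integral>\<^sup>+t. g t x \<partial>\<nu>) \<partial>N) \<partial>\<mu>)"
    by (rule A.Fubini') measurable
  also have "\<dots> = (\<integral>\<^sup>+s. (\<integral>\<^sup>+x. (\<integral>\<^sup>+t. f s x * g t x \<partial>\<nu>) \<partial>N) \<partial>\<mu>)"
  proof (intro nn_integral_cong)
    fix s x assume [measurable]: "s \<in> space \<mu>" "x \<in> space N"
    show "f s x * (\<integral>\<^sup>+t. g t x \<partial>\<nu>) = (\<integral>\<^sup>+t. f s x * g t x \<partial>\<nu>)"
      by (rule nn_integral_cmult[symmetric]) measurable
  qed
  also have "\<dots> = (\<integral>\<^sup>+s. (\<integral>\<^sup>+t. (\<integral>\<^sup>+x. f s x * g t x \<partial>N) \<partial>\<nu>) \<partial>\<mu>)"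
  proof (rule nn_integral_cong)
    fix s assume [measurable]: "s \<in> space \<mu>"
    show "(\<integral>\<^sup>+x. (\<integral>\<^sup>+t. f s x * g t x \<partial>\<nu>) \<partial>N) = (\<integral>\<^sup>+t. (\<integral>\<^sup>+x. f s x * g t x \<partial>N) \<partial>\<nu>)"
      by (rule B.Fubini') measurable
  qed
  finally show ?thesis .
qed

lemma nn_integral_prod_mult:
  assumes [measurable]: "u \<in> borel_measurable borel" "v \<in> borel_measurable borel"
  shows "(\<integral>\<^sup>+p. u (fst p) * v (snd p) \<partial>(lborel :: (real \<times> real) measure)) = (\<integral>\<^sup>+x. u x \<partial>lborel) * (\<integral>\<^sup>+y. v y \<partial>lborel)"
proof -
  have "(\<integral>\<^sup>+p. u (fst p) * v (snd p) \<partial>(lborel :: (real \<times> real) measure))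
     = (\<integral>\<^sup>+x. (\<integral>\<^sup>+y. u x * v y \<partial>lborel) \<partial>lborel)"
    unfolding lborel_prod[symmetric] by (subst lborel.nn_integral_fst[symmetric]) auto
  also have "\<dots> = (\<integral>\<^sup>+x. u x * (\<integral>\<^sup>+y. v y \<partial>lborel) \<partial>lborel)"
    by (intro nn_integral_cong nn_integral_cmult) measurable
  also have "\<dots> = (\<integral>\<^sup>+x. u x \<partial>lborel) * (\<integral>\<^sup>+y. v y \<partial>lborel)" by (rule nn_integral_multc) measurable
  finally show ?thesis .
qed

text \<open>Passes from extended valued integrals, where Tonelli is unconditional, to
  \<open>ip\<close>. The finite upper bound \<open>hi\<close> excludes the case in which
  \<open>enn2real\<close> would turn an infinite integral into 0.\<close>

lemma ip_between:
  assumes [measurable]: "u \<in> borel_measurable N" "v \<in> borel_measurable N"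
    and nn: "\<And>x. 0 \<le> u x" "\<And>x. 0 \<le> v x"
    and ae: "AE x in N. ennreal (u x) = U x" "AE x in N. ennreal (v x) = V x"
    and le: "ennreal lo \<le> (\<integral>\<^sup>+x. U x * V x \<partial>N)" "(\<integral>\<^sup>+x. U x * V x \<partial>N) \<le> ennreal hi" and pos: "0 \<le> lo" "0 \<le> hi"
  shows "lo \<le> ip N u v" "ip N u v \<le> hi"
proof -
  have eq: "(\<integral>\<^sup>+x. ennreal (u x * v x) \<partial>N) = (\<integral>\<^sup>+x. U x * V x \<partial>N)"
  proof (rule nn_integral_cong_AE)
    show "AE x in N. ennreal (u x * v x) = U x * V x"
      using ae by eventually_elim (simp add: ennreal_mult nn)
  qed
  have ip: "ip N u v = enn2real (\<integral>\<^sup>+x. U x * V x \<partial>N)"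
    unfolding ip_def eq[symmetric] by (rule integral_eq_nn_integral) (use nn in auto)
  show "lo \<le> ip N u v"
    unfolding ip using enn2real_mono[OF le(1)] le(2) pos by (simp add: le_less_trans)
  show "ip N u v \<le> hi"
    unfolding ip using enn2real_mono[OF le(2)] pos by simp
qed

locale rosenblatt_exponents =
  fixes a b :: real
  assumes ab: "-1 < a" "a < -1/2" "-1 < b" "b < -1/2" "-3/2 < a + b"
begin

text \<open>The exponent of \<open>kk a s t * kk b s t\<close> as a power of
  \<open>\<bar>s - t\<bar>\<close>. The condition \<open>\<gamma> > -1\<close>, local integrability
  of this power, is exactly \<open>H1 + H2 > 3/2\<close>.\<close>

definition \<gamma> :: real where "\<gamma> = 2 * a + 2 * b + 2"

lemma gamma: "-1 < \<gamma>" "\<gamma> < 0" unfolding \<gamma>_def using ab by auto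

definition C :: real where "C = kconst a * kconst b"

lemma C_nonneg: "C \<ge> 0" unfolding C_def by (simp add: kconst_nonneg)

text \<open>
  \<open>D p q\<close> is the part of the Rosenblatt kernel coming from \<open>s \<in> {p..q}\<close>, and \<open>Dn\<close> its extended valued version,
  which is additive in the interval everywhere; the Bochner integral \<open>D\<close> is \<open>0\<close> where \<open>Dn\<close> is infinite.
\<close>

definition Dn :: "real \<Rightarrow> real \<Rightarrow> real \<times> real \<Rightarrow> ennreal" where
  "Dn p q z = (\<integral>\<^sup>+s. ennreal (pos_powr (s - fst z) a) * ennreal (pos_powr (s - snd z) b) * indicator {p..q} s \<partial>lborel)"

definition D :: "real \<Rightarrow> real \<Rightarrow> real \<times> real \<Rightarrow> real" where
  "D p q = (\<lambda>(x, y). LINT s:{p..q}|lborel. pos_powr (s - x) a * pos_powr (s - y) b)"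

text \<open>Tensor of the kernels of the two increments over the cell. Divided by the cell length it
  is the piece of the approximating kernel that corresponds to \<open>D p q\<close>.\<close>

definition T :: "real \<Rightarrow> real \<Rightarrow> real \<times> real \<Rightarrow> real" where
  "T p q = tensor (cell_kernel a p q) (cell_kernel b p q)"

lemma meas_ab [measurable]: "(\<lambda>x. (f x :: real \<times> real)) \<in> borel_measurable N \<Longrightarrow> (\<lambda>x. fst (f x)) \<in> borel_measurable N"
  "(\<lambda>x. (f x :: real \<times> real)) \<in> borel_measurable N \<Longrightarrow> (\<lambda>x. snd (f x)) \<in> borel_measurable N"
  using measurable_compose[of f N borel fst borel] measurable_compose[of f N borel snd borel]
  by (auto simp: borel_prod[symmetric])

lemma Dn_joint [measurable]:
  "case_prod (\<lambda>s z. ennreal (pos_powr (s - fst z) a) * ennreal (pos_powr (s - snd z) b) * indicator {p..q} s)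
     \<in> borel_measurable (lborel \<Otimes>\<^sub>M (lborel :: (real \<times> real) measure))"
proof -
  have [measurable]: "(\<lambda>x. fst (snd x)) \<in> borel_measurable (lborel \<Otimes>\<^sub>M (lborel :: (real \<times> real) measure))"
    "(\<lambda>x. snd (snd x)) \<in> borel_measurable (lborel \<Otimes>\<^sub>M (lborel :: (real \<times> real) measure))"
    by (intro meas_ab; simp)+
  show ?thesis unfolding split_beta by measurable
qed

lemma Dn_meas [measurable]: "Dn p q \<in> borel_measurable lborel"
  unfolding Dn_def[abs_def]
proof (rule lborel.borel_measurable_nn_integral)
  have "(\<lambda>x. (snd x, fst x)) \<in> measurable ((lborel :: (real \<times> real) measure) \<Otimes>\<^sub>M (lborel :: real measure)) (lborel \<Otimes>\<^sub>M (lborel :: (real \<times> real) measure))"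
    by measurable
  from measurable_compose[OF this Dn_joint[of p q]]
  show "case_prod (\<lambda>z s. ennreal (pos_powr (s - fst z) a) * ennreal (pos_powr (s - snd z) b) * indicator {p..q} s)
     \<in> borel_measurable ((lborel :: (real \<times> real) measure) \<Otimes>\<^sub>M lborel)" by (simp add: split_beta)
qed

lemma D_eq: "D p q z = enn2real (Dn p q z)"
proof -
  have "D p q z = (\<integral>s. indicator {p..q} s * (pos_powr (s - fst z) a * pos_powr (s - snd z) b) \<partial>lborel)"
    unfolding D_def set_lebesgue_integral_def by (simp add: split_beta)
  also have "\<dots> = enn2real (\<integral>\<^sup>+s. ennreal (indicator {p..q} s * (pos_powr (s - fst z) a * pos_powr (s - snd z) b)) \<partial>lborel)"
    by (rule integral_eq_nn_integral) auto
  also have "(\<integral>\<^sup>+s. ennreal (indicator {p..q} s * (pos_powr (s - fst z) a * pos_powr (s - snd z) b)) \<partial>lborel) = Dn p q z"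
    unfolding Dn_def by (intro nn_integral_cong) (auto simp: indicator_def ennreal_mult)
  finally show ?thesis .
qed

lemma D_nonneg: "D p q z \<ge> 0" unfolding D_eq by simp

lemma D_meas [measurable]: "D p q \<in> borel_measurable lborel"
  unfolding D_eq[abs_def] by measurable

text \<open>For fixed \<open>s\<close> and \<open>t\<close> the integral over the plane factorises
  into \<open>kk a s t\<close> and \<open>kk b s t\<close>.\<close>

lemma Dn_Dn: "(\<integral>\<^sup>+z. Dn p q z * Dn p' q' z \<partial>lborel)
   = (\<integral>\<^sup>+s. (\<integral>\<^sup>+t. kk a s t * kk b s t * indicator {p'..q'} t \<partial>lborel) * indicator {p..q} s \<partial>lborel)"
proof -
  have "(\<integral>\<^sup>+z. Dn p q z * Dn p' q' z \<partial>lborel)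
    = (\<integral>\<^sup>+s. (\<integral>\<^sup>+t. (\<integral>\<^sup>+z. (ennreal (pos_powr (s - fst z) a) * ennreal (pos_powr (s - snd z) b) * indicator {p..q} s)
        * (ennreal (pos_powr (t - fst z) a) * ennreal (pos_powr (t - snd z) b) * indicator {p'..q'} t) \<partial>lborel) \<partial>lborel) \<partial>lborel)"
    unfolding Dn_def by (rule nn_integral_mult_swap) (auto intro: lborel.sigma_finite_measure_axioms sigma_finite_lborel)
  also have "\<dots> = (\<integral>\<^sup>+s. (\<integral>\<^sup>+t. (kk a s t * kk b s t * indicator {p'..q'} t) * indicator {p..q} s \<partial>lborel) \<partial>lborel)"
  proof (intro nn_integral_cong)
    fix s t :: real
    have "(\<integral>\<^sup>+z. (ennreal (pos_powr (s - fst z) a) * ennreal (pos_powr (s - snd z) b) * indicator {p..q} s)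
        * (ennreal (pos_powr (t - fst z) a) * ennreal (pos_powr (t - snd z) b) * indicator {p'..q'} t) \<partial>(lborel :: (real \<times> real) measure))
      = (\<integral>\<^sup>+z. (\<lambda>x. ennreal (pos_powr (s - x) a) * ennreal (pos_powr (t - x) a)) (fst z)
         * (\<lambda>y. (ennreal (pos_powr (s - y) b) * ennreal (pos_powr (t - y) b)) * (indicator {p'..q'} t * indicator {p..q} s)) (snd z) \<partial>lborel)"
      by (intro nn_integral_cong) (simp add: mult_ac)
    also have "\<dots> = kk a s t * (kk b s t * (indicator {p'..q'} t * indicator {p..q} s))"
      unfolding kk_def by (subst nn_integral_prod_mult) (auto simp: nn_integral_multc)
    finally show "(\<integral>\<^sup>+z. (ennreal (pos_powr (s - fst z) a) * ennreal (pos_powr (s - snd z) b) * indicator {p..q} s)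
        * (ennreal (pos_powr (t - fst z) a) * ennreal (pos_powr (t - snd z) b) * indicator {p'..q'} t) \<partial>(lborel :: (real \<times> real) measure))
      = (kk a s t * kk b s t * indicator {p'..q'} t) * indicator {p..q} s" by (simp add: mult_ac)
  qed
  also have "\<dots> = (\<integral>\<^sup>+s. (\<integral>\<^sup>+t. kk a s t * kk b s t * indicator {p'..q'} t \<partial>lborel) * indicator {p..q} s \<partial>lborel)"
    by (intro nn_integral_cong) (auto simp: indicator_def)
  finally show ?thesis .
qed

text \<open>For fixed \<open>s\<close> a product function pairs with each factor of the kernel
  separately. This serves both the tensor \<open>T\<close> and products of indicators.\<close>

lemma Dn_prod:
  assumes [measurable]: "u \<in> borel_measurable borel" "v \<in> borel_measurable borel"
  shows "(\<integral>\<^sup>+z. Dn p q z * (u (fst z) * v (snd z)) \<partial>lborel)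
   = (\<integral>\<^sup>+s. ((\<integral>\<^sup>+x. ennreal (pos_powr (s - x) a) * u x \<partial>lborel) * (\<integral>\<^sup>+y. ennreal (pos_powr (s - y) b) * v y \<partial>lborel)) * indicator {p..q} s \<partial>lborel)"
proof -
  have uv: "(\<lambda>z. u (fst z) * v (snd z)) \<in> borel_measurable (lborel :: (real \<times> real) measure)"
  proof -
    have "fst \<in> borel_measurable (lborel :: (real \<times> real) measure)" "snd \<in> borel_measurable (lborel :: (real \<times> real) measure)"
      using meas_ab[of "\<lambda>x. x" lborel] by auto
    then show ?thesis using measurable_compose[of fst _ borel u borel] measurable_compose[of snd _ borel v borel] by measurable
  qed
  have "(\<integral>\<^sup>+z. Dn p q z * (u (fst z) * v (snd z)) \<partial>lborel)
     = (\<integral>\<^sup>+z. (\<integral>\<^sup>+s. (ennreal (pos_powr (s - fst z) a) * ennreal (pos_powr (s - snd z) b) * indicator {p..q} s) * (u (fst z) * v (snd z)) \<partial>lborel) \<partial>lborel)"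
    unfolding Dn_def by (intro nn_integral_cong nn_integral_multc[symmetric]) measurable
  also have "\<dots> = (\<integral>\<^sup>+s. (\<integral>\<^sup>+z. (ennreal (pos_powr (s - fst z) a) * ennreal (pos_powr (s - snd z) b) * indicator {p..q} s) * (u (fst z) * v (snd z)) \<partial>lborel) \<partial>lborel)"
  proof (rule lborel_pair.Fubini')
    have uv': "(\<lambda>x. (u (fst (snd x)) * v (snd (snd x)))) \<in> borel_measurable ((lborel :: real measure) \<Otimes>\<^sub>M (lborel :: (real \<times> real) measure))"
      using measurable_compose[OF measurable_snd uv] by simp
    show "(\<lambda>(s, z). (ennreal (pos_powr (s - fst z) a) * ennreal (pos_powr (s - snd z) b) * indicator {p..q} s) * (u (fst z) * v (snd z)))
        \<in> borel_measurable ((lborel :: real measure) \<Otimes>\<^sub>M (lborel :: (real \<times> real) measure))"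
      using borel_measurable_times_ennreal[OF Dn_joint[of p q] uv'] by (simp add: split_beta)
  qed
  also have "\<dots> = (\<integral>\<^sup>+s. ((\<integral>\<^sup>+x. ennreal (pos_powr (s - x) a) * u x \<partial>lborel) * (\<integral>\<^sup>+y. ennreal (pos_powr (s - y) b) * v y \<partial>lborel)) * indicator {p..q} s \<partial>lborel)"
  proof (rule nn_integral_cong)
    fix s :: real
    have "(\<integral>\<^sup>+z. (ennreal (pos_powr (s - fst z) a) * ennreal (pos_powr (s - snd z) b) * indicator {p..q} s) * (u (fst z) * v (snd z)) \<partial>(lborel :: (real \<times> real) measure))
      = (\<integral>\<^sup>+z. (\<lambda>x. ennreal (pos_powr (s - x) a) * u x) (fst z) * (\<lambda>y. (ennreal (pos_powr (s - y) b) * v y) * indicator {p..q} s) (snd z) \<partial>lborel)"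
      by (intro nn_integral_cong) (simp add: mult_ac)
    also have "\<dots> = (\<integral>\<^sup>+x. ennreal (pos_powr (s - x) a) * u x \<partial>lborel) * ((\<integral>\<^sup>+y. ennreal (pos_powr (s - y) b) * v y \<partial>lborel) * indicator {p..q} s)"
      by (subst nn_integral_prod_mult) (auto simp: nn_integral_multc)
    finally show "(\<integral>\<^sup>+z. (ennreal (pos_powr (s - fst z) a) * ennreal (pos_powr (s - snd z) b) * indicator {p..q} s) * (u (fst z) * v (snd z)) \<partial>(lborel :: (real \<times> real) measure))
      = ((\<integral>\<^sup>+x. ennreal (pos_powr (s - x) a) * u x \<partial>lborel) * (\<integral>\<^sup>+y. ennreal (pos_powr (s - y) b) * v y \<partial>lborel)) * indicator {p..q} s"
      by (simp add: mult_ac)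
  qed
  finally show ?thesis .
qed

end

text \<open>The cell kernel is the superposition of the functions \<open>pos_powr (t - x) c\<close>
  over \<open>t\<close> in the cell, so by Tonelli its pairing with one such function is an integral
  of \<open>kk\<close>.\<close>

lemma kk_cell:
  assumes "p \<le> q" "c > -1"
  shows "(\<integral>\<^sup>+x. ennreal (pos_powr (s - x) c) * ennreal (cell_kernel c p q x) \<partial>lborel) = (\<integral>\<^sup>+t. kk c s t * indicator {p..q} t \<partial>lborel)"
proof -
  have "(\<integral>\<^sup>+x. ennreal (pos_powr (s - x) c) * ennreal (cell_kernel c p q x) \<partial>lborel)
     = (\<integral>\<^sup>+x. (\<integral>\<^sup>+t. ennreal (pos_powr (s - x) c) * (ennreal (pos_powr (t - x) c) * indicator {p..q} t) \<partial>lborel) \<partial>lborel)"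
    unfolding nn_integral_cell_kernel[OF assms, symmetric]
    by (intro nn_integral_cong nn_integral_cmult[symmetric]) measurable
  also have "\<dots> = (\<integral>\<^sup>+t. (\<integral>\<^sup>+x. ennreal (pos_powr (s - x) c) * (ennreal (pos_powr (t - x) c) * indicator {p..q} t) \<partial>lborel) \<partial>lborel)"
    by (rule lborel_pair.Fubini') measurable
  also have "\<dots> = (\<integral>\<^sup>+t. kk c s t * indicator {p..q} t \<partial>lborel)"
    unfolding kk_def mult.assoc[symmetric] by (intro nn_integral_cong nn_integral_multc) measurable
  finally show ?thesis .
qed

lemma cell_cell:
  assumes "p \<le> q" "c > -1" "p' \<le> q'"
  shows "(\<integral>\<^sup>+x. ennreal (cell_kernel c p q x) * ennreal (cell_kernel c p' q' x) \<partial>lborel)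
     = (\<integral>\<^sup>+s. (\<integral>\<^sup>+t. kk c s t * indicator {p'..q'} t \<partial>lborel) * indicator {p..q} s \<partial>lborel)"
proof -
  have "(\<integral>\<^sup>+x. ennreal (cell_kernel c p q x) * ennreal (cell_kernel c p' q' x) \<partial>lborel)
     = (\<integral>\<^sup>+x. (\<integral>\<^sup>+s. (ennreal (pos_powr (s - x) c) * indicator {p..q} s) * ennreal (cell_kernel c p' q' x) \<partial>lborel) \<partial>lborel)"
    unfolding nn_integral_cell_kernel[OF assms(1,2), symmetric]
    by (intro nn_integral_cong nn_integral_multc[symmetric]) measurable
  also have "\<dots> = (\<integral>\<^sup>+s. (\<integral>\<^sup>+x. (ennreal (pos_powr (s - x) c) * indicator {p..q} s) * ennreal (cell_kernel c p' q' x) \<partial>lborel) \<partial>lborel)"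
    by (rule lborel_pair.Fubini') measurable
  also have "\<dots> = (\<integral>\<^sup>+s. (\<integral>\<^sup>+x. ennreal (pos_powr (s - x) c) * ennreal (cell_kernel c p' q' x) \<partial>lborel) * indicator {p..q} s \<partial>lborel)"
    by (intro nn_integral_cong) (auto simp: indicator_def)
  finally show ?thesis unfolding kk_cell[OF assms(3,2)] .
qed

lemma nn_integral_Icc_le:
  assumes "\<And>s. s \<in> {p..q} \<Longrightarrow> f s \<le> ennreal h" "0 \<le> h" "p \<le> q"
  shows "(\<integral>\<^sup>+s. f s * indicator {p..q} s \<partial>lborel) \<le> ennreal (h * (q - p))"
proof -
  have "(\<integral>\<^sup>+s. f s * indicator {p..q} s \<partial>lborel) \<le> (\<integral>\<^sup>+s. ennreal h * indicator {p..q} s \<partial>lborel)"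
    using assms(1) by (intro nn_integral_mono) (auto simp: indicator_def)
  also have "\<dots> = ennreal h * ennreal (q - p)" using assms by (subst nn_integral_cmult_indicator) auto
  also have "\<dots> = ennreal (h * (q - p))" using assms by (simp add: ennreal_mult)
  finally show ?thesis .
qed

lemma nn_integral_Icc_ge:
  assumes "\<And>s. s \<in> {p..q} \<Longrightarrow> ennreal h \<le> f s" "0 \<le> h" "p \<le> q"
  shows "ennreal (h * (q - p)) \<le> (\<integral>\<^sup>+s. f s * indicator {p..q} s \<partial>lborel)"
proof -
  have "ennreal (h * (q - p)) = ennreal h * ennreal (q - p)" using assms by (simp add: ennreal_mult)
  also have "\<dots> = (\<integral>\<^sup>+s. ennreal h * indicator {p..q} s \<partial>lborel)" using assms by (subst nn_integral_cmult_indicator) auto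
  also have "\<dots> \<le> (\<integral>\<^sup>+s. f s * indicator {p..q} s \<partial>lborel)"
    using assms(1) by (intro nn_integral_mono) (auto simp: indicator_def)
  finally show ?thesis .
qed

text \<open>The diagonal, where \<open>kk\<close> is infinite, is a single point for each fixed
  \<open>s\<close>; elsewhere the power \<open>2 * c + 1 > -1\<close> is integrable.\<close>

lemma kk_self_cell_le:
  assumes c: "-1 < c" "c < -1/2" and s: "p \<le> s" "s \<le> q"
  shows "(\<integral>\<^sup>+t. kk c s t * indicator {p..q} t \<partial>lborel) \<le> ennreal (kconst c * (2 * (q - p) powr (2 * c + 2) / (2 * c + 2)))"
proof -
  have "(\<integral>\<^sup>+t. kk c s t * indicator {p..q} t \<partial>lborel)
     = (\<integral>\<^sup>+t. ennreal (kconst c) * (ennreal (\<bar>s - t\<bar> powr (2 * c + 1)) * indicator {p..q} t) \<partial>lborel)"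
  proof (rule nn_integral_cong_AE)
    show "AE t in lborel. kk c s t * indicator {p..q} t = ennreal (kconst c) * (ennreal (\<bar>s - t\<bar> powr (2 * c + 1)) * indicator {p..q} t)"
      using AE_lborel_singleton[of s]
      by eventually_elim (simp add: kk_eq[OF c] ennreal_mult kconst_nonneg mult_ac)
  qed
  also have "\<dots> = ennreal (kconst c) * (\<integral>\<^sup>+t. ennreal (\<bar>s - t\<bar> powr (2 * c + 1)) * indicator {p..q} t \<partial>lborel)"
    by (intro nn_integral_cmult) measurable
  also have "\<dots> \<le> ennreal (kconst c) * ennreal (2 * (q - p) powr ((2 * c + 1) + 1) / ((2 * c + 1) + 1))"
    using nn_integral_dist_powr_le[of "2 * c + 1" p s q] c s by (intro mult_left_mono) auto
  also have "\<dots> = ennreal (kconst c * (2 * (q - p) powr (2 * c + 2) / (2 * c + 2)))"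
    using c by (subst ennreal_mult[symmetric]) (auto simp: kconst_nonneg add.commute)
  finally show ?thesis .
qed

text \<open>The squared norm is the double integral of \<open>kk\<close> over the cell, and
  \<open>kk_self_cell_le\<close> bounds the inner integral uniformly in \<open>s\<close>.\<close>

lemma cell_kernel_L2:
  assumes c: "-1 < c" "c < -1/2" and pq: "p \<le> q"
  shows "cell_kernel c p q \<in> L2 lborel"
    "ip lborel (cell_kernel c p q) (cell_kernel c p q) \<le> kconst c * (2 * (q - p) powr (2 * c + 2) / (2 * c + 2)) * (q - p)"
proof -
  let ?h = "kconst c * (2 * (q - p) powr (2 * c + 2) / (2 * c + 2))"
  have h: "0 \<le> ?h" using c by (intro mult_nonneg_nonneg divide_nonneg_pos) (auto simp: kconst_nonneg)
  have hq: "0 \<le> ?h * (q - p)" by (rule mult_nonneg_nonneg[OF h]) (use pq in simp)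
  have le: "(\<integral>\<^sup>+x. ennreal (cell_kernel c p q x) * ennreal (cell_kernel c p q x) \<partial>lborel) \<le> ennreal (?h * (q - p))"
    unfolding cell_cell[OF pq c(1) pq]
    by (rule nn_integral_Icc_le[OF _ h pq]) (use kk_self_cell_le[OF c] in auto)
  have nn: "0 \<le> cell_kernel c p q x" for x using cell_kernel_nonneg[OF pq c(1)] .
  have sq: "ennreal (cell_kernel c p q x) * ennreal (cell_kernel c p q x) = ennreal ((cell_kernel c p q x)\<^sup>2)" for x
    by (simp add: nn power2_eq_square flip: ennreal_mult)
  show "cell_kernel c p q \<in> L2 lborel"
  proof (rule L2I)
    show "integrable lborel (\<lambda>x. (cell_kernel c p q x)\<^sup>2)"
      using le unfolding sq by (intro integrableI_nonneg) (auto intro: le_less_trans)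
  qed measurable
  show "ip lborel (cell_kernel c p q) (cell_kernel c p q) \<le> ?h * (q - p)"
    by (rule ip_between(2)[of _ _ _ "\<lambda>x. ennreal (cell_kernel c p q x)" "\<lambda>x. ennreal (cell_kernel c p q x)" 0])
      (use le nn hq in simp_all)
qed

context rosenblatt_exponents
begin

lemma powr_gamma: "x powr \<gamma> = x powr (2 * a + 1) * x powr (2 * b + 1)"
  unfolding powr_add[symmetric] \<gamma>_def by (rule arg_cong[where f="\<lambda>e. x powr e"]) simp

lemma kk_prod: "s \<noteq> t \<Longrightarrow> kk a s t * kk b s t = ennreal (C * \<bar>s - t\<bar> powr \<gamma>)"
  unfolding kk_eq[OF ab(1,2)] kk_eq[OF ab(3,4)] C_def powr_gamma
  by (simp add: kconst_nonneg mult_ac flip: ennreal_mult)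

definition D_bound :: "real \<Rightarrow> real" where "D_bound l = C * (2 * l powr (\<gamma> + 1) / (\<gamma> + 1)) * l"

text \<open>The squared norm is the double integral of
  \<open>C * \<bar>s - t\<bar> powr \<gamma>\<close> over the cell, finite because
  \<open>\<gamma> > -1\<close>.\<close>

lemma Dn_self_le:
  assumes "p \<le> q" shows "(\<integral>\<^sup>+z. Dn p q z * Dn p q z \<partial>lborel) \<le> ennreal (D_bound (q - p))"
  unfolding Dn_Dn D_bound_def
proof (rule nn_integral_Icc_le)
  fix s assume s: "s \<in> {p..q}"
  have "(\<integral>\<^sup>+t. kk a s t * kk b s t * indicator {p..q} t \<partial>lborel)
     = (\<integral>\<^sup>+t. ennreal C * (ennreal (\<bar>s - t\<bar> powr \<gamma>) * indicator {p..q} t) \<partial>lborel)"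
  proof (rule nn_integral_cong_AE)
    show "AE t in lborel. kk a s t * kk b s t * indicator {p..q} t = ennreal C * (ennreal (\<bar>s - t\<bar> powr \<gamma>) * indicator {p..q} t)"
      using AE_lborel_singleton[of s] by eventually_elim (simp add: kk_prod ennreal_mult C_nonneg mult_ac)
  qed
  also have "\<dots> = ennreal C * (\<integral>\<^sup>+t. ennreal (\<bar>s - t\<bar> powr \<gamma>) * indicator {p..q} t \<partial>lborel)"
    by (intro nn_integral_cmult) measurable
  also have "\<dots> \<le> ennreal C * ennreal (2 * (q - p) powr (\<gamma> + 1) / (\<gamma> + 1))"
    using nn_integral_dist_powr_le[OF gamma(1), of p s q] s by (intro mult_left_mono) auto
  also have "\<dots> = ennreal (C * (2 * (q - p) powr (\<gamma> + 1) / (\<gamma> + 1)))"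
    using gamma by (subst ennreal_mult[symmetric]) (auto simp: C_nonneg)
  finally show "(\<integral>\<^sup>+t. kk a s t * kk b s t * indicator {p..q} t \<partial>lborel) \<le> ennreal (C * (2 * (q - p) powr (\<gamma> + 1) / (\<gamma> + 1)))" .
qed (use assms gamma C_nonneg in \<open>auto intro!: mult_nonneg_nonneg divide_nonneg_pos\<close>)

lemma Dn_finite: assumes "p \<le> q" shows "AE z in lborel. Dn p q z < \<infinity>"
proof -
  have "(\<integral>\<^sup>+z. Dn p q z * Dn p q z \<partial>lborel) \<noteq> \<infinity>" using le_less_trans[OF Dn_self_le[OF assms] ennreal_less_top] by simp
  then have "AE z in lborel. Dn p q z * Dn p q z \<noteq> \<infinity>"
    by (intro nn_integral_PInf_AE) measurable
  then show ?thesis by eventually_elim (auto simp: less_top ennreal_mult_eq_top_iff)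
qed

lemma D_AE: assumes "p \<le> q" shows "AE z in lborel. ennreal (D p q z) = Dn p q z"
  using Dn_finite[OF assms] by eventually_elim (simp add: D_eq less_top)

lemma D_L2: assumes "p \<le> q" shows "D p q \<in> L2 lborel" "ip lborel (D p q) (D p q) \<le> D_bound (q - p)"
proof -
  have "(\<integral>\<^sup>+z. ennreal ((D p q z)\<^sup>2) \<partial>lborel) = (\<integral>\<^sup>+z. Dn p q z * Dn p q z \<partial>lborel)"
  proof (rule nn_integral_cong_AE)
    show "AE z in lborel. ennreal ((D p q z)\<^sup>2) = Dn p q z * Dn p q z"
      using D_AE[OF assms] by eventually_elim (simp add: power2_eq_square ennreal_mult D_nonneg)
  qed
  then have "(\<integral>\<^sup>+z. ennreal ((D p q z)\<^sup>2) \<partial>lborel) < \<infinity>"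
    using le_less_trans[OF Dn_self_le[OF assms] ennreal_less_top] by simp
  then have "integrable lborel (\<lambda>z. (D p q z)\<^sup>2)" by (intro integrableI_nonneg) auto
  then show "D p q \<in> L2 lborel" by (intro L2I) measurable
  have B: "0 \<le> D_bound (q - p)" unfolding D_bound_def using assms gamma C_nonneg
    by (intro mult_nonneg_nonneg divide_nonneg_pos) auto
  show "ip lborel (D p q) (D p q) \<le> D_bound (q - p)"
    by (rule ip_between(2)[OF D_meas D_meas D_nonneg D_nonneg D_AE[OF assms] D_AE[OF assms] _ Dn_self_le[OF assms] order_refl B]) simp
qed

lemma T_L2: assumes "p \<le> q" shows "T p q \<in> L2 lborel"
  unfolding T_def by (rule tensor_L2[OF cell_kernel_L2(1)[OF ab(1,2) assms] cell_kernel_L2(1)[OF ab(3,4) assms]])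

text \<open>The value of \<open>kk a s t * kk b s t\<close> at distance \<open>d\<close>. As
  \<open>\<gamma>\<close> is negative it decreases in \<open>d\<close>, so for distances between
  \<open>d1\<close> and \<open>d2\<close> the lower bound is \<open>bnd d2\<close> and the upper one
  \<open>bnd d1\<close>.\<close>

definition bnd :: "real \<Rightarrow> real" where "bnd d = C * d powr \<gamma>"

section \<open>Inner products for two separated cells\<close>

context
  fixes p q p' q' d1 d2 :: real
  assumes pq: "p \<le> q" "p' \<le> q'" and d: "0 < d1" "d1 \<le> d2"
    and sep: "\<forall>s\<in>{p..q}. \<forall>t\<in>{p'..q'}. d1 \<le> \<bar>s - t\<bar> \<and> \<bar>s - t\<bar> \<le> d2"
begin

lemma kk_bounds:
  assumes c: "-1 < c" "c < -1/2" and st: "s \<in> {p..q}" "t \<in> {p'..q'}"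
  shows "ennreal (kconst c * d2 powr (2 * c + 1)) \<le> kk c s t" "kk c s t \<le> ennreal (kconst c * d1 powr (2 * c + 1))"
proof -
  have b: "d1 \<le> \<bar>s - t\<bar> \<and> \<bar>s - t\<bar> \<le> d2" using sep st by blast
  then have nz: "s \<noteq> t" "d1 \<le> \<bar>s - t\<bar>" "\<bar>s - t\<bar> \<le> d2" using d by auto
  show "ennreal (kconst c * d2 powr (2 * c + 1)) \<le> kk c s t" "kk c s t \<le> ennreal (kconst c * d1 powr (2 * c + 1))"
    unfolding kk_eq[OF c nz(1)] using nz d c
    by (auto intro!: ennreal_leI mult_left_mono kconst_nonneg powr_mono2')
qed

lemma kk_bounds_cell:
  assumes c: "-1 < c" "c < -1/2" and s: "s \<in> {p..q}"
  shows "ennreal (kconst c * d2 powr (2 * c + 1) * (q' - p')) \<le> (\<integral>\<^sup>+t. kk c s t * indicator {p'..q'} t \<partial>lborel)"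
    "(\<integral>\<^sup>+t. kk c s t * indicator {p'..q'} t \<partial>lborel) \<le> ennreal (kconst c * d1 powr (2 * c + 1) * (q' - p'))"
  by (rule nn_integral_Icc_ge nn_integral_Icc_le; use kk_bounds[OF c s] pq in \<open>auto intro!: mult_nonneg_nonneg kconst_nonneg\<close>)+

lemma lo_hi_eq:
  "kconst a * d2 powr (2 * a + 1) * (kconst b * d2 powr (2 * b + 1)) = bnd d2"
  "kconst a * d1 powr (2 * a + 1) * (kconst b * d1 powr (2 * b + 1)) = bnd d1"
  unfolding bnd_def C_def powr_gamma by (simp_all add: mult_ac)

lemma lo_hi_nonneg: "0 \<le> bnd d2" "0 \<le> bnd d1"
  unfolding bnd_def by (auto intro!: mult_nonneg_nonneg C_nonneg)

lemma DD_bounds: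
  "bnd d2 * (q' - p') * (q - p) \<le> ip lborel (D p q) (D p' q')" "ip lborel (D p q) (D p' q') \<le> bnd d1 * (q' - p') * (q - p)"
proof -
  have kb: "ennreal (bnd d2) \<le> kk a s t * kk b s t" "kk a s t * kk b s t \<le> ennreal (bnd d1)" if "s \<in> {p..q}" "t \<in> {p'..q'}" for s t
  proof -
    have "ennreal (kconst a * d2 powr (2 * a + 1)) * ennreal (kconst b * d2 powr (2 * b + 1)) \<le> kk a s t * kk b s t"
      using kk_bounds[OF ab(1,2) that] kk_bounds[OF ab(3,4) that] by (intro mult_mono) auto
    then show "ennreal (bnd d2) \<le> kk a s t * kk b s t"
      unfolding lo_hi_eq(1)[symmetric] by (subst ennreal_mult) (auto intro!: mult_nonneg_nonneg kconst_nonneg)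
    have "kk a s t * kk b s t \<le> ennreal (kconst a * d1 powr (2 * a + 1)) * ennreal (kconst b * d1 powr (2 * b + 1))"
      using kk_bounds[OF ab(1,2) that] kk_bounds[OF ab(3,4) that] by (intro mult_mono) auto
    then show "kk a s t * kk b s t \<le> ennreal (bnd d1)"
      unfolding lo_hi_eq(2)[symmetric] by (subst ennreal_mult) (auto intro!: mult_nonneg_nonneg kconst_nonneg)
  qed
  have nn: "0 \<le> bnd d2 * (q' - p')" "0 \<le> bnd d1 * (q' - p')" "0 \<le> bnd d2 * (q' - p') * (q - p)" "0 \<le> bnd d1 * (q' - p') * (q - p)"
    using lo_hi_nonneg pq by (auto intro!: mult_nonneg_nonneg)
  have le: "ennreal (bnd d2 * (q' - p') * (q - p)) \<le> (\<integral>\<^sup>+z. Dn p q z * Dn p' q' z \<partial>lborel)"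
    "(\<integral>\<^sup>+z. Dn p q z * Dn p' q' z \<partial>lborel) \<le> ennreal (bnd d1 * (q' - p') * (q - p))"
    unfolding Dn_Dn
    by (rule nn_integral_Icc_ge[OF nn_integral_Icc_ge[OF kb(1) lo_hi_nonneg(1) pq(2)] nn(1) pq(1)]; assumption)
      (rule nn_integral_Icc_le[OF nn_integral_Icc_le[OF kb(2) lo_hi_nonneg(2) pq(2)] nn(2) pq(1)]; assumption)
  show "bnd d2 * (q' - p') * (q - p) \<le> ip lborel (D p q) (D p' q')" "ip lborel (D p q) (D p' q') \<le> bnd d1 * (q' - p') * (q - p)"
    by (rule ip_between[OF D_meas D_meas D_nonneg D_nonneg D_AE[OF pq(1)] D_AE[OF pq(2)] le nn(3,4)])+
qed

lemma ennreal_T: "r \<le> r' \<Longrightarrow> ennreal (T r r' z) = ennreal (cell_kernel a r r' (fst z)) * ennreal (cell_kernel b r r' (snd z))"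
  unfolding T_def tensor_def using ab by (cases z) (simp add: ennreal_mult cell_kernel_nonneg)

lemma T_nonneg: "r \<le> r' \<Longrightarrow> 0 \<le> T r r' z"
  unfolding T_def tensor_def using ab by (cases z) (simp add: cell_kernel_nonneg)

lemma T_meas: "T r r' \<in> borel_measurable lborel"
proof -
  have "T r r' \<in> borel_measurable (lborel \<Otimes>\<^sub>M lborel)" unfolding T_def tensor_def by measurable
  then show ?thesis by (simp add: lborel_prod)
qed

lemma DT_bounds:
  "bnd d2 * (q' - p')\<^sup>2 * (q - p) \<le> ip lborel (D p q) (T p' q')" "ip lborel (D p q) (T p' q') \<le> bnd d1 * (q' - p')\<^sup>2 * (q - p)"
proof -
  let ?A = "\<lambda>s. \<integral>\<^sup>+t. kk a s t * indicator {p'..q'} t \<partial>lborel" and ?B = "\<lambda>s. \<integral>\<^sup>+t. kk b s t * indicator {p'..q'} t \<partial>lborel"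
  have eq: "(\<integral>\<^sup>+z. Dn p q z * ennreal (T p' q' z) \<partial>lborel) = (\<integral>\<^sup>+s. ?A s * ?B s * indicator {p..q} s \<partial>lborel)"
    unfolding ennreal_T[OF pq(2)] kk_cell[OF pq(2) ab(1), symmetric] kk_cell[OF pq(2) ab(3), symmetric]
    by (rule Dn_prod) measurable
  have nn: "0 \<le> bnd d2 * (q' - p')\<^sup>2" "0 \<le> bnd d1 * (q' - p')\<^sup>2" "0 \<le> bnd d2 * (q' - p')\<^sup>2 * (q - p)" "0 \<le> bnd d1 * (q' - p')\<^sup>2 * (q - p)"
    using lo_hi_nonneg pq by (auto intro!: mult_nonneg_nonneg)
  have e1: "kconst a * d2 powr (2 * a + 1) * (q' - p') * (kconst b * d2 powr (2 * b + 1) * (q' - p')) = bnd d2 * (q' - p')\<^sup>2"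
    "kconst a * d1 powr (2 * a + 1) * (q' - p') * (kconst b * d1 powr (2 * b + 1) * (q' - p')) = bnd d1 * (q' - p')\<^sup>2"
    unfolding lo_hi_eq[symmetric] by (simp_all add: power2_eq_square mult_ac)
  have kb: "ennreal (bnd d2 * (q' - p')\<^sup>2) \<le> ?A s * ?B s" "?A s * ?B s \<le> ennreal (bnd d1 * (q' - p')\<^sup>2)" if s: "s \<in> {p..q}" for s
  proof -
    have "ennreal (kconst a * d2 powr (2 * a + 1) * (q' - p')) * ennreal (kconst b * d2 powr (2 * b + 1) * (q' - p')) \<le> ?A s * ?B s"
      using kk_bounds_cell[OF ab(1,2) s] kk_bounds_cell[OF ab(3,4) s] by (intro mult_mono) auto
    then show "ennreal (bnd d2 * (q' - p')\<^sup>2) \<le> ?A s * ?B s"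
      unfolding e1(1)[symmetric] using pq by (subst ennreal_mult) (auto intro!: mult_nonneg_nonneg kconst_nonneg)
    have "?A s * ?B s \<le> ennreal (kconst a * d1 powr (2 * a + 1) * (q' - p')) * ennreal (kconst b * d1 powr (2 * b + 1) * (q' - p'))"
      using kk_bounds_cell[OF ab(1,2) s] kk_bounds_cell[OF ab(3,4) s] by (intro mult_mono) auto
    then show "?A s * ?B s \<le> ennreal (bnd d1 * (q' - p')\<^sup>2)"
      unfolding e1(2)[symmetric] using pq by (subst ennreal_mult) (auto intro!: mult_nonneg_nonneg kconst_nonneg)
  qed
  have le: "ennreal (bnd d2 * (q' - p')\<^sup>2 * (q - p)) \<le> (\<integral>\<^sup>+z. Dn p q z * ennreal (T p' q' z) \<partial>lborel)"
    "(\<integral>\<^sup>+z. Dn p q z * ennreal (T p' q' z) \<partial>lborel) \<le> ennreal (bnd d1 * (q' - p')\<^sup>2 * (q - p))"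
    unfolding eq
    by (rule nn_integral_Icc_ge[OF kb(1) nn(1) pq(1)]; assumption) (rule nn_integral_Icc_le[OF kb(2) nn(2) pq(1)]; assumption)
  show "bnd d2 * (q' - p')\<^sup>2 * (q - p) \<le> ip lborel (D p q) (T p' q')" "ip lborel (D p q) (T p' q') \<le> bnd d1 * (q' - p')\<^sup>2 * (q - p)"
    by (rule ip_between[OF D_meas T_meas D_nonneg T_nonneg[OF pq(2)] D_AE[OF pq(1)] AE_I2[OF refl] le nn(3,4)])+
qed

lemma cell_bounds:
  assumes c: "-1 < c" "c < -1/2"
  shows "kconst c * d2 powr (2 * c + 1) * (q' - p') * (q - p) \<le> ip lborel (cell_kernel c p q) (cell_kernel c p' q')"
    "ip lborel (cell_kernel c p q) (cell_kernel c p' q') \<le> kconst c * d1 powr (2 * c + 1) * (q' - p') * (q - p)"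
proof -
  have nn: "0 \<le> kconst c * d2 powr (2 * c + 1) * (q' - p')" "0 \<le> kconst c * d1 powr (2 * c + 1) * (q' - p')"
    "0 \<le> kconst c * d2 powr (2 * c + 1) * (q' - p') * (q - p)" "0 \<le> kconst c * d1 powr (2 * c + 1) * (q' - p') * (q - p)"
    using pq by (auto intro!: mult_nonneg_nonneg kconst_nonneg)
  have le: "ennreal (kconst c * d2 powr (2 * c + 1) * (q' - p') * (q - p))
       \<le> (\<integral>\<^sup>+x. ennreal (cell_kernel c p q x) * ennreal (cell_kernel c p' q' x) \<partial>lborel)"
    "(\<integral>\<^sup>+x. ennreal (cell_kernel c p q x) * ennreal (cell_kernel c p' q' x) \<partial>lborel)
       \<le> ennreal (kconst c * d1 powr (2 * c + 1) * (q' - p') * (q - p))"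
    unfolding cell_cell[OF pq(1) c(1) pq(2)]
    by (rule nn_integral_Icc_ge[OF kk_bounds_cell(1)[OF c] nn(1) pq(1)]; assumption)
      (rule nn_integral_Icc_le[OF kk_bounds_cell(2)[OF c] nn(2) pq(1)]; assumption)
  show "kconst c * d2 powr (2 * c + 1) * (q' - p') * (q - p) \<le> ip lborel (cell_kernel c p q) (cell_kernel c p' q')"
    "ip lborel (cell_kernel c p q) (cell_kernel c p' q') \<le> kconst c * d1 powr (2 * c + 1) * (q' - p') * (q - p)"
    by (rule ip_between[OF _ _ cell_kernel_nonneg[OF pq(1) c(1)] cell_kernel_nonneg[OF pq(2) c(1)] AE_I2[OF refl] AE_I2[OF refl] le nn(3,4)]; simp)+
qed

lemma TT_bounds:
  "bnd d2 * (q' - p')\<^sup>2 * (q - p)\<^sup>2 \<le> ip lborel (T p q) (T p' q')" "ip lborel (T p q) (T p' q') \<le> bnd d1 * (q' - p')\<^sup>2 * (q - p)\<^sup>2"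
proof -
  have ip: "ip lborel (T p q) (T p' q') = ip lborel (cell_kernel a p q) (cell_kernel a p' q') * ip lborel (cell_kernel b p q) (cell_kernel b p' q')"
    unfolding T_def using pq ab by (intro ip_tensor cell_kernel_L2) auto
  let ?l = "q' - p'" and ?m = "q - p"
  have "bnd d2 * ?l\<^sup>2 * ?m\<^sup>2 = (kconst a * d2 powr (2 * a + 1) * ?l * ?m) * (kconst b * d2 powr (2 * b + 1) * ?l * ?m)"
    unfolding lo_hi_eq[symmetric] by (simp add: power2_eq_square mult_ac)
  also have "\<dots> \<le> ip lborel (T p q) (T p' q')"
    unfolding ip using cell_bounds(1)[OF ab(1,2)] cell_bounds(1)[OF ab(3,4)] pq
    by (intro mult_mono) (auto intro!: mult_nonneg_nonneg kconst_nonneg intro: order_trans[rotated])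
  finally show "bnd d2 * ?l\<^sup>2 * ?m\<^sup>2 \<le> ip lborel (T p q) (T p' q')" .
  have nn: "0 \<le> ip lborel (cell_kernel b p q) (cell_kernel b p' q')"
    unfolding ip_def using cell_kernel_nonneg[OF pq(1) ab(3)] cell_kernel_nonneg[OF pq(2) ab(3)] by (intro Bochner_Integration.integral_nonneg) simp
  have "ip lborel (T p q) (T p' q') \<le> (kconst a * d1 powr (2 * a + 1) * ?l * ?m) * (kconst b * d1 powr (2 * b + 1) * ?l * ?m)"
    unfolding ip using cell_bounds(2)[OF ab(1,2)] cell_bounds(2)[OF ab(3,4)] pq nn
    by (intro mult_mono) (auto intro!: mult_nonneg_nonneg kconst_nonneg)
  also have "\<dots> = bnd d1 * ?l\<^sup>2 * ?m\<^sup>2"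
    unfolding lo_hi_eq[symmetric] by (simp add: power2_eq_square mult_ac)
  finally show "ip lborel (T p q) (T p' q') \<le> bnd d1 * ?l\<^sup>2 * ?m\<^sup>2" .
qed

end

text \<open>
  All four inner products lie between \<open>l\<^sup>2 * bnd d2\<close> and \<open>l\<^sup>2 * bnd d1\<close> and enter with cancelling signs.
\<close>

lemma far_bound:
  assumes l: "l > 0" "q - p = l" "q' - p' = l" and d: "0 < d1" "d1 \<le> d2"
    and sep: "\<forall>s\<in>{p..q}. \<forall>t\<in>{p'..q'}. d1 \<le> \<bar>s - t\<bar> \<and> \<bar>s - t\<bar> \<le> d2"
  shows "\<bar>ip lborel (\<lambda>z. D p q z - (1 / l) * T p q z) (\<lambda>z. D p' q' z - (1 / l) * T p' q' z)\<bar>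
     \<le> 2 * C * l\<^sup>2 * (d1 powr \<gamma> - d2 powr \<gamma>)"
proof -
  have pq: "p \<le> q" "p' \<le> q'" using l by auto
  have sep': "\<forall>s\<in>{p'..q'}. \<forall>t\<in>{p..q}. d1 \<le> \<bar>s - t\<bar> \<and> \<bar>s - t\<bar> \<le> d2"
  proof (intro ballI)
    fix s t assume "s \<in> {p'..q'}" "t \<in> {p..q}"
    then have "d1 \<le> \<bar>t - s\<bar> \<and> \<bar>t - s\<bar> \<le> d2" using sep by blast
    then show "d1 \<le> \<bar>s - t\<bar> \<and> \<bar>s - t\<bar> \<le> d2" by (simp add: abs_minus_commute)
  qed
  note DL = D_L2(1)[OF pq(1)] D_L2(1)[OF pq(2)] and TL = L2_scale[OF T_L2[OF pq(1)], of "1/l"] L2_scale[OF T_L2[OF pq(2)], of "1/l"]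
  note FL = L2_diff[OF DL(1) TL(1)] L2_diff[OF DL(2) TL(2)]
  have eq: "ip lborel (\<lambda>z. D p q z - (1 / l) * T p q z) (\<lambda>z. D p' q' z - (1 / l) * T p' q' z)
     = ip lborel (D p q) (D p' q') - (1 / l) * ip lborel (D p q) (T p' q') - (1 / l) * ip lborel (D p' q') (T p q)
       + (1 / l) * ((1 / l) * ip lborel (T p q) (T p' q'))"
    unfolding ip_diff_left[OF DL(1) TL(1) FL(2)] ip_diff_right[OF DL(2) TL(2) DL(1)] ip_scale_left
      ip_diff_right[OF DL(2) TL(2) T_L2[OF pq(1)]] ip_scale_right ip_commute[of lborel "T p q" "D p' q'"]
    by (simp add: right_diff_distrib)
  let ?lo = "bnd d2" and ?hi = "bnd d1"
  have dd: "?lo * l\<^sup>2 \<le> ip lborel (D p q) (D p' q')" "ip lborel (D p q) (D p' q') \<le> ?hi * l\<^sup>2"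
    using DD_bounds[OF pq d sep] l by (simp_all add: power2_eq_square mult_ac)
  have aux: "(1 / l) * (X * (l\<^sup>2 * l)) = X * l\<^sup>2" "(1 / l) * ((1 / l) * (X * (l\<^sup>2 * l\<^sup>2))) = X * l\<^sup>2" for X
    using l(1) by (simp_all add: power2_eq_square)
  have m: "(1 / l) * x \<le> (1 / l) * y" if "x \<le> y" for x y using that l(1) by (intro mult_left_mono) auto
  have dt: "?lo * l\<^sup>2 \<le> (1 / l) * ip lborel (D p q) (T p' q')" "(1 / l) * ip lborel (D p q) (T p' q') \<le> ?hi * l\<^sup>2"
    using m[OF DT_bounds(1)[OF pq d sep]] m[OF DT_bounds(2)[OF pq d sep]] l
    by (simp_all only: mult.assoc aux)
  have td: "?lo * l\<^sup>2 \<le> (1 / l) * ip lborel (D p' q') (T p q)" "(1 / l) * ip lborel (D p' q') (T p q) \<le> ?hi * l\<^sup>2"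
    using m[OF DT_bounds(1)[OF pq(2,1) d sep']] m[OF DT_bounds(2)[OF pq(2,1) d sep']] l
    by (simp_all only: mult.assoc aux)
  have tt: "?lo * l\<^sup>2 \<le> (1 / l) * ((1 / l) * ip lborel (T p q) (T p' q'))" "(1 / l) * ((1 / l) * ip lborel (T p q) (T p' q')) \<le> ?hi * l\<^sup>2"
    using m[OF m[OF TT_bounds(1)[OF pq d sep]]] m[OF m[OF TT_bounds(2)[OF pq d sep]]] l
    by (simp_all only: mult.assoc aux)
  have "2 * C * l\<^sup>2 * (d1 powr \<gamma> - d2 powr \<gamma>) = 2 * (?hi * l\<^sup>2) - 2 * (?lo * l\<^sup>2)" unfolding bnd_def by (simp add: algebra_simps)
  then show ?thesis unfolding eq using dd dt td tt by linarith
qed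

text \<open>Collects the constants of \<open>near_bound\<close>: twice the bound for
  \<open>D\<close> and twice the one for \<open>(1 / l) * T\<close>.\<close>

definition C0 :: real where
  "C0 = 4 * C / (\<gamma> + 1) + 8 * C / ((2 * a + 2) * (2 * b + 2))"

lemma C0_nonneg: "C0 \<ge> 0"
  unfolding C0_def using C_nonneg gamma ab by (intro add_nonneg_nonneg divide_nonneg_pos mult_pos_pos mult_nonneg_nonneg) auto

text \<open>No cancellation is exploited within a single cell: \<open>D\<close> and
  \<open>(1 / l) * T\<close> each have squared norm of order
  \<open>l powr (\<gamma> + 2)\<close>.\<close>

lemma near_bound:
  assumes l: "l > 0" "q - p = l"
  shows "ip lborel (\<lambda>z. D p q z - (1 / l) * T p q z) (\<lambda>z. D p q z - (1 / l) * T p q z) \<le> C0 * l powr (\<gamma> + 2)"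
proof -
  have pq: "p \<le> q" using l by auto
  let ?A = "ip lborel (cell_kernel a p q) (cell_kernel a p q)" and ?B = "ip lborel (cell_kernel b p q) (cell_kernel b p q)"
  have TT: "ip lborel (T p q) (T p q) = ?A * ?B"
    unfolding T_def using pq ab by (intro ip_tensor cell_kernel_L2) auto
  have A: "?A \<le> kconst a * (2 * l powr (2 * a + 2) / (2 * a + 2)) * l"
    using cell_kernel_L2(2)[OF ab(1,2) pq] unfolding l(2) .
  have B: "?B \<le> kconst b * (2 * l powr (2 * b + 2) / (2 * b + 2)) * l"
    using cell_kernel_L2(2)[OF ab(3,4) pq] unfolding l(2) .
  have "?A * ?B \<le> (kconst a * (2 * l powr (2 * a + 2) / (2 * a + 2)) * l) * (kconst b * (2 * l powr (2 * b + 2) / (2 * b + 2)) * l)"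
    using A B l(1) ab by (intro mult_mono) (auto intro!: mult_nonneg_nonneg divide_nonneg_pos kconst_nonneg ip_self_nonneg)
  also have "\<dots> = 4 * C / ((2 * a + 2) * (2 * b + 2)) * (l powr (2 * a + 2) * l powr (2 * b + 2)) * l\<^sup>2"
    unfolding C_def by (simp add: power2_eq_square mult_ac)
  also have "l powr (2 * a + 2) * l powr (2 * b + 2) = l powr (\<gamma> + 2)"
    unfolding \<gamma>_def by (simp add: algebra_simps flip: powr_add)
  finally have tt: "ip lborel (T p q) (T p q) \<le> 4 * C / ((2 * a + 2) * (2 * b + 2)) * l powr (\<gamma> + 2) * l\<^sup>2" unfolding TT .
  then have tt': "(1 / l) * ((1 / l) * ip lborel (T p q) (T p q)) \<le> (1 / l) * ((1 / l) * (4 * C / ((2 * a + 2) * (2 * b + 2)) * l powr (\<gamma> + 2) * l\<^sup>2))"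
    using l(1) by (intro mult_left_mono) auto
  also have "\<dots> = 4 * C / ((2 * a + 2) * (2 * b + 2)) * l powr (\<gamma> + 2)"
    using l(1) by (simp add: power2_eq_square)
  finally have tt'': "(1 / l) * ((1 / l) * ip lborel (T p q) (T p q)) \<le> 4 * C / ((2 * a + 2) * (2 * b + 2)) * l powr (\<gamma> + 2)" .
  have e: "\<gamma> + 2 = (\<gamma> + 1) + 1" by simp
  have "l powr (\<gamma> + 2) = l powr (\<gamma> + 1) * l"
    unfolding e powr_add[of l "\<gamma> + 1" 1] using l(1) by simp
  then have dd: "ip lborel (D p q) (D p q) \<le> 2 * C / (\<gamma> + 1) * l powr (\<gamma> + 2)"
    using D_L2(2)[OF pq] unfolding l(2) D_bound_def by (simp add: mult_ac)
  have "ip lborel (\<lambda>z. D p q z - (1 / l) * T p q z) (\<lambda>z. D p q z - (1 / l) * T p q z)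
     \<le> 2 * ip lborel (D p q) (D p q) + 2 * ip lborel (\<lambda>z. (1 / l) * T p q z) (\<lambda>z. (1 / l) * T p q z)"
    by (rule ip_self_diff_le[OF D_L2(1)[OF pq] L2_scale[OF T_L2[OF pq]]])
  also have "\<dots> \<le> 2 * (2 * C / (\<gamma> + 1) * l powr (\<gamma> + 2)) + 2 * (4 * C / ((2 * a + 2) * (2 * b + 2)) * l powr (\<gamma> + 2))"
    using dd tt'' unfolding ip_scale_left ip_scale_right by linarith
  also have "\<dots> = C0 * l powr (\<gamma> + 2)" unfolding C0_def by (simp add: algebra_simps)
  finally show ?thesis .
qed

end

section \<open>Summation over all pairs of cells\<close>

lemma sum_dist_le:
  fixes g :: "nat \<Rightarrow> real"
  assumes "k < n" "\<And>j. 0 \<le> g j"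
  shows "(\<Sum>l<n. g (if k \<le> l then l - k else k - l)) \<le> 2 * (\<Sum>j<n. g j)"
proof -
  let ?f = "\<lambda>l. g (if k \<le> l then l - k else k - l)"
  have "{..<n} = {..<k} \<union> {k..<n}" using assms(1) by auto
  then have "(\<Sum>l<n. ?f l) = (\<Sum>l\<in>{..<k} \<union> {k..<n}. ?f l)" by simp
  also have "\<dots> = (\<Sum>l<k. ?f l) + (\<Sum>l\<in>{k..<n}. ?f l)" by (rule sum.union_disjoint) auto
  also have "(\<Sum>l<k. ?f l) = (\<Sum>j\<in>(\<lambda>l. k - l) ` {..<k}. g j)"
    by (subst sum.reindex) (auto simp: inj_on_def intro!: sum.cong)
  also have "\<dots> \<le> (\<Sum>j<n. g j)"
    using assms by (intro sum_mono2) auto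
  also have "(\<Sum>l\<in>{k..<n}. ?f l) = (\<Sum>j\<in>(\<lambda>l. l - k) ` {k..<n}. g j)"
    by (subst sum.reindex) (auto simp: inj_on_def intro!: sum.cong)
  also have "\<dots> \<le> (\<Sum>j<n. g j)"
    using assms by (intro sum_mono2) auto
  finally show ?thesis by simp
qed

text \<open>Two-step differences form two interlaced telescoping sums, which leave
  \<open>h 1 + h 2\<close> minus two non-negative terms.\<close>

lemma telescope_two_step:
  fixes h :: "nat \<Rightarrow> real"
  assumes "\<And>j. 0 \<le> h j" "\<And>j. 1 \<le> j \<Longrightarrow> h j \<le> 1"
  shows "(\<Sum>j\<in>{2..<n}. h (j - 1) - h (j + 1)) \<le> 2"
proof -
  have "n \<ge> 2 \<Longrightarrow> (\<Sum>j\<in>{2..<n}. h (j - 1) - h (j + 1)) = h 1 + h 2 - h (n - 1) - h n"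
    by (induction n rule: dec_induct) (auto simp: numeral_2_eq_2)
  then show ?thesis
    using assms(1)[of "n - 1"] assms(1)[of n] assms(2)[of 1] assms(2)[of 2] by (cases "n \<ge> 2") auto
qed

context rosenblatt_exponents
begin

text \<open>The factor \<open>1 / (1 / real n)\<close> is left in this form to match
  \<open>near_bound\<close> and \<open>far_bound\<close> with \<open>l = 1 / real n\<close>.\<close>

definition cell_error :: "nat \<Rightarrow> nat \<Rightarrow> real \<times> real \<Rightarrow> real" where
  "cell_error n k z = D (real k / real n) ((real k + 1) / real n) z
     - (1 / (1 / real n)) * T (real k / real n) ((real k + 1) / real n) z"

lemma cell_error_L2: "cell_error n k \<in> L2 lborel"
proof -
  have "real k / real n \<le> (real k + 1) / real n" by (intro divide_right_mono) auto
  then show ?thesis unfolding cell_error_def[abs_def] by (intro L2_diff L2_scale D_L2 T_L2)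
qed

lemma cell_distance:
  assumes "n \<ge> 1" "real j = \<bar>real k - real l\<bar>" "j \<ge> 2"
    and "s \<in> {real k / real n..(real k + 1) / real n}" "t \<in> {real l / real n..(real l + 1) / real n}"
  shows "(real j - 1) / real n \<le> \<bar>s - t\<bar> \<and> \<bar>s - t\<bar> \<le> (real j + 1) / real n"
proof -
  have n: "real n > 0" using assms(1) by simp
  have st: "real k \<le> s * real n" "s * real n \<le> real k + 1" "real l \<le> t * real n" "t * real n \<le> real l + 1"
    using assms(4,5) n by (auto simp: field_simps)
  have e: "\<bar>s - t\<bar> = \<bar>s * real n - t * real n\<bar> / real n"
    using n by (simp add: abs_mult flip: left_diff_distrib)
  have "real j - 1 \<le> \<bar>s * real n - t * real n\<bar>" "\<bar>s * real n - t * real n\<bar> \<le> real j + 1"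
    using st assms(2,3) by linarith+
  then show ?thesis unfolding e using n by (intro conjI divide_right_mono) auto
qed

text \<open>Neighbouring cells touch, so index distances 0 and 1 fall back on Cauchy-Schwarz and
  \<open>near_bound\<close>. From 2 on, points of cells at index distance \<open>j\<close> are
  between \<open>(j - 1) / n\<close> and \<open>(j + 1) / n\<close> apart, which is where the
  two-step difference comes from.\<close>

definition error_bound :: "nat \<Rightarrow> nat \<Rightarrow> real" where
  "error_bound n j = (1 / real n) powr (\<gamma> + 2) *
     (if j \<le> 1 then C0 else 2 * C * (real (j - 1) powr \<gamma> - real (j + 1) powr \<gamma>))"

lemma error_bound_nonneg: "0 \<le> error_bound n j"
proof (cases "j \<le> 1")
  case True
  then show ?thesis unfolding error_bound_def using C0_nonneg by simp
next
  case False
  then have "real (j + 1) powr \<gamma> \<le> real (j - 1) powr \<gamma>" using gamma by (intro powr_mono2') auto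
  then show ?thesis unfolding error_bound_def using False C_nonneg by (auto intro!: mult_nonneg_nonneg)
qed

lemma cell_error_ip:
  assumes n: "n \<ge> 1"
  shows "\<bar>ip lborel (cell_error n k) (cell_error n l)\<bar> \<le> error_bound n (if k \<le> l then l - k else k - l)"
proof -
  define j where "j = (if k \<le> l then l - k else k - l)"
  have j: "real j = \<bar>real k - real l\<bar>" unfolding j_def by auto
  have n0: "1 / real n > 0" using n by simp
  have len: "(real i + 1) / real n - real i / real n = 1 / real n" for i by (simp add: add_divide_distrib)
  have p2: "(1 / real n) powr (\<gamma> + 2) = (1 / real n)\<^sup>2 * (1 / real n) powr \<gamma>"
    using n0 by (simp add: powr_add powr_numeral)
  show ?thesis
  proof (cases "j \<le> 1")
    case True
    have self: "ip lborel (cell_error n i) (cell_error n i) \<le> C0 * (1 / real n) powr (\<gamma> + 2)" for i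
      unfolding cell_error_def[abs_def] by (rule near_bound[OF n0 len])
    have "\<bar>ip lborel (cell_error n k) (cell_error n l)\<bar>
       \<le> sqrt (ip lborel (cell_error n k) (cell_error n k)) * sqrt (ip lborel (cell_error n l) (cell_error n l))"
      by (rule ip_abs_le[OF cell_error_L2 cell_error_L2])
    also have "\<dots> \<le> sqrt (C0 * (1 / real n) powr (\<gamma> + 2)) * sqrt (C0 * (1 / real n) powr (\<gamma> + 2))"
      by (intro mult_mono real_sqrt_le_mono self) (auto simp: C0_nonneg ip_self_nonneg)
    also have "\<dots> = C0 * (1 / real n) powr (\<gamma> + 2)" using C0_nonneg by simp
    finally show ?thesis using True unfolding error_bound_def j_def[symmetric] by (simp add: mult.commute)
  next
    case False
    then have j2: "j \<ge> 2" by simp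
    have d: "0 < (real j - 1) / real n" "(real j - 1) / real n \<le> (real j + 1) / real n"
      using j2 n by (auto intro!: divide_right_mono)
    have "\<bar>ip lborel (cell_error n k) (cell_error n l)\<bar>
       \<le> 2 * C * (1 / real n)\<^sup>2 * (((real j - 1) / real n) powr \<gamma> - ((real j + 1) / real n) powr \<gamma>)"
      unfolding cell_error_def[abs_def]
      by (rule far_bound[OF n0 len len d]) (intro ballI cell_distance[OF n j j2])
    also have "((real j - 1) / real n) powr \<gamma> = real (j - 1) powr \<gamma> * (1 / real n) powr \<gamma>"
      using j2 by (subst powr_mult[symmetric]) (auto simp: of_nat_diff)
    also have "((real j + 1) / real n) powr \<gamma> = real (j + 1) powr \<gamma> * (1 / real n) powr \<gamma>"
      by (subst powr_mult[symmetric]) (auto simp: add.commute)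
    finally show ?thesis using False unfolding error_bound_def j_def[symmetric] p2 by (simp add: algebra_simps)
  qed
qed

lemma error_bound_sum: "(\<Sum>j<n. error_bound n j) \<le> (1 / real n) powr (\<gamma> + 2) * (2 * C0 + 4 * C)"
proof -
  let ?g = "\<lambda>j. if j \<le> 1 then C0 else 2 * C * (real (j - 1) powr \<gamma> - real (j + 1) powr \<gamma>)"
  have g0: "0 \<le> ?g j" for j
    using gamma C_nonneg C0_nonneg by (auto intro!: mult_nonneg_nonneg powr_mono2')
  have "(\<Sum>j<n. ?g j) \<le> (\<Sum>j\<in>{..<2} \<union> {2..<n}. ?g j)"
    by (intro sum_mono2) (use g0 in auto)
  also have "\<dots> = (\<Sum>j\<in>{..<2}. ?g j) + (\<Sum>j\<in>{2..<n}. ?g j)"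
    by (rule sum.union_disjoint) auto
  also have "(\<Sum>j\<in>{..<2}. ?g j) = 2 * C0" by (simp add: numeral_2_eq_2)
  also have "(\<Sum>j\<in>{2..<n}. ?g j) = 2 * C * (\<Sum>j\<in>{2..<n}. real (j - 1) powr \<gamma> - real (j + 1) powr \<gamma>)"
    unfolding sum_distrib_left by (intro sum.cong) auto
  also have "\<dots> \<le> 2 * C * 2"
  proof (intro mult_left_mono telescope_two_step[of "\<lambda>j. real j powr \<gamma>"])
    fix j :: nat assume "1 \<le> j"
    then show "real j powr \<gamma> \<le> 1" using powr_mono2'[of \<gamma> 1 "real j"] gamma by simp
  qed (use C_nonneg in auto)
  finally have "(\<Sum>j<n. ?g j) \<le> 2 * C0 + 4 * C" by simp
  then show ?thesis unfolding error_bound_def sum_distrib_left[symmetric] by (intro mult_left_mono) auto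
qed

definition rate :: real where "rate = 2 * (2 * C0 + 4 * C)"

lemma rate_nonneg: "rate \<ge> 0" unfolding rate_def using C_nonneg C0_nonneg by simp

text \<open>For each cell the pairings with all cells add up to order
  \<open>n powr (- (\<gamma> + 2))\<close>, and the \<open>n\<close> cells contribute one more
  factor \<open>n\<close>.\<close>

lemma cell_error_sum:
  assumes n: "n \<ge> 1"
  shows "ip lborel (\<lambda>z. \<Sum>k<n. cell_error n k z) (\<lambda>z. \<Sum>k<n. cell_error n k z) \<le> rate * real n powr (- 1 - \<gamma>)"
proof -
  have "ip lborel (\<lambda>z. \<Sum>k<n. cell_error n k z) (\<lambda>z. \<Sum>k<n. cell_error n k z)
     = (\<Sum>k<n. \<Sum>l<n. ip lborel (cell_error n k) (cell_error n l))"
    by (subst ip_sum_left; (intro cell_error_L2 L2_sum)?) (intro sum.cong refl ip_sum_right cell_error_L2)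
  also have "\<dots> \<le> (\<Sum>k<n. \<Sum>l<n. error_bound n (if k \<le> l then l - k else k - l))"
    by (intro sum_mono order_trans[OF abs_ge_self cell_error_ip[OF n]])
  also have "\<dots> \<le> (\<Sum>k<n. 2 * (\<Sum>j<n. error_bound n j))"
    by (intro sum_mono sum_dist_le error_bound_nonneg) auto
  also have "\<dots> = real n * 2 * (\<Sum>j<n. error_bound n j)" by simp
  also have "\<dots> \<le> real n * 2 * ((1 / real n) powr (\<gamma> + 2) * (2 * C0 + 4 * C))"
    by (intro mult_left_mono error_bound_sum) auto
  also have "\<dots> = rate * (real n powr 1 * real n powr (- (\<gamma> + 2)))"
    unfolding rate_def powr_minus_divide using n by (simp add: powr_divide)
  also have "real n powr 1 * real n powr (- (\<gamma> + 2)) = real n powr (- 1 - \<gamma>)"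
    unfolding powr_add[symmetric] by (simp add: algebra_simps)
  finally show ?thesis .
qed

text \<open>The common endpoint \<open>q\<close> is counted twice on the right, which is immaterial
  as a single point is a null set.\<close>

lemma Dn_split: assumes "p \<le> q" "q \<le> r" shows "Dn p r z = Dn p q z + Dn q r z"
proof -
  let ?f = "\<lambda>s. ennreal (pos_powr (s - fst z) a) * ennreal (pos_powr (s - snd z) b)"
  have "Dn p r z = (\<integral>\<^sup>+s. ?f s * indicator {p..q} s + ?f s * indicator {q..r} s \<partial>lborel)"
    unfolding Dn_def
  proof (rule nn_integral_cong_AE)
    show "AE s in lborel. ?f s * indicator {p..r} s = ?f s * indicator {p..q} s + ?f s * indicator {q..r} s"
      using AE_lborel_singleton[of q] by eventually_elim (use assms in \<open>auto simp: indicator_def\<close>)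
  qed
  also have "\<dots> = Dn p q z + Dn q r z"
    unfolding Dn_def by (rule nn_integral_add) measurable
  finally show ?thesis .
qed

lemma Dn_partition:
  assumes "n \<ge> 1" shows "Dn 0 (real j / real n) z = (\<Sum>k<j. Dn (real k / real n) ((real k + 1) / real n) z)"
proof (induction j)
  case 0
  have "Dn 0 0 z = 0"
    unfolding Dn_def
  proof (subst nn_integral_0_iff_AE)
    show "AE s in lborel. ennreal (pos_powr (s - fst z) a) * ennreal (pos_powr (s - snd z) b) * indicator {0..0} s = 0"
      using AE_lborel_singleton[of "0::real"] by eventually_elim auto
  qed measurable
  then show ?case by simp
next
  case (Suc j)
  have "Dn 0 (real (Suc j) / real n) z = Dn 0 (real j / real n) z + Dn (real j / real n) (real (Suc j) / real n) z"
    by (rule Dn_split) (auto intro!: divide_right_mono)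
  then show ?case using Suc by (simp add: add.commute)
qed

lemma D_partition:
  assumes n: "n \<ge> 1"
  shows "AE z in lborel. D 0 1 z = (\<Sum>k<n. D (real k / real n) ((real k + 1) / real n) z)"
proof -
  have "AE z in lborel. \<forall>k\<in>{..<n}. ennreal (D (real k / real n) ((real k + 1) / real n) z) = Dn (real k / real n) ((real k + 1) / real n) z"
    by (intro AE_finite_allI D_AE) (auto intro!: divide_right_mono)
  moreover have "AE z in lborel. ennreal (D 0 1 z) = Dn 0 1 z" by (rule D_AE) simp
  ultimately show ?thesis
  proof eventually_elim
    case (elim z)
    have "ennreal (D 0 1 z) = (\<Sum>k<n. Dn (real k / real n) ((real k + 1) / real n) z)"
      using elim(2) Dn_partition[OF n, of n z] n by simp
    also have "\<dots> = (\<Sum>k<n. ennreal (D (real k / real n) ((real k + 1) / real n) z))"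
      by (intro sum.cong refl) (use elim(1) in auto)
    also have "\<dots> = ennreal (\<Sum>k<n. D (real k / real n) ((real k + 1) / real n) z)"
      by (rule sum_ennreal) (rule D_nonneg)
    finally show ?case by (simp add: D_nonneg sum_nonneg)
  qed
qed

text \<open>Riemann sum for \<open>D 0 1\<close>, with every cell tensor divided by the cell length
  \<open>1 / n\<close>. Up to \<open>norming\<close> this is the kernel of
  \<open>Z n\<close>.\<close>

definition Rn :: "nat \<Rightarrow> real \<times> real \<Rightarrow> real" where
  "Rn n z = (\<Sum>k<n. real n * T (real k / real n) ((real k + 1) / real n) z)"

lemma Rn_L2: "Rn n \<in> L2 lborel"
  unfolding Rn_def[abs_def] by (intro L2_sum L2_scale T_L2 divide_right_mono) auto

lemma Rn_rate:
  assumes n: "n \<ge> 1"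
  shows "ip lborel (\<lambda>z. D 0 1 z - Rn n z) (\<lambda>z. D 0 1 z - Rn n z) \<le> rate * real n powr (- 1 - \<gamma>)"
proof -
  have "ip lborel (\<lambda>z. D 0 1 z - Rn n z) (\<lambda>z. D 0 1 z - Rn n z)
     = ip lborel (\<lambda>z. \<Sum>k<n. cell_error n k z) (\<lambda>z. \<Sum>k<n. cell_error n k z)"
    unfolding ip_self
  proof (rule integral_cong_AE)
    have "(\<lambda>z. D 0 1 z - Rn n z) \<in> L2 lborel" by (intro L2_diff Rn_L2 D_L2) auto
    then show "(\<lambda>z. (D 0 1 z - Rn n z)\<^sup>2) \<in> borel_measurable lborel" by (auto dest: L2_meas)
    have "(\<lambda>z. \<Sum>k<n. cell_error n k z) \<in> L2 lborel" by (intro L2_sum cell_error_L2)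
    then show "(\<lambda>z. (\<Sum>k<n. cell_error n k z)\<^sup>2) \<in> borel_measurable lborel" by (auto dest: L2_meas)
    show "AE z in lborel. (D 0 1 z - Rn n z)\<^sup>2 = (\<Sum>k<n. cell_error n k z)\<^sup>2"
      using D_partition[OF n] by eventually_elim (simp add: Rn_def cell_error_def sum_subtractf)
  qed
  then show ?thesis using cell_error_sum[OF n] by simp
qed

text \<open>Self-similarity makes the expectation in the denominators of \<open>Z n\<close>
  independent of \<open>k\<close>. The exponent \<open>- 3 - a - b\<close> is
  \<open>- H1 - H2\<close>.\<close>

lemma ip_cell_scale:
  assumes n: "n \<ge> 1"
  shows "ip lborel (cell_kernel a (real k / real n) ((real k + 1) / real n)) (cell_kernel b (real k / real n) ((real k + 1) / real n))
    = real n powr (- 3 - a - b) * ip lborel (cell_kernel a 0 1) (cell_kernel b 0 1)"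
proof -
  have n0: "real n > 0" using n by simp
  let ?A = "cell_kernel a (real k / real n) ((real k + 1) / real n)" and ?B = "cell_kernel b (real k / real n) ((real k + 1) / real n)"
  have "ip lborel ?A ?B = \<bar>1 / real n\<bar> *\<^sub>R (\<integral>z. ?A (real k / real n + (1 / real n) * z) * ?B (real k / real n + (1 / real n) * z) \<partial>lborel)"
    unfolding ip_def by (rule lborel_integral_real_affine) (use n in simp)
  also have "(\<lambda>z. ?A (real k / real n + (1 / real n) * z) * ?B (real k / real n + (1 / real n) * z))
     = (\<lambda>z. (real n powr (- (a + 1)) * real n powr (- (b + 1))) * (cell_kernel a 0 1 z * cell_kernel b 0 1 z))"
  proof (rule ext)
    fix z
    have e: "real k / real n + (1 / real n) * z = (real k + z) / real n" by (simp add: add_divide_distrib)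
    show "?A (real k / real n + (1 / real n) * z) * ?B (real k / real n + (1 / real n) * z)
       = (real n powr (- (a + 1)) * real n powr (- (b + 1))) * (cell_kernel a 0 1 z * cell_kernel b 0 1 z)"
      unfolding e cell_kernel_scale[OF n0 ab(1)] cell_kernel_scale[OF n0 ab(3)] by (simp add: mult_ac)
  qed
  also have "\<bar>1 / real n\<bar> *\<^sub>R (\<integral>z. (real n powr (- (a + 1)) * real n powr (- (b + 1))) * (cell_kernel a 0 1 z * cell_kernel b 0 1 z) \<partial>lborel)
     = (real n powr (-1) * (real n powr (- (a + 1)) * real n powr (- (b + 1)))) * ip lborel (cell_kernel a 0 1) (cell_kernel b 0 1)"
    unfolding ip_def using n0 by (simp add: powr_minus_divide)
  also have "real n powr (-1) * (real n powr (- (a + 1)) * real n powr (- (b + 1))) = real n powr (- 3 - a - b)"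
    unfolding powr_add[symmetric] by (rule arg_cong[where f="\<lambda>e. real n powr e"]) simp
  finally show ?thesis .
qed

lemma cell_kernel_lower:
  assumes "-1 < c" "y \<in> {0..1/2}" shows "(1/2) powr (c + 1) / (c + 1) \<le> cell_kernel c 0 1 y"
  unfolding cell_kernel_def using assms
  by (intro divide_right_mono) (auto simp: pos_powr_nonpos pos_powr_pos intro!: powr_mono2)

text \<open>Both kernels are bounded below by positive constants on \<open>{0..1/2}\<close>.
  Positivity makes the divisions in \<open>Z n\<close> and in the constant \<open>b\<close>
  genuine.\<close>

lemma ip_cell_pos: "0 < ip lborel (cell_kernel a 0 1) (cell_kernel b 0 1)"
proof -
  define v where "v = (1/2) powr (a + 1) / (a + 1)"
  define w where "w = (1/2) powr (b + 1) / (b + 1)"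
  have vw: "v > 0" "w > 0" unfolding v_def w_def using ab by auto
  have ge: "(v * w) * indicator {0..1/2} y \<le> cell_kernel a 0 1 y * cell_kernel b 0 1 y" for y
  proof (cases "y \<in> {0..1/2::real}")
    case True
    have "v * w \<le> cell_kernel a 0 1 y * cell_kernel b 0 1 y"
      by (rule mult_mono) (use cell_kernel_lower[OF ab(1) True] cell_kernel_lower[OF ab(3) True] ab vw in
          \<open>auto simp: v_def w_def intro!: cell_kernel_nonneg\<close>)
    then show ?thesis using True by simp
  next
    case False
    then show ?thesis using ab by (auto intro!: mult_nonneg_nonneg cell_kernel_nonneg)
  qed
  have "emeasure lborel {0..1/2::real} < \<infinity>"
    unfolding infinity_ennreal_def by (subst emeasure_lborel_Icc, simp, rule ennreal_less_top)
  then have i: "integrable lborel (\<lambda>y. (v * w) * indicator {0..1/2::real} y)"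
    by (intro integrable_mult_right integrable_real_indicator) auto
  have "(\<integral>y. (v * w) * indicator {0..1/2::real} y \<partial>lborel) = (v * w) * (\<integral>y. indicator {0..1/2::real} y \<partial>lborel)"
    by (rule integral_mult_right_zero)
  also have "(\<integral>y. indicator {0..1/2::real} y \<partial>lborel) = (1/2 :: real)" by simp
  finally have eq: "(\<integral>y. (v * w) * indicator {0..1/2::real} y \<partial>lborel) = (v * w) * (1/2)" .
  have "(\<integral>y. (v * w) * indicator {0..1/2::real} y \<partial>lborel) \<le> ip lborel (cell_kernel a 0 1) (cell_kernel b 0 1)"
    unfolding ip_def
  proof (rule integral_mono[OF i])
    show "integrable lborel (\<lambda>y. cell_kernel a 0 1 y * cell_kernel b 0 1 y)"
      by (rule L2_mult_int) (rule cell_kernel_L2; use ab in simp)+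
  qed (rule ge)
  then show ?thesis unfolding eq using mult_pos_pos[OF vw] by linarith
qed

end

section \<open>Six directions with nearly diagonal Hessian\<close>

lemma nn_integral_pos_powr_Ioc:
  assumes "c > -1" "0 \<le> e" "s \<le> 1"
  shows "(\<integral>\<^sup>+x. ennreal (pos_powr (s - x) c) * indicator {1 - e<..1} x \<partial>lborel) = ennreal (pos_powr (s - (1 - e)) (c + 1) / (c + 1))"
proof -
  have "(\<integral>\<^sup>+x. ennreal (pos_powr (s - x) c) * indicator {1 - e<..1} x \<partial>lborel)
     = (\<integral>\<^sup>+x. ennreal (pos_powr (s - x) c) * indicator {1 - e..1} x \<partial>lborel)"
  proof (rule nn_integral_cong_AE)
    show "AE x in lborel. ennreal (pos_powr (s - x) c) * indicator {1 - e<..1} x = ennreal (pos_powr (s - x) c) * indicator {1 - e..1} x"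
      using AE_lborel_singleton[of "1 - e"] by eventually_elim (auto simp: indicator_def)
  qed
  also have "\<dots> = ennreal ((pos_powr (s - (1 - e)) (c + 1) - pos_powr (s - 1) (c + 1)) / (c + 1))"
    by (rule pos_powr_nn_integral_flip) (use assms in auto)
  also have "pos_powr (s - 1) (c + 1) = 0" using assms by (simp add: pos_powr_nonpos)
  finally show ?thesis by simp
qed

context rosenblatt_exponents
begin

text \<open>Symmetrised in its two arguments, this is half of the Hessian entry of the Rosenblatt
  variable in the directions of the two indicators, before normalisation.\<close>

definition entry :: "real \<Rightarrow> real \<Rightarrow> real" where
  "entry e e' = ip lborel (D 0 1) (tensor (indicator {1 - e<..1}) (indicator {1 - e'<..1}))"

text \<open>Testing against indicators integrates each factor of the kernel to a truncated power, so
  that a single integral over \<open>s\<close> remains.\<close>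

lemma entry_eq:
  assumes "0 \<le> e" "0 \<le> e'"
  shows "entry e e' = enn2real (\<integral>\<^sup>+s. (ennreal (pos_powr (s - (1 - e)) (a + 1) / (a + 1)) * ennreal (pos_powr (s - (1 - e')) (b + 1) / (b + 1)))
      * indicator {0..1} s \<partial>lborel)"
proof -
  let ?u = "indicator {1 - e<..1} :: real \<Rightarrow> real" and ?v = "indicator {1 - e'<..1} :: real \<Rightarrow> real"
  have uv: "ennreal (tensor ?u ?v z) = indicator {1 - e<..1} (fst z) * indicator {1 - e'<..1} (snd z)" for z
    by (cases z) (simp add: tensor_def ennreal_mult ennreal_indicator)
  have m: "tensor ?u ?v \<in> borel_measurable lborel" by (intro L2_meas tensor_L2 Ioc_L2)
  have "entry e e' = enn2real (\<integral>\<^sup>+z. ennreal (D 0 1 z * tensor ?u ?v z) \<partial>lborel)"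
    unfolding entry_def ip_def
    by (rule integral_eq_nn_integral) (use m in \<open>auto intro!: mult_nonneg_nonneg D_nonneg simp: tensor_def\<close>)
  also have "(\<integral>\<^sup>+z. ennreal (D 0 1 z * tensor ?u ?v z) \<partial>lborel)
     = (\<integral>\<^sup>+z. Dn 0 1 z * (indicator {1 - e<..1} (fst z) * indicator {1 - e'<..1} (snd z)) \<partial>lborel)"
  proof (rule nn_integral_cong_AE)
    have "AE z in lborel. ennreal (D 0 1 z) = Dn 0 1 z" by (rule D_AE) simp
    then show "AE z in lborel. ennreal (D 0 1 z * tensor ?u ?v z) = Dn 0 1 z * (indicator {1 - e<..1} (fst z) * indicator {1 - e'<..1} (snd z))"
      by eventually_elim (simp add: ennreal_mult' D_nonneg uv)
  qed
  also have "\<dots> = (\<integral>\<^sup>+s. ((\<integral>\<^sup>+x. ennreal (pos_powr (s - x) a) * indicator {1 - e<..1} x \<partial>lborel)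
      * (\<integral>\<^sup>+y. ennreal (pos_powr (s - y) b) * indicator {1 - e'<..1} y \<partial>lborel)) * indicator {0..1} s \<partial>lborel)"
    by (rule Dn_prod) auto
  also have "\<dots> = (\<integral>\<^sup>+s. (ennreal (pos_powr (s - (1 - e)) (a + 1) / (a + 1)) * ennreal (pos_powr (s - (1 - e')) (b + 1) / (b + 1)))
      * indicator {0..1} s \<partial>lborel)"
  proof (rule nn_integral_cong)
    fix s :: real
    show "((\<integral>\<^sup>+x. ennreal (pos_powr (s - x) a) * indicator {1 - e<..1} x \<partial>lborel)
        * (\<integral>\<^sup>+y. ennreal (pos_powr (s - y) b) * indicator {1 - e'<..1} y \<partial>lborel)) * indicator {0..1} s
      = (ennreal (pos_powr (s - (1 - e)) (a + 1) / (a + 1)) * ennreal (pos_powr (s - (1 - e')) (b + 1) / (b + 1))) * indicator {0..1} s"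
      by (cases "s \<le> 1") (simp_all add: nn_integral_pos_powr_Ioc[OF ab(1) assms(1)] nn_integral_pos_powr_Ioc[OF ab(3) assms(2)])
  qed
  finally show ?thesis .
qed

lemma entry_self:
  assumes e: "0 < e" "e \<le> 1"
  shows "entry e e = e powr (a + b + 3) / ((a + b + 3) * ((a + 1) * (b + 1)))"
proof -
  let ?k = "1 / ((a + 1) * (b + 1))"
  have k: "?k \<ge> 0" using ab by simp
  have "(\<integral>\<^sup>+s. (ennreal (pos_powr (s - (1 - e)) (a + 1) / (a + 1)) * ennreal (pos_powr (s - (1 - e)) (b + 1) / (b + 1))) * indicator {0..1} s \<partial>lborel)
     = (\<integral>\<^sup>+s. ennreal ?k * (ennreal (pos_powr (s - (1 - e)) (a + b + 2)) * indicator {0..1} s) \<partial>lborel)"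
  proof (intro nn_integral_cong)
    fix s :: real
    have "pos_powr (s - (1 - e)) (a + 1) * pos_powr (s - (1 - e)) (b + 1) = pos_powr (s - (1 - e)) (a + b + 2)"
      unfolding pos_powr_def powr_add[symmetric] by (simp add: algebra_simps)
    then have "pos_powr (s - (1 - e)) (a + 1) / (a + 1) * (pos_powr (s - (1 - e)) (b + 1) / (b + 1)) = ?k * pos_powr (s - (1 - e)) (a + b + 2)"
      by simp
    then have "ennreal (pos_powr (s - (1 - e)) (a + 1) / (a + 1)) * ennreal (pos_powr (s - (1 - e)) (b + 1) / (b + 1))
       = ennreal (?k * pos_powr (s - (1 - e)) (a + b + 2))"
      using ab by (subst ennreal_mult[symmetric]) auto
    also have "\<dots> = ennreal ?k * ennreal (pos_powr (s - (1 - e)) (a + b + 2))" by (rule ennreal_mult[OF k]) simp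
    finally show "(ennreal (pos_powr (s - (1 - e)) (a + 1) / (a + 1)) * ennreal (pos_powr (s - (1 - e)) (b + 1) / (b + 1))) * indicator {0..1} s
      = ennreal ?k * (ennreal (pos_powr (s - (1 - e)) (a + b + 2)) * indicator {0..1} s)" by (simp add: mult.assoc)
  qed
  also have "\<dots> = ennreal ?k * (\<integral>\<^sup>+s. ennreal (pos_powr (s - (1 - e)) (a + b + 2)) * indicator {0..1} s \<partial>lborel)"
    by (rule nn_integral_cmult) measurable
  also have "(\<integral>\<^sup>+s. ennreal (pos_powr (s - (1 - e)) (a + b + 2)) * indicator {0..1} s \<partial>lborel)
     = ennreal ((pos_powr (1 - (1 - e)) (a + b + 2 + 1) - pos_powr (0 - (1 - e)) (a + b + 2 + 1)) / (a + b + 2 + 1))"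
    by (rule pos_powr_nn_integral) (use ab in auto)
  also have "(pos_powr (1 - (1 - e)) (a + b + 2 + 1) - pos_powr (0 - (1 - e)) (a + b + 2 + 1)) / (a + b + 2 + 1) = e powr (a + b + 3) / (a + b + 3)"
    using e by (simp add: pos_powr_pos pos_powr_nonpos add.assoc)
  finally show ?thesis
    unfolding entry_eq[OF less_imp_le[OF e(1)] less_imp_le[OF e(1)]] using ab
    by (simp add: enn2real_mult)
qed

lemma entry_nonneg: "0 \<le> entry e e'"
  unfolding entry_def ip_def by (intro integral_nonneg_AE AE_I2) (auto intro!: mult_nonneg_nonneg D_nonneg simp: tensor_def)

text \<open>The integrand of \<open>entry_eq\<close> vanishes for \<open>s\<close> below
  \<open>1 - min e e'\<close>. On the remaining interval of length \<open>min e e'\<close> each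
  factor is at most its value at \<open>s = 1\<close>.\<close>

lemma entry_le:
  assumes e: "0 < e" "e \<le> 1" "0 < e'" "e' \<le> 1"
  shows "entry e e' \<le> e powr (a + 1) * e' powr (b + 1) * min e e' / ((a + 1) * (b + 1))"
proof -
  define m where "m = min e e'"
  define h where "h = e powr (a + 1) / (a + 1) * (e' powr (b + 1) / (b + 1))"
  have h: "h \<ge> 0" unfolding h_def using ab by simp
  have m: "0 < m" "m \<le> 1" "m \<le> e" "m \<le> e'" unfolding m_def using e by auto
  let ?f = "\<lambda>s. ennreal (pos_powr (s - (1 - e)) (a + 1) / (a + 1)) * ennreal (pos_powr (s - (1 - e')) (b + 1) / (b + 1))"
  have le: "pos_powr (s - (1 - x)) c \<le> x powr c" if "s \<le> 1" "c > 0" "x > 0" for s x c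
    unfolding pos_powr_def using that by (intro powr_mono2) auto
  have zero: "?f s = 0" if "s < 1 - m" for s
  proof -
    have "s - (1 - e) \<le> 0 \<or> s - (1 - e') \<le> 0" using that unfolding m_def by auto
    then show ?thesis by (auto simp: pos_powr_nonpos)
  qed
  have "(\<integral>\<^sup>+s. ?f s * indicator {0..1} s \<partial>lborel) = (\<integral>\<^sup>+s. ?f s * indicator {1 - m..1} s \<partial>lborel)"
    using zero m by (intro nn_integral_cong) (auto simp: indicator_def not_le)
  also have "\<dots> \<le> ennreal (h * (1 - (1 - m)))"
  proof (rule nn_integral_Icc_le[OF _ h])
    fix s assume s: "s \<in> {1 - m..1}"
    have "?f s \<le> ennreal (e powr (a + 1) / (a + 1)) * ennreal (e' powr (b + 1) / (b + 1))"
      using s ab e by (intro mult_mono ennreal_leI divide_right_mono le) auto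
    also have "\<dots> = ennreal h" unfolding h_def using ab by (subst ennreal_mult) auto
    finally show "?f s \<le> ennreal h" .
  qed (use m in simp)
  finally have "entry e e' \<le> h * m"
    unfolding entry_eq[OF less_imp_le[OF e(1)] less_imp_le[OF e(3)]]
    using enn2real_mono[of _ "ennreal (h * m)"] h m by (simp add: mult_nonneg_nonneg)
  then show ?thesis unfolding h_def m_def by (simp add: mult_ac)
qed

text \<open>Relative to the geometric mean of the diagonal entries, an off-diagonal entry is bounded
  by a positive power of \<open>e' / e\<close>: the exponent \<open>(d - c + 1) / 2\<close> exceeds
  1/4 because \<open>d > -1\<close> and \<open>c < -1/2\<close>. The factor 2 compensates the
  denominator \<open>\<sigma> \<le> 2\<close> of \<open>entry_self\<close>.\<close>

lemma entry_ratio: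
  assumes e: "0 < e'" "e' \<le> e" "e \<le> 1"
  shows "(entry e e' + entry e' e) / 2 \<le> 2 * (e' / e) powr (1/4) * sqrt (entry e e) * sqrt (entry e' e')"
proof -
  define A where "A = (a + 1) * (b + 1)"
  define \<sigma> where "\<sigma> = a + b + 3"
  have A: "A > 0" unfolding A_def using ab by simp
  have \<sigma>: "0 < \<sigma>" "\<sigma> \<le> 2" unfolding \<sigma>_def using ab by auto
  have e0: "e > 0" "e' \<le> 1" using e by auto
  let ?t = "(e' / e) powr (1/4)"
  let ?R = "e powr (\<sigma> / 2) * e' powr (\<sigma> / 2)"
  have key: "e powr (c + 1) * e' powr (d + 1) * e' \<le> ?t * ?R"
    if cd: "c < -1/2" "d > -1" "c + d + 3 = \<sigma>" for c d
  proof -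
    have "e powr (c + 1) * e' powr (d + 1) * e' = e powr (c + 1) * e' powr (d + 2)"
      using powr_add[of e' "d + 1" 1] e by (simp add: add.assoc)
    \<comment> \<open>Both exponents are recentred at \<open>\<sigma> / 2\<close>, the exponent in
      the square root of a diagonal entry. The surplus is a power of \<open>e' / e\<close>.\<close>
    also have "\<dots> = e powr (\<sigma> / 2 - (d - c + 1) / 2) * e' powr (\<sigma> / 2 + (d - c + 1) / 2)"
      by (rule arg_cong2[where f="\<lambda>x y. e powr x * e' powr y"]) (use cd in \<open>simp_all add: field_simps\<close>)
    also have "\<dots> = (e' / e) powr ((d - c + 1) / 2) * ?R"
      using e e0 by (simp add: powr_diff powr_add powr_divide)
    also have "\<dots> \<le> ?t * ?R"
      by (intro mult_right_mono powr_mono') (use e e0 cd in auto)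
    finally show ?thesis .
  qed
  have "entry e e' \<le> e powr (a + 1) * e' powr (b + 1) * e' / A"
    using entry_le[OF e0(1) e(3) e(1) e0(2)] e unfolding A_def by (simp add: min_def split: if_splits)
  also have "\<dots> \<le> (?t * ?R) / A"
    by (intro divide_right_mono key) (use ab A in \<open>auto simp: \<sigma>_def\<close>)
  finally have 1: "entry e e' \<le> (?t * ?R) / A" .
  have "entry e' e \<le> e powr (b + 1) * e' powr (a + 1) * e' / A"
    using entry_le[OF e(1) e0(2) e0(1) e(3)] e unfolding A_def by (simp add: min_def mult.commute split: if_splits)
  also have "\<dots> \<le> (?t * ?R) / A"
    by (intro divide_right_mono key) (use ab A in \<open>auto simp: \<sigma>_def\<close>)
  finally have 2: "entry e' e \<le> (?t * ?R) / A" .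
  have sq: "sqrt (entry x x) = x powr (\<sigma> / 2) / sqrt (\<sigma> * A)" if "0 < x" "x \<le> 1" for x
    unfolding entry_self[OF that] A_def[symmetric] \<sigma>_def[symmetric]
    using that by (simp add: real_sqrt_divide powr_half_sqrt[symmetric] powr_powr)
  have "sqrt (entry e e) * sqrt (entry e' e') = ?R / (\<sigma> * A)"
    unfolding sq[OF e0(1) e(3)] sq[OF e(1) e0(2)] using \<sigma> A by (simp add: mult_pos_pos less_imp_le)
  then have "2 * ?t * sqrt (entry e e) * sqrt (entry e' e') = (2 / \<sigma>) * ((?t * ?R) / A)"
    by (simp add: mult.assoc)
  moreover have "(?t * ?R) / A \<le> (2 / \<sigma>) * ((?t * ?R) / A)"
    using \<sigma> A mult_right_mono[of 1 "2 / \<sigma>" "(?t * ?R) / A"] by (simp add: field_simps)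
  ultimately show ?thesis using 1 2 by simp
qed

text \<open>
  The ratio makes the off-diagonal entries in \<open>entry_ratio\<close> at most \<open>2 / 120\<close> times the geometric mean of
  the diagonal ones, half of the tolerance \<open>1/30\<close> in \<open>stein_field\<close>.
\<close>

definition scale :: "nat \<Rightarrow> real" where "scale i = (1 / 120 ^ 4) ^ i"

lemma scale: "0 < scale i" "scale i \<le> 1"
  unfolding scale_def by (auto intro!: power_le_one)

lemma entry_off_diagonal:
  assumes "i \<noteq> j"
  shows "(entry (scale i) (scale j) + entry (scale j) (scale i)) / 2 \<le> 1/60 * (sqrt (entry (scale i) (scale i)) * sqrt (entry (scale j) (scale j)))"
proof -
  have *: "(entry (scale i) (scale j) + entry (scale j) (scale i)) / 2 \<le> 1/60 * (sqrt (entry (scale i) (scale i)) * sqrt (entry (scale j) (scale j)))"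
    if ij: "i < j" for i j
  proof -
    obtain d where d: "j = i + Suc d" using ij less_iff_Suc_add by auto
    have "(1 / 120 ^ 4 :: real) ^ d \<le> 1" by (rule power_le_one) auto
    then have r: "scale j \<le> (1 / 120 ^ 4) * scale i"
      unfolding scale_def d power_add power_Suc using mult_left_le[of "(1 / 120 ^ 4) ^ d" "(1 / 120 ^ 4) * (1 / 120 ^ 4 :: real) ^ i"]
      by (simp add: mult_ac)
    then have le: "scale j \<le> scale i" using scale(1)[of i] by simp
    have "(scale j / scale i) powr (1/4) \<le> ((1 / 120) ^ 4) powr (1/4)"
      using r scale(1)[of i] scale(1)[of j] by (intro powr_mono2) (auto simp: divide_le_eq power_divide)
    also have "((1 / 120) ^ 4) powr (1/4) = ((1 / 120 :: real) powr 4) powr (1/4)" by (subst powr_numeral) auto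
    also have "\<dots> = 1 / 120" unfolding powr_powr by simp
    finally have t: "2 * (scale j / scale i) powr (1/4) \<le> 1/60" by simp
    have "(entry (scale i) (scale j) + entry (scale j) (scale i)) / 2
       \<le> 2 * (scale j / scale i) powr (1/4) * sqrt (entry (scale i) (scale i)) * sqrt (entry (scale j) (scale j))"
      by (rule entry_ratio) (use le scale in auto)
    also have "\<dots> \<le> 1/60 * sqrt (entry (scale i) (scale i)) * sqrt (entry (scale j) (scale j))"
      by (intro mult_right_mono t) (auto simp: entry_nonneg)
    finally show ?thesis by simp
  qed
  show ?thesis
  proof (cases "i < j")
    case True then show ?thesis by (rule *)
  next
    case False
    then have "j < i" using assms by simp
    from *[OF this] show ?thesis by (simp add: add.commute mult.commute)
  qed
qed

lemma entry_self_pos: "0 < entry (scale i) (scale i)"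
  unfolding entry_self[OF scale] using ab scale(1)[of i] by simp

end

section \<open>Comparison of two quadratic functionals\<close>

lemma sum_lessThan_add: "sum f {..<N + M} = sum f {..<N} + (\<Sum>l<M. f (N + l))" for f :: "nat \<Rightarrow> real"
  by (induction M) (simp_all add: add.assoc)

lemma L2_cong_AE:
  fixes M :: "'b measure"
  assumes "V \<in> L2 M" "U \<in> borel_measurable M" "AE \<omega> in M. U \<omega> = V \<omega>"
  shows "U \<in> L2 M" "ip M U U = ip M V V"
proof -
  note [measurable] = assms(2) L2_meas[OF assms(1)]
  have ae: "AE \<omega> in M. (V \<omega>)\<^sup>2 = (U \<omega>)\<^sup>2" using assms(3) by eventually_elim simp
  show "U \<in> L2 M"
    by (rule L2I[OF assms(2)]) (rule integrable_cong_AE_imp[OF L2_sq_int[OF assms(1)] _ ae], measurable)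
  show "ip M U U = ip M V V" unfolding ip_self by (rule integral_cong_AE) (use ae in \<open>auto elim: eventually_mono\<close>)
qed

lemma growth_half_one: "growth m (1/2) f \<Longrightarrow> growth m 1 f"
  by (rule growth_mono) auto

lemma growth_const': "growth m 1 (\<lambda>_. c)"
  by (rule growth_mono[OF growth_const]) simp

context double_wiener
begin

definition tensor_sum :: "nat \<Rightarrow> (nat \<Rightarrow> real) \<Rightarrow> (nat \<Rightarrow> real \<Rightarrow> real) \<Rightarrow> (nat \<Rightarrow> real \<Rightarrow> real) \<Rightarrow> real \<times> real \<Rightarrow> real" where
  "tensor_sum N c g h p = (\<Sum>k<N. c k * tensor (g k) (h k) p)"

text \<open>A version of the double integral of \<open>tensor_sum\<close> that is an honest
  polynomial in Wiener integrals, at every point of the sample space, whereas \<open>J\<close> is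
  determined only up to null sets.\<close>

definition chaos :: "nat \<Rightarrow> (nat \<Rightarrow> real) \<Rightarrow> (nat \<Rightarrow> real \<Rightarrow> real) \<Rightarrow> (nat \<Rightarrow> real \<Rightarrow> real) \<Rightarrow> 'a \<Rightarrow> real" where
  "chaos N c g h \<omega> = (\<Sum>k<N. c k * (I (g k) \<omega> * I (h k) \<omega> - ip lborel (g k) (h k)))"

context
  fixes N :: nat and g h :: "nat \<Rightarrow> real \<Rightarrow> real"
  assumes g: "\<And>k. k < N \<Longrightarrow> g k \<in> L2 lborel" and h: "\<And>k. k < N \<Longrightarrow> h k \<in> L2 lborel"
begin

lemma tensor_sum_L2: "tensor_sum N c g h \<in> L2 lborel"
  unfolding tensor_sum_def[abs_def] by (intro L2_sum L2_scale tensor_L2 g h) auto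

lemma chaos_AE: "AE \<omega> in M. chaos N c g h \<omega> = J (symmetrization (tensor_sum N c g h)) \<omega>"
  unfolding chaos_def tensor_sum_def[abs_def]
  using J_tensor_sum[of "{..<N}" g h c] g h by (auto elim!: eventually_mono)

lemma chaos_meas: "chaos N c g h \<in> borel_measurable M"
proof -
  have "I (g k) \<in> borel_measurable M" "I (h k) \<in> borel_measurable M" if "k < N" for k
    using I_L2[OF g[OF that]] I_L2[OF h[OF that]] by (auto dest: L2_meas)
  then show ?thesis unfolding chaos_def[abs_def]
    by (intro borel_measurable_sum borel_measurable_times borel_measurable_diff borel_measurable_const) auto
qed

lemma chaos_L2: "chaos N c g h \<in> L2 M"
  by (rule L2_cong_AE(1)[OF J_L2[OF symmetrization_sym_L2[OF tensor_sum_L2]] chaos_meas chaos_AE])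

lemma chaos_norm_le:
  assumes K: "\<And>f. f \<in> sym_L2 \<Longrightarrow> ip M (J f) (J f) \<le> K * ip lborel f f" "K \<ge> 0"
  shows "ip M (chaos N c g h) (chaos N c g h) \<le> K * ip lborel (tensor_sum N c g h) (tensor_sum N c g h)"
proof -
  have "ip M (chaos N c g h) (chaos N c g h) = ip M (J (symmetrization (tensor_sum N c g h))) (J (symmetrization (tensor_sum N c g h)))"
    by (rule L2_cong_AE(2)[OF J_L2[OF symmetrization_sym_L2[OF tensor_sum_L2]] chaos_meas chaos_AE])
  also have "\<dots> \<le> K * ip lborel (symmetrization (tensor_sum N c g h)) (symmetrization (tensor_sum N c g h))"
    by (rule K(1)[OF symmetrization_sym_L2[OF tensor_sum_L2]])
  also have "\<dots> \<le> K * ip lborel (tensor_sum N c g h) (tensor_sum N c g h)"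
    by (intro mult_left_mono ip_symmetrization_le tensor_sum_L2 K)
  finally show ?thesis .
qed

text \<open>One Gaussian vector of length \<open>N + N\<close>: the partner of coordinate
  \<open>k\<close> in the product \<open>I (g k) * I (h k)\<close> is coordinate
  \<open>N + k\<close>.\<close>

definition stack :: "nat \<Rightarrow> real \<Rightarrow> real" where "stack k = (if k < N then g k else h (k - N))"

lemma stack_L2: "k < N + N \<Longrightarrow> stack k \<in> L2 lborel"
  unfolding stack_def using g h by auto

text \<open>Differentiating a product exchanges partners: the coefficient of the \<open>g l\<close>
  coordinate is determined by \<open>h l\<close>, and conversely. The halving makes it the form
  \<open>\<beta>\<close> of \<open>stein_field\<close>.\<close>

definition half_gradient :: "(nat \<Rightarrow> real) \<Rightarrow> (real \<Rightarrow> real) \<Rightarrow> nat \<Rightarrow> real" where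
  "half_gradient c u l = (if l < N then c l * ip lborel (h l) u / 2 else c (l - N) * ip lborel (g (l - N)) u / 2)"

text \<open>For the kernel \<open>k = tensor_sum N c g h\<close> this is the function of
  \<open>x\<close> obtained by integrating \<open>(k (x, y) + k (y, x)) * u y\<close> over
  \<open>y\<close>, written without that integral. Its Wiener integral is the derivative of
  \<open>chaos\<close> in direction \<open>u\<close>.\<close>

definition slice :: "(nat \<Rightarrow> real) \<Rightarrow> (real \<Rightarrow> real) \<Rightarrow> real \<Rightarrow> real" where
  "slice c u = (\<lambda>x. \<Sum>l<N + N. (2 * half_gradient c u l) * stack l x)"

lemma slice_L2: "slice c u \<in> L2 lborel"
  unfolding slice_def by (intro L2_sum L2_scale stack_L2) auto

lemma ip_tensor_sum:
  assumes "u \<in> L2 lborel" "v \<in> L2 lborel"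
  shows "ip lborel (tensor_sum N c g h) (tensor u v) = (\<Sum>k<N. c k * (ip lborel (g k) u * ip lborel (h k) v))"
proof -
  have "ip lborel (tensor_sum N c g h) (tensor u v) = (\<Sum>k<N. ip lborel (\<lambda>p. c k * tensor (g k) (h k) p) (tensor u v))"
    unfolding tensor_sum_def[abs_def] by (intro ip_sum_left L2_scale tensor_L2 assms g h) auto
  also have "\<dots> = (\<Sum>k<N. c k * (ip lborel (g k) u * ip lborel (h k) v))"
    unfolding ip_scale_left by (intro sum.cong refl) (simp add: ip_tensor g h assms)
  finally show ?thesis .
qed

text \<open>Pairing the coefficients with a second direction tests the symmetrised kernel against
  the tensor of \<open>u\<close> and \<open>v\<close>, which is half of the Hessian entry and hence
  the matrix \<open>a\<close> of \<open>stein_field\<close>.\<close>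

lemma half_gradient_ip:
  assumes "u \<in> L2 lborel" "v \<in> L2 lborel"
  shows "(\<Sum>l<N + N. ip lborel (stack l) u * half_gradient c v l)
    = (ip lborel (tensor_sum N c g h) (tensor u v) + ip lborel (tensor_sum N c g h) (tensor v u)) / 2"
  unfolding sum_lessThan_add ip_tensor_sum[OF assms] ip_tensor_sum[OF assms(2,1)] add_divide_distrib sum_divide_distrib
  by (intro arg_cong2[where f="(+)"] sum.cong) (auto simp: stack_def half_gradient_def)

text \<open>
  The slice \<open>s\<close> of the kernel satisfies \<open>\<bar>s\<bar>\<^sup>2 = \<langle>k, s \<otimes> u\<rangle> + \<langle>k, u \<otimes> s\<rangle>\<close>, which avoids integrating over sections.
\<close>

lemma slice_norm_le:
  assumes u: "u \<in> L2 lborel"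
  shows "ip lborel (slice c u) (slice c u) \<le> 4 * ip lborel u u * ip lborel (tensor_sum N c g h) (tensor_sum N c g h)"
proof -
  let ?s = "slice c u" and ?k = "tensor_sum N c g h"
  define A where "A = sqrt (ip lborel u u)"
  define B where "B = sqrt (ip lborel ?k ?k)"
  define S where "S = sqrt (ip lborel ?s ?s)"
  have nn: "A \<ge> 0" "B \<ge> 0" "S \<ge> 0" unfolding A_def B_def S_def by (auto simp: ip_self_nonneg)
  have sq: "ip lborel u u = A\<^sup>2" "ip lborel ?k ?k = B\<^sup>2" "ip lborel ?s ?s = S\<^sup>2"
    unfolding A_def B_def S_def by (simp_all add: ip_self_nonneg)
  have "ip lborel ?s ?s = (\<Sum>l<N + N. 2 * half_gradient c u l * ip lborel (stack l) ?s)"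
  proof -
    have "ip lborel ?s ?s = (\<Sum>l<N + N. ip lborel (\<lambda>x. (2 * half_gradient c u l) * stack l x) ?s)"
      by (subst (1) slice_def) (intro ip_sum_left L2_scale stack_L2 slice_L2, auto)
    then show ?thesis unfolding ip_scale_left .
  qed
  also have "\<dots> = 2 * (\<Sum>l<N + N. ip lborel (stack l) ?s * half_gradient c u l)"
    unfolding sum_distrib_left by (intro sum.cong) auto
  also have "\<dots> = ip lborel ?k (tensor ?s u) + ip lborel ?k (tensor u ?s)"
    unfolding half_gradient_ip[OF slice_L2 u] by simp
  finally have eq: "S\<^sup>2 = ip lborel ?k (tensor ?s u) + ip lborel ?k (tensor u ?s)" unfolding sq .
  have "ip lborel ?k (tensor ?s u) \<le> B * (S * A)" "ip lborel ?k (tensor u ?s) \<le> B * (A * S)"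
    using ip_abs_le[OF tensor_sum_L2 tensor_L2[OF slice_L2 u], of c c u] ip_abs_le[OF tensor_sum_L2 tensor_L2[OF u slice_L2], of c c u]
    unfolding ip_tensor[OF slice_L2 u slice_L2 u] ip_tensor[OF u slice_L2 u slice_L2] real_sqrt_mult A_def B_def S_def by auto
  then have "S * S \<le> (2 * A * B) * S" using eq by (simp add: power2_eq_square mult_ac)
  then have "S \<le> 2 * A * B"
    using nn by (cases "S = 0") (auto simp: mult_le_cancel_right)
  then have "S\<^sup>2 \<le> (2 * A * B)\<^sup>2" using nn by (intro power_mono)
  then show ?thesis unfolding sq by (simp add: power_mult_distrib)
qed

definition quad :: "(nat \<Rightarrow> real) \<Rightarrow> (nat \<Rightarrow> real) \<Rightarrow> real" where
  "quad c x = (\<Sum>k<N. c k * (x k * x (N + k) + - ip lborel (g k) (h k)))"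

text \<open>Left as the differentiation rules produce it, including the \<open>+ 0\<close> from the
  constant; \<open>quad_gradient\<close> simplifies it.\<close>

definition quad' :: "(nat \<Rightarrow> real) \<Rightarrow> nat \<Rightarrow> (nat \<Rightarrow> real) \<Rightarrow> real" where
  "quad' c l x = (\<Sum>k<N. c k * (((if l = k then 1 else 0) * x (N + k) + x k * (if l = N + k then 1 else 0)) + 0))"

lemma quad_C1: "C1_fun (N + N) (quad c) (quad' c)"
  unfolding quad_def[abs_def] quad'_def[abs_def]
  by (intro C1_fun_sum C1_fun_cmult C1_fun_add C1_fun_mult C1_fun_const C1_fun_coord) auto

lemma quad_growth: "growth (N + N) 1 (quad c)"
  unfolding quad_def[abs_def]
proof (rule growth_sum)
  fix k assume "k \<in> {..<N}"
  then have "growth (N + N) 1 (\<lambda>x. x k * x (N + k))"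
    by (intro growth_mult'[OF growth_coord growth_coord]) auto
  then have "growth (N + N) 1 (\<lambda>x. x k * x (N + k) + - ip lborel (g k) (h k))"
    by (rule growth_add[OF _ growth_const'])
  then show "growth (N + N) 1 (\<lambda>x. c k * (x k * x (N + k) + - ip lborel (g k) (h k)))"
    by (rule growth_mult'[OF growth_const]) simp
qed simp

lemma quad'_growth: "growth (N + N) 1 (quad' c l)"
  unfolding quad'_def[abs_def]
proof (rule growth_sum)
  fix k assume "k \<in> {..<N}"
  then have k: "k < N + N" "N + k < N + N" by auto
  have "growth (N + N) (1/2) (\<lambda>x. (if l = k then 1 else 0) * x (N + k))"
    by (rule growth_mult'[OF growth_const growth_coord[OF k(2)]]) simp
  moreover have "growth (N + N) (1/2) (\<lambda>x. x k * (if l = N + k then 1 else 0))"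
    by (rule growth_mult'[OF growth_coord[OF k(1)] growth_const]) simp
  ultimately have "growth (N + N) 1 (\<lambda>x. (if l = k then 1 else 0) * x (N + k) + x k * (if l = N + k then 1 else 0))"
    by (intro growth_half_one growth_add)
  then have "growth (N + N) 1 (\<lambda>x. ((if l = k then 1 else 0) * x (N + k) + x k * (if l = N + k then 1 else 0)) + 0)"
    by (rule growth_add[OF _ growth_const'])
  then show "growth (N + N) 1 (\<lambda>x. c k * (((if l = k then 1 else 0) * x (N + k) + x k * (if l = N + k then 1 else 0)) + 0))"
    by (rule growth_mult'[OF growth_const]) simp
qed simp

lemma quad_gradient:
  "(\<Sum>l<N + N. ip lborel (stack l) u * quad' c l x) = 2 * (\<Sum>l<N + N. half_gradient c u l * x l)"
proof -
  have q1: "quad' c l x = c l * x (N + l)" if "l < N" for l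
  proof -
    have "quad' c l x = (\<Sum>k<N. if k = l then c l * x (N + l) else 0)"
      unfolding quad'_def using that by (intro sum.cong) auto
    also have "\<dots> = c l * x (N + l)" using that by simp
    finally show ?thesis .
  qed
  have q2: "quad' c (N + l) x = c l * x l" if "l < N" for l
  proof -
    have "quad' c (N + l) x = (\<Sum>k<N. if k = l then c l * x l else 0)"
      unfolding quad'_def using that by (intro sum.cong) auto
    also have "\<dots> = c l * x l" using that by simp
    finally show ?thesis .
  qed
  have "(\<Sum>l<N + N. ip lborel (stack l) u * quad' c l x)
     = (\<Sum>l<N. ip lborel (g l) u * (c l * x (N + l))) + (\<Sum>l<N. ip lborel (h l) u * (c l * x l))"
    unfolding sum_lessThan_add by (intro arg_cong2[where f="(+)"] sum.cong) (auto simp: stack_def q1 q2)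
  moreover have "2 * (\<Sum>l<N + N. half_gradient c u l * x l)
     = (\<Sum>l<N. ip lborel (h l) u * (c l * x l)) + (\<Sum>l<N. ip lborel (g l) u * (c l * x (N + l)))"
    unfolding sum_lessThan_add distrib_left sum_distrib_left
    by (intro arg_cong2[where f="(+)"] sum.cong) (auto simp: half_gradient_def)
  ultimately show ?thesis by simp
qed

lemma quad_chaos: "quad c (xi (N + N) stack \<omega>) = chaos N c g h \<omega>"
  unfolding quad_def chaos_def by (intro sum.cong) (auto simp: xi_def stack_def)

lemma chaos_diff: "chaos N c g h \<omega> - chaos N d g h \<omega> = chaos N (\<lambda>k. c k - d k) g h \<omega>"
  unfolding chaos_def by (simp add: left_diff_distrib sum_subtractf)

lemma half_gradient_diff: "half_gradient c u l - half_gradient d u l = half_gradient (\<lambda>k. c k - d k) u l"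
  unfolding half_gradient_def by (simp add: left_diff_distrib diff_divide_distrib)

lemma slice_AE: "AE \<omega> in M. 2 * (\<Sum>l<N + N. half_gradient c u l * xi (N + N) stack \<omega> l) = I (slice c u) \<omega>"
proof -
  have "AE \<omega> in M. I (slice c u) \<omega> = (\<Sum>l<N + N. (2 * half_gradient c u l) * I (stack l) \<omega>)"
    unfolding slice_def by (rule I_sum) (auto intro: stack_L2)
  then show ?thesis
    by eventually_elim (auto simp: sum_distrib_left xi_def intro!: sum.cong)
qed

text \<open>Two functionals of the same Gaussian vector with different coefficients.
  \<open>K\<close> bounds the second moment of their difference and \<open>4 * E\<close> that of its
  derivatives in the directions \<open>e i\<close>, both relative to the difference of the kernels;
  the condition on \<open>\<rho>\<close> covers the two at once.\<close>

lemma chaos_distance: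
  fixes e :: "nat \<Rightarrow> real \<Rightarrow> real"
  assumes e: "\<And>i. e i \<in> steps" and X4: "\<And>i. i < 6 \<Longrightarrow> integrable M (\<lambda>\<omega>. I (e i) \<omega> ^ 4)"
    and near: "\<And>c i j. c \<in> {c0, c1} \<Longrightarrow> i < 6 \<Longrightarrow> j < 6 \<Longrightarrow>
      \<bar>(ip lborel (tensor_sum N c g h) (tensor (e i) (e j)) + ip lborel (tensor_sum N c g h) (tensor (e j) (e i))) / 2
        - (if i = j then 1 else 0)\<bar> \<le> 1/30"
    and E: "\<And>i. i < 6 \<Longrightarrow> ip lborel (e i) (e i) \<le> E"
    and K: "\<And>f. f \<in> sym_L2 \<Longrightarrow> ip M (J f) (J f) \<le> K * ip lborel f f" "K \<ge> 0"
    and rho: "\<rho> > 0" "(K + 4 * E) * ip lborel (tensor_sum N (\<lambda>k. c1 k - c0 k) g h) (tensor_sum N (\<lambda>k. c1 k - c0 k) g h) \<le> \<rho>\<^sup>2"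
    and phi: "\<And>y. \<bar>\<phi> y\<bar> \<le> 1" "\<And>y. (\<phi> has_real_derivative \<phi>' y) (at y)" "continuous_on UNIV \<phi>'"
      "\<And>y. \<bar>\<phi>' y\<bar> \<le> L"
  shows "\<bar>expectation (\<lambda>\<omega>. \<phi> (chaos N c1 g h \<omega>)) - expectation (\<lambda>\<omega>. \<phi> (chaos N c0 g h \<omega>))\<bar>
     \<le> \<rho> * (5 + 3 * expectation (\<lambda>\<omega>. (\<Sum>i<6. (I (e i) \<omega>)\<^sup>2)\<^sup>2))"
proof -
  define d where "d k = c1 k - c0 k" for k
  note eL = steps_L2[OF e]
  let ?T = "ip lborel (tensor_sum N d g h) (tensor_sum N d g h)"
  have E0: "E \<ge> 0" using E[of 0] ip_self_nonneg[of lborel "e 0"] by simp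
  have r: "K * ?T \<le> \<rho>\<^sup>2" "4 * E * ?T \<le> \<rho>\<^sup>2"
  proof -
    have "0 \<le> K * ?T" "0 \<le> 4 * E * ?T" using K(2) E0 by (auto intro!: mult_nonneg_nonneg ip_self_nonneg)
    then show "K * ?T \<le> \<rho>\<^sup>2" "4 * E * ?T \<le> \<rho>\<^sup>2" using rho(2) unfolding d_def[abs_def, symmetric] distrib_right by linarith+
  qed
  interpret SV: stein_vector M "N + N" "xi (N + N) stack" "\<lambda>i. I (e i)" "\<lambda>i l. ip lborel (stack l) (e i)"
  proof unfold_locales
    show "xi (N + N) stack \<in> borel_measurable M" by (rule xi_meas) (rule stack_L2)
    show "I (e i) \<in> borel_measurable M" for i using I_L2[OF eL] by (auto dest: L2_meas)
    show "integrable M (\<lambda>\<omega>. I (e i) \<omega> ^ 4)" if "i < 6" for i by (rule X4[OF that])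
    fix i :: nat and f f' assume f: "C1_fun (N + N) f f'" "growth (N + N) 0 f" "\<And>k. k < N + N \<Longrightarrow> growth (N + N) 0 (f' k)"
    show "expectation (\<lambda>\<omega>. f (xi (N + N) stack \<omega>) * I (e i) \<omega>)
      = (\<Sum>k<N + N. ip lborel (stack k) (e i) * expectation (\<lambda>\<omega>. f' k (xi (N + N) stack \<omega>)))"
      by (rule stein_L2[OF stack_L2 e f])
  qed
  have kap: "SV.\<kappa> = expectation (\<lambda>\<omega>. (\<Sum>i<6. (I (e i) \<omega>)\<^sup>2)\<^sup>2)"
    unfolding SV.\<kappa>_def SV.X_sq_def ..
  have dY: "quad c1 (xi (N + N) stack \<omega>) - quad c0 (xi (N + N) stack \<omega>) = chaos N d g h \<omega>" for \<omega>
    unfolding quad_chaos chaos_diff d_def[abs_def] ..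
  have dG: "half_gradient c1 u l - half_gradient c0 u l = half_gradient d u l" for u l
    unfolding half_gradient_diff d_def[abs_def] ..
  have sl: "(\<lambda>\<omega>. 2 * (\<Sum>l<N + N. half_gradient d (e i) l * xi (N + N) stack \<omega> l)) \<in> L2 M"
    "ip M (\<lambda>\<omega>. 2 * (\<Sum>l<N + N. half_gradient d (e i) l * xi (N + N) stack \<omega> l))
       (\<lambda>\<omega>. 2 * (\<Sum>l<N + N. half_gradient d (e i) l * xi (N + N) stack \<omega> l)) = ip M (I (slice d (e i))) (I (slice d (e i)))" for i
  proof -
    have m: "(\<lambda>\<omega>. 2 * (\<Sum>l<N + N. half_gradient d (e i) l * xi (N + N) stack \<omega> l)) \<in> borel_measurable M"
    proof (intro borel_measurable_times borel_measurable_const borel_measurable_sum)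
      fix l assume "l \<in> {..<N + N}"
      then have "I (stack l) \<in> borel_measurable M" using I_L2[OF stack_L2] by (auto dest: L2_meas)
      then show "(\<lambda>\<omega>. xi (N + N) stack \<omega> l) \<in> borel_measurable M" using \<open>l \<in> _\<close> unfolding xi_def by simp
    qed
    show "(\<lambda>\<omega>. 2 * (\<Sum>l<N + N. half_gradient d (e i) l * xi (N + N) stack \<omega> l)) \<in> L2 M"
      "ip M (\<lambda>\<omega>. 2 * (\<Sum>l<N + N. half_gradient d (e i) l * xi (N + N) stack \<omega> l))
       (\<lambda>\<omega>. 2 * (\<Sum>l<N + N. half_gradient d (e i) l * xi (N + N) stack \<omega> l)) = ip M (I (slice d (e i))) (I (slice d (e i)))"
      by (rule L2_cong_AE[OF I_L2[OF slice_L2] m slice_AE])+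
  qed
  have "\<bar>expectation (\<lambda>\<omega>. \<phi> (quad c1 (xi (N + N) stack \<omega>))) - expectation (\<lambda>\<omega>. \<phi> (quad c0 (xi (N + N) stack \<omega>)))\<bar> \<le> \<rho> * (5 + 3 * SV.\<kappa>)"
  proof (rule SV.smooth_distance_bound[where ?F0.0 = "quad c0" and ?F1.0 = "quad c1" and ?\<beta>0.0 = "\<lambda>i. half_gradient c0 (e i)" and ?\<beta>1.0 = "\<lambda>i. half_gradient c1 (e i)"
        and F0' = "quad' c0" and F1' = "quad' c1"])
    fix i j :: nat assume ij: "i < 6" "j < 6"
    show "\<bar>(\<Sum>k<N + N. ip lborel (stack k) (e i) * half_gradient c0 (e j) k) - (if i = j then 1 else 0)\<bar> \<le> 1/30"
      "\<bar>(\<Sum>k<N + N. ip lborel (stack k) (e i) * half_gradient c1 (e j) k) - (if i = j then 1 else 0)\<bar> \<le> 1/30"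
      unfolding half_gradient_ip[OF eL eL] by (rule near[OF _ ij], simp)+
  next
    show "integrable M (\<lambda>\<omega>. (quad c1 (xi (N + N) stack \<omega>) - quad c0 (xi (N + N) stack \<omega>))\<^sup>2)"
      unfolding dY by (rule L2_sq_int[OF chaos_L2])
    show "expectation (\<lambda>\<omega>. (quad c1 (xi (N + N) stack \<omega>) - quad c0 (xi (N + N) stack \<omega>))\<^sup>2) \<le> \<rho>\<^sup>2"
      unfolding dY ip_self[symmetric] by (rule order_trans[OF chaos_norm_le[OF K] r(1)])
  next
    fix i :: nat assume i: "i < 6"
    show "integrable M (\<lambda>\<omega>. (2 * (\<Sum>k<N + N. (half_gradient c1 (e i) k - half_gradient c0 (e i) k) * xi (N + N) stack \<omega> k))\<^sup>2)"
      unfolding dG by (rule L2_sq_int[OF sl(1)])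
    have "ip M (I (slice d (e i))) (I (slice d (e i))) = ip lborel (slice d (e i)) (slice d (e i))"
      by (rule isometry[OF slice_L2 slice_L2])
    also have "\<dots> \<le> 4 * ip lborel (e i) (e i) * ?T" by (rule slice_norm_le[OF eL])
    also have "\<dots> \<le> 4 * E * ?T" using E[OF i] by (intro mult_right_mono ip_self_nonneg) simp
    also have "\<dots> \<le> \<rho>\<^sup>2" by (rule r(2))
    finally show "expectation (\<lambda>\<omega>. (2 * (\<Sum>k<N + N. (half_gradient c1 (e i) k - half_gradient c0 (e i) k) * xi (N + N) stack \<omega> k))\<^sup>2) \<le> \<rho>\<^sup>2"
      unfolding dG ip_self[symmetric] sl(2) .
  qed (rule quad_C1 quad_growth quad'_growth quad_gradient rho(1) phi)+
  then show ?thesis unfolding quad_chaos kap .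
qed

end

end

section \<open>The approximating sequence\<close>

lemma average_close:
  fixes x y x' y' t :: real
  assumes "\<bar>x - x'\<bar> \<le> 1/60" "\<bar>y - y'\<bar> \<le> 1/60" "\<bar>(x' + y') / 2 - t\<bar> \<le> 1/60"
  shows "\<bar>(x + y) / 2 - t\<bar> \<le> 1/30"
proof -
  have "(x + y) / 2 - t = (x - x') / 2 + (y - y') / 2 + ((x' + y') / 2 - t)" by (simp add: field_simps)
  also have "\<bar>\<dots>\<bar> \<le> \<bar>(x - x') / 2\<bar> + \<bar>(y - y') / 2\<bar> + \<bar>(x' + y') / 2 - t\<bar>" by linarith
  also have "\<dots> \<le> 1/120 + 1/120 + 1/60" using assms by (intro add_mono) auto
  finally show ?thesis by simp
qed

locale rosenblatt_chaos = double_wiener M W I J + rosenblatt_exponents a b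
  for M :: "'a measure" and W I J and a b :: real
begin

text \<open>The value of \<open>b\<close>: the constants \<open>c1 * c2\<close> cancel against the
  same factor in the covariance of \<open>B1 1\<close> and \<open>B2 1\<close>.\<close>

definition norming :: real where "norming = 1 / ip lborel (cell_kernel a 0 1) (cell_kernel b 0 1)"

lemma norming_pos: "norming > 0" unfolding norming_def using ip_cell_pos by simp

definition G :: "nat \<Rightarrow> nat \<Rightarrow> real \<Rightarrow> real" where "G n k = cell_kernel a (real k / real n) ((real k + 1) / real n)"
definition H :: "nat \<Rightarrow> nat \<Rightarrow> real \<Rightarrow> real" where "H n k = cell_kernel b (real k / real n) ((real k + 1) / real n)"

lemma G_L2: "G n k \<in> L2 lborel" and H_L2: "H n k \<in> L2 lborel"
  unfolding G_def H_def by (intro cell_kernel_L2(1) ab divide_right_mono; simp)+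

text \<open>The coefficient \<open>norming * real n\<close> is what remains of the prefactor
  \<open>n powr (1 - H1 - H2)\<close> after division by an expectation proportional to
  \<open>n powr (- H1 - H2)\<close>.\<close>

definition kn :: "nat \<Rightarrow> real \<times> real \<Rightarrow> real" where "kn n = tensor_sum n (\<lambda>_. norming * real n) (G n) (H n)"
definition Xn :: "nat \<Rightarrow> 'a \<Rightarrow> real" where "Xn n = chaos n (\<lambda>_. norming * real n) (G n) (H n)"
definition kinf :: "real \<times> real \<Rightarrow> real" where "kinf z = norming * D 0 1 z"
definition Xinf :: "'a \<Rightarrow> real" where "Xinf \<omega> = norming * J (symmetrization (D 0 1)) \<omega>"

lemma kn_L2: "kn n \<in> L2 lborel" unfolding kn_def by (intro tensor_sum_L2 G_L2 H_L2)
lemma kinf_L2: "kinf \<in> L2 lborel" unfolding kinf_def[abs_def] by (intro L2_scale D_L2) simp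
lemma Xn_L2: "Xn n \<in> L2 M" unfolding Xn_def by (intro chaos_L2 G_L2 H_L2)
lemma Xn_AE: "AE \<omega> in M. Xn n \<omega> = J (symmetrization (kn n)) \<omega>"
  unfolding Xn_def kn_def by (intro chaos_AE G_L2 H_L2)

lemma Xinf_L2: "Xinf \<in> L2 M"
  unfolding Xinf_def[abs_def] by (intro L2_scale J_L2 symmetrization_sym_L2 D_L2) simp

lemma Xinf_AE: "AE \<omega> in M. Xinf \<omega> = J (symmetrization kinf) \<omega>"
proof -
  have s: "symmetrization (D 0 1) \<in> sym_L2" by (intro symmetrization_sym_L2 D_L2) simp
  have "symmetrization kinf = (\<lambda>p. norming * symmetrization (D 0 1) p + 0 * symmetrization (D 0 1) p)"
    unfolding symmetrization_def kinf_def by (auto simp: distrib_left)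
  then show ?thesis unfolding Xinf_def using J_lin[OF s s, of norming 0] by (auto elim!: eventually_mono)
qed

lemma kn_eq: "kn n z = norming * Rn n z"
  unfolding kn_def tensor_sum_def Rn_def T_def G_def H_def sum_distrib_left by (simp add: mult.assoc)

lemma kn_rate:
  assumes "n \<ge> 1"
  shows "ip lborel (\<lambda>z. kn n z - kinf z) (\<lambda>z. kn n z - kinf z) \<le> norming\<^sup>2 * rate * real n powr (- 1 - \<gamma>)"
proof -
  have "ip lborel (\<lambda>z. kn n z - kinf z) (\<lambda>z. kn n z - kinf z)
     = norming\<^sup>2 * ip lborel (\<lambda>z. D 0 1 z - Rn n z) (\<lambda>z. D 0 1 z - Rn n z)"
  proof -
    have "(kn n z - kinf z)\<^sup>2 = norming\<^sup>2 * (D 0 1 z - Rn n z)\<^sup>2" for z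
      unfolding kn_eq kinf_def by (simp add: power2_eq_square algebra_simps)
    then show ?thesis unfolding ip_self by simp
  qed
  also have "\<dots> \<le> norming\<^sup>2 * (rate * real n powr (- 1 - \<gamma>))"
    by (intro mult_left_mono Rn_rate assms) simp
  finally show ?thesis by (simp add: mult.assoc)
qed

text \<open>Normalises the diagonal of half the Hessian of \<open>Xinf\<close> to exactly 1.\<close>

definition weight :: "nat \<Rightarrow> real" where "weight i = 1 / sqrt (norming * entry (scale i) (scale i))"

definition direction :: "nat \<Rightarrow> real \<Rightarrow> real" where
  "direction i = (\<lambda>x. weight i * indicator {1 - scale i<..1} x)"

lemma direction_steps: "direction i \<in> steps"
proof -
  have s: "1 - scale i \<le> 1" using scale(1)[of i] by simp
  have "step_on {1 - scale i, 1} (direction i)"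
    using step_on_lin[OF step_on_Ioc[OF s] step_on_Ioc[OF s], of "weight i" 0] unfolding direction_def by simp
  then show ?thesis unfolding steps_def by (intro CollectI exI[of _ "{1 - scale i, 1}"]) simp
qed

lemma direction_L2: "direction i \<in> L2 lborel" by (rule steps_L2[OF direction_steps])

text \<open>The integral of a direction is almost surely a multiple of one Brownian increment, so
  its fourth moment is a normal moment.\<close>

lemma direction_moment: "integrable M (\<lambda>\<omega>. I (direction i) \<omega> ^ 4)"
proof -
  have s: "1 - scale i < 1" using scale(1)[of i] by simp
  have "AE \<omega> in M. I (direction i) \<omega> = weight i * (W 1 \<omega> - W (1 - scale i) \<omega>)"
    using I_scale[OF Ioc_L2, of "weight i" "1 - scale i" 1] I_Ioc[OF less_imp_le[OF s]]
    unfolding direction_def by eventually_elim simp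
  then have ae: "AE \<omega> in M. weight i ^ 4 * (W 1 \<omega> - W (1 - scale i) \<omega>) ^ 4 = I (direction i) \<omega> ^ 4"
    by eventually_elim (simp add: power_mult_distrib)
  have [measurable]: "I (direction i) \<in> borel_measurable M" using I_L2[OF direction_L2] by (auto dest: L2_meas)
  show ?thesis
    by (rule integrable_cong_AE_imp[OF _ _ ae]) (auto intro: increment_moment[OF s])
qed

lemma ip_kinf_direction:
  "ip lborel kinf (tensor (direction i) (direction j)) = norming * (weight i * weight j) * entry (scale i) (scale j)"
proof -
  have "tensor (direction i) (direction j) = (\<lambda>z. (weight i * weight j) * tensor (indicator {1 - scale i<..1}) (indicator {1 - scale j<..1}) z)"
    unfolding tensor_def direction_def by auto
  then have "ip lborel kinf (tensor (direction i) (direction j))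
     = ip lborel kinf (\<lambda>z. (weight i * weight j) * tensor (indicator {1 - scale i<..1}) (indicator {1 - scale j<..1}) z)" by simp
  also have "\<dots> = norming * (weight i * weight j) * entry (scale i) (scale j)"
    unfolding ip_scale_right kinf_def[abs_def] ip_scale_left entry_def by simp
  finally show ?thesis .
qed

text \<open>The weights turn the off-diagonal entries into the ratios of
  \<open>entry_off_diagonal\<close>. The tolerance 1/60 leaves another 1/60 for the passage from
  \<open>kinf\<close> to \<open>kn n\<close>.\<close>

lemma kinf_near_identity:
  "\<bar>(ip lborel kinf (tensor (direction i) (direction j)) + ip lborel kinf (tensor (direction j) (direction i))) / 2
     - (if i = j then 1 else 0)\<bar> \<le> 1/60"
proof -
  let ?q = "\<lambda>i. entry (scale i) (scale i)"
  have n: "norming > 0" by (rule norming_pos)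
  have w: "norming * (weight i * weight j) = 1 / (sqrt (?q i) * sqrt (?q j))"
  proof -
    have aux: "s * s * (1 / (s * x) * (1 / (s * y))) = 1 / (x * y)" if "s \<noteq> 0" for s x y :: real
      using that by simp
    have s: "norming = sqrt norming * sqrt norming" using n by simp
    have "norming * (weight i * weight j)
       = sqrt norming * sqrt norming * (1 / (sqrt norming * sqrt (?q i)) * (1 / (sqrt norming * sqrt (?q j))))"
      unfolding weight_def real_sqrt_mult by (rule arg_cong2[where f="(*)", OF s refl])
    also have "\<dots> = 1 / (sqrt (?q i) * sqrt (?q j))" by (rule aux) (use n in simp)
    finally show ?thesis .
  qed
  have eq: "(ip lborel kinf (tensor (direction i) (direction j)) + ip lborel kinf (tensor (direction j) (direction i))) / 2
     = ((entry (scale i) (scale j) + entry (scale j) (scale i)) / 2) / (sqrt (?q i) * sqrt (?q j))"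
    unfolding ip_kinf_direction mult.commute[of "weight j" "weight i"] w by (simp add: add_divide_distrib)
  have p: "sqrt (?q i) * sqrt (?q j) > 0" by (simp add: entry_self_pos)
  show ?thesis
  proof (cases "i = j")
    case True
    then show ?thesis unfolding eq using entry_self_pos[of j] by simp
  next
    case False
    have "((entry (scale i) (scale j) + entry (scale j) (scale i)) / 2) / (sqrt (?q i) * sqrt (?q j)) \<le> 1/60"
      using entry_off_diagonal[OF False] p by (simp add: divide_le_eq)
    moreover have "0 \<le> ((entry (scale i) (scale j) + entry (scale j) (scale i)) / 2) / (sqrt (?q i) * sqrt (?q j))"
      using p by (intro divide_nonneg_nonneg) (auto simp: entry_nonneg)
    ultimately show ?thesis unfolding eq using False by (simp only: if_False abs_of_nonneg diff_zero)
  qed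
qed

definition energy :: real where "energy = (\<Sum>i<6. ip lborel (direction i) (direction i))"

lemma energy_le: "i < 6 \<Longrightarrow> ip lborel (direction i) (direction i) \<le> energy"
  unfolding energy_def by (rule member_le_sum) (auto simp: ip_self_nonneg)

lemma energy_nonneg: "0 \<le> energy" unfolding energy_def by (intro sum_nonneg ip_self_nonneg)

text \<open>Each entry is a continuous linear functional of the kernel, with norm at most
  \<open>energy\<close>. The smallness assumption says that the kernel error moves it by no more
  than 1/60.\<close>

lemma kn_near_identity:
  assumes n: "n \<ge> 1" and small: "sqrt (norming\<^sup>2 * rate * real n powr (- 1 - \<gamma>)) * energy \<le> 1/60" and ij: "i < 6" "j < 6"
  shows "\<bar>(ip lborel (kn n) (tensor (direction i) (direction j)) + ip lborel (kn n) (tensor (direction j) (direction i))) / 2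
     - (if i = j then 1 else 0)\<bar> \<le> 1/30"
proof -
  have d: "\<bar>ip lborel (kn n) (tensor (direction i) (direction j)) - ip lborel kinf (tensor (direction i) (direction j))\<bar> \<le> 1/60"
    if "i < 6" "j < 6" for i j
  proof -
    have tL: "tensor (direction i) (direction j) \<in> L2 lborel" by (rule tensor_L2[OF direction_L2 direction_L2])
    have "\<bar>ip lborel (\<lambda>z. kn n z - kinf z) (tensor (direction i) (direction j))\<bar>
       \<le> sqrt (ip lborel (\<lambda>z. kn n z - kinf z) (\<lambda>z. kn n z - kinf z))
         * sqrt (ip lborel (tensor (direction i) (direction j)) (tensor (direction i) (direction j)))"
      by (rule ip_abs_le[OF L2_diff[OF kn_L2 kinf_L2] tL])
    also have "sqrt (ip lborel (tensor (direction i) (direction j)) (tensor (direction i) (direction j)))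
       = sqrt (ip lborel (direction i) (direction i)) * sqrt (ip lborel (direction j) (direction j))"
      unfolding ip_tensor[OF direction_L2 direction_L2 direction_L2 direction_L2] real_sqrt_mult ..
    also have "sqrt (ip lborel (\<lambda>z. kn n z - kinf z) (\<lambda>z. kn n z - kinf z))
         * (sqrt (ip lborel (direction i) (direction i)) * sqrt (ip lborel (direction j) (direction j)))
       \<le> sqrt (norming\<^sup>2 * rate * real n powr (- 1 - \<gamma>)) * (sqrt energy * sqrt energy)"
      by (intro mult_mono real_sqrt_le_mono kn_rate n energy_le that)
        (auto intro!: mult_nonneg_nonneg simp: rate_nonneg energy_nonneg ip_self_nonneg)
    also have "\<dots> \<le> 1/60" using small energy_nonneg by simp
    finally show ?thesis unfolding ip_diff_left[OF kn_L2 kinf_L2 tL] .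
  qed
  show ?thesis by (rule average_close[OF d[OF ij] d[OF ij(2,1)] kinf_near_identity])
qed

lemma small_eventually:
  "\<forall>\<^sub>F n in sequentially. n \<ge> 1 \<and> sqrt (norming\<^sup>2 * rate * real n powr (- 1 - \<gamma>)) * energy \<le> 1/60"
proof -
  have "(\<lambda>n. real n powr (- 1 - \<gamma>)) \<longlonglongrightarrow> 0"
    using gamma by (intro tendsto_neg_powr filterlim_real_sequentially) simp
  then have "(\<lambda>n. sqrt (norming\<^sup>2 * rate * real n powr (- 1 - \<gamma>)) * energy) \<longlonglongrightarrow> sqrt (norming\<^sup>2 * rate * 0) * energy"
    by (intro tendsto_intros)
  then have "(\<lambda>n. sqrt (norming\<^sup>2 * rate * real n powr (- 1 - \<gamma>)) * energy) \<longlonglongrightarrow> 0" by simp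
  then have "\<forall>\<^sub>F n in sequentially. sqrt (norming\<^sup>2 * rate * real n powr (- 1 - \<gamma>)) * energy < 1/60"
    by (rule order_tendstoD(2)) simp
  then show ?thesis using eventually_ge_at_top[of 1] by eventually_elim simp
qed

definition \<kappa>6 :: real where "\<kappa>6 = expectation (\<lambda>\<omega>. (\<Sum>i<6. (I (direction i) \<omega>)\<^sup>2)\<^sup>2)"

text \<open>Both kernels are written over one list of \<open>n + m\<close> pairs, with
  \<open>c0\<close> and \<open>c1\<close> selecting the two parts, so both variables become
  polynomials in the same Gaussian vector. The bound does not depend on \<open>m\<close>.\<close>

lemma Xn_distance:
  assumes n: "n \<ge> 1" "sqrt (norming\<^sup>2 * rate * real n powr (- 1 - \<gamma>)) * energy \<le> 1/60"
    and m: "m \<ge> n" "sqrt (norming\<^sup>2 * rate * real m powr (- 1 - \<gamma>)) * energy \<le> 1/60"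
    and K: "\<And>f. f \<in> sym_L2 \<Longrightarrow> ip M (J f) (J f) \<le> K * ip lborel f f" "K \<ge> 0"
    and phi: "\<And>y. \<bar>\<phi> y\<bar> \<le> 1" "\<And>y. (\<phi> has_real_derivative \<phi>' y) (at y)" "continuous_on UNIV \<phi>'"
      "\<And>y. \<bar>\<phi>' y\<bar> \<le> L"
  shows "\<bar>expectation (\<lambda>\<omega>. \<phi> (Xn m \<omega>)) - expectation (\<lambda>\<omega>. \<phi> (Xn n \<omega>))\<bar>
    \<le> (sqrt ((K + 4 * energy) * (4 * (norming\<^sup>2 * rate)) + 1) * real n powr ((- 1 - \<gamma>) / 2)) * (5 + 3 * \<kappa>6)"
proof -
  define g where "g k = (if k < n then G n k else G m (k - n))" for k
  define h where "h k = (if k < n then H n k else H m (k - n))" for k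
  define c0 where "c0 k = (if k < n then norming * real n else 0)" for k
  define c1 where "c1 k = (if k < n then 0 else norming * real m)" for k
  define Q where "Q = (K + 4 * energy) * (4 * (norming\<^sup>2 * rate))"
  \<comment> \<open>The summand 1 keeps \<open>\<rho>\<close> positive even if \<open>Q\<close> is
    zero.\<close>
  define \<rho> where "\<rho> = sqrt (Q + 1) * real n powr ((- 1 - \<gamma>) / 2)"
  have g: "g k \<in> L2 lborel" and h: "h k \<in> L2 lborel" for k unfolding g_def h_def by (auto intro: G_L2 H_L2)
  have t0: "tensor_sum (n + m) c0 g h = kn n" and t1: "tensor_sum (n + m) c1 g h = kn m"
    unfolding tensor_sum_def[abs_def] kn_def sum_lessThan_add by (auto simp: c0_def c1_def g_def h_def)
  have x0: "chaos (n + m) c0 g h = Xn n" and x1: "chaos (n + m) c1 g h = Xn m"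
    unfolding chaos_def[abs_def] Xn_def sum_lessThan_add by (auto simp: c0_def c1_def g_def h_def)
  have td: "tensor_sum (n + m) (\<lambda>k. c1 k - c0 k) g h = (\<lambda>z. kn m z - kn n z)"
    unfolding t0[symmetric] t1[symmetric] tensor_sum_def by (simp add: left_diff_distrib sum_subtractf)
  have Q: "Q \<ge> 0" unfolding Q_def using K(2) energy_nonneg rate_nonneg by simp
  have n0: "real n > 0" using n(1) by simp
  have rho: "\<rho> > 0" unfolding \<rho>_def using Q n0 by simp
  let ?u = "\<lambda>z. kn m z - kinf z" and ?v = "\<lambda>z. kn n z - kinf z"
  have uL: "?u \<in> L2 lborel" "?v \<in> L2 lborel" by (intro L2_diff kn_L2 kinf_L2)+
  have "real m powr (- 1 - \<gamma>) \<le> real n powr (- 1 - \<gamma>)" using m(1) n0 gamma by (intro powr_mono2') auto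
  then have um: "norming\<^sup>2 * rate * real m powr (- 1 - \<gamma>) \<le> norming\<^sup>2 * rate * real n powr (- 1 - \<gamma>)"
    using rate_nonneg by (intro mult_left_mono) auto
  have "ip lborel (\<lambda>z. ?u z - ?v z) (\<lambda>z. ?u z - ?v z) \<le> 2 * ip lborel ?u ?u + 2 * ip lborel ?v ?v"
    by (rule ip_self_diff_le[OF uL])
  also have "\<dots> \<le> 4 * (norming\<^sup>2 * rate) * real n powr (- 1 - \<gamma>)"
    using kn_rate[OF n(1)] kn_rate[OF order_trans[OF n(1) m(1)]] um by simp
  finally have dk: "ip lborel (\<lambda>z. kn m z - kn n z) (\<lambda>z. kn m z - kn n z) \<le> 4 * (norming\<^sup>2 * rate) * real n powr (- 1 - \<gamma>)"
    by simp
  have "(K + 4 * energy) * ip lborel (\<lambda>z. kn m z - kn n z) (\<lambda>z. kn m z - kn n z)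
      \<le> (K + 4 * energy) * (4 * (norming\<^sup>2 * rate) * real n powr (- 1 - \<gamma>))"
    using K(2) energy_nonneg by (intro mult_left_mono dk) simp
  also have "\<dots> = Q * real n powr (- 1 - \<gamma>)" unfolding Q_def by (simp add: mult.assoc)
  also have "\<dots> \<le> (Q + 1) * real n powr (- 1 - \<gamma>)" by (intro mult_right_mono) auto
  also have "\<dots> = \<rho>\<^sup>2"
  proof -
    have "(real n powr ((- 1 - \<gamma>) / 2))\<^sup>2 = real n powr (- 1 - \<gamma>)"
      unfolding power2_eq_square powr_add[symmetric] by (rule arg_cong[where f="\<lambda>e. real n powr e"]) simp
    then show ?thesis unfolding \<rho>_def power_mult_distrib using Q by simp
  qed
  finally have r2: "(K + 4 * energy) * ip lborel (\<lambda>z. kn m z - kn n z) (\<lambda>z. kn m z - kn n z) \<le> \<rho>\<^sup>2" .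
  have near: "\<bar>(ip lborel (tensor_sum (n + m) c g h) (tensor (direction i) (direction j))
      + ip lborel (tensor_sum (n + m) c g h) (tensor (direction j) (direction i))) / 2 - (if i = j then 1 else 0)\<bar> \<le> 1/30"
    if "c \<in> {c0, c1}" "i < 6" "j < 6" for c i j
  proof -
    from that(1) have "c = c0 \<or> c = c1" by simp
    then show ?thesis
    proof
      assume "c = c0" then show ?thesis by (simp only: t0 kn_near_identity[OF n that(2,3)])
    next
      assume "c = c1" then show ?thesis by (simp only: t1 kn_near_identity[OF order_trans[OF n(1) m(1)] m(2) that(2,3)])
    qed
  qed
  have "\<bar>expectation (\<lambda>\<omega>. \<phi> (chaos (n + m) c1 g h \<omega>)) - expectation (\<lambda>\<omega>. \<phi> (chaos (n + m) c0 g h \<omega>))\<bar>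
     \<le> \<rho> * (5 + 3 * expectation (\<lambda>\<omega>. (\<Sum>i<6. (I (direction i) \<omega>)\<^sup>2)\<^sup>2))"
    by (rule chaos_distance[where E = energy and K = K, OF g h direction_steps direction_moment near energy_le K rho _ phi])
      (simp_all only: td r2)
  then show ?thesis unfolding x0 x1 \<kappa>6_def[symmetric] \<rho>_def Q_def .
qed

lemma expectation_abs_le:
  assumes "f \<in> L2 M" shows "integrable M f" "expectation (\<lambda>\<omega>. \<bar>f \<omega>\<bar>) \<le> sqrt (ip M f f)"
proof -
  have one: "(\<lambda>_. 1) \<in> L2 M" by (rule L2I) auto
  have [measurable]: "f \<in> borel_measurable M" using assms by (auto dest: L2_meas)
  have abs: "(\<lambda>\<omega>. \<bar>f \<omega>\<bar>) \<in> L2 M" by (rule L2_bound[OF assms]) auto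
  show "integrable M f" using L2_mult_int[OF assms one] by simp
  have "\<bar>ip M (\<lambda>\<omega>. \<bar>f \<omega>\<bar>) (\<lambda>_. 1)\<bar> \<le> sqrt (ip M (\<lambda>\<omega>. \<bar>f \<omega>\<bar>) (\<lambda>\<omega>. \<bar>f \<omega>\<bar>)) * sqrt (ip M (\<lambda>_. 1) (\<lambda>_. 1))"
    by (rule ip_abs_le[OF abs one])
  then show "expectation (\<lambda>\<omega>. \<bar>f \<omega>\<bar>) \<le> sqrt (ip M f f)" by (simp add: ip_def prob_space)
qed

text \<open>The bound of \<open>Xn_distance\<close> is uniform in \<open>m\<close> and in the test
  function, and \<open>Xn m\<close> tends to \<open>Xinf\<close> in mean square, hence in
  \<open>L\<^sup>1\<close>. The limit in \<open>m\<close> is taken for each test function, before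
  passing to total variation.\<close>

lemma Xinf_distance:
  "\<exists>C. \<forall>\<^sub>F n in sequentially. total_variation_dist M (Xn n) Xinf \<le> C * real n powr ((- 1 - \<gamma>) / 2)"
proof -
  obtain K where K: "K \<ge> 0" "\<And>f. f \<in> sym_L2 \<Longrightarrow> ip M (J f) (J f) \<le> K * ip lborel f f"
    by (rule J_bounded) blast
  define Q where "Q = sqrt ((K + 4 * energy) * (4 * (norming\<^sup>2 * rate)) + 1) * (5 + 3 * \<kappa>6)"
  obtain n0 where n0: "\<And>n. n \<ge> n0 \<Longrightarrow> n \<ge> 1 \<and> sqrt (norming\<^sup>2 * rate * real n powr (- 1 - \<gamma>)) * energy \<le> 1/60"
    using small_eventually unfolding eventually_sequentially by blast
  have L1: "(\<lambda>m. expectation (\<lambda>\<omega>. \<bar>Xn (m + n) \<omega> - Xinf \<omega>\<bar>)) \<longlonglongrightarrow> 0" for n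
  proof -
    have "(\<lambda>m. expectation (\<lambda>\<omega>. \<bar>Xn m \<omega> - Xinf \<omega>\<bar>)) \<longlonglongrightarrow> 0"
    proof (rule Lim_null_comparison)
      show "\<forall>\<^sub>F m in sequentially. norm (expectation (\<lambda>\<omega>. \<bar>Xn m \<omega> - Xinf \<omega>\<bar>)) \<le> sqrt (K * (norming\<^sup>2 * rate * real m powr (- 1 - \<gamma>)))"
        using eventually_ge_at_top[of 1]
      proof eventually_elim
        case (elim m)
        have dL: "(\<lambda>\<omega>. Xn m \<omega> - Xinf \<omega>) \<in> L2 M" by (intro L2_diff Xn_L2 Xinf_L2)
        have "ip M (\<lambda>\<omega>. Xn m \<omega> - Xinf \<omega>) (\<lambda>\<omega>. Xn m \<omega> - Xinf \<omega>) \<le> K * ip lborel (\<lambda>p. kn m p - kinf p) (\<lambda>p. kn m p - kinf p)"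
          by (rule J_diff_le[OF K(2,1) kn_L2 kinf_L2 Xn_L2 Xn_AE Xinf_L2 Xinf_AE])
        also have "\<dots> \<le> K * (norming\<^sup>2 * rate * real m powr (- 1 - \<gamma>))"
          by (intro mult_left_mono kn_rate elim K(1))
        finally have "expectation (\<lambda>\<omega>. \<bar>Xn m \<omega> - Xinf \<omega>\<bar>) \<le> sqrt (K * (norming\<^sup>2 * rate * real m powr (- 1 - \<gamma>)))"
          by (intro order_trans[OF expectation_abs_le(2)[OF dL]] real_sqrt_le_mono)
        then show ?case by simp
      qed
      have "(\<lambda>m. real m powr (- 1 - \<gamma>)) \<longlonglongrightarrow> 0"
        using gamma by (intro tendsto_neg_powr filterlim_real_sequentially) simp
      then have "(\<lambda>m. sqrt (K * (norming\<^sup>2 * rate * real m powr (- 1 - \<gamma>)))) \<longlonglongrightarrow> sqrt (K * (norming\<^sup>2 * rate * 0))"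
        by (intro tendsto_intros)
      then show "(\<lambda>m. sqrt (K * (norming\<^sup>2 * rate * real m powr (- 1 - \<gamma>)))) \<longlonglongrightarrow> 0" by simp
    qed
    then show ?thesis by (rule LIMSEQ_ignore_initial_segment)
  qed
  have "total_variation_dist M (Xn n) Xinf \<le> Q * real n powr ((- 1 - \<gamma>) / 2)" if n: "n \<ge> n0" for n
  proof (rule total_variation_dist_le)
    show "Xn n \<in> borel_measurable M" "Xinf \<in> borel_measurable M" using L2_meas[OF Xn_L2] L2_meas[OF Xinf_L2] by auto
    fix \<phi> \<phi>' :: "real \<Rightarrow> real" and L
    assume phi: "\<And>y. \<bar>\<phi> y\<bar> \<le> 1" "\<And>y. (\<phi> has_real_derivative \<phi>' y) (at y)" "continuous_on UNIV \<phi>'" "\<And>y. \<bar>\<phi>' y\<bar> \<le> L"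
    have lim: "(\<lambda>m. expectation (\<lambda>\<omega>. \<phi> (Xn (m + n) \<omega>))) \<longlonglongrightarrow> expectation (\<lambda>\<omega>. \<phi> (Xinf \<omega>))"
      by (rule expectation_lipschitz_limit[OF expectation_abs_le(1)[OF Xn_L2] expectation_abs_le(1)[OF Xinf_L2] L1 phi(1,2,4)])
    have "(\<lambda>m. \<bar>expectation (\<lambda>\<omega>. \<phi> (Xn (m + n) \<omega>)) - expectation (\<lambda>\<omega>. \<phi> (Xn n \<omega>))\<bar>)
       \<longlonglongrightarrow> \<bar>expectation (\<lambda>\<omega>. \<phi> (Xinf \<omega>)) - expectation (\<lambda>\<omega>. \<phi> (Xn n \<omega>))\<bar>"
      by (intro tendsto_rabs tendsto_diff lim tendsto_const)
    moreover have "\<bar>expectation (\<lambda>\<omega>. \<phi> (Xn (m + n) \<omega>)) - expectation (\<lambda>\<omega>. \<phi> (Xn n \<omega>))\<bar> \<le> Q * real n powr ((- 1 - \<gamma>) / 2)" for m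
    proof -
      have "\<bar>expectation (\<lambda>\<omega>. \<phi> (Xn (m + n) \<omega>)) - expectation (\<lambda>\<omega>. \<phi> (Xn n \<omega>))\<bar>
         \<le> (sqrt ((K + 4 * energy) * (4 * (norming\<^sup>2 * rate)) + 1) * real n powr ((- 1 - \<gamma>) / 2)) * (5 + 3 * \<kappa>6)"
        by (rule Xn_distance[OF _ _ _ _ K(2,1) phi]) (use n0[of n] n0[of "m + n"] n in auto)
      then show ?thesis unfolding Q_def by (simp add: mult_ac)
    qed
    ultimately have "\<bar>expectation (\<lambda>\<omega>. \<phi> (Xinf \<omega>)) - expectation (\<lambda>\<omega>. \<phi> (Xn n \<omega>))\<bar> \<le> Q * real n powr ((- 1 - \<gamma>) / 2)"
      by (intro LIMSEQ_le_const2) auto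
    then show "\<bar>expectation (\<lambda>\<omega>. \<phi> (Xn n \<omega>)) - expectation (\<lambda>\<omega>. \<phi> (Xinf \<omega>))\<bar> \<le> Q * real n powr ((- 1 - \<gamma>) / 2)"
      by (simp add: abs_minus_commute)
  qed
  then show ?thesis unfolding eventually_sequentially by blast
qed

end

section \<open>Identification of the statistic and its limit with the chaos variables\<close>

theorem mainTheorem2:
  fixes M :: "'a measure" and W :: "real \<Rightarrow> 'a \<Rightarrow> real"
    and I\<^sub>1 :: "(real \<Rightarrow> real) \<Rightarrow> 'a \<Rightarrow> real"
    and I\<^sub>2 :: "(real \<times> real \<Rightarrow> real) \<Rightarrow> 'a \<Rightarrow> real"
    and H1 H2 c1 c2 b :: real
    and B1 B2 :: "real \<Rightarrow> 'a \<Rightarrow> real"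
    and Z :: "nat \<Rightarrow> 'a \<Rightarrow> real" and Zinf :: "'a \<Rightarrow> real"
  assumes "prob_space M"
    and "two_sided_brownian_motion M W"
    and "is_wiener_integral M W I\<^sub>1"
    and "is_double_wiener_integral M I\<^sub>1 I\<^sub>2"
    and "0 < H1" "H1 < 1" "0 < H2" "H2 < 1"
    and "H1 > 1/2" "H2 > 1/2" "H1 + H2 > 3/2"
    and B1: "B1 = fbm I\<^sub>1 c1 H1" and c1: "(\<integral>\<omega>. (B1 1 \<omega>)\<^sup>2 \<partial>M) = 1"
    and B2: "B2 = fbm I\<^sub>1 c2 H2" and c2: "(\<integral>\<omega>. (B2 1 \<omega>)\<^sup>2 \<partial>M) = 1"
    and Z: "Z = quadratic_covariation_stat M H1 H2 B1 B2"
    and b: "b = c1 * c2 / (\<integral>\<omega>. B1 1 \<omega> * B2 1 \<omega> \<partial>M)"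
    and Zinf: "Zinf = (\<lambda>\<omega>. b * I\<^sub>2 (symmetrization (rosenblatt_kernel H1 H2)) \<omega>)"
  shows "(\<lambda>n. total_variation_dist M (Z n) Zinf) \<in> O(\<lambda>n. real n powr (3/2 - H1 - H2))"
proof -
  interpret prob_space M by fact
  define p where "p = H1 - 3/2"
  define q where "q = H2 - 3/2"
  interpret rosenblatt_chaos M W I\<^sub>1 I\<^sub>2 p q
    by unfold_locales (use assms in \<open>auto simp: p_def q_def\<close>)
  have hs: "H1 - 3/2 = p" "H2 - 3/2 = q" unfolding p_def q_def by auto
  have cell_L2: "cell_kernel p s t \<in> L2 lborel" "cell_kernel q s t \<in> L2 lborel" if "s \<le> t" for s t
    by (rule cell_kernel_L2(1)[OF ab(1,2) that]) (rule cell_kernel_L2(1)[OF ab(3,4) that])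
  have fbm: "B1 t = (\<lambda>\<omega>. c1 * I\<^sub>1 (cell_kernel p 0 t) \<omega>)" "B2 t = (\<lambda>\<omega>. c2 * I\<^sub>1 (cell_kernel q 0 t) \<omega>)" if "t \<ge> 0" for t
    unfolding B1 B2 fbm_def[abs_def] hs[symmetric] using fbm_kernel_eq[OF that] assms(9,10) by auto
  \<comment> \<open>The unit variances exclude zero constants, so \<open>c1 * c2\<close> cancels in
    \<open>b\<close> and in every summand of \<open>Z n\<close>.\<close>
  have c: "c1 \<noteq> 0" "c2 \<noteq> 0" using c1 c2 fbm[of 1] by auto
  have exp_prod: "expectation (\<lambda>\<omega>. U \<omega> * V \<omega>) = c1 * c2 * ip lborel f g"
    if "AE \<omega> in M. U \<omega> = c1 * I\<^sub>1 f \<omega>" "AE \<omega> in M. V \<omega> = c2 * I\<^sub>1 g \<omega>" "U \<in> borel_measurable M" "V \<in> borel_measurable M"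
      "f \<in> L2 lborel" "g \<in> L2 lborel" for U V f g
  proof -
    note [measurable] = that(3,4) L2_meas[OF I_L2[OF that(5)]] L2_meas[OF I_L2[OF that(6)]]
    have "expectation (\<lambda>\<omega>. U \<omega> * V \<omega>) = expectation (\<lambda>\<omega>. (c1 * c2) * (I\<^sub>1 f \<omega> * I\<^sub>1 g \<omega>))"
    proof (rule integral_cong_AE)
      show "AE \<omega> in M. U \<omega> * V \<omega> = (c1 * c2) * (I\<^sub>1 f \<omega> * I\<^sub>1 g \<omega>)" using that(1,2) by eventually_elim simp
    qed measurable
    also have "\<dots> = c1 * c2 * ip M (I\<^sub>1 f) (I\<^sub>1 g)" unfolding ip_def by simp
    finally show ?thesis unfolding isometry[OF that(5,6)] .
  qed
  have I_meas: "I\<^sub>1 f \<in> borel_measurable M" if "f \<in> L2 lborel" for f using L2_meas[OF I_L2[OF that]] .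
  have B_meas: "B1 t \<in> borel_measurable M" "B2 t \<in> borel_measurable M" if "t \<ge> 0" for t
    unfolding fbm[OF that] using I_meas[OF cell_L2(1)[OF that]] I_meas[OF cell_L2(2)[OF that]] by measurable
  have "expectation (\<lambda>\<omega>. B1 1 \<omega> * B2 1 \<omega>) = c1 * c2 * ip lborel (cell_kernel p 0 1) (cell_kernel q 0 1)"
    by (rule exp_prod) (use B_meas[of 1] cell_L2[of 0 1] in \<open>simp_all add: fbm\<close>)
  then have b_eq: "b = norming" unfolding b norming_def using c by simp
  have ros: "rosenblatt_kernel H1 H2 = D 0 1" unfolding rosenblatt_kernel_def D_def hs ..
  have Zinf_eq: "Zinf = Xinf" unfolding Zinf Xinf_def[abs_def] b_eq ros ..
  have incr_meas: "increment B1 n k \<in> borel_measurable M" "increment B2 n k \<in> borel_measurable M" for n k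
  proof -
    have t: "0 \<le> (real k + 1) / real n" "0 \<le> real k / real n" by auto
    show "increment B1 n k \<in> borel_measurable M" "increment B2 n k \<in> borel_measurable M"
      unfolding increment_def[abs_def] using B_meas[OF t(1)] B_meas[OF t(2)] by measurable
  qed
  have incr: "AE \<omega> in M. increment B1 n k \<omega> = c1 * I\<^sub>1 (G n k) \<omega>" "AE \<omega> in M. increment B2 n k \<omega> = c2 * I\<^sub>1 (H n k) \<omega>" for n k
  proof -
    have t: "0 \<le> (real k + 1) / real n" "0 \<le> real k / real n" by auto
    have eq: "G n k = (\<lambda>y. cell_kernel p 0 ((real k + 1) / real n) y - cell_kernel p 0 (real k / real n) y)"
      "H n k = (\<lambda>y. cell_kernel q 0 ((real k + 1) / real n) y - cell_kernel q 0 (real k / real n) y)"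
      unfolding G_def H_def cell_kernel_diff by auto
    show "AE \<omega> in M. increment B1 n k \<omega> = c1 * I\<^sub>1 (G n k) \<omega>"
      unfolding increment_def fbm[OF t(1)] fbm[OF t(2)] eq right_diff_distrib[symmetric]
      using I_diff[OF cell_L2(1)[OF t(1)] cell_L2(1)[OF t(2)]] by eventually_elim simp
    show "AE \<omega> in M. increment B2 n k \<omega> = c2 * I\<^sub>1 (H n k) \<omega>"
      unfolding increment_def fbm[OF t(1)] fbm[OF t(2)] eq right_diff_distrib[symmetric]
      using I_diff[OF cell_L2(2)[OF t(1)] cell_L2(2)[OF t(2)]] by eventually_elim simp
  qed
  \<comment> \<open>The identification is made for \<open>n \<ge> 1\<close>, where the cells have
    length \<open>1 / n\<close>; this suffices for a statement about large \<open>n\<close>.\<close>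
  have Z_AE: "AE \<omega> in M. Z n \<omega> = Xn n \<omega>" if n: "n \<ge> 1" for n
  proof -
    have n0: "real n > 0" using n by simp
    let ?e = "real n powr (- 3 - p - q)"
    have ip_GH: "ip lborel (G n k) (H n k) = ?e / norming" for k
      unfolding G_def H_def ip_cell_scale[OF n] norming_def by simp
    have E: "expectation (\<lambda>\<omega>. increment B1 n k \<omega> * increment B2 n k \<omega>) = c1 * c2 * (?e / norming)" for k
      unfolding exp_prod[OF incr incr_meas G_L2 H_L2] ip_GH ..
    \<comment> \<open>The expectation carries \<open>n powr (- H1 - H2)\<close>; against the
      prefactor exactly one power of \<open>n\<close> is left, the coefficient in
      \<open>kn\<close>.\<close>
    have scale: "real n powr (1 - H1 - H2) * (1 / ?e) = real n"
    proof -
      have "1 / ?e = real n powr (- (- 3 - p - q))" by (simp only: powr_minus_divide)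
      then have "real n powr (1 - H1 - H2) * (1 / ?e) = real n powr ((1 - H1 - H2) + (- (- 3 - p - q)))"
        by (simp only: powr_add)
      also have "(1 - H1 - H2) + (- (- 3 - p - q)) = 1" unfolding p_def q_def by simp
      finally show ?thesis using n0 by simp
    qed
    have "AE \<omega> in M. \<forall>k\<in>{..<n}. increment B1 n k \<omega> = c1 * I\<^sub>1 (G n k) \<omega> \<and> increment B2 n k \<omega> = c2 * I\<^sub>1 (H n k) \<omega>"
      by (intro AE_finite_allI AE_conjI incr) auto
    then show ?thesis
    proof eventually_elim
      case (elim \<omega>)
      have "Z n \<omega> = real n powr (1 - H1 - H2) * (\<Sum>k<n. c1 * I\<^sub>1 (G n k) \<omega> * (c2 * I\<^sub>1 (H n k) \<omega>) / (c1 * c2 * (?e / norming)) - 1)"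
        unfolding Z quadratic_covariation_stat_def E using elim by (intro arg_cong2[where f="(*)"] sum.cong) auto
      also have "\<dots> = (\<Sum>k<n. real n powr (1 - H1 - H2) * (1 / ?e) * norming * (I\<^sub>1 (G n k) \<omega> * I\<^sub>1 (H n k) \<omega> - ip lborel (G n k) (H n k)))"
        unfolding sum_distrib_left
      proof (intro sum.cong refl)
        fix k
        have "?e \<noteq> 0" using n0 by simp
        then show "real n powr (1 - H1 - H2) * (c1 * I\<^sub>1 (G n k) \<omega> * (c2 * I\<^sub>1 (H n k) \<omega>) / (c1 * c2 * (?e / norming)) - 1)
          = real n powr (1 - H1 - H2) * (1 / ?e) * norming * (I\<^sub>1 (G n k) \<omega> * I\<^sub>1 (H n k) \<omega> - ip lborel (G n k) (H n k))"
          unfolding ip_GH using c norming_pos by (simp add: field_simps)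
      qed
      also have "\<dots> = Xn n \<omega>" unfolding Xn_def chaos_def scale by (simp add: mult.commute)
      finally show ?case .
    qed
  qed
  have Z_meas: "Z n \<in> borel_measurable M" for n
    unfolding Z quadratic_covariation_stat_def[abs_def] using incr_meas by measurable
  \<comment> \<open>Almost sure equality preserves the law, so the total variation distance may be
    computed with the polynomial \<open>Xn n\<close>.\<close>
  have tv: "total_variation_dist M (Z n) Zinf = total_variation_dist M (Xn n) Xinf" if n: "n \<ge> 1" for n
    unfolding total_variation_dist_def Zinf_eq
  proof (intro SUP_cong refl)
    fix S :: "real set" assume S: "S \<in> sets borel"
    have "prob {\<omega> \<in> space M. Z n \<omega> \<in> S} = prob {\<omega> \<in> space M. Xn n \<omega> \<in> S}"
    proof (rule finite_measure_eq_AE)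
      show "AE \<omega> in M. \<omega> \<in> {\<omega> \<in> space M. Z n \<omega> \<in> S} \<longleftrightarrow> \<omega> \<in> {\<omega> \<in> space M. Xn n \<omega> \<in> S}"
        using Z_AE[OF n] by eventually_elim auto
      show "{\<omega> \<in> space M. Z n \<omega> \<in> S} \<in> events" "{\<omega> \<in> space M. Xn n \<omega> \<in> S} \<in> events"
        using measurable_sets[OF Z_meas S, of n] measurable_sets[OF L2_meas[OF Xn_L2] S, of n]
        by (simp_all add: vimage_def Int_def conj_commute)
    qed
    then show "\<bar>prob {\<omega> \<in> space M. Z n \<omega> \<in> S} - prob {\<omega> \<in> space M. Xinf \<omega> \<in> S}\<bar>
      = \<bar>prob {\<omega> \<in> space M. Xn n \<omega> \<in> S} - prob {\<omega> \<in> space M. Xinf \<omega> \<in> S}\<bar>" by simp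
  qed
  obtain Q where Q: "\<forall>\<^sub>F n in sequentially. total_variation_dist M (Xn n) Xinf \<le> Q * real n powr ((- 1 - \<gamma>) / 2)"
    using Xinf_distance by blast
  \<comment> \<open>In terms of the Hurst parameters
    \<open>\<gamma> = 2 * (H1 + H2) - 4\<close>.\<close>
  have ex: "(- 1 - \<gamma>) / 2 = 3/2 - H1 - H2" unfolding \<gamma>_def unfolding p_def q_def by simp
  show ?thesis
  proof (rule bigoI[where c = Q])
    show "\<forall>\<^sub>F n in sequentially. norm (total_variation_dist M (Z n) Zinf) \<le> Q * norm (real n powr (3/2 - H1 - H2))"
      using Q eventually_ge_at_top[of 1]
    proof eventually_elim
      case (elim n)
      then show ?case using total_variation_dist_nonneg[of "Xn n" Xinf] unfolding tv[OF elim(2)] ex by simp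
    qed
  qed
qed

end
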